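(* Let $D$ be a commutative Dedekind domain with an automorphism $\sigma\colon D\to D$. Then the skew Laurent series ring $R = D((x;\sigma))$ is a noncommutative Dedekind domain. Furthermore, if $\sigma$ acts trivially on the ideal class group $G(D)$ of $D$, then $K_0(R)\cong K_0(D)$.
   Context: A commutative Dedekind domain is a commutative domain in which every nonzero ideal is invertible (fields are allowed). The skew Laurent series ring $D((x;\sigma))$ is the set of formal series $\sum_{i=k}^\infty a_i x^i$ with $k\in\mathbb Z$, $a_i\in D$, with termwise addition and multiplication determined by $x^i a=\sigma^i(a)x^i$ for $a\in D$, $i\in\mathbb Z$. A (unital) ring $S$ is a noncommutative Dedekind domain if it is a domain, is left and right noetherian, is hereditary (all left ideals and all right ideals are projective), and is an Asano order, i.e. every nonzero two-sided ideal $I$ is left and right invertible (there is an $S$-sub-bimodule $J$ of the division ring of fractions of $S$ with $IJ=JI=S$). We say $\sigma$ acts trivially on $G(D)$ if $\sigma(\mathfrak I)$ is isomorphic to $\mathfrak I$ as a $D$-module for every ideal $\mathfrak I$ of $D$. $K_0(S)$ denotes the Grothendieck group of finitely generated projective right $S$-modules. *)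

theory Defs
  imports "HOL-Algebra.Algebra"
begin

section \<open>Modules over a noncommutative ring\<close>

text \<open>
  The locale \<^locale>\<open>module\<close> of the library requires a commutative ring of scalars.  Here
  \<open>a \<odot>\<^bsub>M\<^esub> x\<close> stands for the right action \<open>x \<cdot> a\<close>, whence the order of the factors in
  \<open>smult_assoc\<close>.  The fields \<open>mult\<close> and \<open>one\<close> of a module record play no role.
\<close>

locale right_module = S?: ring S + M?: abelian_group M
  for S :: "('a, 'm) ring_scheme" (structure) and M :: "('a, 'b, 'n) module_scheme" (structure) +
  assumes smult_closed:
      "\<lbrakk>a \<in> carrier S; x \<in> carrier M\<rbrakk> \<Longrightarrow> a \<odot>\<^bsub>M\<^esub> x \<in> carrier M"
    and smult_distrib_scalar:
      "\<lbrakk>a \<in> carrier S; b \<in> carrier S; x \<in> carrier M\<rbrakk> \<Longrightarrow>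
        (a \<oplus>\<^bsub>S\<^esub> b) \<odot>\<^bsub>M\<^esub> x = a \<odot>\<^bsub>M\<^esub> x \<oplus>\<^bsub>M\<^esub> b \<odot>\<^bsub>M\<^esub> x"
    and smult_distrib_vector:
      "\<lbrakk>a \<in> carrier S; x \<in> carrier M; y \<in> carrier M\<rbrakk> \<Longrightarrow>
        a \<odot>\<^bsub>M\<^esub> (x \<oplus>\<^bsub>M\<^esub> y) = a \<odot>\<^bsub>M\<^esub> x \<oplus>\<^bsub>M\<^esub> a \<odot>\<^bsub>M\<^esub> y"
    and smult_assoc:
      "\<lbrakk>a \<in> carrier S; b \<in> carrier S; x \<in> carrier M\<rbrakk> \<Longrightarrow>
        (a \<otimes>\<^bsub>S\<^esub> b) \<odot>\<^bsub>M\<^esub> x = b \<odot>\<^bsub>M\<^esub> (a \<odot>\<^bsub>M\<^esub> x)"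
    and smult_one:
      "x \<in> carrier M \<Longrightarrow> \<one>\<^bsub>S\<^esub> \<odot>\<^bsub>M\<^esub> x = x"

definition module_isomorphic ::
    "('a, 'm) ring_scheme \<Rightarrow> ('a, 'b) module \<Rightarrow> ('a, 'c) module \<Rightarrow> bool" where
  "module_isomorphic S M N \<longleftrightarrow>
     (\<exists>f. bij_betw f (carrier M) (carrier N) \<and>
          (\<forall>x\<in>carrier M. \<forall>y\<in>carrier M. f (x \<oplus>\<^bsub>M\<^esub> y) = f x \<oplus>\<^bsub>N\<^esub> f y) \<and>
          (\<forall>a\<in>carrier S. \<forall>x\<in>carrier M. f (a \<odot>\<^bsub>M\<^esub> x) = a \<odot>\<^bsub>N\<^esub> f x))"

definition direct_sum_module ::
    "('a, 'b) module \<Rightarrow> ('a, 'c) module \<Rightarrow> ('a, 'b \<times> 'c) module" where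
  "direct_sum_module M N =
     \<lparr>carrier = carrier M \<times> carrier N,
      monoid.mult = (\<lambda>_ _. undefined), one = undefined,
      ring.zero = (\<zero>\<^bsub>M\<^esub>, \<zero>\<^bsub>N\<^esub>),
      ring.add = (\<lambda>(x, y) (x', y'). (x \<oplus>\<^bsub>M\<^esub> x', y \<oplus>\<^bsub>N\<^esub> y')),
      smult = (\<lambda>a (x, y). (a \<odot>\<^bsub>M\<^esub> x, a \<odot>\<^bsub>N\<^esub> y))\<rparr>"

definition free_right_module ::
    "('a, 'm) ring_scheme \<Rightarrow> 'x set \<Rightarrow> ('a, 'x \<Rightarrow> 'a) module" where
  "free_right_module S B =
     \<lparr>carrier = {f. range f \<subseteq> carrier S \<and> {x. f x \<noteq> \<zero>\<^bsub>S\<^esub>} \<subseteq> B \<and> finite {x. f x \<noteq> \<zero>\<^bsub>S\<^esub>}},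
      monoid.mult = (\<lambda>_ _. undefined), one = undefined,
      ring.zero = (\<lambda>_. \<zero>\<^bsub>S\<^esub>),
      ring.add = (\<lambda>f g x. f x \<oplus>\<^bsub>S\<^esub> g x),
      smult = (\<lambda>a f x. f x \<otimes>\<^bsub>S\<^esub> a)\<rparr>"

definition finitely_generated_module ::
    "('a, 'm) ring_scheme \<Rightarrow> ('a, 'b) module \<Rightarrow> bool" where
  "finitely_generated_module S M \<longleftrightarrow>
     (\<exists>A. finite A \<and> A \<subseteq> carrier M \<and>
          (\<forall>x\<in>carrier M. \<exists>c\<in>A \<rightarrow> carrier S. x = (\<Oplus>\<^bsub>M\<^esub>y\<in>A. c y \<odot>\<^bsub>M\<^esub> y)))"

text \<open>
  Projective modules are the direct summands of free modules.  Restricting the type of the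
  basis \<open>B\<close> and of the complement \<open>Q\<close> loses nothing: a projective \<open>P\<close> is a quotient of the
  free module on \<open>B = carrier P\<close>, and the kernel of this quotient map is a complement.
\<close>

definition projective_right_module ::
    "('a, 'm) ring_scheme \<Rightarrow> ('a, 'b) module \<Rightarrow> bool" where
  "projective_right_module S P \<longleftrightarrow>
     right_module S P \<and>
     (\<exists>(B :: 'b set) (Q :: ('a, 'b \<Rightarrow> 'a) module).
        right_module S Q \<and>
        module_isomorphic S (direct_sum_module P Q) (free_right_module S B))"

section \<open>One-sided conditions on rings\<close>

definition right_ideal :: "'a set \<Rightarrow> ('a, 'm) ring_scheme \<Rightarrow> bool" where
  "right_ideal I S \<longleftrightarrow>
     additive_subgroup I S \<and> (\<forall>x\<in>I. \<forall>a\<in>carrier S. x \<otimes>\<^bsub>S\<^esub> a \<in> I)"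

definition ideal_as_module :: "('a, 'm) ring_scheme \<Rightarrow> 'a set \<Rightarrow> ('a, 'a) module" where
  "ideal_as_module S I =
     \<lparr>carrier = I, monoid.mult = (\<lambda>_ _. undefined), one = undefined,
      ring.zero = \<zero>\<^bsub>S\<^esub>, ring.add = ring.add S, smult = (\<lambda>a x. x \<otimes>\<^bsub>S\<^esub> a)\<rparr>"

definition right_noetherian :: "('a, 'm) ring_scheme \<Rightarrow> bool" where
  "right_noetherian S \<longleftrightarrow>
     (\<forall>I :: nat \<Rightarrow> 'a set.
        (\<forall>n. right_ideal (I n) S) \<and> (\<forall>n. I n \<subseteq> I (Suc n)) \<longrightarrow>
        (\<exists>N. \<forall>n\<ge>N. I n = I N))"

definition right_hereditary :: "('a, 'm) ring_scheme \<Rightarrow> bool" where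
  "right_hereditary S \<longleftrightarrow>
     (\<forall>I. right_ideal I S \<longrightarrow> projective_right_module S (ideal_as_module S I))"

text \<open>Left ideals and left modules are right ideals and right modules of the opposite ring.\<close>

definition opposite_ring :: "('a, 'm) ring_scheme \<Rightarrow> ('a, 'm) ring_scheme" where
  "opposite_ring S = S\<lparr>monoid.mult := (\<lambda>a b. b \<otimes>\<^bsub>S\<^esub> a)\<rparr>"

definition left_noetherian :: "('a, 'm) ring_scheme \<Rightarrow> bool" where
  "left_noetherian S \<longleftrightarrow> right_noetherian (opposite_ring S)"

definition left_hereditary :: "('a, 'm) ring_scheme \<Rightarrow> bool" where
  "left_hereditary S \<longleftrightarrow> right_hereditary (opposite_ring S)"

section \<open>Dedekind domains\<close>

text \<open>The locale \<^locale>\<open>domain\<close> of the library includes commutativity.\<close>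

definition noncommutative_domain :: "('a, 'm) ring_scheme \<Rightarrow> bool" where
  "noncommutative_domain S \<longleftrightarrow>
     ring S \<and> \<one>\<^bsub>S\<^esub> \<noteq> \<zero>\<^bsub>S\<^esub> \<and>
     (\<forall>a\<in>carrier S. \<forall>b\<in>carrier S.
        a \<otimes>\<^bsub>S\<^esub> b = \<zero>\<^bsub>S\<^esub> \<longrightarrow> a = \<zero>\<^bsub>S\<^esub> \<or> b = \<zero>\<^bsub>S\<^esub>)"

definition division_ring :: "('a, 'm) ring_scheme \<Rightarrow> bool" where
  "division_ring Q \<longleftrightarrow>
     ring Q \<and> \<one>\<^bsub>Q\<^esub> \<noteq> \<zero>\<^bsub>Q\<^esub> \<and> Units Q = carrier Q - {\<zero>\<^bsub>Q\<^esub>}"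

definition division_ring_of_fractions ::
    "('a, 'm) ring_scheme \<Rightarrow> ('q, 'n) ring_scheme \<Rightarrow> ('a \<Rightarrow> 'q) \<Rightarrow> bool" where
  "division_ring_of_fractions S Q \<iota> \<longleftrightarrow>
     division_ring Q \<and> \<iota> \<in> ring_hom S Q \<and> inj_on \<iota> (carrier S) \<and>
     (\<forall>q\<in>carrier Q. \<exists>a\<in>carrier S. \<exists>s\<in>carrier S - {\<zero>\<^bsub>S\<^esub>}. q = \<iota> a \<otimes>\<^bsub>Q\<^esub> inv\<^bsub>Q\<^esub> (\<iota> s)) \<and>
     (\<forall>q\<in>carrier Q. \<exists>a\<in>carrier S. \<exists>s\<in>carrier S - {\<zero>\<^bsub>S\<^esub>}. q = inv\<^bsub>Q\<^esub> (\<iota> s) \<otimes>\<^bsub>Q\<^esub> \<iota> a)"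

definition sub_bimodule ::
    "('a, 'm) ring_scheme \<Rightarrow> ('q, 'n) ring_scheme \<Rightarrow> ('a \<Rightarrow> 'q) \<Rightarrow> 'q set \<Rightarrow> bool" where
  "sub_bimodule S Q \<iota> J \<longleftrightarrow>
     additive_subgroup J Q \<and>
     (\<forall>a\<in>carrier S. \<forall>x\<in>J. \<iota> a \<otimes>\<^bsub>Q\<^esub> x \<in> J \<and> x \<otimes>\<^bsub>Q\<^esub> \<iota> a \<in> J)"

text \<open>Note that \<^const>\<open>ideal_prod\<close> makes sense for additive subgroups, not only for ideals.\<close>

definition invertible_ideal ::
    "('a, 'm) ring_scheme \<Rightarrow> ('q, 'n) ring_scheme \<Rightarrow> ('a \<Rightarrow> 'q) \<Rightarrow> 'a set \<Rightarrow> bool" where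
  "invertible_ideal S Q \<iota> I \<longleftrightarrow>
     (\<exists>J. sub_bimodule S Q \<iota> J \<and>
          ideal_prod Q (\<iota> ` I) J = \<iota> ` carrier S \<and>
          ideal_prod Q J (\<iota> ` I) = \<iota> ` carrier S)"

text \<open>
  A division ring of fractions is unique up to isomorphism over \<open>S\<close>, and one that exists on
  any type has a copy on \<open>('a \<times> 'a) set\<close>, obtained by sending \<open>q\<close> to the set of all
  \<open>(a, s)\<close> with \<open>q = a s\<^sup>-\<^sup>1\<close>.  For a domain \<open>S\<close> the property below says that \<open>S\<close> is an Asano
  order, and for a commutative domain that it is a Dedekind domain.
\<close>

definition all_nonzero_ideals_invertible :: "('a, 'm) ring_scheme \<Rightarrow> bool" where
  "all_nonzero_ideals_invertible S \<longleftrightarrow>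
     (\<exists>(Q :: ('a \<times> 'a) set ring) \<iota>.
        division_ring_of_fractions S Q \<iota> \<and>
        (\<forall>I. ideal I S \<and> I \<noteq> {\<zero>\<^bsub>S\<^esub>} \<longrightarrow> invertible_ideal S Q \<iota> I))"

definition commutative_dedekind_domain :: "('a, 'm) ring_scheme \<Rightarrow> bool" where
  "commutative_dedekind_domain D \<longleftrightarrow> domain D \<and> all_nonzero_ideals_invertible D"

definition noncommutative_dedekind_domain :: "('a, 'm) ring_scheme \<Rightarrow> bool" where
  "noncommutative_dedekind_domain S \<longleftrightarrow>
     noncommutative_domain S \<and>
     left_noetherian S \<and> right_noetherian S \<and>
     left_hereditary S \<and> right_hereditary S \<and>
     all_nonzero_ideals_invertible S"

section \<open>Skew Laurent series\<close>

definition automorphism_power ::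
    "('a, 'm) ring_scheme \<Rightarrow> ('a \<Rightarrow> 'a) \<Rightarrow> int \<Rightarrow> 'a \<Rightarrow> 'a" where
  "automorphism_power D \<sigma> i =
     (if 0 \<le> i then \<sigma> ^^ nat i else inv_into (carrier D) \<sigma> ^^ nat (- i))"

text \<open>
  The function \<open>f\<close> represents the series \<open>\<Sum>i. f i x\<^sup>i\<close>.  Since
  \<open>(a x\<^sup>i) (b x\<^sup>j) = a \<sigma>\<^sup>i(b) x\<^sup>i\<^sup>+\<^sup>j\<close>, the coefficient of \<open>x\<^sup>n\<close> in \<open>f g\<close> is the sum of all
  \<open>f i \<sigma>\<^sup>i(g (n - i))\<close>; the index set below leaves out vanishing terms only and is finite.
\<close>

definition skew_laurent_ring ::
    "('a, 'm) ring_scheme \<Rightarrow> ('a \<Rightarrow> 'a) \<Rightarrow> (int \<Rightarrow> 'a) ring" where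
  "skew_laurent_ring D \<sigma> =
     \<lparr>carrier = {f. range f \<subseteq> carrier D \<and> (\<exists>k. \<forall>i<k. f i = \<zero>\<^bsub>D\<^esub>)},
      monoid.mult = (\<lambda>f g n. \<Oplus>\<^bsub>D\<^esub>i\<in>{i. f i \<noteq> \<zero>\<^bsub>D\<^esub> \<and> g (n - i) \<noteq> \<zero>\<^bsub>D\<^esub>}.
                f i \<otimes>\<^bsub>D\<^esub> automorphism_power D \<sigma> i (g (n - i))),
      one = (\<lambda>i. if i = 0 then \<one>\<^bsub>D\<^esub> else \<zero>\<^bsub>D\<^esub>),
      ring.zero = (\<lambda>_. \<zero>\<^bsub>D\<^esub>),
      ring.add = (\<lambda>f g i. f i \<oplus>\<^bsub>D\<^esub> g i)\<rparr>"

definition acts_trivially_on_class_group ::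
    "('a, 'm) ring_scheme \<Rightarrow> ('a \<Rightarrow> 'a) \<Rightarrow> bool" where
  "acts_trivially_on_class_group D \<sigma> \<longleftrightarrow>
     (\<forall>I. ideal I D \<longrightarrow>
        module_isomorphic D (ideal_as_module D (\<sigma> ` I)) (ideal_as_module D I))"

section \<open>The Grothendieck group\<close>

text \<open>
  Every finitely generated projective module is isomorphic to a submodule of some \<open>S\<^sup>n\<close>,
  hence to a module whose elements have type \<open>nat \<Rightarrow> 'a\<close>.
\<close>

definition fg_projective_modules ::
    "('a, 'm) ring_scheme \<Rightarrow> ('a, nat \<Rightarrow> 'a) module set" where
  "fg_projective_modules S =
     {P. projective_right_module S P \<and> finitely_generated_module S P}"

text \<open>The case \<open>Q = 0\<close> of the relations identifies the classes of isomorphic modules.\<close>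

definition K0_relations ::
    "('a, 'm) ring_scheme \<Rightarrow> (('a, nat \<Rightarrow> 'a) module \<Rightarrow>\<^sub>0 int) set" where
  "K0_relations S =
     {frag_of N - frag_of P - frag_of Q | N P Q.
        N \<in> fg_projective_modules S \<and> P \<in> fg_projective_modules S \<and>
        Q \<in> fg_projective_modules S \<and> module_isomorphic S N (direct_sum_module P Q)}"

definition K0 ::
    "('a, 'm) ring_scheme \<Rightarrow> (('a, nat \<Rightarrow> 'a) module \<Rightarrow>\<^sub>0 int) set monoid" where
  "K0 S = free_Abelian_group (fg_projective_modules S)
            Mod generate (free_Abelian_group (fg_projective_modules S)) (K0_relations S)"

end

theory Submission
  imports Defs
begin

text \<open>
  Let \<open>E = K((x;\<sigma>))\<close>, a division ring, where \<open>K\<close> is the field of fractions of \<open>D\<close>.  The lowest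
  coefficients of the elements of a nonzero right ideal \<open>I\<close> of \<open>R\<close> form an ideal \<open>J\<close> of \<open>D\<close>.
  If \<open>\<Sum> a\<^sub>i b\<^sub>i = 1\<close> with \<open>a\<^sub>i \<in> J\<close>, \<open>b\<^sub>i \<in> J\<^sup>-\<^sup>1\<close>, and \<open>f\<^sub>i \<in> I\<close> has lowest term \<open>a\<^sub>i\<close>, then
  \<open>u = \<Sum> f\<^sub>i b\<^sub>i \<in> E\<close> is a unit and \<open>I = u J((x))\<close>.  So \<open>I \<cong> J((x))\<close> is finitely generated and
  projective; left ideals are treated by passing to the opposite ring \<open>D((x;\<sigma>\<^sup>-\<^sup>1))\<close>.  If \<open>I\<close> is
  two-sided, then \<open>\<sigma>(J) = J\<close> and \<open>u R u\<^sup>-\<^sup>1 = R\<close>, whence the inverse \<open>J\<^sup>-\<^sup>1((x)) u\<^sup>-\<^sup>1\<close> of \<open>I\<close>.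

  For \<open>K\<^sub>0\<close>, the map \<open>P \<mapsto> P((x))\<close> is surjective on classes, since every finitely generated
  projective module is a direct sum of right ideals.  For injectivity, an isomorphism
  \<open>P((x)) \<cong> P'((x))\<close> gives two \<open>D[[x;\<sigma>]]\<close>-lattices \<open>N \<subseteq> W\<close> in one module.  With \<open>T = W / N\<close>,
  computing the class of \<open>W / N x\<close> in two ways yields \<open>[W / W x] + [T\<^sup>\<sigma>] = [T] + [N / N x]\<close>, and
  \<open>T\<^sup>\<sigma> \<cong> T\<close> if \<open>\<sigma>\<close> acts trivially on the class group.
\<close>

section \<open>Finite sums\<close>

text \<open>Since \<open>x\<close> is a unit of \<open>R\<close>, every lowest term can be moved to
  exponent 0, so one ideal of \<open>D\<close> describes the lowest coefficients at all exponents.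
  The obstacle is that \<open>u\<close> has coefficients in the field of fractions: left
  multiplication by \<open>u\<close> determines \<open>I\<close> as a right module, but controls
  products \<open>i e\<close> with \<open>i\<close> in \<open>I\<close> only once conjugation by
  \<open>u\<close> is known to preserve \<open>R\<close>. Moreover, \<open>E\<close> is in general
  larger than the ring of fractions of \<open>R\<close>, which therefore has to be cut out of
  \<open>E\<close> by the Ore conditions.

  On \<open>P((x))\<close> right multiplication by \<open>x\<close> is only semilinear over
  \<open>D\<close>, because \<open>d x = x \<sigma>\<^sup>-\<^sup>1(d)\<close>. This is where the
  twist of \<open>T\<close> comes from, and it is the only way in which the action on the class
  group enters. Both filtrations of \<open>W / N x\<close> split only if \<open>T\<close> is
  projective. This is not clear from its definition as a quotient; it follows from the hereditary
  property of \<open>D\<close>.\<close>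

lemma additive_zero:
  assumes "abelian_group G" "abelian_group H" "h \<in> carrier G \<rightarrow> carrier H"
    and "\<And>x y. x \<in> carrier G \<Longrightarrow> y \<in> carrier G \<Longrightarrow> h (x \<oplus>\<^bsub>G\<^esub> y) = h x \<oplus>\<^bsub>H\<^esub> h y"
  shows "h \<zero>\<^bsub>G\<^esub> = \<zero>\<^bsub>H\<^esub>"
proof -
  interpret G: abelian_group G by fact
  interpret H: abelian_group H by fact
  have c: "h \<zero>\<^bsub>G\<^esub> \<in> carrier H" using assms(3) by auto
  have "h \<zero>\<^bsub>G\<^esub> \<oplus>\<^bsub>H\<^esub> h \<zero>\<^bsub>G\<^esub> = h \<zero>\<^bsub>G\<^esub>" using assms(4)[of "\<zero>\<^bsub>G\<^esub>" "\<zero>\<^bsub>G\<^esub>"] by simp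
  then show ?thesis using c by (simp add: H.add.r_cancel_one)
qed

text \<open>Stated for a bare additive map because it serves maps of several kinds: linear maps,
  ring homomorphisms, scalar multiplication in either argument, the projections of a direct sum, and
  evaluation of a series at one exponent.\<close>

lemma additive_finsum:
  assumes "abelian_group G" "abelian_group H" "h \<in> carrier G \<rightarrow> carrier H"
    and "\<And>x y. x \<in> carrier G \<Longrightarrow> y \<in> carrier G \<Longrightarrow> h (x \<oplus>\<^bsub>G\<^esub> y) = h x \<oplus>\<^bsub>H\<^esub> h y"
    and "f \<in> A \<rightarrow> carrier G"
  shows "h (finsum G f A) = finsum H (\<lambda>i. h (f i)) A"
proof -
  interpret G: abelian_group G by fact
  interpret H: abelian_group H by fact
  have z: "h \<zero>\<^bsub>G\<^esub> = \<zero>\<^bsub>H\<^esub>" by (rule additive_zero[OF assms(1-4)])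
  show ?thesis using assms(5)
  proof (induct A rule: infinite_finite_induct)
    case (infinite A) then show ?case by (simp add: z)
  next
    case empty then show ?case by (simp add: z)
  next
    case (insert a A)
    have "f \<in> A \<rightarrow> carrier G" "f a \<in> carrier G" "finsum G f A \<in> carrier G"
      using insert.prems by auto
    moreover have "(\<lambda>i. h (f i)) \<in> A \<rightarrow> carrier H" "h (f a) \<in> carrier H"
      using insert.prems assms(3) by auto
    ultimately show ?case using insert by (simp add: assms(4))
  qed
qed

text \<open>A sum sees only the additive fields of a record. Hence sums in the regular module or in
  a twist are sums in the original structure.\<close>

lemma finsum_record_cong:
  assumes "carrier G = carrier H" "add G = add H" "ring.zero G = ring.zero H"
  shows "finsum G f A = finsum H f A"
  using assms by (simp add: finsum_def finprod_def)

lemma (in abelian_monoid) finsum_swap: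
  assumes "finite A" "finite B" "\<And>i j. i \<in> A \<Longrightarrow> j \<in> B \<Longrightarrow> F i j \<in> carrier G"
  shows "(\<Oplus>i\<in>A. \<Oplus>j\<in>B. F i j) = (\<Oplus>j\<in>B. \<Oplus>i\<in>A. F i j)"
  using assms(1,3)
proof (induct A rule: finite_induct)
  case empty then show ?case by simp
next
  case (insert a A)
  have 1: "(\<lambda>i. \<Oplus>j\<in>B. F i j) \<in> A \<rightarrow> carrier G" "(\<Oplus>j\<in>B. F a j) \<in> carrier G"
    using insert.prems by (auto intro!: finsum_closed)
  have 2: "(\<lambda>j. \<Oplus>i\<in>A. F i j) \<in> B \<rightarrow> carrier G" "F a \<in> B \<rightarrow> carrier G"
    using insert.prems by (auto intro!: finsum_closed)
  have "(\<Oplus>i\<in>insert a A. \<Oplus>j\<in>B. F i j) = (\<Oplus>j\<in>B. F a j) \<oplus> (\<Oplus>j\<in>B. \<Oplus>i\<in>A. F i j)"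
    using insert 1 by simp
  also have "\<dots> = (\<Oplus>j\<in>B. F a j \<oplus> (\<Oplus>i\<in>A. F i j))"
    using 2 by (simp add: finsum_addf)
  also have "\<dots> = (\<Oplus>j\<in>B. \<Oplus>i\<in>insert a A. F i j)"
  proof (rule finsum_cong')
    show "(\<lambda>j. \<Oplus>i\<in>insert a A. F i j) \<in> B \<rightarrow> carrier G"
      using insert.prems by (intro Pi_I finsum_closed) auto
    fix j assume "j \<in> B"
    then have "(\<lambda>i. F i j) \<in> A \<rightarrow> carrier G" "F a j \<in> carrier G" using insert.prems by auto
    then show "F a j \<oplus> (\<Oplus>i\<in>A. F i j) = (\<Oplus>i\<in>insert a A. F i j)"
      using insert(1,2) by simp
  qed simp
  finally show ?case .
qed

lemma (in abelian_monoid) finsum_superset: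
  assumes "finite B" "A \<subseteq> B" "f \<in> B \<rightarrow> carrier G" "\<And>i. i \<in> B - A \<Longrightarrow> f i = \<zero>"
  shows "finsum G f A = finsum G f B"
  using assms by (intro add.finprod_mono_neutral_cong_left) auto

section \<open>Modules, submodules and linear maps\<close>

text \<open>Negatives come from the action of -1 (\<open>right_submodule_uminus\<close>). As a
  module, the submodule is the record \<open>M\<lparr>carrier := U\<rparr>\<close>, so that neither
  the operations nor the type change.\<close>

definition right_submodule :: "('a, 'm) ring_scheme \<Rightarrow> ('a, 'b) module \<Rightarrow> 'b set \<Rightarrow> bool" where
  "right_submodule S M U \<longleftrightarrow>
     U \<subseteq> carrier M \<and> \<zero>\<^bsub>M\<^esub> \<in> U \<and> (\<forall>x\<in>U. \<forall>y\<in>U. x \<oplus>\<^bsub>M\<^esub> y \<in> U) \<and>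
     (\<forall>a\<in>carrier S. \<forall>x\<in>U. a \<odot>\<^bsub>M\<^esub> x \<in> U)"

definition right_linear ::
    "('a, 'm) ring_scheme \<Rightarrow> ('a, 'b) module \<Rightarrow> ('a, 'c) module \<Rightarrow> ('b \<Rightarrow> 'c) \<Rightarrow> bool" where
  "right_linear S M N f \<longleftrightarrow>
     f \<in> carrier M \<rightarrow> carrier N \<and>
     (\<forall>x\<in>carrier M. \<forall>y\<in>carrier M. f (x \<oplus>\<^bsub>M\<^esub> y) = f x \<oplus>\<^bsub>N\<^esub> f y) \<and>
     (\<forall>a\<in>carrier S. \<forall>x\<in>carrier M. f (a \<odot>\<^bsub>M\<^esub> x) = a \<odot>\<^bsub>N\<^esub> f x)"

abbreviation regular_module :: "('a, 'm) ring_scheme \<Rightarrow> ('a, 'a) module" where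
  "regular_module S \<equiv> ideal_as_module S (carrier S)"

lemma right_moduleI:
  assumes "ring S" "abelian_group M"
    and "\<And>a x. a \<in> carrier S \<Longrightarrow> x \<in> carrier M \<Longrightarrow> a \<odot>\<^bsub>M\<^esub> x \<in> carrier M"
    and "\<And>a b x. \<lbrakk>a \<in> carrier S; b \<in> carrier S; x \<in> carrier M\<rbrakk> \<Longrightarrow>
        (a \<oplus>\<^bsub>S\<^esub> b) \<odot>\<^bsub>M\<^esub> x = a \<odot>\<^bsub>M\<^esub> x \<oplus>\<^bsub>M\<^esub> b \<odot>\<^bsub>M\<^esub> x"
    and "\<And>a x y. \<lbrakk>a \<in> carrier S; x \<in> carrier M; y \<in> carrier M\<rbrakk> \<Longrightarrow>
        a \<odot>\<^bsub>M\<^esub> (x \<oplus>\<^bsub>M\<^esub> y) = a \<odot>\<^bsub>M\<^esub> x \<oplus>\<^bsub>M\<^esub> a \<odot>\<^bsub>M\<^esub> y"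
    and "\<And>a b x. \<lbrakk>a \<in> carrier S; b \<in> carrier S; x \<in> carrier M\<rbrakk> \<Longrightarrow>
        (a \<otimes>\<^bsub>S\<^esub> b) \<odot>\<^bsub>M\<^esub> x = b \<odot>\<^bsub>M\<^esub> (a \<odot>\<^bsub>M\<^esub> x)"
    and "\<And>x. x \<in> carrier M \<Longrightarrow> \<one>\<^bsub>S\<^esub> \<odot>\<^bsub>M\<^esub> x = x"
  shows "right_module S M"
  using assms by (simp add: right_module_def right_module_axioms_def)

lemma right_moduleD:
  assumes "right_module S M"
  shows "ring S" "abelian_group M"
  using assms by (simp_all add: right_module_def)

context right_module
begin

lemma smult_zero_vector [simp]: "a \<in> carrier S \<Longrightarrow> a \<odot>\<^bsub>M\<^esub> \<zero>\<^bsub>M\<^esub> = \<zero>\<^bsub>M\<^esub>"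
  using additive_zero[OF M.abelian_group_axioms M.abelian_group_axioms, of "\<lambda>x. a \<odot>\<^bsub>M\<^esub> x"]
  by (simp add: smult_closed smult_distrib_vector)

lemma smult_zero_scalar [simp]: "x \<in> carrier M \<Longrightarrow> \<zero> \<odot>\<^bsub>M\<^esub> x = \<zero>\<^bsub>M\<^esub>"
  using additive_zero[OF S.abelian_group_axioms M.abelian_group_axioms, of "\<lambda>a. a \<odot>\<^bsub>M\<^esub> x"]
  by (simp add: smult_closed smult_distrib_scalar)

lemma smult_uminus: "x \<in> carrier M \<Longrightarrow> (\<ominus> \<one>) \<odot>\<^bsub>M\<^esub> x = \<ominus>\<^bsub>M\<^esub> x"
proof -
  assume x: "x \<in> carrier M"
  have "(\<ominus> \<one>) \<odot>\<^bsub>M\<^esub> x \<oplus>\<^bsub>M\<^esub> x = (\<ominus> \<one> \<oplus> \<one>) \<odot>\<^bsub>M\<^esub> x"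
    using x by (subst smult_distrib_scalar) (auto simp: smult_one)
  also have "\<dots> = \<zero>\<^bsub>M\<^esub>" using x by (simp add: S.l_neg)
  finally show ?thesis using x by (metis M.minus_equality S.add.inv_closed S.one_closed smult_closed)
qed

lemma smult_finsum_vector:
  assumes "a \<in> carrier S" "f \<in> A \<rightarrow> carrier M"
  shows "a \<odot>\<^bsub>M\<^esub> finsum M f A = (\<Oplus>\<^bsub>M\<^esub>i\<in>A. a \<odot>\<^bsub>M\<^esub> f i)"
  by (rule additive_finsum[OF M.abelian_group_axioms M.abelian_group_axioms])
     (use assms in \<open>auto simp: smult_closed smult_distrib_vector\<close>)

lemma smult_finsum_scalar:
  assumes "x \<in> carrier M" "f \<in> A \<rightarrow> carrier S"
  shows "finsum S f A \<odot>\<^bsub>M\<^esub> x = (\<Oplus>\<^bsub>M\<^esub>i\<in>A. f i \<odot>\<^bsub>M\<^esub> x)"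
  by (rule additive_finsum[OF S.abelian_group_axioms M.abelian_group_axioms])
     (use assms in \<open>auto simp: smult_closed smult_distrib_scalar\<close>)

end

section \<open>Submodules\<close>

lemma right_submodule_uminus:
  assumes "right_module S M" "right_submodule S M U" "x \<in> U"
  shows "\<ominus>\<^bsub>M\<^esub> x \<in> U"
proof -
  interpret right_module S M by fact
  show ?thesis using assms smult_uminus[of x] unfolding right_submodule_def
    by (metis S.add.inv_closed S.one_closed subsetD)
qed

lemma right_submodule_self: "right_module S M \<Longrightarrow> right_submodule S M (carrier M)"
  unfolding right_submodule_def right_module_def right_module_axioms_def
  by (auto simp: abelian_group_def intro: abelian_monoid.zero_closed abelian_monoid.a_closed)

lemma right_submodule_finsum:
  assumes "right_module S M" "right_submodule S M U" "f \<in> A \<rightarrow> U"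
  shows "finsum M f A \<in> U"
proof -
  interpret right_module S M by fact
  show ?thesis using assms(3)
  proof (induct A rule: infinite_finite_induct)
    case (insert a A)
    have "f \<in> A \<rightarrow> carrier M" "f a \<in> carrier M"
      using insert.prems assms(2) by (auto simp: right_submodule_def)
    then show ?case using insert assms(2) by (auto simp: right_submodule_def)
  qed (use assms(2) in \<open>auto simp: right_submodule_def\<close>)
qed

lemma right_module_submodule:
  assumes "right_module S M" "right_submodule S M U"
  shows "right_module S (M\<lparr>carrier := U\<rparr>)"
proof -
  interpret right_module S M by fact
  have U: "U \<subseteq> carrier M" and c: "\<And>x y. x \<in> U \<Longrightarrow> y \<in> U \<Longrightarrow> x \<oplus>\<^bsub>M\<^esub> y \<in> U"
     "\<And>a x. a \<in> carrier S \<Longrightarrow> x \<in> U \<Longrightarrow> a \<odot>\<^bsub>M\<^esub> x \<in> U" and z: "\<zero>\<^bsub>M\<^esub> \<in> U"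
    using assms(2) by (auto simp: right_submodule_def)
  have "abelian_group (M\<lparr>carrier := U\<rparr>)"
  proof (rule abelian_groupI, goal_cases)
    case (6 x)
    then show ?case using right_submodule_uminus[OF assms, of x] U
      by (auto simp: M.l_neg intro!: bexI[of _ "\<ominus>\<^bsub>M\<^esub> x"])
  qed (use U c z in \<open>auto simp: M.a_ac subset_iff\<close>)
  then show ?thesis
    by (rule right_moduleI[OF S.ring_axioms])
       (use U c in \<open>auto simp: subset_iff smult_distrib_scalar smult_distrib_vector smult_assoc smult_one\<close>)
qed

lemma finsum_submodule:
  assumes "right_module S M" "right_submodule S M U" "f \<in> A \<rightarrow> U"
  shows "finsum (M\<lparr>carrier := U\<rparr>) f A = finsum M f A"
proof -
  interpret right_module S M by fact
  interpret U: right_module S "M\<lparr>carrier := U\<rparr>" by (rule right_module_submodule[OF assms(1,2)])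
  show ?thesis
    using additive_finsum[OF U.M.abelian_group_axioms M.abelian_group_axioms, of "\<lambda>x. x" f A] assms
    by (auto simp: right_submodule_def)
qed

section \<open>Linear maps, kernels and images\<close>

lemma right_linearI:
  assumes "\<And>x. x \<in> carrier M \<Longrightarrow> f x \<in> carrier N"
    "\<And>x y. x \<in> carrier M \<Longrightarrow> y \<in> carrier M \<Longrightarrow> f (x \<oplus>\<^bsub>M\<^esub> y) = f x \<oplus>\<^bsub>N\<^esub> f y"
    "\<And>a x. a \<in> carrier S \<Longrightarrow> x \<in> carrier M \<Longrightarrow> f (a \<odot>\<^bsub>M\<^esub> x) = a \<odot>\<^bsub>N\<^esub> f x"
  shows "right_linear S M N f"
  using assms by (auto simp: right_linear_def)

lemma right_linearD:
  assumes "right_linear S M N f"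
  shows "x \<in> carrier M \<Longrightarrow> f x \<in> carrier N"
    "x \<in> carrier M \<Longrightarrow> y \<in> carrier M \<Longrightarrow> f (x \<oplus>\<^bsub>M\<^esub> y) = f x \<oplus>\<^bsub>N\<^esub> f y"
    "a \<in> carrier S \<Longrightarrow> x \<in> carrier M \<Longrightarrow> f (a \<odot>\<^bsub>M\<^esub> x) = a \<odot>\<^bsub>N\<^esub> f x"
  using assms by (auto simp: right_linear_def)

lemma right_linear_zero:
  assumes "right_module S M" "right_module S N" "right_linear S M N f"
  shows "f \<zero>\<^bsub>M\<^esub> = \<zero>\<^bsub>N\<^esub>"
  using additive_zero[of M N f] assms by (auto simp: right_linear_def right_module_def)

lemma right_linear_uminus:
  assumes "right_module S M" "right_module S N" "right_linear S M N f" "x \<in> carrier M"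
  shows "f (\<ominus>\<^bsub>M\<^esub> x) = \<ominus>\<^bsub>N\<^esub> f x"
proof -
  interpret M: right_module S M by fact
  interpret N: right_module S N by fact
  show ?thesis using assms M.smult_uminus[of x] N.smult_uminus[of "f x"]
    by (metis M.S.add.inv_closed M.S.one_closed right_linearD(1) right_linearD(3))
qed

lemma right_linear_minus:
  assumes "right_module S M" "right_module S N" "right_linear S M N f" "x \<in> carrier M" "y \<in> carrier M"
  shows "f (x \<ominus>\<^bsub>M\<^esub> y) = f x \<ominus>\<^bsub>N\<^esub> f y"
proof -
  interpret M: right_module S M by fact
  show ?thesis using assms by (simp add: a_minus_def right_linearD(2) right_linear_uminus)
qed

lemma right_linear_finsum:
  assumes "right_module S M" "right_module S N" "right_linear S M N f" "g \<in> A \<rightarrow> carrier M"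
  shows "f (finsum M g A) = (\<Oplus>\<^bsub>N\<^esub>i\<in>A. f (g i))"
  using additive_finsum[of M N f g A] assms by (auto simp: right_linear_def right_module_def)

lemma right_linear_compose:
  "right_linear S M N f \<Longrightarrow> right_linear S N L g \<Longrightarrow> right_linear S M L (\<lambda>x. g (f x))"
  by (rule right_linearI) (simp_all add: right_linearD)

lemma right_linear_subset:
  "right_linear S M N f \<Longrightarrow> U \<subseteq> carrier M \<Longrightarrow> right_linear S (M\<lparr>carrier := U\<rparr>) N f"
  by (rule right_linearI) (simp_all add: right_linearD subset_iff)

lemma right_linear_into:
  "right_linear S M N f \<Longrightarrow> f ` carrier M \<subseteq> V \<Longrightarrow> right_linear S M (N\<lparr>carrier := V\<rparr>) f"
  unfolding right_linear_def by auto

lemma right_linear_inj_iff: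
  assumes "right_module S M" "right_module S N" "right_linear S M N f"
  shows "inj_on f (carrier M) \<longleftrightarrow> (\<forall>x\<in>carrier M. f x = \<zero>\<^bsub>N\<^esub> \<longrightarrow> x = \<zero>\<^bsub>M\<^esub>)"
proof -
  interpret M: right_module S M by fact
  interpret N: right_module S N by fact
  note lin = right_linearD[OF assms(3)] right_linear_minus[OF assms] right_linear_zero[OF assms]
  show ?thesis
  proof
    show "inj_on f (carrier M) \<Longrightarrow> \<forall>x\<in>carrier M. f x = \<zero>\<^bsub>N\<^esub> \<longrightarrow> x = \<zero>\<^bsub>M\<^esub>"
      using lin by (metis M.M.zero_closed inj_onD)
  next
    assume a: "\<forall>x\<in>carrier M. f x = \<zero>\<^bsub>N\<^esub> \<longrightarrow> x = \<zero>\<^bsub>M\<^esub>"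
    show "inj_on f (carrier M)"
    proof (rule inj_onI)
      fix x y assume xy: "x \<in> carrier M" "y \<in> carrier M" "f x = f y"
      then have "f (x \<ominus>\<^bsub>M\<^esub> y) = \<zero>\<^bsub>N\<^esub>" using lin by (simp add: N.M.r_neg a_minus_def)
      then have "x \<ominus>\<^bsub>M\<^esub> y = \<zero>\<^bsub>M\<^esub>" using a xy by auto
      then have "(x \<ominus>\<^bsub>M\<^esub> y) \<oplus>\<^bsub>M\<^esub> y = y" using xy by simp
      then show "x = y" using xy by (simp add: a_minus_def M.M.a_assoc M.M.l_neg)
    qed
  qed
qed

lemma right_submodule_kernel:
  assumes "right_module S M" "right_module S N" "right_linear S M N f"
  shows "right_submodule S M {x \<in> carrier M. f x = \<zero>\<^bsub>N\<^esub>}"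
proof -
  interpret M: right_module S M by fact
  interpret N: right_module S N by fact
  show ?thesis using right_linearD[OF assms(3)] right_linear_zero[OF assms]
    by (auto simp: right_submodule_def M.smult_closed)
qed

lemma right_submodule_image:
  assumes "right_module S M" "right_module S N" "right_linear S M N f"
  shows "right_submodule S N (f ` carrier M)"
proof -
  interpret M: right_module S M by fact
  interpret N: right_module S N by fact
  note l = right_linearD[OF assms(3)] right_linear_zero[OF assms]
  show ?thesis unfolding right_submodule_def
    using l(1) l(2)[symmetric] l(3)[symmetric] l(4)[symmetric] by (auto simp: M.smult_closed intro!: imageI)
qed

section \<open>Isomorphisms and direct sums\<close>

lemma module_isomorphic_iff:
  "module_isomorphic S M N \<longleftrightarrow> (\<exists>f. bij_betw f (carrier M) (carrier N) \<and> right_linear S M N f)"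
  unfolding module_isomorphic_def right_linear_def by (auto simp: bij_betw_def)

lemma right_linear_inv:
  assumes "right_module S M" "bij_betw f (carrier M) (carrier N)" "right_linear S M N f"
  shows "right_linear S N M (inv_into (carrier M) f)"
proof -
  interpret M: right_module S M by fact
  let ?g = "inv_into (carrier M) f"
  have g: "\<And>y. y \<in> carrier N \<Longrightarrow> ?g y \<in> carrier M \<and> f (?g y) = y"
    using assms(2) by (auto simp: bij_betw_def intro: inv_into_into f_inv_into_f)
  have e: "\<And>x. x \<in> carrier M \<Longrightarrow> ?g (f x) = x"
    using assms(2) by (auto simp: bij_betw_def)
  note l = right_linearD[OF assms(3)]
  show ?thesis
  proof (rule right_linearI)
    fix x y assume "x \<in> carrier N" "y \<in> carrier N"
    then show "?g (x \<oplus>\<^bsub>N\<^esub> y) = ?g x \<oplus>\<^bsub>M\<^esub> ?g y" using g e[of "?g x \<oplus>\<^bsub>M\<^esub> ?g y"] l(2)[of "?g x" "?g y"]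
      by auto
  next
    fix a x assume "a \<in> carrier S" "x \<in> carrier N"
    then show "?g (a \<odot>\<^bsub>N\<^esub> x) = a \<odot>\<^bsub>M\<^esub> ?g x"
      using g e[of "a \<odot>\<^bsub>M\<^esub> ?g x"] l(3)[of a "?g x"] M.smult_closed by auto
  qed (use g in auto)
qed

lemma module_isomorphic_refl: "module_isomorphic S M M"
  unfolding module_isomorphic_def by (rule exI[of _ id]) (auto simp: bij_betw_def)

lemma module_isomorphic_sym:
  "right_module S M \<Longrightarrow> module_isomorphic S M N \<Longrightarrow> module_isomorphic S N M"
  unfolding module_isomorphic_iff using right_linear_inv bij_betw_inv_into by blast

lemma module_isomorphic_trans:
  "module_isomorphic S M N \<Longrightarrow> module_isomorphic S N L \<Longrightarrow> module_isomorphic S M L"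
  unfolding module_isomorphic_iff
  using bij_betw_trans right_linear_compose by (metis (no_types, lifting) comp_apply ext)

section \<open>Direct sums\<close>

lemma direct_sum_simps [simp]:
  "carrier (direct_sum_module M N) = carrier M \<times> carrier N"
  "\<zero>\<^bsub>direct_sum_module M N\<^esub> = (\<zero>\<^bsub>M\<^esub>, \<zero>\<^bsub>N\<^esub>)"
  "x \<oplus>\<^bsub>direct_sum_module M N\<^esub> y = (fst x \<oplus>\<^bsub>M\<^esub> fst y, snd x \<oplus>\<^bsub>N\<^esub> snd y)"
  "a \<odot>\<^bsub>direct_sum_module M N\<^esub> x = (a \<odot>\<^bsub>M\<^esub> fst x, a \<odot>\<^bsub>N\<^esub> snd x)"
  by (auto simp: direct_sum_module_def split: prod.splits)

lemma right_module_direct_sum: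
  assumes "right_module S M" "right_module S N"
  shows "right_module S (direct_sum_module M N)"
proof -
  interpret M: right_module S M by fact
  interpret N: right_module S N by fact
  have "abelian_group (direct_sum_module M N)"
  proof (rule abelian_groupI, goal_cases)
    case (6 x)
    then show ?case by (intro bexI[of _ "(\<ominus>\<^bsub>M\<^esub> fst x, \<ominus>\<^bsub>N\<^esub> snd x)"]) (auto simp: M.M.l_neg N.M.l_neg)
  qed (auto simp: M.M.a_ac N.M.a_ac)
  then show ?thesis
    by (rule right_moduleI[OF M.S.ring_axioms])
       (auto simp: M.smult_distrib_scalar M.smult_distrib_vector M.smult_assoc M.smult_one M.smult_closed
         N.smult_distrib_scalar N.smult_distrib_vector N.smult_assoc N.smult_one N.smult_closed)
qed

lemma module_isomorphic_direct_sum: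
  assumes "module_isomorphic S M M'" "module_isomorphic S N N'"
  shows "module_isomorphic S (direct_sum_module M N) (direct_sum_module M' N')"
proof -
  obtain f g where f: "bij_betw f (carrier M) (carrier M')" "right_linear S M M' f"
    and g: "bij_betw g (carrier N) (carrier N')" "right_linear S N N' g"
    using assms unfolding module_isomorphic_iff by blast
  show ?thesis unfolding module_isomorphic_iff
    using f g bij_betw_map_prod[OF f(1) g(1)]
    by (intro exI[of _ "map_prod f g"]) (auto simp: right_linear_def)
qed

section \<open>Right ideals as submodules of the regular module\<close>

lemma ideal_as_module_simps [simp]:
  "carrier (ideal_as_module S I) = I" "\<zero>\<^bsub>ideal_as_module S I\<^esub> = \<zero>\<^bsub>S\<^esub>"
  "x \<oplus>\<^bsub>ideal_as_module S I\<^esub> y = x \<oplus>\<^bsub>S\<^esub> y" "a \<odot>\<^bsub>ideal_as_module S I\<^esub> x = x \<otimes>\<^bsub>S\<^esub> a"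
  by (simp_all add: ideal_as_module_def)

lemma ideal_as_module_regular: "ideal_as_module S I = (regular_module S)\<lparr>carrier := I\<rparr>"
  by (simp add: ideal_as_module_def)

lemma right_module_regular:
  assumes "ring S" shows "right_module S (regular_module S)"
proof -
  interpret ring S by fact
  have "abelian_group (regular_module S)"
  proof (rule abelian_groupI, goal_cases)
    case (6 x) then show ?case by (auto intro!: bexI[of _ "\<ominus>\<^bsub>S\<^esub> x"] simp: l_neg)
  qed (auto simp: a_ac)
  then show ?thesis
    by (rule right_moduleI[OF assms]) (auto simp: l_distr r_distr m_assoc)
qed

lemma finsum_regular: "finsum (regular_module S) f A = finsum S f A"
  by (rule finsum_record_cong) (auto simp: ideal_as_module_def)

lemma right_submodule_regular_iff:
  assumes "ring S" shows "right_submodule S (regular_module S) I \<longleftrightarrow> right_ideal I S"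
proof -
  interpret ring S by fact
  show ?thesis
  proof
    assume a: "right_submodule S (regular_module S) I"
    have "\<And>x. x \<in> I \<Longrightarrow> \<ominus>\<^bsub>S\<^esub> x \<in> I"
      using a by (simp add: right_submodule_def) (metis add.inv_closed one_closed r_minus r_one subsetD)
    then have "additive_subgroup I S"
      using a by (intro additive_subgroupI add.subgroupI) (auto simp: right_submodule_def a_inv_def)
    then show "right_ideal I S" using a by (auto simp: right_submodule_def right_ideal_def)
  next
    assume a: "right_ideal I S"
    then interpret additive_subgroup I S by (simp add: right_ideal_def)
    show "right_submodule S (regular_module S) I"
      using a a_subset by (auto simp: right_submodule_def right_ideal_def)
  qed
qed

lemma right_module_ideal: "ring S \<Longrightarrow> right_ideal I S \<Longrightarrow> right_module S (ideal_as_module S I)"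
  using right_module_submodule[OF right_module_regular] right_submodule_regular_iff
  by (metis ideal_as_module_regular)

lemma finsum_right_ideal:
  assumes "ring S" "right_ideal I S" "f \<in> A \<rightarrow> I"
  shows "finsum (ideal_as_module S I) f A = finsum S f A"
  unfolding ideal_as_module_regular[of S I]
  using finsum_submodule[OF right_module_regular[OF assms(1)] _ assms(3)]
    right_submodule_regular_iff[OF assms(1)] assms(2) by (simp add: finsum_regular)

lemma (in abelian_group) minus_eq_zero_iff:
  assumes "x \<in> carrier G" "y \<in> carrier G"
  shows "x \<ominus> y = \<zero> \<longleftrightarrow> x = y"
proof
  assume "x \<ominus> y = \<zero>"
  then have "(x \<ominus> y) \<oplus> y = y" using assms by simp
  then show "x = y" using assms by (simp add: a_minus_def a_assoc l_neg)
qed (use assms in \<open>simp add: a_minus_def r_neg\<close>)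

lemma (in right_module) smult_uminus_vector:
  assumes "a \<in> carrier S" "x \<in> carrier M"
  shows "a \<odot>\<^bsub>M\<^esub> (\<ominus>\<^bsub>M\<^esub> x) = \<ominus>\<^bsub>M\<^esub> (a \<odot>\<^bsub>M\<^esub> x)"
proof (rule M.minus_equality[symmetric])
  show "a \<odot>\<^bsub>M\<^esub> (\<ominus>\<^bsub>M\<^esub> x) \<oplus>\<^bsub>M\<^esub> a \<odot>\<^bsub>M\<^esub> x = \<zero>\<^bsub>M\<^esub>"
    using assms smult_distrib_vector[of a "\<ominus>\<^bsub>M\<^esub> x" x] by (simp add: M.l_neg)
qed (use assms in \<open>auto simp: smult_closed\<close>)

section \<open>Finite dual bases\<close>

text \<open>The dual basis criterion: \<open>x = \<Sum> p i \<phi> i (x)\<close> factors the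
  identity of \<open>M\<close> through a free module on \<open>A\<close>, which makes
  \<open>M\<close> a direct summand of it.\<close>

definition dual_basis ::
    "('a, 'm) ring_scheme \<Rightarrow> ('a, 'b) module \<Rightarrow> 'i set \<Rightarrow> ('i \<Rightarrow> 'b) \<Rightarrow> ('i \<Rightarrow> 'b \<Rightarrow> 'a) \<Rightarrow> bool" where
  "dual_basis S M A p \<phi> \<longleftrightarrow>
     finite A \<and> p \<in> A \<rightarrow> carrier M \<and> (\<forall>i\<in>A. right_linear S M (regular_module S) (\<phi> i)) \<and>
     (\<forall>x\<in>carrier M. x = (\<Oplus>\<^bsub>M\<^esub>i\<in>A. \<phi> i x \<odot>\<^bsub>M\<^esub> p i))"

text \<open>The working form of "finitely generated and projective"; \<open>fin_proj_iff\<close>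
  proves the equivalence. The index set is an initial segment of \<open>nat\<close> because the
  definition cannot quantify over index types; \<open>fin_projI\<close> accepts any finite index
  set.\<close>

definition fin_proj :: "('a, 'm) ring_scheme \<Rightarrow> ('a, 'b) module \<Rightarrow> bool" where
  "fin_proj S M \<longleftrightarrow>
     right_module S M \<and> (\<exists>(n :: nat) p \<phi>. dual_basis S M {..<n} p \<phi>)"

lemma dual_basis_scalar_closed:
  "dual_basis S M A p \<phi> \<Longrightarrow> i \<in> A \<Longrightarrow> x \<in> carrier M \<Longrightarrow> \<phi> i x \<in> carrier S"
  unfolding dual_basis_def right_linear_def by auto

lemma dual_basis_scalar_add:
  "dual_basis S M A p \<phi> \<Longrightarrow> i \<in> A \<Longrightarrow> x \<in> carrier M \<Longrightarrow> y \<in> carrier M \<Longrightarrow>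
     \<phi> i (x \<oplus>\<^bsub>M\<^esub> y) = \<phi> i x \<oplus>\<^bsub>S\<^esub> \<phi> i y"
  unfolding dual_basis_def right_linear_def by auto

lemma dual_basis_scalar_smult:
  "dual_basis S M A p \<phi> \<Longrightarrow> i \<in> A \<Longrightarrow> x \<in> carrier M \<Longrightarrow> a \<in> carrier S \<Longrightarrow>
     \<phi> i (a \<odot>\<^bsub>M\<^esub> x) = \<phi> i x \<otimes>\<^bsub>S\<^esub> a"
  unfolding dual_basis_def right_linear_def by auto

lemma dual_basis_expand:
  "dual_basis S M A p \<phi> \<Longrightarrow> x \<in> carrier M \<Longrightarrow> (\<Oplus>\<^bsub>M\<^esub>i\<in>A. \<phi> i x \<odot>\<^bsub>M\<^esub> p i) = x"
  unfolding dual_basis_def by metis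

lemma fin_projI:
  assumes "right_module S M" "dual_basis S M A p \<phi>"
  shows "fin_proj S M"
proof -
  interpret right_module S M by fact
  have fin: "finite A" and p: "p \<in> A \<rightarrow> carrier M" using assms(2) by (auto simp: dual_basis_def)
  from fin obtain h where h: "bij_betw h {..<card A} A"
    using ex_bij_betw_nat_finite atLeast0LessThan by metis
  have inj: "inj_on h {..<card A}" and im: "h ` {..<card A} = A" using h by (auto simp: bij_betw_def)
  have "dual_basis S M {..<card A} (\<lambda>i. p (h i)) (\<lambda>i. \<phi> (h i))"
    unfolding dual_basis_def
  proof (intro conjI ballI)
    show "(\<lambda>i. p (h i)) \<in> {..<card A} \<rightarrow> carrier M" using p im by auto
  next
    fix i assume "i \<in> {..<card A}"
    then show "right_linear S M (regular_module S) (\<phi> (h i))"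
      using assms(2) im by (auto simp: dual_basis_def)
  next
    fix x assume x: "x \<in> carrier M"
    have "x = (\<Oplus>\<^bsub>M\<^esub>i\<in>h ` {..<card A}. \<phi> i x \<odot>\<^bsub>M\<^esub> p i)"
      using im dual_basis_expand[OF assms(2) x] by simp
    also have "\<dots> = (\<Oplus>\<^bsub>M\<^esub>i\<in>{..<card A}. \<phi> (h i) x \<odot>\<^bsub>M\<^esub> p (h i))"
      by (rule M.finsum_reindex)
         (use inj im x p dual_basis_scalar_closed[OF assms(2)] in \<open>auto simp: smult_closed Pi_iff\<close>)
    finally show "x = (\<Oplus>\<^bsub>M\<^esub>i\<in>{..<card A}. \<phi> (h i) x \<odot>\<^bsub>M\<^esub> p (h i))" .
  qed simp
  then show ?thesis unfolding fin_proj_def using assms(1) by blast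
qed

text \<open>The vectors are pushed forward along \<open>f\<close> and the functionals are pulled
  back along \<open>s\<close>; applying \<open>f\<close> to the expansion of \<open>s y\<close>
  gives the expansion of \<open>y\<close>.\<close>

lemma fin_proj_retract:
  assumes "fin_proj S M" "right_module S N" "right_linear S M N f" "right_linear S N M s"
    and "\<And>y. y \<in> carrier N \<Longrightarrow> f (s y) = y"
  shows "fin_proj S N"
proof -
  interpret N: right_module S N by fact
  obtain n p \<phi> where b: "dual_basis S M {..<n::nat} p \<phi>" and M: "right_module S M"
    using assms(1) by (auto simp: fin_proj_def)
  interpret M: right_module S M by fact
  have p: "p \<in> {..<n} \<rightarrow> carrier M" using b by (auto simp: dual_basis_def)
  have "dual_basis S N {..<n} (\<lambda>i. f (p i)) (\<lambda>i y. \<phi> i (s y))"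
    unfolding dual_basis_def
  proof (intro conjI ballI)
    show "(\<lambda>i. f (p i)) \<in> {..<n} \<rightarrow> carrier N" using p right_linearD(1)[OF assms(3)] by auto
  next
    fix i assume "i \<in> {..<n}"
    then show "right_linear S N (regular_module S) (\<lambda>y. \<phi> i (s y))"
      using b right_linear_compose[OF assms(4)] by (auto simp: dual_basis_def)
  next
    fix y assume y: "y \<in> carrier N"
    have sy: "s y \<in> carrier M" using assms(4) y by (rule right_linearD)
    have "y = f (\<Oplus>\<^bsub>M\<^esub>i\<in>{..<n}. \<phi> i (s y) \<odot>\<^bsub>M\<^esub> p i)"
      using dual_basis_expand[OF b sy] assms(5)[OF y] by simp
    also have "\<dots> = (\<Oplus>\<^bsub>N\<^esub>i\<in>{..<n}. f (\<phi> i (s y) \<odot>\<^bsub>M\<^esub> p i))"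
      by (rule right_linear_finsum[OF M assms(2,3)])
         (use p sy dual_basis_scalar_closed[OF b] in \<open>auto simp: M.smult_closed Pi_iff\<close>)
    also have "\<dots> = (\<Oplus>\<^bsub>N\<^esub>i\<in>{..<n}. \<phi> i (s y) \<odot>\<^bsub>N\<^esub> f (p i))"
      by (rule N.M.finsum_cong')
         (use p sy dual_basis_scalar_closed[OF b] right_linearD[OF assms(3)] in
           \<open>auto simp: M.smult_closed N.smult_closed Pi_iff\<close>)
    finally show "y = (\<Oplus>\<^bsub>N\<^esub>i\<in>{..<n}. \<phi> i (s y) \<odot>\<^bsub>N\<^esub> f (p i))" .
  qed simp
  then show ?thesis using assms(2) unfolding fin_proj_def by blast
qed

lemma fin_proj_isomorphic:
  assumes "fin_proj S M" "right_module S N" "module_isomorphic S M N"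
  shows "fin_proj S N"
proof -
  obtain f where f: "bij_betw f (carrier M) (carrier N)" "right_linear S M N f"
    using assms(3) by (auto simp: module_isomorphic_iff)
  have M: "right_module S M" using assms(1) by (auto simp: fin_proj_def)
  show ?thesis
    by (rule fin_proj_retract[OF assms(1,2) f(2) right_linear_inv[OF M f]])
       (use f(1) in \<open>auto simp: bij_betw_def f_inv_into_f\<close>)
qed

lemma fin_proj_direct_sum:
  assumes "fin_proj S M" "fin_proj S N"
  shows "fin_proj S (direct_sum_module M N)"
proof -
  let ?L = "direct_sum_module M N"
  obtain n p \<phi> where b: "dual_basis S M {..<n::nat} p \<phi>" and M: "right_module S M"
    using assms(1) by (auto simp: fin_proj_def)
  obtain m q \<psi> where c: "dual_basis S N {..<m::nat} q \<psi>" and N: "right_module S N"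
    using assms(2) by (auto simp: fin_proj_def)
  interpret M: right_module S M by fact
  interpret N: right_module S N by fact
  interpret L: right_module S ?L by (rule right_module_direct_sum[OF M N])
  have p: "p \<in> {..<n} \<rightarrow> carrier M" "q \<in> {..<m} \<rightarrow> carrier N"
    using b c by (auto simp: dual_basis_def)
  \<comment> \<open>The tagged union of the two index sets. Each projection of the sum over it loses
    the terms with the foreign tag.\<close>
  define A where "A = Inl ` {..<n} \<union> Inr ` {..<m}"
  define r where "r = case_sum (\<lambda>i. (p i, \<zero>\<^bsub>N\<^esub>)) (\<lambda>j. (\<zero>\<^bsub>M\<^esub>, q j))"
  define \<rho> where "\<rho> = case_sum (\<lambda>i x. \<phi> i (fst x)) (\<lambda>j x. \<psi> j (snd x))"
  have "dual_basis S ?L A r \<rho>"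
    unfolding dual_basis_def
  proof (intro conjI ballI)
    show "finite A" by (simp add: A_def)
    show r: "r \<in> A \<rightarrow> carrier ?L" using p by (auto simp: A_def r_def)
    {
      fix i assume "i \<in> A"
      then show "right_linear S ?L (regular_module S) (\<rho> i)"
        using b c by (auto simp: A_def \<rho>_def dual_basis_def right_linear_def Pi_iff)
    }
    fix x assume x: "x \<in> carrier ?L"
    have cl: "(\<lambda>i. \<rho> i x \<odot>\<^bsub>?L\<^esub> r i) \<in> A \<rightarrow> carrier ?L"
    proof
      fix i assume i: "i \<in> A"
      have "\<rho> i x \<in> carrier S" using i x dual_basis_scalar_closed[OF b] dual_basis_scalar_closed[OF c]
        by (auto simp: A_def \<rho>_def)
      then show "\<rho> i x \<odot>\<^bsub>?L\<^esub> r i \<in> carrier ?L" using r i by (intro L.smult_closed) auto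
    qed
    have fs: "fst (finsum ?L (\<lambda>i. \<rho> i x \<odot>\<^bsub>?L\<^esub> r i) A) = (\<Oplus>\<^bsub>M\<^esub>i\<in>A. fst (\<rho> i x \<odot>\<^bsub>?L\<^esub> r i))"
      by (rule additive_finsum[OF L.M.abelian_group_axioms M.M.abelian_group_axioms]) (use cl in auto)
    have sn: "snd (finsum ?L (\<lambda>i. \<rho> i x \<odot>\<^bsub>?L\<^esub> r i) A) = (\<Oplus>\<^bsub>N\<^esub>i\<in>A. snd (\<rho> i x \<odot>\<^bsub>?L\<^esub> r i))"
      by (rule additive_finsum[OF L.M.abelian_group_axioms N.M.abelian_group_axioms]) (use cl in auto)
    have x': "fst x \<in> carrier M" "snd x \<in> carrier N" using x by auto
    have "(\<Oplus>\<^bsub>M\<^esub>i\<in>A. fst (\<rho> i x \<odot>\<^bsub>?L\<^esub> r i)) = (\<Oplus>\<^bsub>M\<^esub>i\<in>Inl ` {..<n}. fst (\<rho> i x \<odot>\<^bsub>?L\<^esub> r i))"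
      by (rule M.M.finsum_superset[symmetric])
         (use p x' dual_basis_scalar_closed[OF b] dual_basis_scalar_closed[OF c] in
           \<open>auto simp: A_def \<rho>_def r_def M.smult_closed Pi_iff\<close>)
    also have "\<dots> = (\<Oplus>\<^bsub>M\<^esub>i\<in>{..<n}. fst (\<rho> (Inl i) x \<odot>\<^bsub>?L\<^esub> r (Inl i)))"
      by (rule M.M.finsum_reindex)
         (use p x' dual_basis_scalar_closed[OF b] in \<open>auto simp: \<rho>_def r_def M.smult_closed Pi_iff\<close>)
    also have "\<dots> = fst x"
      using dual_basis_expand[OF b x'(1)] by (simp add: \<rho>_def r_def)
    finally have 1: "(\<Oplus>\<^bsub>M\<^esub>i\<in>A. fst (\<rho> i x \<odot>\<^bsub>?L\<^esub> r i)) = fst x" .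
    have "(\<Oplus>\<^bsub>N\<^esub>i\<in>A. snd (\<rho> i x \<odot>\<^bsub>?L\<^esub> r i)) = (\<Oplus>\<^bsub>N\<^esub>i\<in>Inr ` {..<m}. snd (\<rho> i x \<odot>\<^bsub>?L\<^esub> r i))"
      by (rule N.M.finsum_superset[symmetric])
         (use p x' dual_basis_scalar_closed[OF b] dual_basis_scalar_closed[OF c] in
           \<open>auto simp: A_def \<rho>_def r_def N.smult_closed Pi_iff\<close>)
    also have "\<dots> = (\<Oplus>\<^bsub>N\<^esub>i\<in>{..<m}. snd (\<rho> (Inr i) x \<odot>\<^bsub>?L\<^esub> r (Inr i)))"
      by (rule N.M.finsum_reindex)
         (use p x' dual_basis_scalar_closed[OF c] in \<open>auto simp: \<rho>_def r_def N.smult_closed Pi_iff\<close>)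
    also have "\<dots> = snd x"
      using dual_basis_expand[OF c x'(2)] by (simp add: \<rho>_def r_def)
    finally have 2: "(\<Oplus>\<^bsub>N\<^esub>i\<in>A. snd (\<rho> i x \<odot>\<^bsub>?L\<^esub> r i)) = snd x" .
    show "x = (\<Oplus>\<^bsub>?L\<^esub>i\<in>A. \<rho> i x \<odot>\<^bsub>?L\<^esub> r i)"
      using fs sn 1 2 by (intro prod_eqI) simp_all
  qed
  then show ?thesis by (rule fin_projI[OF L.right_module_axioms])
qed

text \<open>Lift the vectors of a dual basis of \<open>T\<close> to \<open>M\<close> and keep its
  functionals: \<open>s t = \<Sum> m i \<phi> i (t)\<close> inherits linearity from the
  \<open>\<phi> i\<close>, and \<open>f\<close> maps the sum to the expansion of
  \<open>t\<close>.\<close>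

lemma section_exists:
  assumes "right_module S M" "fin_proj S T" "right_linear S M T f" "f ` carrier M = carrier T"
  shows "\<exists>s. right_linear S T M s \<and> (\<forall>t\<in>carrier T. f (s t) = t)"
proof -
  interpret M: right_module S M by fact
  obtain n p \<phi> where b: "dual_basis S T {..<n::nat} p \<phi>" and T: "right_module S T"
    using assms(2) by (auto simp: fin_proj_def)
  interpret T: right_module S T by fact
  have p: "p \<in> {..<n} \<rightarrow> carrier T" using b by (auto simp: dual_basis_def)
  then have "p i \<in> f ` carrier M" if "i < n" for i using that assms(4) by auto
  then have "\<forall>i\<in>{..<n}. \<exists>m\<in>carrier M. f m = p i" by fastforce
  then obtain m where m: "\<And>i. i < n \<Longrightarrow> m i \<in> carrier M" "\<And>i. i < n \<Longrightarrow> f (m i) = p i"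
    by (metis lessThan_iff)
  define s where "s t = (\<Oplus>\<^bsub>M\<^esub>i\<in>{..<n}. \<phi> i t \<odot>\<^bsub>M\<^esub> m i)" for t
  note c = dual_basis_scalar_closed[OF b]
  have cl: "\<And>t. t \<in> carrier T \<Longrightarrow> (\<lambda>i. \<phi> i t \<odot>\<^bsub>M\<^esub> m i) \<in> {..<n} \<rightarrow> carrier M"
    using c m by (auto simp: M.smult_closed)
  have "right_linear S T M s"
  proof (rule right_linearI)
    fix x y assume xy: "x \<in> carrier T" "y \<in> carrier T"
    have "s (x \<oplus>\<^bsub>T\<^esub> y) = (\<Oplus>\<^bsub>M\<^esub>i\<in>{..<n}. \<phi> i x \<odot>\<^bsub>M\<^esub> m i \<oplus>\<^bsub>M\<^esub> \<phi> i y \<odot>\<^bsub>M\<^esub> m i)" unfolding s_def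
      by (rule M.M.finsum_cong')
         (use xy c m in \<open>auto simp: dual_basis_scalar_add[OF b] M.smult_distrib_scalar M.smult_closed\<close>)
    then show "s (x \<oplus>\<^bsub>T\<^esub> y) = s x \<oplus>\<^bsub>M\<^esub> s y"
      using cl xy by (simp add: s_def M.M.finsum_addf)
  next
    fix a x assume ax: "a \<in> carrier S" "x \<in> carrier T"
    have "s (a \<odot>\<^bsub>T\<^esub> x) = (\<Oplus>\<^bsub>M\<^esub>i\<in>{..<n}. a \<odot>\<^bsub>M\<^esub> (\<phi> i x \<odot>\<^bsub>M\<^esub> m i))" unfolding s_def
      by (rule M.M.finsum_cong')
         (use ax c m in \<open>auto simp: dual_basis_scalar_smult[OF b] M.smult_assoc M.smult_closed\<close>)
    then show "s (a \<odot>\<^bsub>T\<^esub> x) = a \<odot>\<^bsub>M\<^esub> s x"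
      using cl ax by (simp add: s_def M.smult_finsum_vector)
  qed (use cl in \<open>auto simp: s_def\<close>)
  moreover have "f (s t) = t" if t: "t \<in> carrier T" for t
  proof -
    have "f (s t) = (\<Oplus>\<^bsub>T\<^esub>i\<in>{..<n}. f (\<phi> i t \<odot>\<^bsub>M\<^esub> m i))" unfolding s_def
      by (rule right_linear_finsum[OF assms(1) T assms(3) cl[OF t]])
    also have "\<dots> = (\<Oplus>\<^bsub>T\<^esub>i\<in>{..<n}. \<phi> i t \<odot>\<^bsub>T\<^esub> p i)"
      by (rule T.M.finsum_cong')
         (use t c m p in \<open>auto simp: right_linearD(3)[OF assms(3)] T.smult_closed Pi_iff\<close>)
    also have "\<dots> = t" by (rule dual_basis_expand[OF b t])
    finally show ?thesis .
  qed
  ultimately show ?thesis by blast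
qed

lemma right_linear_diff:
  assumes "right_module S M" "right_module S N" "right_linear S M N f" "right_linear S M N g"
  shows "right_linear S M N (\<lambda>x. f x \<ominus>\<^bsub>N\<^esub> g x)"
proof -
  interpret N: right_module S N by fact
  note f = right_linearD[OF assms(3)] note g = right_linearD[OF assms(4)]
  show ?thesis
  proof (rule right_linearI)
    fix x y assume "x \<in> carrier M" "y \<in> carrier M"
    then show "f (x \<oplus>\<^bsub>M\<^esub> y) \<ominus>\<^bsub>N\<^esub> g (x \<oplus>\<^bsub>M\<^esub> y) = (f x \<ominus>\<^bsub>N\<^esub> g x) \<oplus>\<^bsub>N\<^esub> (f y \<ominus>\<^bsub>N\<^esub> g y)"
      using f(1)[of x] f(1)[of y] g(1)[of x] g(1)[of y]
      by (simp add: f(2) g(2) a_minus_def N.M.minus_add N.M.a_ac)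
  next
    fix a x assume ax: "a \<in> carrier S" "x \<in> carrier M"
    have c: "f x \<in> carrier N" "g x \<in> carrier N" using ax f(1) g(1) by auto
    have "a \<odot>\<^bsub>N\<^esub> (\<ominus>\<^bsub>N\<^esub> g x) = \<ominus>\<^bsub>N\<^esub> (a \<odot>\<^bsub>N\<^esub> g x)"
      by (rule N.smult_uminus_vector[OF ax(1) c(2)])
    then show "f (a \<odot>\<^bsub>M\<^esub> x) \<ominus>\<^bsub>N\<^esub> g (a \<odot>\<^bsub>M\<^esub> x) = a \<odot>\<^bsub>N\<^esub> (f x \<ominus>\<^bsub>N\<^esub> g x)"
      using ax c by (simp add: f(3) g(3) a_minus_def N.smult_distrib_vector)
  qed (use f(1) g(1) in auto)
qed

text \<open>Stated for a submodule \<open>N\<close> of \<open>W\<close>, so that it composes two steps of a filtration.\<close>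

lemma extension_split:
  assumes "right_module S W" "fin_proj S T" "right_module S P"
    and f: "right_linear S W T f" "f ` carrier W = carrier T"
    and N: "N = {x \<in> carrier W. f x = \<zero>\<^bsub>T\<^esub>}"
    and g: "right_linear S (W\<lparr>carrier := N\<rparr>) P g" "g ` N = carrier P"
  shows "\<exists>h. right_linear S W (direct_sum_module T P) h \<and>
     h ` carrier W = carrier (direct_sum_module T P) \<and>
     {x \<in> carrier W. h x = \<zero>\<^bsub>direct_sum_module T P\<^esub>} = {x \<in> N. g x = \<zero>\<^bsub>P\<^esub>}"
proof -
  interpret W: right_module S W by fact
  have T: "right_module S T" using assms(2) by (simp add: fin_proj_def)
  interpret T: right_module S T by fact
  interpret P: right_module S P by fact
  obtain s where s: "right_linear S T W s" and fs: "\<And>t. t \<in> carrier T \<Longrightarrow> f (s t) = t"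
    using section_exists[OF assms(1,2) f] by blast
  note fl = right_linearD[OF f(1)] right_linear_minus[OF assms(1) T f(1)]
  note sl = right_linearD[OF s] right_linear_zero[OF T assms(1) s]
  have gl: "\<And>x. x \<in> N \<Longrightarrow> g x \<in> carrier P"
    "\<And>x y. x \<in> N \<Longrightarrow> y \<in> N \<Longrightarrow> g (x \<oplus>\<^bsub>W\<^esub> y) = g x \<oplus>\<^bsub>P\<^esub> g y"
    "\<And>a x. a \<in> carrier S \<Longrightarrow> x \<in> N \<Longrightarrow> g (a \<odot>\<^bsub>W\<^esub> x) = a \<odot>\<^bsub>P\<^esub> g x"
    using g(1) by (auto simp: right_linear_def)
  \<comment> \<open>The projection of \<open>W\<close> onto \<open>N\<close> along the image of the
    section \<open>s\<close>. It extends the domain of \<open>g\<close> from \<open>N\<close> to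
    \<open>W\<close>.\<close>
  define k where "k x = x \<ominus>\<^bsub>W\<^esub> s (f x)" for x
  have kN: "k x \<in> N" if "x \<in> carrier W" for x
  proof -
    have "s (f x) \<in> carrier W" "f x \<in> carrier T" using that fl(1) sl(1) by auto
    then show ?thesis using that fl(4)[of x "s (f x)"] fs[of "f x"]
      by (auto simp: N k_def T.M.r_neg a_minus_def)
  qed
  have kl: "right_linear S W W k" unfolding k_def[abs_def]
    by (rule right_linear_diff[OF assms(1,1) _ right_linear_compose[OF f(1) s]]) (simp add: right_linear_def)
  note kl = right_linearD[OF kl]
  define h where "h x = (f x, g (k x))" for x
  have "right_linear S W (direct_sum_module T P) h"
  proof (rule right_linearI)
    fix x y assume xy: "x \<in> carrier W" "y \<in> carrier W"
    then show "h (x \<oplus>\<^bsub>W\<^esub> y) = h x \<oplus>\<^bsub>direct_sum_module T P\<^esub> h y"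
      using gl(2)[OF kN kN, OF xy] by (simp add: h_def fl kl)
  next
    fix a x assume ax: "a \<in> carrier S" "x \<in> carrier W"
    then show "h (a \<odot>\<^bsub>W\<^esub> x) = a \<odot>\<^bsub>direct_sum_module T P\<^esub> h x"
      using gl(3)[OF ax(1) kN, OF ax(2)] by (simp add: h_def fl kl)
  qed (use fl(1) gl(1) kN in \<open>auto simp: h_def\<close>)
  moreover have "h ` carrier W = carrier (direct_sum_module T P)"
  proof
    show "h ` carrier W \<subseteq> carrier (direct_sum_module T P)" using fl(1) gl(1) kN by (auto simp: h_def)
    show "carrier (direct_sum_module T P) \<subseteq> h ` carrier W"
    proof
      fix z assume "z \<in> carrier (direct_sum_module T P)"
      then obtain t q where z: "z = (t, q)" "t \<in> carrier T" "q \<in> carrier P" by auto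
      have "q \<in> g ` N" using g(2) z(3) by simp
      then obtain y where y: "y \<in> N" "g y = q" by blast
      have yW: "y \<in> carrier W" "f y = \<zero>\<^bsub>T\<^esub>" using y(1) by (auto simp: N)
      \<comment> \<open>The preimage of \<open>(t, q)\<close> is \<open>y + s t\<close>:
        \<open>f\<close> kills \<open>y\<close> and returns \<open>t\<close> from
        \<open>s t\<close>, while \<open>k\<close> removes \<open>s t\<close>.\<close>
      have w: "y \<oplus>\<^bsub>W\<^esub> s t \<in> carrier W" using yW sl(1) z by auto
      have ft: "f (y \<oplus>\<^bsub>W\<^esub> s t) = t" using yW sl(1) z fl(2)[of y "s t"] fs by simp
      then have "k (y \<oplus>\<^bsub>W\<^esub> s t) = y" using yW sl(1) z
        by (simp add: k_def a_minus_def W.M.a_assoc W.M.r_neg)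
      then have "h (y \<oplus>\<^bsub>W\<^esub> s t) = z" using ft y z by (simp add: h_def)
      then show "z \<in> h ` carrier W" using w by blast
    qed
  qed
  moreover have "{x \<in> carrier W. h x = \<zero>\<^bsub>direct_sum_module T P\<^esub>} = {x \<in> N. g x = \<zero>\<^bsub>P\<^esub>}"
  proof -
    have kx: "k x = x" if "x \<in> N" for x
    proof -
      have "f x = \<zero>\<^bsub>T\<^esub>" "x \<in> carrier W" using that by (auto simp: N)
      then show ?thesis using sl(4) by (simp add: k_def a_minus_def)
    qed
    show ?thesis
    proof (intro equalityI subsetI)
      fix x assume "x \<in> {x \<in> carrier W. h x = \<zero>\<^bsub>direct_sum_module T P\<^esub>}"
      then have "x \<in> carrier W" "f x = \<zero>\<^bsub>T\<^esub>" "g (k x) = \<zero>\<^bsub>P\<^esub>" by (auto simp: h_def)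
      then show "x \<in> {x \<in> N. g x = \<zero>\<^bsub>P\<^esub>}" using kx[of x] by (simp add: N)
    next
      fix x assume x: "x \<in> {x \<in> N. g x = \<zero>\<^bsub>P\<^esub>}"
      then have "k x = x" using kx by simp
      then show "x \<in> {x \<in> carrier W. h x = \<zero>\<^bsub>direct_sum_module T P\<^esub>}"
        using x by (simp add: N h_def)
    qed
  qed
  ultimately show ?thesis by blast
qed

text \<open>Quotient modules are not formed as sets of cosets here: any surjection with kernel
  \<open>N\<close> stands for \<open>W / N\<close>. This lemma says that two such models agree, and
  it is what turns two filtrations of \<open>W / N x\<close> into an isomorphism of direct
  sums.\<close>

lemma isomorphic_of_same_kernel:
  assumes "right_module S W" "right_module S Z" "right_module S Y"
    and f: "right_linear S W Z f" "f ` carrier W = carrier Z"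
    and g: "right_linear S W Y g" "g ` carrier W = carrier Y"
    and k: "{x \<in> carrier W. f x = \<zero>\<^bsub>Z\<^esub>} = {x \<in> carrier W. g x = \<zero>\<^bsub>Y\<^esub>}"
  shows "module_isomorphic S Z Y"
proof -
  interpret W: right_module S W by fact
  interpret Z: right_module S Z by fact
  interpret Y: right_module S Y by fact
  note fl = right_linearD[OF f(1)] right_linear_minus[OF assms(1,2) f(1)]
  note gl = right_linearD[OF g(1)] right_linear_minus[OF assms(1,3) g(1)]
  have eq: "f x = f y \<longleftrightarrow> g x = g y" if xy: "x \<in> carrier W" "y \<in> carrier W" for x y
  proof -
    have "f x = f y \<longleftrightarrow> f (x \<ominus>\<^bsub>W\<^esub> y) = \<zero>\<^bsub>Z\<^esub>"
      unfolding fl(4)[OF xy] Z.M.minus_eq_zero_iff[OF fl(1) fl(1), OF xy] ..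
    also have "\<dots> \<longleftrightarrow> g (x \<ominus>\<^bsub>W\<^esub> y) = \<zero>\<^bsub>Y\<^esub>"
      using k W.M.minus_closed[OF xy] by blast
    also have "\<dots> \<longleftrightarrow> g x = g y"
      unfolding gl(4)[OF xy] Y.M.minus_eq_zero_iff[OF gl(1) gl(1), OF xy] ..
    finally show ?thesis .
  qed
  \<comment> \<open>\<open>r\<close> merely picks preimages and need not be additive; by
    \<open>eq\<close> the value \<open>g (r x)\<close> does not depend on the choice.\<close>
  define r where "r = inv_into (carrier W) f"
  have r: "r x \<in> carrier W" "f (r x) = x" if "x \<in> carrier Z" for x
    using that unfolding r_def f(2)[symmetric] by (rule inv_into_into, rule f_inv_into_f)
  have "right_linear S Z Y (\<lambda>x. g (r x))"
  proof (rule right_linearI)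
    fix x y assume xy: "x \<in> carrier Z" "y \<in> carrier Z"
    have c: "x \<oplus>\<^bsub>Z\<^esub> y \<in> carrier Z" using xy by simp
    have "f (r (x \<oplus>\<^bsub>Z\<^esub> y)) = f (r x \<oplus>\<^bsub>W\<^esub> r y)"
      unfolding r(2)[OF c] fl(2)[OF r(1) r(1), OF xy] r(2)[OF xy(1)] r(2)[OF xy(2)] ..
    then have "g (r (x \<oplus>\<^bsub>Z\<^esub> y)) = g (r x \<oplus>\<^bsub>W\<^esub> r y)"
      using eq[OF r(1)[OF c] W.M.a_closed[OF r(1) r(1), OF xy]] by simp
    then show "g (r (x \<oplus>\<^bsub>Z\<^esub> y)) = g (r x) \<oplus>\<^bsub>Y\<^esub> g (r y)"
      unfolding gl(2)[OF r(1) r(1), OF xy] .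
  next
    fix a x assume a: "a \<in> carrier S" and x: "x \<in> carrier Z"
    have c: "a \<odot>\<^bsub>Z\<^esub> x \<in> carrier Z" using a x by (rule Z.smult_closed)
    have "f (r (a \<odot>\<^bsub>Z\<^esub> x)) = f (a \<odot>\<^bsub>W\<^esub> r x)"
      unfolding r(2)[OF c] fl(3)[OF a r(1)[OF x]] r(2)[OF x] ..
    then have "g (r (a \<odot>\<^bsub>Z\<^esub> x)) = g (a \<odot>\<^bsub>W\<^esub> r x)"
      using eq[OF r(1)[OF c] W.smult_closed[OF a r(1)[OF x]]] by simp
    then show "g (r (a \<odot>\<^bsub>Z\<^esub> x)) = a \<odot>\<^bsub>Y\<^esub> g (r x)"
      unfolding gl(3)[OF a r(1)[OF x]] .
  qed (rule gl(1)[OF r(1)])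
  moreover have "inj_on (\<lambda>x. g (r x)) (carrier Z)"
  proof (rule inj_onI)
    fix x y assume xy: "x \<in> carrier Z" "y \<in> carrier Z" "g (r x) = g (r y)"
    then have "f (r x) = f (r y)" using eq[OF r(1) r(1)] by blast
    then show "x = y" using r(2) xy by simp
  qed
  moreover have "(\<lambda>x. g (r x)) ` carrier Z = carrier Y"
  proof (intro equalityI subsetI)
    fix y assume "y \<in> carrier Y"
    then have "y \<in> g ` carrier W" using g(2) by simp
    then obtain w where w: "w \<in> carrier W" "g w = y" by blast
    have fw: "f w \<in> carrier Z" using w(1) by (rule fl(1))
    have "g (r (f w)) = g w" using eq[OF r(1)[OF fw] w(1)] r(2)[OF fw] by blast
    then show "y \<in> (\<lambda>x. g (r x)) ` carrier Z" using w fw by (intro image_eqI[of _ _ "f w"]) simp_all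
  qed (use gl(1) r(1) in blast)
  ultimately show ?thesis by (auto simp: module_isomorphic_iff bij_betw_def)
qed

text \<open>The case of \<open>extension_split\<close> in which \<open>g\<close> is the identity of
  the kernel, so that \<open>h\<close> is injective.\<close>

lemma kernel_split:
  assumes M: "right_module S M" and T: "fin_proj S T"
    and f: "right_linear S M T f" "f ` carrier M = carrier T"
  shows "module_isomorphic S M
           (direct_sum_module T (M\<lparr>carrier := {x \<in> carrier M. f x = \<zero>\<^bsub>T\<^esub>}\<rparr>))"
proof -
  let ?N = "{x \<in> carrier M. f x = \<zero>\<^bsub>T\<^esub>}" let ?K = "M\<lparr>carrier := ?N\<rparr>"
  have T': "right_module S T" using T by (simp add: fin_proj_def)
  have K: "right_module S ?K" by (rule right_module_submodule[OF M right_submodule_kernel[OF M T' f(1)]])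
  obtain h where h: "right_linear S M (direct_sum_module T ?K) h"
      "h ` carrier M = carrier (direct_sum_module T ?K)"
     "{x \<in> carrier M. h x = \<zero>\<^bsub>direct_sum_module T ?K\<^esub>} = {x \<in> ?N. x = \<zero>\<^bsub>?K\<^esub>}"
    using extension_split[OF M T K f refl, of "\<lambda>x. x"] by (auto simp: right_linear_def)
  interpret M: right_module S M by fact
  note DK = right_module_direct_sum[OF T' K]
  have "inj_on h (carrier M)"
    unfolding right_linear_inj_iff[OF M DK h(1)] using h(3) by auto
  then show ?thesis using h unfolding module_isomorphic_iff bij_betw_def by blast
qed

lemma right_submodule_smult:
  "right_submodule S M U \<Longrightarrow> a \<in> carrier S \<Longrightarrow> x \<in> U \<Longrightarrow> a \<odot>\<^bsub>M\<^esub> x \<in> U"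
  by (auto simp: right_submodule_def)

lemma right_submodule_add:
  "right_submodule S M U \<Longrightarrow> x \<in> U \<Longrightarrow> y \<in> U \<Longrightarrow> x \<oplus>\<^bsub>M\<^esub> y \<in> U"
  by (auto simp: right_submodule_def)

section \<open>Free modules and projective modules\<close>

lemma free_right_module_simps [simp]:
  "f \<in> carrier (free_right_module S B) \<longleftrightarrow>
     (\<forall>x. f x \<in> carrier S) \<and> (\<forall>x. f x \<noteq> \<zero>\<^bsub>S\<^esub> \<longrightarrow> x \<in> B) \<and> finite {x. f x \<noteq> \<zero>\<^bsub>S\<^esub>}"
  "\<zero>\<^bsub>free_right_module S B\<^esub> = (\<lambda>_. \<zero>\<^bsub>S\<^esub>)"
  "f \<oplus>\<^bsub>free_right_module S B\<^esub> g = (\<lambda>x. f x \<oplus>\<^bsub>S\<^esub> g x)"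
  "a \<odot>\<^bsub>free_right_module S B\<^esub> f = (\<lambda>x. f x \<otimes>\<^bsub>S\<^esub> a)"
  by (auto simp: free_right_module_def)

lemma right_module_free:
  assumes "ring S" shows "right_module S (free_right_module S B)"
proof -
  interpret ring S by fact
  have fin: "finite {x. h (f x) (g x) \<noteq> \<zero>\<^bsub>S\<^esub>}"
    if "finite {x. f x \<noteq> \<zero>\<^bsub>S\<^esub>}" "finite {x. g x \<noteq> \<zero>\<^bsub>S\<^esub>}" "h \<zero>\<^bsub>S\<^esub> \<zero>\<^bsub>S\<^esub> = \<zero>\<^bsub>S\<^esub>" for h f g
    by (rule finite_subset[OF _ finite_UnI[OF that(1,2)]]) (use that(3) in auto)
  have "abelian_group (free_right_module S B)"
  proof (rule abelian_groupI, goal_cases)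
    case (1 f g)
    then show ?case using fin[of f g "add S"] by (auto) (metis r_zero zero_closed)
  next
    case (6 f)
    have e: "(\<ominus>\<^bsub>S\<^esub> f x \<noteq> \<zero>\<^bsub>S\<^esub>) \<longleftrightarrow> f x \<noteq> \<zero>\<^bsub>S\<^esub>" for x using 6 by simp
    show ?case using 6 by (intro bexI[of _ "\<lambda>x. \<ominus>\<^bsub>S\<^esub> f x"]) (auto simp: l_neg e)
  qed (auto simp: a_ac)
  then show ?thesis
  proof (rule right_moduleI[OF assms], goal_cases)
    case (1 a f)
    then show ?case using fin[of f f "\<lambda>x y. x \<otimes>\<^bsub>S\<^esub> a"] by auto (metis l_null)
  qed (auto simp: l_distr r_distr m_assoc)
qed

lemma free_right_module_finsum_apply:
  assumes "ring S" "F \<in> A \<rightarrow> carrier (free_right_module S B)"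
  shows "finsum (free_right_module S B) F A x = (\<Oplus>\<^bsub>S\<^esub>i\<in>A. F i x)"
  using additive_finsum[of "free_right_module S B" S "\<lambda>f. f x" F A] right_module_free[OF assms(1)] assms
  by (auto simp: right_module_def ring_def)

lemma fin_proj_free:
  fixes B :: "'x set"
  assumes "ring S" "finite B" shows "fin_proj S (free_right_module S B)"
proof -
  interpret ring S by fact
  let ?F = "free_right_module S B"
  interpret F: right_module S ?F by (rule right_module_free[OF assms(1)])
  define e where "e b = (\<lambda>x. if x = b then \<one>\<^bsub>S\<^esub> else \<zero>\<^bsub>S\<^esub>)" for b :: 'x
  have e: "e b \<in> carrier ?F" if "b \<in> B" for b
    using that by (auto simp: e_def)
  have "dual_basis S ?F B e (\<lambda>b f. f b)"
    unfolding dual_basis_def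
  proof (intro conjI ballI)
    fix f assume f: "f \<in> carrier ?F"
    have cl: "(\<lambda>b. f b \<odot>\<^bsub>?F\<^esub> e b) \<in> B \<rightarrow> carrier ?F"
      using f e by (intro Pi_I F.smult_closed) auto
    show "f = (\<Oplus>\<^bsub>?F\<^esub>b\<in>B. f b \<odot>\<^bsub>?F\<^esub> e b)"
    proof
      fix x
      have "(\<Oplus>\<^bsub>?F\<^esub>b\<in>B. f b \<odot>\<^bsub>?F\<^esub> e b) x = (\<Oplus>\<^bsub>S\<^esub>b\<in>B. if x = b then f b else \<zero>\<^bsub>S\<^esub>)"
        unfolding free_right_module_finsum_apply[OF assms(1) cl]
        by (rule finsum_cong') (use f in \<open>auto simp: e_def\<close>)
      also have "\<dots> = f x"
      proof (cases "x \<in> B")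
        case True
        then show ?thesis using f assms(2) by (intro finsum_singleton) auto
      next
        case False
        then have "(\<Oplus>\<^bsub>S\<^esub>b\<in>B. if x = b then f b else \<zero>\<^bsub>S\<^esub>) = (\<Oplus>\<^bsub>S\<^esub>b\<in>B. \<zero>\<^bsub>S\<^esub>)"
          by (intro finsum_cong') auto
        moreover have "f x = \<zero>\<^bsub>S\<^esub>" using False f by auto
        ultimately show ?thesis by (simp add: finsum_zero)
      qed
      finally show "f x = (\<Oplus>\<^bsub>?F\<^esub>b\<in>B. f b \<odot>\<^bsub>?F\<^esub> e b) x" by simp
    qed
  qed (use assms e in \<open>auto simp: right_linear_def\<close>)
  then show ?thesis by (rule fin_projI[OF F.right_module_axioms])
qed

text \<open>The basis consists of elements of \<open>M\<close> because
  \<open>projective_right_module\<close> admits only bases of the element type of \<open>M\<close>.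
  Repeated vectors of the dual basis collapse in the set \<open>B\<close>; surjectivity is therefore
  derived from the image being a submodule that contains each \<open>p i\<close>.\<close>

lemma fin_proj_generators:
  assumes "fin_proj S M"
  shows "\<exists>B. finite B \<and> B \<subseteq> carrier M \<and>
    right_linear S (free_right_module S B) M (\<lambda>c. \<Oplus>\<^bsub>M\<^esub>b\<in>B. c b \<odot>\<^bsub>M\<^esub> b) \<and>
    (\<lambda>c. \<Oplus>\<^bsub>M\<^esub>b\<in>B. c b \<odot>\<^bsub>M\<^esub> b) ` carrier (free_right_module S B) = carrier M"
proof -
  obtain n p \<phi> where b: "dual_basis S M {..<n::nat} p \<phi>" and M: "right_module S M"
    using assms by (auto simp: fin_proj_def)
  interpret right_module S M by fact
  let ?B = "p ` {..<n}" let ?F = "free_right_module S ?B"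
  let ?q = "\<lambda>c. \<Oplus>\<^bsub>M\<^esub>b\<in>?B. c b \<odot>\<^bsub>M\<^esub> b"
  have F: "right_module S ?F" by (rule right_module_free[OF S.ring_axioms])
  have B: "?B \<subseteq> carrier M" using b by (auto simp: dual_basis_def)
  have cl: "(\<lambda>b. c b \<odot>\<^bsub>M\<^esub> b) \<in> ?B \<rightarrow> carrier M" if "c \<in> carrier ?F" for c
    using that B by (intro Pi_I smult_closed) auto
  have lin: "right_linear S ?F M ?q"
  proof (rule right_linearI)
    fix x y assume xy: "x \<in> carrier ?F" "y \<in> carrier ?F"
    have "?q (x \<oplus>\<^bsub>?F\<^esub> y) = (\<Oplus>\<^bsub>M\<^esub>b\<in>?B. x b \<odot>\<^bsub>M\<^esub> b \<oplus>\<^bsub>M\<^esub> y b \<odot>\<^bsub>M\<^esub> b)"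
      using B cl[OF xy(1)] cl[OF xy(2)] xy
      by (intro M.finsum_cong') (auto simp: subset_iff Pi_iff smult_distrib_scalar)
    then show "?q (x \<oplus>\<^bsub>?F\<^esub> y) = ?q x \<oplus>\<^bsub>M\<^esub> ?q y"
      using M.finsum_addf[OF cl[OF xy(1)] cl[OF xy(2)]] by simp
  next
    fix a x assume ax: "a \<in> carrier S" "x \<in> carrier ?F"
    have "?q (a \<odot>\<^bsub>?F\<^esub> x) = (\<Oplus>\<^bsub>M\<^esub>b\<in>?B. a \<odot>\<^bsub>M\<^esub> (x b \<odot>\<^bsub>M\<^esub> b))"
      using B cl[OF ax(2)] ax by (intro M.finsum_cong') (auto simp: subset_iff Pi_iff smult_assoc smult_closed)
    then show "?q (a \<odot>\<^bsub>?F\<^esub> x) = a \<odot>\<^bsub>M\<^esub> ?q x"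
      using smult_finsum_vector[OF ax(1) cl[OF ax(2)]] by simp
  qed (rule M.finsum_closed[OF cl])
  have im: "right_submodule S M (?q ` carrier ?F)" by (rule right_submodule_image[OF F M lin])
  have gen: "p i \<in> ?q ` carrier ?F" if i: "i < n" for i
  proof
    let ?e = "\<lambda>x. if x = p i then \<one>\<^bsub>S\<^esub> else \<zero>\<^bsub>S\<^esub>"
    have "?q ?e = (\<Oplus>\<^bsub>M\<^esub>b\<in>?B. if p i = b then b else \<zero>\<^bsub>M\<^esub>)"
      using B by (intro M.finsum_cong') (auto simp: smult_one)
    also have "\<dots> = p i" using i B by (intro M.finsum_singleton) auto
    finally show "p i = ?q ?e" by simp
    show "?e \<in> carrier ?F" using i by auto
  qed
  have "carrier M \<subseteq> ?q ` carrier ?F"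
  proof
    fix x assume x: "x \<in> carrier M"
    have "(\<Oplus>\<^bsub>M\<^esub>i\<in>{..<n}. \<phi> i x \<odot>\<^bsub>M\<^esub> p i) \<in> ?q ` carrier ?F"
      by (rule right_submodule_finsum[OF M im], rule Pi_I, rule right_submodule_smult[OF im])
        (use dual_basis_scalar_closed[OF b _ x] in simp, rule gen, simp)
    then show "x \<in> ?q ` carrier ?F" using dual_basis_expand[OF b x] by simp
  qed
  then have "?q ` carrier ?F = carrier M" using im by (auto simp: right_submodule_def)
  then show ?thesis using B lin by (intro exI[of _ ?B]) auto
qed

lemma fin_proj_imp_projective:
  assumes "fin_proj S M" shows "projective_right_module S M"
proof -
  obtain B where B: "finite B" "B \<subseteq> carrier M"
    and q: "right_linear S (free_right_module S B) M (\<lambda>c. \<Oplus>\<^bsub>M\<^esub>b\<in>B. c b \<odot>\<^bsub>M\<^esub> b)"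
     "(\<lambda>c. \<Oplus>\<^bsub>M\<^esub>b\<in>B. c b \<odot>\<^bsub>M\<^esub> b) ` carrier (free_right_module S B) = carrier M"
    using fin_proj_generators[OF assms] by blast
  let ?F = "free_right_module S B"
  have M: "right_module S M" using assms by (simp add: fin_proj_def)
  then have F: "right_module S ?F" by (intro right_module_free right_moduleD)
  let ?K = "?F\<lparr>carrier := {x \<in> carrier ?F. (\<Oplus>\<^bsub>M\<^esub>b\<in>B. x b \<odot>\<^bsub>M\<^esub> b) = \<zero>\<^bsub>M\<^esub>}\<rparr>"
  have "right_module S ?K" by (rule right_module_submodule[OF F right_submodule_kernel[OF F M q(1)]])
  moreover have "module_isomorphic S (direct_sum_module M ?K) ?F"
    by (rule module_isomorphic_sym[OF F kernel_split[OF F assms q]])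
  ultimately show ?thesis using M unfolding projective_right_module_def by blast
qed

lemma fin_proj_imp_finitely_generated:
  assumes "fin_proj S M" shows "finitely_generated_module S M"
proof -
  obtain B where B: "finite B" "B \<subseteq> carrier M"
    and q: "(\<lambda>c. \<Oplus>\<^bsub>M\<^esub>b\<in>B. c b \<odot>\<^bsub>M\<^esub> b) ` carrier (free_right_module S B) = carrier M"
    using fin_proj_generators[OF assms] by blast
  have "\<exists>c\<in>B \<rightarrow> carrier S. x = (\<Oplus>\<^bsub>M\<^esub>y\<in>B. c y \<odot>\<^bsub>M\<^esub> y)" if "x \<in> carrier M" for x
  proof -
    have "x \<in> (\<lambda>c. \<Oplus>\<^bsub>M\<^esub>b\<in>B. c b \<odot>\<^bsub>M\<^esub> b) ` carrier (free_right_module S B)" using that q by simp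
    then obtain c where "c \<in> carrier (free_right_module S B)" "x = (\<Oplus>\<^bsub>M\<^esub>y\<in>B. c y \<odot>\<^bsub>M\<^esub> y)" by blast
    then show ?thesis by (intro bexI[of _ c]) auto
  qed
  then show ?thesis unfolding finitely_generated_module_def using B by blast
qed

text \<open>For the direction from right to left: the images of finitely many generators in the free
  module have finite supports, so \<open>M\<close> is already a retract of the free module on the
  union \<open>B'\<close> of these supports.\<close>

lemma fin_proj_iff:
  "fin_proj S M \<longleftrightarrow> projective_right_module S M \<and> finitely_generated_module S M"
proof
  assume "fin_proj S M"
  then show "projective_right_module S M \<and> finitely_generated_module S M"
    by (simp add: fin_proj_imp_projective fin_proj_imp_finitely_generated)
next
  assume a: "projective_right_module S M \<and> finitely_generated_module S M"
  then have M: "right_module S M" by (simp add: projective_right_module_def)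
  interpret right_module S M by fact
  obtain B :: "'c set" and Q :: "('a, 'c \<Rightarrow> 'a) module" where Q: "right_module S Q"
    and "module_isomorphic S (direct_sum_module M Q) (free_right_module S B)"
    using a by (auto simp: projective_right_module_def)
  then obtain h where h: "bij_betw h (carrier (direct_sum_module M Q)) (carrier (free_right_module S B))"
      "right_linear S (direct_sum_module M Q) (free_right_module S B) h"
    by (auto simp: module_isomorphic_iff)
  let ?L = "direct_sum_module M Q" let ?F = "free_right_module S B"
  have L: "right_module S ?L" by (rule right_module_direct_sum[OF M Q])
  interpret Q: right_module S Q by fact
  note g = right_linear_inv[OF L h]
  define i where "i x = h (x, \<zero>\<^bsub>Q\<^esub>)" for x
  define r where "r c = fst (inv_into (carrier ?L) h c)" for c
  have i: "right_linear S M ?F i"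
  proof (rule right_linearI)
    fix x assume "x \<in> carrier M"
    then show "i x \<in> carrier ?F" unfolding i_def by (intro right_linearD(1)[OF h(2)]) auto
  next
    fix x y assume "x \<in> carrier M" "y \<in> carrier M"
    then show "i (x \<oplus>\<^bsub>M\<^esub> y) = i x \<oplus>\<^bsub>?F\<^esub> i y"
      using right_linearD(2)[OF h(2), of "(x, \<zero>\<^bsub>Q\<^esub>)" "(y, \<zero>\<^bsub>Q\<^esub>)"] by (simp add: i_def)
  next
    fix a x assume "a \<in> carrier S" "x \<in> carrier M"
    then show "i (a \<odot>\<^bsub>M\<^esub> x) = a \<odot>\<^bsub>?F\<^esub> i x"
      using right_linearD(3)[OF h(2), of a "(x, \<zero>\<^bsub>Q\<^esub>)"] by (simp add: i_def)
  qed
  have r: "right_linear S ?F M r"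
    using right_linearD[OF g] by (intro right_linearI) (simp_all add: r_def mem_Times_iff)
  have ri: "r (i x) = x" if "x \<in> carrier M" for x
    using h(1) that by (simp add: r_def i_def bij_betw_def inv_into_f_f)
  obtain A where A: "finite A" "A \<subseteq> carrier M"
    and gen: "\<And>x. x \<in> carrier M \<Longrightarrow> \<exists>c\<in>A \<rightarrow> carrier S. x = (\<Oplus>\<^bsub>M\<^esub>y\<in>A. c y \<odot>\<^bsub>M\<^esub> y)"
    using a unfolding finitely_generated_module_def by blast
  define B' where "B' = (\<Union>y\<in>A. {x. i y x \<noteq> \<zero>\<^bsub>S\<^esub>})"
  have fin: "finite B'" unfolding B'_def
  proof (intro finite_UN_I A)
    fix y assume "y \<in> A"
    then have "i y \<in> carrier ?F" using A by (intro right_linearD(1)[OF i]) auto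
    then show "finite {x. i y x \<noteq> \<zero>\<^bsub>S\<^esub>}" by simp
  qed
  have B'B: "B' \<subseteq> B"
  proof
    fix x assume "x \<in> B'"
    then obtain y where y: "y \<in> A" "i y x \<noteq> \<zero>\<^bsub>S\<^esub>" by (auto simp: B'_def)
    then have "i y \<in> carrier ?F" using A by (intro right_linearD(1)[OF i]) auto
    then show "x \<in> B" using y(2) by auto
  qed
  let ?G = "free_right_module S B'"
  have F: "right_module S ?F" by (rule right_module_free[OF S.ring_axioms])
  have G: "right_module S ?G" by (rule right_module_free[OF S.ring_axioms])
  have GF: "right_submodule S ?F (carrier ?G)"
  proof -
    have "carrier ?G \<subseteq> carrier ?F" using B'B by (auto, blast)
    then show ?thesis
      using right_submodule_self[OF G] unfolding right_submodule_def free_right_module_simps(2-4) by blast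
  qed
  have "i x \<in> carrier ?G" if x: "x \<in> carrier M" for x
  proof -
    obtain c where c: "c \<in> A \<rightarrow> carrier S" "x = (\<Oplus>\<^bsub>M\<^esub>y\<in>A. c y \<odot>\<^bsub>M\<^esub> y)" using gen[OF x] by blast
    have cl: "(\<lambda>y. c y \<odot>\<^bsub>M\<^esub> y) \<in> A \<rightarrow> carrier M" using c(1) A by (auto intro!: smult_closed)
    have "i x = (\<Oplus>\<^bsub>?F\<^esub>y\<in>A. i (c y \<odot>\<^bsub>M\<^esub> y))"
      unfolding c(2) by (rule right_linear_finsum[OF M F i cl])
    also have "\<dots> \<in> carrier ?G"
    proof (rule right_submodule_finsum[OF F GF], rule Pi_I)
      fix y assume y: "y \<in> A"
      have "i y \<in> carrier ?F" using y A by (intro right_linearD(1)[OF i]) auto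
      then have "i y \<in> carrier ?G" using y by (auto simp: B'_def)
      then have "c y \<odot>\<^bsub>?F\<^esub> i y \<in> carrier ?G" using c(1) y by (intro right_submodule_smult[OF GF]) auto
      moreover have "c y \<in> carrier S" "y \<in> carrier M" using c(1) y A by auto
      ultimately show "i (c y \<odot>\<^bsub>M\<^esub> y) \<in> carrier ?G"
        using right_linearD(3)[OF i, of "c y" y] by (simp only:)
    qed
    finally show ?thesis .
  qed
  then have i': "right_linear S M ?G i" using i by (simp add: right_linear_def)
  have "carrier ?G \<subseteq> carrier ?F" using GF by (simp add: right_submodule_def)
  then have r': "right_linear S ?G M r"
    using r unfolding right_linear_def Pi_iff free_right_module_simps(2-4) by blast
  show "fin_proj S M" by (rule fin_proj_retract[OF fin_proj_free[OF S.ring_axioms fin] M r' i']) (rule ri)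
qed

lemma fg_projective_modules_iff: "M \<in> fg_projective_modules S \<longleftrightarrow> fin_proj S M"
  by (simp add: fg_projective_modules_def fin_proj_iff)

text \<open>The functionals of a dual basis serve as coordinates, padded by zeros from
  \<open>n\<close> on. The bound \<open>n\<close> is what \<open>free_submodule_induct\<close>
  inducts on.\<close>

lemma fin_proj_embed:
  assumes "fin_proj S M"
  shows "\<exists>(n :: nat) e. right_linear S M (free_right_module S UNIV) e \<and> inj_on e (carrier M) \<and>
     (\<forall>x\<in>carrier M. \<forall>k\<ge>n. e x k = \<zero>\<^bsub>S\<^esub>)"
proof -
  obtain n p \<phi> where b: "dual_basis S M {..<n::nat} p \<phi>" and M: "right_module S M"
    using assms by (auto simp: fin_proj_def)
  interpret right_module S M by fact
  define e where "e x k = (if k < n then \<phi> k x else \<zero>\<^bsub>S\<^esub>)" for x k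
  have "finite {k. e x k \<noteq> \<zero>\<^bsub>S\<^esub>}" for x
    by (rule finite_subset[of _ "{..<n}"]) (auto simp: e_def)
  then have lin: "right_linear S M (free_right_module S UNIV) e"
    using dual_basis_scalar_closed[OF b] dual_basis_scalar_add[OF b] dual_basis_scalar_smult[OF b]
    by (intro right_linearI) (auto simp: e_def)
  have "inj_on e (carrier M)"
    unfolding right_linear_inj_iff[OF M right_module_free[OF S.ring_axioms] lin]
  proof (intro ballI impI)
    fix x assume x: "x \<in> carrier M" "e x = \<zero>\<^bsub>free_right_module S UNIV\<^esub>"
    then have "\<phi> k x = \<zero>\<^bsub>S\<^esub>" if "k < n" for k using that by (auto simp: e_def fun_eq_iff) (metis)
    then have "(\<Oplus>\<^bsub>M\<^esub>i\<in>{..<n}. \<phi> i x \<odot>\<^bsub>M\<^esub> p i) = (\<Oplus>\<^bsub>M\<^esub>i\<in>{..<n}. \<zero>\<^bsub>M\<^esub>)"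
      using b by (intro M.finsum_cong') (auto simp: dual_basis_def Pi_iff)
    then show "x = \<zero>\<^bsub>M\<^esub>" using dual_basis_expand[OF b x(1)] by simp
  qed
  then show ?thesis using lin by (intro exI[of _ n] exI[of _ e]) (auto simp: e_def)
qed

lemma module_isomorphic_image:
  assumes "right_linear S M N f" "inj_on f (carrier M)"
  shows "module_isomorphic S M (N\<lparr>carrier := f ` carrier M\<rparr>)"
  unfolding module_isomorphic_iff
  by (rule exI[of _ f]) (use assms right_linear_into[OF assms(1)] in \<open>auto simp: bij_betw_def\<close>)

text \<open>\<open>K0\<close> knows only modules with elements of type
  \<open>nat \<Rightarrow> 'a\<close>. Constructions such as direct sums, ideals and quotients leave
  this type and are brought back by passing to an isomorphic copy.\<close>

lemma fin_proj_copy: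
  assumes "fin_proj S M"
  shows "\<exists>N :: ('a, nat \<Rightarrow> 'a) module. N \<in> fg_projective_modules S \<and> module_isomorphic S N M"
proof -
  obtain n e where e: "right_linear S M (free_right_module S (UNIV :: nat set)) e" "inj_on e (carrier M)"
    using fin_proj_embed[OF assms] by blast
  let ?F = "free_right_module S (UNIV :: nat set)"
  have M: "right_module S M" using assms by (simp add: fin_proj_def)
  have F: "right_module S ?F" by (rule right_module_free[OF right_moduleD(1)[OF M]])
  have N: "right_module S (?F\<lparr>carrier := e ` carrier M\<rparr>)"
    by (rule right_module_submodule[OF F right_submodule_image[OF M F e(1)]])
  have iso: "module_isomorphic S M (?F\<lparr>carrier := e ` carrier M\<rparr>)"
    by (rule module_isomorphic_image[OF e])
  show ?thesis
    using module_isomorphic_sym[OF M iso] fin_proj_isomorphic[OF assms N iso]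
    by (auto simp: fg_projective_modules_iff)
qed

section \<open>Rings whose right ideals are finitely generated and projective\<close>

text \<open>Right noetherian and right hereditary in a single condition. In this form both
  properties of the Laurent series ring follow from one description of its right ideals.\<close>

definition ideals_fin_proj :: "('a, 'm) ring_scheme \<Rightarrow> bool" where
  "ideals_fin_proj S \<longleftrightarrow> ring S \<and> (\<forall>I. right_ideal I S \<longrightarrow> fin_proj S (ideal_as_module S I))"

lemma ideals_fin_proj_imp_hereditary: "ideals_fin_proj S \<Longrightarrow> right_hereditary S"
  by (simp add: ideals_fin_proj_def right_hereditary_def fin_proj_imp_projective)

text \<open>The union of the chain is a right ideal, and the finitely many vectors of its dual basis
  all lie in one member of the chain.\<close>

lemma ideals_fin_proj_imp_noetherian:
  assumes "ideals_fin_proj S" shows "right_noetherian S"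
  unfolding right_noetherian_def
proof (intro allI impI, elim conjE)
  fix I :: "nat \<Rightarrow> 'a set" assume I: "\<forall>n. right_ideal (I n) S" and inc: "\<forall>n. I n \<subseteq> I (Suc n)"
  interpret ring S using assms by (simp add: ideals_fin_proj_def)
  note R = right_module_regular[OF ring_axioms]
  note iff = right_submodule_regular_iff[OF ring_axioms]
  have mono: "I m \<subseteq> I n" if "m \<le> n" for m n using inc that by (metis lift_Suc_mono_le)
  have sub: "right_submodule S (regular_module S) (I n)" for n using I by (simp add: iff)
  let ?U = "\<Union>n. I n"
  have U: "right_submodule S (regular_module S) ?U"
    unfolding right_submodule_def
  proof (intro conjI ballI)
    show "?U \<subseteq> carrier (regular_module S)" using sub unfolding right_submodule_def by blast
    show "\<zero>\<^bsub>regular_module S\<^esub> \<in> ?U" using sub by (auto simp: right_submodule_def)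
  next
    fix x y assume "x \<in> ?U" "y \<in> ?U"
    then obtain m n where "x \<in> I m" "y \<in> I n" by blast
    then have "x \<in> I (max m n)" "y \<in> I (max m n)"
      using mono[of m "max m n"] mono[of n "max m n"] by auto
    then have "x \<oplus>\<^bsub>regular_module S\<^esub> y \<in> I (max m n)"
      using sub[of "max m n"] unfolding right_submodule_def by blast
    then show "x \<oplus>\<^bsub>regular_module S\<^esub> y \<in> ?U" by blast
  next
    fix a x assume "a \<in> carrier S" "x \<in> ?U"
    then show "a \<odot>\<^bsub>regular_module S\<^esub> x \<in> ?U" using sub unfolding right_submodule_def by blast
  qed
  then have "fin_proj S (ideal_as_module S ?U)" using assms by (simp add: ideals_fin_proj_def iff)
  then obtain n p \<phi> where b: "dual_basis S (ideal_as_module S ?U) {..<n::nat} p \<phi>"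
    by (auto simp: fin_proj_def)
  have p: "\<And>i. i < n \<Longrightarrow> p i \<in> ?U" using b by (auto simp: dual_basis_def)
  then have "\<forall>i. \<exists>k. i < n \<longrightarrow> p i \<in> I k" by blast
  then obtain k where k: "\<And>i. i < n \<Longrightarrow> p i \<in> I (k i)" by metis
  define N where "N = Max (k ` {..<n})"
  have pN: "p i \<in> I N" if "i < n" for i
    using k[OF that] mono[of "k i" N] that by (auto simp: N_def)
  have "?U \<subseteq> I N"
  proof
    fix x assume x: "x \<in> ?U"
    note c = dual_basis_scalar_closed[OF b, of _ x]
    have cl: "(\<lambda>i. \<phi> i x \<odot>\<^bsub>ideal_as_module S ?U\<^esub> p i) \<in> {..<n} \<rightarrow> I N"
      using c x sub[of N] pN by (auto simp: right_submodule_def)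
    then have cl': "(\<lambda>i. \<phi> i x \<odot>\<^bsub>ideal_as_module S ?U\<^esub> p i) \<in> {..<n} \<rightarrow> ?U" by blast
    have "x = (\<Oplus>\<^bsub>ideal_as_module S ?U\<^esub>i\<in>{..<n}. \<phi> i x \<odot>\<^bsub>ideal_as_module S ?U\<^esub> p i)"
      using dual_basis_expand[OF b, of x] x by simp
    also have "\<dots> = (\<Oplus>\<^bsub>regular_module S\<^esub>i\<in>{..<n}. \<phi> i x \<odot>\<^bsub>ideal_as_module S ?U\<^esub> p i)"
      unfolding ideal_as_module_regular[of S ?U]
      by (rule finsum_submodule[OF R U cl'[unfolded ideal_as_module_regular[of S ?U]]])
    also have "\<dots> \<in> I N" by (rule right_submodule_finsum[OF R sub cl])
    finally show "x \<in> I N" .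
  qed
  then have "\<forall>m\<ge>N. I m = I N" using mono by blast
  then show "\<exists>N. \<forall>n\<ge>N. I n = I N" by blast
qed

text \<open>The argument behind Kaplansky's theorem on hereditary rings. The last coordinates of the
  elements of \<open>U\<close> form a right ideal; this ideal is projective, so \<open>U\<close>
  splits into it and a kernel with one coordinate fewer. Projectivity is carried along in the
  induction because the case \<open>sum\<close> applies to finitely generated projective modules
  only.\<close>

lemma free_submodule_induct:
  fixes Pr :: "('a, nat \<Rightarrow> 'a) module \<Rightarrow> bool"
  assumes S: "ideals_fin_proj S"
    and ideal: "\<And>N I. right_ideal I S \<Longrightarrow> N \<in> fg_projective_modules S \<Longrightarrow>
         module_isomorphic S N (ideal_as_module S I) \<Longrightarrow> Pr N"
    and sum: "\<And>N P Q. N \<in> fg_projective_modules S \<Longrightarrow> P \<in> fg_projective_modules S \<Longrightarrow>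
         Q \<in> fg_projective_modules S \<Longrightarrow> module_isomorphic S N (direct_sum_module P Q) \<Longrightarrow>
         Pr P \<Longrightarrow> Pr Q \<Longrightarrow> Pr N"
    and "right_submodule S (free_right_module S UNIV) U" "\<And>u k. u \<in> U \<Longrightarrow> n \<le> k \<Longrightarrow> u k = \<zero>\<^bsub>S\<^esub>"
  shows "fin_proj S ((free_right_module S UNIV)\<lparr>carrier := U\<rparr>) \<and>
    Pr ((free_right_module S UNIV)\<lparr>carrier := U\<rparr>)"
  using assms(4,5)
proof (induction n arbitrary: U)
  let ?F = "free_right_module S (UNIV :: nat set)"
  have ring: "ring S" using S by (simp add: ideals_fin_proj_def)
  interpret ring S by fact
  have F: "right_module S ?F" by (rule right_module_free[OF ring])
  note R = right_module_regular[OF ring]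
  {
    case 0
    have U: "U = {\<lambda>_. \<zero>\<^bsub>S\<^esub>}" using 0 by (auto simp: right_submodule_def)
    \<comment> \<open>The zero module is treated as the zero right ideal, so that the case
      \<open>ideal\<close> also starts the induction.\<close>
    have z: "right_ideal {\<zero>\<^bsub>S\<^esub>} S"
      unfolding right_submodule_regular_iff[OF ring, symmetric] by (auto simp: right_submodule_def)
    have iso: "module_isomorphic S (?F\<lparr>carrier := U\<rparr>) (ideal_as_module S {\<zero>\<^bsub>S\<^esub>})"
      unfolding module_isomorphic_def U by (rule exI[of _ "\<lambda>_. \<zero>\<^bsub>S\<^esub>"]) (auto simp: bij_betw_def)
    have m: "right_module S (?F\<lparr>carrier := U\<rparr>)" by (rule right_module_submodule[OF F 0(1)])
    have "fin_proj S (?F\<lparr>carrier := U\<rparr>)"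
      using fin_proj_isomorphic[OF _ m module_isomorphic_sym[OF m iso]] S z
      by (auto simp: ideals_fin_proj_def)
    then show ?case using ideal[OF z _ iso] by (simp add: fg_projective_modules_iff)
  next
    case (Suc n)
    let ?U = "?F\<lparr>carrier := U\<rparr>"
    have m: "right_module S ?U" by (rule right_module_submodule[OF F Suc.prems(1)])
    have UF: "U \<subseteq> carrier ?F" using Suc.prems(1) by (simp add: right_submodule_def)
    define I where "I = (\<lambda>u. u n) ` U"
    have f: "right_linear S ?U (regular_module S) (\<lambda>u. u n)"
      using UF by (intro right_linearI) auto
    have "right_ideal I S" using right_submodule_image[OF m R f]
      by (simp add: I_def right_submodule_regular_iff[OF ring])
    then have I: "fin_proj S (ideal_as_module S I)" using S by (simp add: ideals_fin_proj_def)
    have f': "right_linear S ?U (ideal_as_module S I) (\<lambda>u. u n)"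
      unfolding ideal_as_module_regular[of S I] by (rule right_linear_into[OF f]) (simp add: I_def)
    define K where "K = {u \<in> U. u n = \<zero>\<^bsub>S\<^esub>}"
    have K: "right_submodule S ?F K"
      using right_submodule_kernel[OF m R f] Suc.prems(1) by (auto simp: K_def right_submodule_def)
    have "fin_proj S (?F\<lparr>carrier := K\<rparr>) \<and> Pr (?F\<lparr>carrier := K\<rparr>)"
    proof (rule Suc.IH[OF K])
      fix u k assume "u \<in> K" "n \<le> k"
      then show "u k = \<zero>\<^bsub>S\<^esub>" using Suc.prems(2)[of u k] by (cases "k = n") (auto simp: K_def)
    qed
    then have K1: "fin_proj S (?F\<lparr>carrier := K\<rparr>)" and K2: "Pr (?F\<lparr>carrier := K\<rparr>)" by auto
    have "module_isomorphic S ?U (direct_sum_module (ideal_as_module S I)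
        (?U\<lparr>carrier := {x \<in> carrier ?U. x n = \<zero>\<^bsub>ideal_as_module S I\<^esub>}\<rparr>))"
      by (rule kernel_split[OF m I f']) (simp add: I_def)
    then have iso: "module_isomorphic S ?U (direct_sum_module (ideal_as_module S I) (?F\<lparr>carrier := K\<rparr>))"
      by (simp add: K_def)
    have fpU: "fin_proj S ?U"
      by (rule fin_proj_isomorphic[OF fin_proj_direct_sum[OF I K1] m module_isomorphic_sym[OF m iso]])
    \<comment> \<open>The predicate is available only for modules on
      \<open>nat \<Rightarrow> 'a\<close>, so the ideal \<open>I\<close> is replaced by a
      copy.\<close>
    obtain N :: "('a, nat \<Rightarrow> 'a) module" where N: "N \<in> fg_projective_modules S"
      "module_isomorphic S N (ideal_as_module S I)" using fin_proj_copy[OF I] by blast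
    have "right_module S N" using N(1) by (simp add: fg_projective_modules_iff fin_proj_def)
    then have "module_isomorphic S (ideal_as_module S I) N" using N(2) by (rule module_isomorphic_sym)
    then have "module_isomorphic S ?U (direct_sum_module N (?F\<lparr>carrier := K\<rparr>))"
      using iso module_isomorphic_direct_sum[OF _ module_isomorphic_refl] module_isomorphic_trans by blast
    moreover have "Pr N" by (rule ideal[OF \<open>right_ideal I S\<close> N])
    ultimately have "Pr ?U" using sum[of ?U N "?F\<lparr>carrier := K\<rparr>"] N(1) K1 K2 fpU
      by (simp add: fg_projective_modules_iff)
    then show ?case using fpU by blast
  }
qed

text \<open>The preceding induction with a trivial predicate, applied to the image of
  \<open>U\<close> in a free module. Its purpose is the projectivity of the quotient of two lattices
  in \<open>lattice_comparison\<close>.\<close>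

lemma fin_proj_submodule:
  assumes "ideals_fin_proj S" "fin_proj S M" "right_submodule S M U"
  shows "fin_proj S (M\<lparr>carrier := U\<rparr>)"
proof -
  let ?F = "free_right_module S (UNIV :: nat set)"
  have M: "right_module S M" using assms(2) by (simp add: fin_proj_def)
  have F: "right_module S ?F" by (rule right_module_free[OF right_moduleD(1)[OF M]])
  have U: "right_module S (M\<lparr>carrier := U\<rparr>)" by (rule right_module_submodule[OF M assms(3)])
  have UM: "U \<subseteq> carrier M" using assms(3) by (simp add: right_submodule_def)
  obtain n e where e: "right_linear S M ?F e" "inj_on e (carrier M)"
      "\<forall>x\<in>carrier M. \<forall>k\<ge>n. e x k = \<zero>\<^bsub>S\<^esub>"
    using fin_proj_embed[OF assms(2)] by blast
  have e': "right_linear S (M\<lparr>carrier := U\<rparr>) ?F e" by (rule right_linear_subset[OF e(1) UM])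
  have "inj_on e U" using e(2) UM by (rule inj_on_subset)
  then have iso: "module_isomorphic S (M\<lparr>carrier := U\<rparr>) (?F\<lparr>carrier := e ` U\<rparr>)"
    using module_isomorphic_image[OF e'] by simp
  have eU: "right_submodule S ?F (e ` U)" using right_submodule_image[OF U F e'] by simp
  have "fin_proj S (?F\<lparr>carrier := e ` U\<rparr>)"
    using free_submodule_induct[OF assms(1), of "\<lambda>_. True" "e ` U" n] eU e(3) UM by auto
  then show ?thesis by (rule fin_proj_isomorphic[OF _ U module_isomorphic_sym[OF U iso]])
qed

text \<open>Reduces statements on finitely generated projective modules to right ideals and direct
  sums. It is used over \<open>D\<close> for the triviality of twists, and over the Laurent series
  ring for essential surjectivity.\<close>

lemma fg_projective_induct [consumes 2, case_names ideal sum]: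
  fixes Pr :: "('a, nat \<Rightarrow> 'a) module \<Rightarrow> bool"
  assumes S: "ideals_fin_proj S" and M: "M \<in> fg_projective_modules S"
    and ideal: "\<And>N I. right_ideal I S \<Longrightarrow> N \<in> fg_projective_modules S \<Longrightarrow>
         module_isomorphic S N (ideal_as_module S I) \<Longrightarrow> Pr N"
    and sum: "\<And>N P Q. N \<in> fg_projective_modules S \<Longrightarrow> P \<in> fg_projective_modules S \<Longrightarrow>
         Q \<in> fg_projective_modules S \<Longrightarrow> module_isomorphic S N (direct_sum_module P Q) \<Longrightarrow>
         Pr P \<Longrightarrow> Pr Q \<Longrightarrow> Pr N"
  shows "Pr M"
proof -
  let ?F = "free_right_module S (UNIV :: nat set)"
  have fpM: "fin_proj S M" using M by (simp add: fg_projective_modules_iff)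
  then have rM: "right_module S M" by (simp add: fin_proj_def)
  have F: "right_module S ?F" by (rule right_module_free[OF right_moduleD(1)[OF rM]])
  obtain n e where e: "right_linear S M ?F e" "inj_on e (carrier M)"
      "\<forall>x\<in>carrier M. \<forall>k\<ge>n. e x k = \<zero>\<^bsub>S\<^esub>"
    using fin_proj_embed[OF fpM] by blast
  let ?V = "?F\<lparr>carrier := e ` carrier M\<rparr>"
  have V: "right_submodule S ?F (e ` carrier M)" by (rule right_submodule_image[OF rM F e(1)])
  have "fin_proj S ?V \<and> Pr ?V"
    by (rule free_submodule_induct[of S Pr _ n, OF S])
      (erule (2) ideal, erule (5) sum, rule V, use e(3) in auto)
  then have V': "?V \<in> fg_projective_modules S" "Pr ?V" by (auto simp: fg_projective_modules_iff)
  have iso: "module_isomorphic S M ?V" by (rule module_isomorphic_image[OF e(1,2)])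
  \<comment> \<open>\<open>Pr\<close> is not assumed to be invariant under isomorphism. The case
    \<open>sum\<close> with a zero summand carries it from the copy inside the free module to
    \<open>M\<close> itself.\<close>
  let ?Z = "?F\<lparr>carrier := {\<lambda>_. \<zero>\<^bsub>S\<^esub>}\<rparr>"
  interpret ring S by (rule right_moduleD(1)[OF rM])
  interpret F: right_module S ?F by fact
  interpret V: right_module S ?V by (rule right_module_submodule[OF F V])
  have Z: "right_submodule S ?F {\<lambda>_. \<zero>\<^bsub>S\<^esub>}" by (auto simp: right_submodule_def)
  have "fin_proj S ?Z \<and> Pr ?Z"
    by (rule free_submodule_induct[of S Pr _ 0, OF S])
      (erule (2) ideal, erule (5) sum, rule Z, auto)
  then have Z': "?Z \<in> fg_projective_modules S" "Pr ?Z" by (auto simp: fg_projective_modules_iff)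
  have "module_isomorphic S ?V (direct_sum_module ?V ?Z)"
    unfolding module_isomorphic_def
    by (rule exI[of _ "\<lambda>v. (v, \<lambda>_. \<zero>\<^bsub>S\<^esub>)"]) (auto simp: bij_betw_def inj_on_def)
  then have "module_isomorphic S M (direct_sum_module ?V ?Z)" by (rule module_isomorphic_trans[OF iso])
  then show ?thesis using sum[OF M V'(1) Z'(1) _ V'(2) Z'(2)] by blast
qed

section \<open>The Grothendieck group\<close>

definition k0_subgroup ::
    "('a, 'm) ring_scheme \<Rightarrow> (('a, nat \<Rightarrow> 'a) module \<Rightarrow>\<^sub>0 int) set" where
  "k0_subgroup S = generate (free_Abelian_group (fg_projective_modules S)) (K0_relations S)"

definition k0_generator ::
    "('a, 'm) ring_scheme \<Rightarrow> ('a, nat \<Rightarrow> 'a) module \<Rightarrow> (('a, nat \<Rightarrow> 'a) module \<Rightarrow>\<^sub>0 int) set" where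
  "k0_generator S P = r_coset (free_Abelian_group (fg_projective_modules S)) (k0_subgroup S) (frag_of P)"

text \<open>Gives modules on arbitrary types a class, through a chosen copy on
  \<open>nat \<Rightarrow> 'a\<close>. By \<open>k0_class_eq\<close> the choice does not
  matter.\<close>

definition k0_class ::
    "('a, 'm) ring_scheme \<Rightarrow> ('a, 'b) module \<Rightarrow> (('a, nat \<Rightarrow> 'a) module \<Rightarrow>\<^sub>0 int) set" where
  "k0_class S M =
     k0_generator S (SOME N. N \<in> fg_projective_modules S \<and> module_isomorphic S N M)"

lemma K0_eq: "K0 S = free_Abelian_group (fg_projective_modules S) Mod k0_subgroup S"
  by (simp add: K0_def k0_subgroup_def)

lemma K0_relations_closed:
  "K0_relations S \<subseteq> carrier (free_Abelian_group (fg_projective_modules S))"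
proof -
  have "Poly_Mapping.keys (frag_of N - frag_of P - frag_of Q) \<subseteq> fg_projective_modules S"
    if "N \<in> fg_projective_modules S" "P \<in> fg_projective_modules S" "Q \<in> fg_projective_modules S"
    for N P Q
    using that keys_diff[of "frag_of N - frag_of P" "frag_of Q"] keys_diff[of "frag_of N" "frag_of P"]
    by auto
  then show ?thesis by (auto simp: K0_relations_def)
qed

lemma k0_subgroup_subgroup:
  "subgroup (k0_subgroup S) (free_Abelian_group (fg_projective_modules S))"
  unfolding k0_subgroup_def
  by (rule group.generate_is_subgroup[OF group_free_Abelian_group K0_relations_closed])

lemma k0_subgroup_normal:
  "k0_subgroup S \<lhd> free_Abelian_group (fg_projective_modules S)"
  by (rule comm_group.subgroup_imp_normal[OF abelian_free_Abelian_group k0_subgroup_subgroup])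

lemma comm_group_K0: "comm_group (K0 S)"
  unfolding K0_eq
  by (rule comm_group.abelian_FactGroup[OF abelian_free_Abelian_group k0_subgroup_subgroup])

lemma k0_generator_closed: "P \<in> fg_projective_modules S \<Longrightarrow> k0_generator S P \<in> carrier (K0 S)"
  unfolding K0_eq carrier_FactGroup k0_generator_def
  by (rule imageI) (simp only: frag_of_in_free_Abelian_group)

lemma coset_map_hom:
  "(\<lambda>x. r_coset (free_Abelian_group (fg_projective_modules S)) (k0_subgroup S) x)
     \<in> hom (free_Abelian_group (fg_projective_modules S)) (K0 S)"
  unfolding K0_eq by (rule normal.r_coset_hom_Mod[OF k0_subgroup_normal])

lemma k0_generator_sum:
  assumes "N \<in> fg_projective_modules S" "P \<in> fg_projective_modules S" "Q \<in> fg_projective_modules S"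
    "module_isomorphic S N (direct_sum_module P Q)"
  shows "k0_generator S N = k0_generator S P \<otimes>\<^bsub>K0 S\<^esub> k0_generator S Q"
proof -
  let ?F = "free_Abelian_group (fg_projective_modules S)"
  let ?H = "k0_subgroup S"
  have PQ: "frag_of P \<in> carrier ?F" "frag_of Q \<in> carrier ?F" "frag_of N \<in> carrier ?F"
    using assms by simp_all
  interpret F: comm_group ?F by (rule abelian_free_Abelian_group)
  have PQ': "frag_of P + frag_of Q \<in> carrier ?F"
    using F.m_closed[OF PQ(1,2)] by simp
  have "frag_of N - frag_of P - frag_of Q \<in> ?H"
    unfolding k0_subgroup_def
    by (rule generate.incl) (use assms in \<open>auto simp: K0_relations_def\<close>)
  then have "frag_of N \<otimes>\<^bsub>?F\<^esub> inv\<^bsub>?F\<^esub> (frag_of P + frag_of Q) \<in> ?H"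
    using PQ' by (simp add: algebra_simps)
  then have "?H #>\<^bsub>?F\<^esub> frag_of N = ?H #>\<^bsub>?F\<^esub> (frag_of P \<otimes>\<^bsub>?F\<^esub> frag_of Q)"
    using F.coset_join2 PQ PQ' k0_subgroup_subgroup[of S]
    by (metis F.coset_mult_inv1 F.coset_mult_inv2 F.inv_closed F.m_closed F.subgroupE(1) mult_free_Abelian_group)
  then show ?thesis
    using hom_mult[OF coset_map_hom PQ(1,2)] by (simp add: k0_generator_def)
qed

lemma zero_module_exists:
  assumes "ring S"
  shows "\<exists>Z :: ('a, nat \<Rightarrow> 'a) module. Z \<in> fg_projective_modules S \<and> carrier Z = {\<zero>\<^bsub>Z\<^esub>}"
proof
  interpret ring S by fact
  let ?Z = "free_right_module S {} :: ('a, nat \<Rightarrow> 'a) module"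
  have "carrier ?Z = {\<zero>\<^bsub>?Z\<^esub>}" by (auto simp: free_right_module_def)
  then show "?Z \<in> fg_projective_modules S \<and> carrier ?Z = {\<zero>\<^bsub>?Z\<^esub>}"
    using fin_proj_free[OF assms, of "{}"] by (simp add: fg_projective_modules_iff del: free_right_module_simps)
qed

text \<open>With a zero module \<open>Z\<close>, both \<open>N\<close> and \<open>P\<close> are
  isomorphic to the direct sum of \<open>P\<close> and \<open>Z\<close>, so both classes equal the
  product of the classes of \<open>P\<close> and \<open>Z\<close>.\<close>

lemma k0_generator_cong:
  assumes "N \<in> fg_projective_modules S" "P \<in> fg_projective_modules S" "module_isomorphic S N P"
  shows "k0_generator S N = k0_generator S P"
proof -
  have P: "right_module S P" using assms(2) by (simp add: fg_projective_modules_iff fin_proj_def)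
  interpret P: right_module S P by fact
  obtain Z :: "('a, nat \<Rightarrow> 'a) module"
    where Z: "Z \<in> fg_projective_modules S" "carrier Z = {\<zero>\<^bsub>Z\<^esub>}"
    using zero_module_exists[OF P.S.ring_axioms] by blast
  interpret Z: right_module S Z using Z(1) by (simp add: fg_projective_modules_iff fin_proj_def)
  have "module_isomorphic S P (direct_sum_module P Z)"
    unfolding module_isomorphic_def
    by (rule exI[of _ "\<lambda>p. (p, \<zero>\<^bsub>Z\<^esub>)"]) (use Z(2) in \<open>auto simp: bij_betw_def inj_on_def\<close>)
  then show ?thesis
    using k0_generator_sum[OF assms(2,2) Z(1)] k0_generator_sum[OF assms(1,2) Z(1)]
      module_isomorphic_trans[OF assms(3)] by metis
qed

lemma k0_class_eq:
  assumes "N \<in> fg_projective_modules S" "module_isomorphic S N M"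
  shows "k0_class S M = k0_generator S N"
proof -
  let ?N = "SOME N. N \<in> fg_projective_modules S \<and> module_isomorphic S N M"
  have N': "?N \<in> fg_projective_modules S \<and> module_isomorphic S ?N M"
    by (rule someI[of _ N]) (use assms in simp)
  have "right_module S N" using assms(1) by (simp add: fg_projective_modules_iff fin_proj_def)
  then have "module_isomorphic S M N" using assms(2) by (rule module_isomorphic_sym)
  then show ?thesis using k0_generator_cong[of ?N S N] N' assms(1) module_isomorphic_trans
    unfolding k0_class_def by blast
qed

lemma k0_class_generator: "P \<in> fg_projective_modules S \<Longrightarrow> k0_class S P = k0_generator S P"
  by (rule k0_class_eq[OF _ module_isomorphic_refl])

lemma k0_class_closed:
  assumes "fin_proj S M" shows "k0_class S M \<in> carrier (K0 S)"
  using fin_proj_copy[OF assms] k0_class_eq k0_generator_closed by metis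

lemma k0_class_cong:
  assumes "fin_proj S M" "module_isomorphic S M M'"
  shows "k0_class S M = k0_class S M'"
proof -
  obtain N :: "('a, nat \<Rightarrow> 'a) module" where N: "N \<in> fg_projective_modules S" "module_isomorphic S N M"
    using fin_proj_copy[OF assms(1)] by blast
  show ?thesis
    using k0_class_eq[OF N] k0_class_eq[OF N(1) module_isomorphic_trans[OF N(2) assms(2)]] by simp
qed

lemma k0_class_sum:
  assumes "fin_proj S P" "fin_proj S Q"
  shows "k0_class S (direct_sum_module P Q) = k0_class S P \<otimes>\<^bsub>K0 S\<^esub> k0_class S Q"
proof -
  obtain P' :: "('a, nat \<Rightarrow> 'a) module" where P': "P' \<in> fg_projective_modules S" "module_isomorphic S P' P"
    using fin_proj_copy[OF assms(1)] by blast
  obtain Q' :: "('a, nat \<Rightarrow> 'a) module" where Q': "Q' \<in> fg_projective_modules S" "module_isomorphic S Q' Q"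
    using fin_proj_copy[OF assms(2)] by blast
  have "fin_proj S (direct_sum_module P' Q')"
    using P'(1) Q'(1) by (simp add: fg_projective_modules_iff fin_proj_direct_sum)
  then obtain N :: "('a, nat \<Rightarrow> 'a) module" where
    N: "N \<in> fg_projective_modules S" "module_isomorphic S N (direct_sum_module P' Q')"
    using fin_proj_copy by blast
  have "module_isomorphic S N (direct_sum_module P Q)"
    by (rule module_isomorphic_trans[OF N(2) module_isomorphic_direct_sum[OF P'(2) Q'(2)]])
  then show ?thesis
    using k0_class_eq[OF N(1)] k0_class_eq[OF P'] k0_class_eq[OF Q'] k0_generator_sum[OF N(1) P'(1) Q'(1) N(2)]
    by simp
qed

section \<open>Homomorphisms out of the Grothendieck group\<close>

lemma K0_universal:
  assumes "comm_group A" "\<And>P. P \<in> fg_projective_modules S \<Longrightarrow> c P \<in> carrier A"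
    and rel: "\<And>N P Q. \<lbrakk>N \<in> fg_projective_modules S; P \<in> fg_projective_modules S;
        Q \<in> fg_projective_modules S; module_isomorphic S N (direct_sum_module P Q)\<rbrakk> \<Longrightarrow>
        c N = c P \<otimes>\<^bsub>A\<^esub> c Q"
  shows "\<exists>h\<in>hom (K0 S) A. \<forall>P\<in>fg_projective_modules S. h (k0_generator S P) = c P"
proof -
  let ?X = "fg_projective_modules S" let ?F = "free_Abelian_group ?X" let ?H = "k0_subgroup S"
  interpret A: comm_group A by fact
  interpret F: comm_group ?F by (rule abelian_free_Abelian_group)
  obtain h where h: "h \<in> hom ?F A" and hc: "\<And>P. P \<in> ?X \<Longrightarrow> h (frag_of P) = c P"
    using A.free_Abelian_group_universal[of c ?X] assms(2) by (metis image_subsetI)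
  interpret h: group_hom ?F A h by unfold_locales (rule h)
  have "K0_relations S \<subseteq> kernel ?F A h"
  proof
    fix r assume r: "r \<in> K0_relations S"
    then obtain N P Q where NPQ: "N \<in> ?X" "P \<in> ?X" "Q \<in> ?X" "module_isomorphic S N (direct_sum_module P Q)"
      and r': "r = frag_of N - frag_of P - frag_of Q" by (auto simp: K0_relations_def)
    have rF: "r \<in> carrier ?F" using r K0_relations_closed by blast
    have "r \<otimes>\<^bsub>?F\<^esub> (frag_of P \<otimes>\<^bsub>?F\<^esub> frag_of Q) = frag_of N" by (simp add: r')
    then have "c N = h r \<otimes>\<^bsub>A\<^esub> (c P \<otimes>\<^bsub>A\<^esub> c Q)"
      using rF NPQ h.hom_mult[of r "frag_of P \<otimes>\<^bsub>?F\<^esub> frag_of Q"] h.hom_mult[of "frag_of P" "frag_of Q"]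
        F.m_closed[of "frag_of P" "frag_of Q"]
      by (simp add: hc del: mult_free_Abelian_group carrier_free_Abelian_group_iff)
    then have "h r \<otimes>\<^bsub>A\<^esub> c N = c N" using rel[OF NPQ] by simp
    then have "h r = \<one>\<^bsub>A\<^esub>" using rF NPQ assms(2)[of N] by simp
    then show "r \<in> kernel ?F A h" using rF by (simp add: kernel_def)
  qed
  then have Hk: "?H \<subseteq> kernel ?F A h"
    unfolding k0_subgroup_def by (rule F.generate_subgroup_incl[OF _ h.subgroup_kernel])
  have "h x = h y" if xy: "x \<in> carrier ?F" "y \<in> carrier ?F" "?H #>\<^bsub>?F\<^esub> x = ?H #>\<^bsub>?F\<^esub> y" for x y
  proof -
    have "x \<in> ?H #>\<^bsub>?F\<^esub> y" using xy F.rcos_self[OF _ k0_subgroup_subgroup] by metis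
    then obtain k where k: "k \<in> ?H" "x = k \<otimes>\<^bsub>?F\<^esub> y" by (auto simp: r_coset_def)
    have "k \<in> kernel ?F A h" using k(1) Hk by blast
    then show ?thesis using k(2) xy(2) h.hom_mult[of k y] by (auto simp: kernel_def)
  qed
  from FactGroup_universal[OF h k0_subgroup_normal this] obtain g where
    g: "g \<in> hom (K0 S) A" "\<And>x. x \<in> carrier ?F \<Longrightarrow> g (?H #>\<^bsub>?F\<^esub> x) = h x"
    unfolding K0_eq by blast
  then have "g (k0_generator S P) = c P" if "P \<in> ?X" for P
    using g(2)[of "frag_of P"] that hc by (simp add: k0_generator_def)
  then show ?thesis using g(1) by blast
qed

lemma K0_hom_eqI:
  assumes A: "group A" and f: "f \<in> hom (K0 S) A" and g: "g \<in> hom (K0 S) A"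
    and eq: "\<And>P. P \<in> fg_projective_modules S \<Longrightarrow> f (k0_generator S P) = g (k0_generator S P)"
    and "x \<in> carrier (K0 S)"
  shows "f x = g x"
proof -
  let ?X = "fg_projective_modules S" let ?F = "free_Abelian_group ?X" let ?H = "k0_subgroup S"
  interpret A: group A by fact
  interpret F: comm_group ?F by (rule abelian_free_Abelian_group)
  interpret K: comm_group "K0 S" by (rule comm_group_K0)
  interpret f: group_hom "K0 S" A f by unfold_locales (rule f)
  interpret g: group_hom "K0 S" A g by unfold_locales (rule g)
  interpret q: group_hom ?F "K0 S" "\<lambda>x. ?H #>\<^bsub>?F\<^esub> x" by unfold_locales (rule coset_map_hom)
  obtain u where u: "Poly_Mapping.keys u \<subseteq> ?X" and x: "x = ?H #>\<^bsub>?F\<^esub> u"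
    using assms(5) unfolding K0_eq carrier_FactGroup by auto
  have "f (?H #>\<^bsub>?F\<^esub> u) = g (?H #>\<^bsub>?F\<^esub> u)" using u
  proof (induction u rule: free_Abelian_group_induct[consumes 1])
    case 1
    show ?case using q.hom_one f.hom_one g.hom_one by simp
  next
    case (2 u v)
    have uv: "u \<in> carrier ?F" "v \<in> carrier ?F" using 2 by auto
    have e: "u - v = u \<otimes>\<^bsub>?F\<^esub> inv\<^bsub>?F\<^esub> v" using 2 by simp
    show ?case unfolding e
      using uv 2 by (simp only: q.hom_mult q.hom_inv f.hom_mult f.hom_inv g.hom_mult g.hom_inv
          q.hom_closed F.inv_closed K.inv_closed)
  next
    case (3 P)
    then show ?case using eq by (simp add: k0_generator_def)
  qed
  then show ?thesis using x by simp
qed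

text \<open>\<open>F\<close> need not be a functor: it only has to preserve direct sum
  decompositions, to be essentially surjective, and to be injective up to classes.\<close>

lemma K0_isomorphic:
  fixes S :: "('a, 'm) ring_scheme" and S' :: "('b, 'n) ring_scheme"
    and F :: "('a, nat \<Rightarrow> 'a) module \<Rightarrow> ('b, 'c) module"
  assumes F: "\<And>P. fin_proj S P \<Longrightarrow> fin_proj S' (F P)"
    and sum: "\<And>N P Q. \<lbrakk>fin_proj S N; fin_proj S P; fin_proj S Q;
        module_isomorphic S N (direct_sum_module P Q)\<rbrakk> \<Longrightarrow>
        module_isomorphic S' (F N) (direct_sum_module (F P) (F Q))"
    and surj: "\<And>M :: ('b, nat \<Rightarrow> 'b) module. fin_proj S' M \<Longrightarrow> \<exists>P. fin_proj S P \<and> module_isomorphic S' (F P) M"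
    and inj: "\<And>P Q. \<lbrakk>fin_proj S P; fin_proj S Q; module_isomorphic S' (F P) (F Q)\<rbrakk> \<Longrightarrow>
        k0_class S P = k0_class S Q"
  shows "K0 S' \<cong> K0 S"
proof -
  have "\<exists>h\<in>hom (K0 S) (K0 S'). \<forall>P\<in>fg_projective_modules S. h (k0_generator S P) = k0_class S' (F P)"
  proof (rule K0_universal[OF comm_group_K0])
    fix N P Q assume a: "N \<in> fg_projective_modules S" "P \<in> fg_projective_modules S"
      "Q \<in> fg_projective_modules S" "module_isomorphic S N (direct_sum_module P Q)"
    then have "fin_proj S N" "fin_proj S P" "fin_proj S Q" by (auto simp: fg_projective_modules_iff)
    then show "k0_class S' (F N) = k0_class S' (F P) \<otimes>\<^bsub>K0 S'\<^esub> k0_class S' (F Q)"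
      using k0_class_cong[OF F sum[OF _ _ _ a(4)]] k0_class_sum[OF F F] by metis
  qed (simp add: F fg_projective_modules_iff k0_class_closed)
  then obtain \<Phi> where \<Phi>: "\<Phi> \<in> hom (K0 S) (K0 S')"
    and \<Phi>_gen: "\<And>P. P \<in> fg_projective_modules S \<Longrightarrow> \<Phi> (k0_generator S P) = k0_class S' (F P)" by blast
  \<comment> \<open>A choice of preimages under \<open>F\<close> up to isomorphism. \<open>G\<close>
    need not respect isomorphisms or direct sums of modules; its classes do, by
    \<open>inj\<close>.\<close>
  define G where "G M = (SOME P. fin_proj S P \<and> module_isomorphic S' (F P) M)"
    for M :: "('b, nat \<Rightarrow> 'b) module"
  have G: "fin_proj S (G M)" "module_isomorphic S' (F (G M)) M" if "M \<in> fg_projective_modules S'" for M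
    using someI_ex[OF surj, of M] that by (auto simp: G_def fg_projective_modules_iff)
  have modF: "right_module S' (F P)" if "fin_proj S P" for P
    using F[OF that] by (simp add: fin_proj_def)
  have "\<exists>h\<in>hom (K0 S') (K0 S). \<forall>M\<in>fg_projective_modules S'. h (k0_generator S' M) = k0_class S (G M)"
  proof (rule K0_universal[OF comm_group_K0])
    fix N P Q assume a: "N \<in> fg_projective_modules S'" "P \<in> fg_projective_modules S'"
      "Q \<in> fg_projective_modules S'" "module_isomorphic S' N (direct_sum_module P Q)"
    note GP = G[OF a(2)] and GQ = G[OF a(3)] and GN = G[OF a(1)]
    \<comment> \<open>\<open>sum\<close> and \<open>inj\<close> concern modules on
      \<open>nat \<Rightarrow> 'a\<close>, so the direct sum of \<open>G P\<close> and
      \<open>G Q\<close> is replaced by the copy \<open>B\<close> before \<open>F\<close> is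
      applied.\<close>
    obtain B :: "('a, nat \<Rightarrow> 'a) module" where B: "B \<in> fg_projective_modules S"
      "module_isomorphic S B (direct_sum_module (G P) (G Q))"
      using fin_proj_copy[OF fin_proj_direct_sum[OF GP(1) GQ(1)]] by blast
    have B': "fin_proj S B" using B(1) by (simp add: fg_projective_modules_iff)
    have "module_isomorphic S' (F B) (direct_sum_module P Q)"
      by (rule module_isomorphic_trans[OF sum[OF B' GP(1) GQ(1) B(2)] module_isomorphic_direct_sum[OF GP(2) GQ(2)]])
    moreover have "module_isomorphic S' (F (G N)) (direct_sum_module P Q)"
      by (rule module_isomorphic_trans[OF GN(2) a(4)])
    ultimately have "module_isomorphic S' (F (G N)) (F B)"
      using module_isomorphic_sym[OF modF[OF B']] module_isomorphic_trans by blast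
    then have "k0_class S (G N) = k0_class S B" by (rule inj[OF GN(1) B'])
    also have "\<dots> = k0_class S (direct_sum_module (G P) (G Q))" by (rule k0_class_cong[OF B' B(2)])
    also have "\<dots> = k0_class S (G P) \<otimes>\<^bsub>K0 S\<^esub> k0_class S (G Q)" by (rule k0_class_sum[OF GP(1) GQ(1)])
    finally show "k0_class S (G N) = k0_class S (G P) \<otimes>\<^bsub>K0 S\<^esub> k0_class S (G Q)" .
  qed (simp add: G k0_class_closed)
  then obtain \<Psi> where \<Psi>: "\<Psi> \<in> hom (K0 S') (K0 S)"
    and \<Psi>_gen: "\<And>M. M \<in> fg_projective_modules S' \<Longrightarrow> \<Psi> (k0_generator S' M) = k0_class S (G M)" by blast
  have idh: "id \<in> hom (K0 T) (K0 T)" for T :: "('t, 'r) ring_scheme" by (simp add: hom_def)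
  have "\<Psi> (\<Phi> x) = x" if "x \<in> carrier (K0 S)" for x
  proof -
    have "(\<Psi> \<circ> \<Phi>) x = id x"
    proof (rule K0_hom_eqI[OF _ hom_compose[OF \<Phi> \<Psi>] idh _ that])
      show "group (K0 S)" using comm_group_K0 by (rule comm_group.axioms)
      fix P assume P: "P \<in> fg_projective_modules S"
      then have P': "fin_proj S P" by (simp add: fg_projective_modules_iff)
      obtain M :: "('b, nat \<Rightarrow> 'b) module" where M: "M \<in> fg_projective_modules S'"
        "module_isomorphic S' M (F P)" using fin_proj_copy[OF F[OF P']] by blast
      have "\<Psi> (\<Phi> (k0_generator S P)) = k0_class S (G M)"
        using \<Phi>_gen[OF P] k0_class_eq[OF M] \<Psi>_gen[OF M(1)] by simp
      also have "\<dots> = k0_class S P"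
        by (rule inj[OF G(1)[OF M(1)] P' module_isomorphic_trans[OF G(2)[OF M(1)] M(2)]])
      finally show "(\<Psi> \<circ> \<Phi>) (k0_generator S P) = id (k0_generator S P)"
        by (simp add: k0_class_generator[OF P])
    qed
    then show ?thesis by simp
  qed
  moreover have "\<Phi> (\<Psi> y) = y" if "y \<in> carrier (K0 S')" for y
  proof -
    have "(\<Phi> \<circ> \<Psi>) y = id y"
    proof (rule K0_hom_eqI[OF _ hom_compose[OF \<Psi> \<Phi>] idh _ that])
      show "group (K0 S')" using comm_group_K0 by (rule comm_group.axioms)
      fix M assume M: "M \<in> fg_projective_modules S'"
      have GM: "G M \<in> fg_projective_modules S" using G(1)[OF M] by (simp add: fg_projective_modules_iff)
      have "\<Phi> (\<Psi> (k0_generator S' M)) = k0_class S' (F (G M))"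
        using \<Psi>_gen[OF M] \<Phi>_gen[OF GM] k0_class_generator[OF GM] by simp
      also have "\<dots> = k0_class S' M"
        by (rule k0_class_cong[OF F[OF G(1)[OF M]] G(2)[OF M]])
      finally show "(\<Phi> \<circ> \<Psi>) (k0_generator S' M) = id (k0_generator S' M)"
        by (simp add: k0_class_generator[OF M])
    qed
    then show ?thesis by simp
  qed
  ultimately have "group_isomorphisms (K0 S') (K0 S) \<Psi> \<Phi>"
    using \<Phi> \<Psi> by (simp add: group_isomorphisms_def)
  then show ?thesis unfolding is_iso_def using group_isomorphisms_imp_iso by blast
qed

section \<open>Skew Laurent series over a module\<close>

text \<open>The formula comes from \<open>(p x\<^sup>i) (b x\<^sup>j) = p \<sigma>\<^sup>i(b)
  x\<^sup>i\<^sup>+\<^sup>j\<close>. For \<open>P = D\<close> it is the multiplication of the skew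
  Laurent series ring, so the associativity and distributivity laws of the ring and of its modules
  come from the same lemmas.\<close>

definition laurent_action ::
    "('a, 'm) ring_scheme \<Rightarrow> ('a \<Rightarrow> 'a) \<Rightarrow> ('a, 'b) module \<Rightarrow> (int \<Rightarrow> 'b) \<Rightarrow> (int \<Rightarrow> 'a) \<Rightarrow> int \<Rightarrow> 'b" where
  "laurent_action D \<sigma> P f g n =
     (\<Oplus>\<^bsub>P\<^esub>i\<in>{i. f i \<noteq> \<zero>\<^bsub>P\<^esub> \<and> g (n - i) \<noteq> \<zero>\<^bsub>D\<^esub>}. automorphism_power D \<sigma> i (g (n - i)) \<odot>\<^bsub>P\<^esub> f i)"

definition laurent_module ::
    "('a, 'm) ring_scheme \<Rightarrow> ('a \<Rightarrow> 'a) \<Rightarrow> ('a, 'b) module \<Rightarrow> (int \<Rightarrow> 'a, int \<Rightarrow> 'b) module" where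
  "laurent_module D \<sigma> P =
     \<lparr>carrier = {f. range f \<subseteq> carrier P \<and> (\<exists>k. \<forall>i<k. f i = \<zero>\<^bsub>P\<^esub>)},
      monoid.mult = (\<lambda>_ _. undefined), one = undefined,
      ring.zero = (\<lambda>_. \<zero>\<^bsub>P\<^esub>),
      ring.add = (\<lambda>f g i. f i \<oplus>\<^bsub>P\<^esub> g i),
      smult = (\<lambda>g f. laurent_action D \<sigma> P f g)\<rparr>"

text \<open>Membership of the coefficients is included, so that the existence of a bound
  \<open>k\<close> is exactly membership in the Laurent module or ring. Most computations carry the
  bound along explicitly.\<close>

definition vanishes_below :: "('b, 'm) ring_scheme \<Rightarrow> int \<Rightarrow> (int \<Rightarrow> 'b) \<Rightarrow> bool" where
  "vanishes_below P k f \<longleftrightarrow> (\<forall>i. f i \<in> carrier P) \<and> (\<forall>i<k. f i = \<zero>\<^bsub>P\<^esub>)"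

definition monomial :: "('b, 'm) ring_scheme \<Rightarrow> 'b \<Rightarrow> int \<Rightarrow> int \<Rightarrow> 'b" where
  "monomial P a m = (\<lambda>i. if i = m then a else \<zero>\<^bsub>P\<^esub>)"

lemma laurent_module_simps [simp]:
  "f \<in> carrier (laurent_module D \<sigma> P) \<longleftrightarrow> (\<exists>k. vanishes_below P k f)"
  "\<zero>\<^bsub>laurent_module D \<sigma> P\<^esub> = (\<lambda>_. \<zero>\<^bsub>P\<^esub>)"
  "f \<oplus>\<^bsub>laurent_module D \<sigma> P\<^esub> h = (\<lambda>i. f i \<oplus>\<^bsub>P\<^esub> h i)"
  "g \<odot>\<^bsub>laurent_module D \<sigma> P\<^esub> f = laurent_action D \<sigma> P f g"
  by (auto simp: laurent_module_def vanishes_below_def)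

lemma skew_laurent_ring_simps [simp]:
  "f \<in> carrier (skew_laurent_ring D \<sigma>) \<longleftrightarrow> (\<exists>k. vanishes_below D k f)"
  "\<zero>\<^bsub>skew_laurent_ring D \<sigma>\<^esub> = (\<lambda>_. \<zero>\<^bsub>D\<^esub>)"
  "f \<oplus>\<^bsub>skew_laurent_ring D \<sigma>\<^esub> h = (\<lambda>i. f i \<oplus>\<^bsub>D\<^esub> h i)"
  "\<one>\<^bsub>skew_laurent_ring D \<sigma>\<^esub> = monomial D \<one>\<^bsub>D\<^esub> 0"
  "f \<otimes>\<^bsub>skew_laurent_ring D \<sigma>\<^esub> g = laurent_action D \<sigma> (regular_module D) f g"
  by (auto simp: skew_laurent_ring_def vanishes_below_def monomial_def laurent_action_def finsum_regular
      intro!: ext)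

lemma vanishes_below_closed: "vanishes_below P k f \<Longrightarrow> f i \<in> carrier P"
  by (simp add: vanishes_below_def)

lemma vanishes_below_zero: "vanishes_below P k f \<Longrightarrow> i < k \<Longrightarrow> f i = \<zero>\<^bsub>P\<^esub>"
  by (simp add: vanishes_below_def)

lemma vanishes_below_mono: "vanishes_below P k f \<Longrightarrow> l \<le> k \<Longrightarrow> vanishes_below P l f"
  by (simp add: vanishes_below_def)

lemma vanishes_below_regular [simp]: "vanishes_below (regular_module D) k f = vanishes_below D k f"
  by (simp add: vanishes_below_def)

lemma monomial_regular [simp]: "monomial (regular_module D) = monomial D"
  by (simp add: monomial_def fun_eq_iff)

lemma vanishes_below_add:
  "abelian_monoid P \<Longrightarrow> vanishes_below P k f \<Longrightarrow> vanishes_below P l g \<Longrightarrow>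
     vanishes_below P (min k l) (\<lambda>i. f i \<oplus>\<^bsub>P\<^esub> g i)"
  by (simp add: vanishes_below_def abelian_monoid.a_closed abelian_monoid.l_zero abelian_monoid.zero_closed)

lemma vanishes_below_monomial:
  "abelian_monoid P \<Longrightarrow> a \<in> carrier P \<Longrightarrow> k \<le> m \<Longrightarrow> vanishes_below P k (monomial P a m)"
  by (simp add: vanishes_below_def monomial_def abelian_monoid.zero_closed)

lemma leading_index:
  assumes "vanishes_below P k f" "f \<noteq> (\<lambda>_. \<zero>\<^bsub>P\<^esub>)"
  shows "\<exists>m\<ge>k. vanishes_below P m f \<and> f m \<noteq> \<zero>\<^bsub>P\<^esub>"
proof -
  define n where "n = (LEAST n. f (k + int n) \<noteq> \<zero>\<^bsub>P\<^esub>)"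
  obtain i where i: "f i \<noteq> \<zero>\<^bsub>P\<^esub>" using assms(2) by auto
  then have "k \<le> i" using assms(1) by (metis not_le vanishes_below_zero)
  then have "f (k + int (nat (i - k))) \<noteq> \<zero>\<^bsub>P\<^esub>" using i by simp
  then have n: "f (k + int n) \<noteq> \<zero>\<^bsub>P\<^esub>" unfolding n_def by (rule LeastI)
  have "f j = \<zero>\<^bsub>P\<^esub>" if "j < k + int n" for j
  proof (cases "j < k")
    case False
    then have "j = k + int (nat (j - k))" "nat (j - k) < n" using that by auto
    then show ?thesis using not_less_Least[of "nat (j - k)" "\<lambda>n. f (k + int n) \<noteq> \<zero>\<^bsub>P\<^esub>"]
      unfolding n_def by metis
  qed (use assms(1) in \<open>auto simp: vanishes_below_def\<close>)
  then show ?thesis using n assms(1) by (intro exI[of _ "k + int n"]) (auto simp: vanishes_below_def)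
qed

locale skew_laurent = "domain" D for D (structure) +
  fixes \<sigma> :: "'a \<Rightarrow> 'a"
  assumes aut: "\<sigma> \<in> ring_iso D D"
begin

abbreviation "R \<equiv> skew_laurent_ring D \<sigma>"
abbreviation "s \<equiv> automorphism_power D \<sigma>"
abbreviation "act \<equiv> laurent_action D \<sigma>"
abbreviation "LM \<equiv> laurent_module D \<sigma>"

section \<open>Powers of the automorphism\<close>

lemma sigma_bij: "bij_betw \<sigma> (carrier D) (carrier D)" and sigma_hom: "\<sigma> \<in> ring_hom D D"
  using aut by (auto simp: ring_iso_def)

lemma sigma_inv_hom: "inv_into (carrier D) \<sigma> \<in> ring_hom D D"
  using ring_iso_set_sym[OF ring_axioms aut] by (simp add: ring_iso_def)

lemma funpow_ring_hom: "f \<in> ring_hom D D \<Longrightarrow> f ^^ n \<in> ring_hom D D"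
proof (induction n)
  case 0
  have "id \<in> ring_hom D D" by (rule ring_hom_memI) auto
  then show ?case by (simp add: id_def)
next
  case (Suc n)
  then show ?case using ring_hom_trans[of "f ^^ n" D D f D] by (simp add: comp_def)
qed

lemma s_hom: "s i \<in> ring_hom D D"
  unfolding automorphism_power_def using funpow_ring_hom sigma_hom sigma_inv_hom by auto

lemma s_closed [simp]: "a \<in> carrier D \<Longrightarrow> s i a \<in> carrier D"
  and s_add: "a \<in> carrier D \<Longrightarrow> b \<in> carrier D \<Longrightarrow> s i (a \<oplus> b) = s i a \<oplus> s i b"
  and s_mult: "a \<in> carrier D \<Longrightarrow> b \<in> carrier D \<Longrightarrow> s i (a \<otimes> b) = s i a \<otimes> s i b"
  and s_one [simp]: "s i \<one> = \<one>"
  using s_hom[of i] by (auto simp: ring_hom_def)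

lemma s_zero [simp]: "s i \<zero> = \<zero>"
  using additive_zero[of D D "s i"] s_add by (simp add: is_abelian_group)

lemma s_finsum: "f \<in> A \<rightarrow> carrier D \<Longrightarrow> s i (finsum D f A) = (\<Oplus>j\<in>A. s i (f j))"
  using additive_finsum[of D D "s i" f A] s_add by (simp add: is_abelian_group)

lemma s_0 [simp]: "s 0 a = a" and s_1: "s 1 a = \<sigma> a"
  by (simp_all add: automorphism_power_def)

text \<open>Negative powers are iterates of the inverse map. For \<open>i = - (n + 1)\<close> the
  extra application of \<open>\<sigma>\<close> cancels the outermost inverse.\<close>

lemma s_succ: "a \<in> carrier D \<Longrightarrow> s (i + 1) a = \<sigma> (s i a)"
proof (cases "0 \<le> i")
  case True
  then have "nat (i + 1) = Suc (nat i)" by simp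
  then show ?thesis using True by (simp add: automorphism_power_def)
next
  case False
  define n where "n = nat (- i - 1)"
  have i: "i = - int (Suc n)" using False by (simp add: n_def)
  assume a: "a \<in> carrier D"
  let ?t = "inv_into (carrier D) \<sigma>"
  have "(?t ^^ n) a \<in> carrier D"
    using a funpow_ring_hom[OF sigma_inv_hom, of n] by (auto simp: ring_hom_def)
  then have "(?t ^^ n) a = \<sigma> (?t ((?t ^^ n) a))"
    using sigma_bij by (simp add: bij_betw_def f_inv_into_f)
  moreover have "s i a = ?t ((?t ^^ n) a)" by (simp add: automorphism_power_def i nat_add_distrib)
  moreover have "s (i + 1) a = (?t ^^ n) a" by (cases n) (simp_all add: automorphism_power_def i nat_add_distrib)
  ultimately show ?thesis by simp
qed

lemma s_s: "a \<in> carrier D \<Longrightarrow> s i (s j a) = s (i + j) a"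
proof (induction i rule: int_induct[where k = 0])
  case (step1 i)
  then show ?case using s_succ[of "s j a" i] s_succ[of a "i + j"] by (simp add: algebra_simps)
next
  case (step2 i)
  have "\<sigma> (s (i - 1) (s j a)) = s i (s j a)" using s_succ[of "s j a" "i - 1"] step2 by simp
  also have "\<dots> = \<sigma> (s (i - 1 + j) a)" using s_succ[of a "i - 1 + j"] step2 by simp
  finally show ?case using sigma_bij step2 by (auto simp: bij_betw_def inj_on_def)
qed simp

lemma s_eq_zero [simp]: "a \<in> carrier D \<Longrightarrow> s i a = \<zero> \<longleftrightarrow> a = \<zero>"
  using s_s[of a "- i" i] by (metis add.left_inverse s_0 s_zero)

section \<open>Laws of the action of series on series\<close>

lemma act_eq_finsum:
  assumes "right_module D P" "\<And>i. f i \<in> carrier P" "\<And>i. g i \<in> carrier D" "finite A"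
    and "\<And>i. f i \<noteq> \<zero>\<^bsub>P\<^esub> \<Longrightarrow> g (n - i) \<noteq> \<zero> \<Longrightarrow> i \<in> A"
  shows "act P f g n = (\<Oplus>\<^bsub>P\<^esub>i\<in>A. s i (g (n - i)) \<odot>\<^bsub>P\<^esub> f i)"
proof -
  interpret P: right_module D P by fact
  show ?thesis unfolding laurent_action_def
    by (rule P.M.finsum_superset) (use assms in \<open>auto simp: P.smult_closed\<close>)
qed

text \<open>The index set in the definition depends on both series. The free bounds \<open>a\<close>
  and \<open>b\<close> allow several products to be summed over one common interval, where sums can
  be added and exchanged.\<close>

lemma act_window:
  assumes "right_module D P" "vanishes_below P k f" "vanishes_below D l g" "a \<le> k" "n - l \<le> b"
  shows "act P f g n = (\<Oplus>\<^bsub>P\<^esub>i\<in>{a..b}. s i (g (n - i)) \<odot>\<^bsub>P\<^esub> f i)"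
proof (rule act_eq_finsum[OF assms(1)])
  fix i assume "f i \<noteq> \<zero>\<^bsub>P\<^esub>" "g (n - i) \<noteq> \<zero>"
  then have "k \<le> i" "l \<le> n - i" using assms(2,3) by (metis not_le vanishes_below_zero)+
  then show "i \<in> {a..b}" using assms(4,5) by auto
qed (use assms vanishes_below_closed in auto)

lemma act_closed:
  assumes "right_module D P" "vanishes_below P k f" "vanishes_below D l g"
  shows "vanishes_below P (k + l) (act P f g)"
proof -
  interpret P: right_module D P by fact
  note c = vanishes_below_closed[OF assms(2)] vanishes_below_closed[OF assms(3)]
  show ?thesis unfolding vanishes_below_def
  proof (intro conjI allI impI)
    fix n
    show "act P f g n \<in> carrier P"
      unfolding act_window[OF assms order_refl order_refl]
      using c by (intro P.M.finsum_closed) (auto simp: P.smult_closed)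
    assume "n < k + l"
    then have "{k..n - l} = {}" by auto
    then show "act P f g n = \<zero>\<^bsub>P\<^esub>"
      unfolding act_window[OF assms order_refl order_refl] by simp
  qed
qed

text \<open>At exponent \<open>k + l\<close> only the two lowest terms meet. Zero divisors, inverses
  and the lowest coefficients of right ideals are all handled through this formula.\<close>

lemma act_leading:
  assumes "right_module D P" "vanishes_below P k f" "vanishes_below D l g"
  shows "act P f g (k + l) = s k (g l) \<odot>\<^bsub>P\<^esub> f k"
proof -
  interpret P: right_module D P by fact
  note c = vanishes_below_closed[OF assms(2)] vanishes_below_closed[OF assms(3)]
  have "act P f g (k + l) = (\<Oplus>\<^bsub>P\<^esub>i\<in>{k..k}. s i (g (k + l - i)) \<odot>\<^bsub>P\<^esub> f i)"
    by (rule act_window[OF assms]) auto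
  then show ?thesis using c by (simp add: P.smult_closed)
qed

lemma act_add_left:
  assumes "right_module D P" "vanishes_below P k f" "vanishes_below P k' f'" "vanishes_below D l g"
  shows "act P (\<lambda>i. f i \<oplus>\<^bsub>P\<^esub> f' i) g = (\<lambda>n. act P f g n \<oplus>\<^bsub>P\<^esub> act P f' g n)"
proof
  fix n
  interpret P: right_module D P by fact
  note c = vanishes_below_closed[OF assms(2)] vanishes_below_closed[OF assms(3)] vanishes_below_closed[OF assms(4)]
  let ?W = "{min k k'..n - l}"
  have 1: "act P f g n = (\<Oplus>\<^bsub>P\<^esub>i\<in>?W. s i (g (n - i)) \<odot>\<^bsub>P\<^esub> f i)"
    by (rule act_window[OF assms(1,2,4)]) auto
  have 2: "act P f' g n = (\<Oplus>\<^bsub>P\<^esub>i\<in>?W. s i (g (n - i)) \<odot>\<^bsub>P\<^esub> f' i)"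
    by (rule act_window[OF assms(1,3,4)]) auto
  have "act P (\<lambda>i. f i \<oplus>\<^bsub>P\<^esub> f' i) g n = (\<Oplus>\<^bsub>P\<^esub>i\<in>?W. s i (g (n - i)) \<odot>\<^bsub>P\<^esub> (f i \<oplus>\<^bsub>P\<^esub> f' i))"
    by (rule act_window[OF assms(1) vanishes_below_add[OF P.M.abelian_monoid_axioms assms(2,3)] assms(4)]) auto
  also have "\<dots> = (\<Oplus>\<^bsub>P\<^esub>i\<in>?W. s i (g (n - i)) \<odot>\<^bsub>P\<^esub> f i \<oplus>\<^bsub>P\<^esub> s i (g (n - i)) \<odot>\<^bsub>P\<^esub> f' i)"
    using c by (intro P.M.finsum_cong') (auto simp: P.smult_distrib_vector P.smult_closed)
  also have "\<dots> = act P f g n \<oplus>\<^bsub>P\<^esub> act P f' g n"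
    unfolding 1 2 using c by (intro P.M.finsum_addf) (auto simp: P.smult_closed)
  finally show "act P (\<lambda>i. f i \<oplus>\<^bsub>P\<^esub> f' i) g n = act P f g n \<oplus>\<^bsub>P\<^esub> act P f' g n" .
qed

lemma act_add_right:
  assumes "right_module D P" "vanishes_below P k f" "vanishes_below D l g" "vanishes_below D l' g'"
  shows "act P f (\<lambda>i. g i \<oplus> g' i) = (\<lambda>n. act P f g n \<oplus>\<^bsub>P\<^esub> act P f g' n)"
proof
  fix n
  interpret P: right_module D P by fact
  note c = vanishes_below_closed[OF assms(2)] vanishes_below_closed[OF assms(3)] vanishes_below_closed[OF assms(4)]
  let ?W = "{k..n - min l l'}"
  have 1: "act P f g n = (\<Oplus>\<^bsub>P\<^esub>i\<in>?W. s i (g (n - i)) \<odot>\<^bsub>P\<^esub> f i)"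
    by (rule act_window[OF assms(1,2,3)]) auto
  have 2: "act P f g' n = (\<Oplus>\<^bsub>P\<^esub>i\<in>?W. s i (g' (n - i)) \<odot>\<^bsub>P\<^esub> f i)"
    by (rule act_window[OF assms(1,2,4)]) auto
  have "act P f (\<lambda>i. g i \<oplus> g' i) n = (\<Oplus>\<^bsub>P\<^esub>i\<in>?W. s i (g (n - i) \<oplus> g' (n - i)) \<odot>\<^bsub>P\<^esub> f i)"
    by (rule act_window[OF assms(1,2) vanishes_below_add[OF abelian_monoid_axioms assms(3,4)]]) auto
  also have "\<dots> = (\<Oplus>\<^bsub>P\<^esub>i\<in>?W. s i (g (n - i)) \<odot>\<^bsub>P\<^esub> f i \<oplus>\<^bsub>P\<^esub> s i (g' (n - i)) \<odot>\<^bsub>P\<^esub> f i)"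
    using c by (intro P.M.finsum_cong') (auto simp: P.smult_distrib_scalar P.smult_closed s_add)
  also have "\<dots> = act P f g n \<oplus>\<^bsub>P\<^esub> act P f g' n"
    unfolding 1 2 using c by (intro P.M.finsum_addf) (auto simp: P.smult_closed)
  finally show "act P f (\<lambda>i. g i \<oplus> g' i) n = act P f g n \<oplus>\<^bsub>P\<^esub> act P f g' n" .
qed

lemma act_assoc:
  assumes "right_module D P" "vanishes_below P k f" "vanishes_below D l g" "vanishes_below D q h"
  shows "act P f (act (regular_module D) g h) = act P (act P f g) h"
proof
  fix n
  interpret P: right_module D P by fact
  note reg = right_module_regular[OF ring_axioms]
  have g': "vanishes_below (regular_module D) l g" using assms(3) by simp
  note c = vanishes_below_closed[OF assms(2)] vanishes_below_closed[OF assms(3)] vanishes_below_closed[OF assms(4)]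
  note fg = act_closed[OF assms(1-3)]
  note gh = act_closed[OF reg g' assms(4), unfolded vanishes_below_regular]
  \<comment> \<open>\<open>?I\<close> holds the exponent \<open>i\<close> of \<open>f\<close>, and
    \<open>?M\<close> the exponent \<open>m = i + j\<close> belonging to the product of
    \<open>f\<close> and \<open>g\<close>. Taking \<open>m\<close> instead of \<open>j\<close> as
    second variable makes the index set a rectangle, so that the sums can be exchanged.\<close>
  let ?I = "{k..n - (l + q)}" let ?M = "{k + l..n - q}"
  let ?t = "\<lambda>i m. (s i (g (m - i)) \<otimes> s m (h (n - m))) \<odot>\<^bsub>P\<^esub> f i"
  have t: "?t i m \<in> carrier P" for i m using c by (simp add: P.smult_closed)
  have "act P f (act (regular_module D) g h) n =
      (\<Oplus>\<^bsub>P\<^esub>i\<in>?I. s i (act (regular_module D) g h (n - i)) \<odot>\<^bsub>P\<^esub> f i)"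
    by (rule act_window[OF assms(1,2) gh]) auto
  also have "\<dots> = (\<Oplus>\<^bsub>P\<^esub>i\<in>?I. \<Oplus>\<^bsub>P\<^esub>m\<in>?M. ?t i m)"
  proof (rule P.M.finsum_cong')
    show "(\<lambda>i. \<Oplus>\<^bsub>P\<^esub>m\<in>?M. ?t i m) \<in> ?I \<rightarrow> carrier P" using t by (intro Pi_I P.M.finsum_closed) auto
    fix i assume i: "i \<in> ?I"
    let ?J = "{k + l - i..n - q - i}"
    have "act (regular_module D) g h (n - i) = (\<Oplus>j\<in>?J. g j \<otimes> s j (h (n - i - j)))"
      using act_window[OF reg g' assms(4), of "k + l - i" "n - i" "n - q - i"] i
      by (simp add: finsum_regular)
    also have "s i \<dots> = (\<Oplus>j\<in>?J. s i (g j) \<otimes> s (i + j) (h (n - i - j)))"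
      using c by (subst s_finsum) (auto simp: s_mult s_s intro!: finsum_cong')
    also have "\<dots> \<odot>\<^bsub>P\<^esub> f i = (\<Oplus>\<^bsub>P\<^esub>j\<in>?J. (s i (g j) \<otimes> s (i + j) (h (n - i - j))) \<odot>\<^bsub>P\<^esub> f i)"
      using c by (intro P.smult_finsum_scalar) auto
    also have "\<dots> = (\<Oplus>\<^bsub>P\<^esub>j\<in>?J. ?t i (i + j))"
      using c by (intro P.M.finsum_cong') (auto simp: P.smult_closed algebra_simps)
    also have "\<dots> = (\<Oplus>\<^bsub>P\<^esub>m\<in>(\<lambda>j. i + j) ` ?J. ?t i m)"
      by (rule P.M.finsum_reindex[symmetric]) (use t in auto)
    also have "(\<lambda>j. i + j) ` ?J = ?M" by (auto intro!: image_eqI[of _ _ "_ - i"])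
    finally show "s i (act (regular_module D) g h (n - i)) \<odot>\<^bsub>P\<^esub> f i = (\<Oplus>\<^bsub>P\<^esub>m\<in>?M. ?t i m)" .
  qed simp
  also have "\<dots> = (\<Oplus>\<^bsub>P\<^esub>m\<in>?M. \<Oplus>\<^bsub>P\<^esub>i\<in>?I. ?t i m)"
    by (rule P.M.finsum_swap) (use t in auto)
  also have "\<dots> = (\<Oplus>\<^bsub>P\<^esub>m\<in>?M. s m (h (n - m)) \<odot>\<^bsub>P\<^esub> act P f g m)"
  proof (rule P.M.finsum_cong')
    show "(\<lambda>m. s m (h (n - m)) \<odot>\<^bsub>P\<^esub> act P f g m) \<in> ?M \<rightarrow> carrier P"
      using c vanishes_below_closed[OF fg] by (auto simp: P.smult_closed)
    fix m assume m: "m \<in> ?M"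
    have "act P f g m = (\<Oplus>\<^bsub>P\<^esub>i\<in>?I. s i (g (m - i)) \<odot>\<^bsub>P\<^esub> f i)"
      by (rule act_window[OF assms(1-3)]) (use m in auto)
    then show "(\<Oplus>\<^bsub>P\<^esub>i\<in>?I. ?t i m) = s m (h (n - m)) \<odot>\<^bsub>P\<^esub> act P f g m"
      using c by (subst P.smult_assoc[symmetric] | simp add: P.smult_finsum_vector P.smult_assoc P.smult_closed)+
  qed simp
  also have "\<dots> = act P (act P f g) h n"
    by (rule act_window[OF assms(1) fg assms(4), symmetric]) auto
  finally show "act P f (act (regular_module D) g h) n = act P (act P f g) h n" .
qed

lemma act_monomial_right:
  assumes "right_module D P" "vanishes_below P k f" "a \<in> carrier D"
  shows "act P f (monomial D a m) n = s (n - m) a \<odot>\<^bsub>P\<^esub> f (n - m)"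
proof -
  interpret P: right_module D P by fact
  have "act P f (monomial D a m) n = (\<Oplus>\<^bsub>P\<^esub>i\<in>{n - m}. s i (monomial D a m (n - i)) \<odot>\<^bsub>P\<^esub> f i)"
    by (rule act_eq_finsum[OF assms(1)])
      (use assms(3) vanishes_below_closed[OF assms(2)] in \<open>auto simp: monomial_def split: if_splits\<close>)
  then show ?thesis using assms(3) vanishes_below_closed[OF assms(2)]
    by (simp add: P.smult_closed monomial_def)
qed

lemma act_monomial_left:
  assumes "right_module D P" "p \<in> carrier P" "vanishes_below D l g"
  shows "act P (monomial P p m) g n = s m (g (n - m)) \<odot>\<^bsub>P\<^esub> p"
proof -
  interpret P: right_module D P by fact
  have "act P (monomial P p m) g n = (\<Oplus>\<^bsub>P\<^esub>i\<in>{m}. s i (g (n - i)) \<odot>\<^bsub>P\<^esub> monomial P p m i)"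
    by (rule act_eq_finsum[OF assms(1)])
      (use assms(2) vanishes_below_closed[OF assms(3)] in \<open>auto simp: monomial_def split: if_splits\<close>)
  then show ?thesis using assms(2) vanishes_below_closed[OF assms(3)]
    by (simp add: P.smult_closed monomial_def)
qed

lemma act_one: "right_module D P \<Longrightarrow> vanishes_below P k f \<Longrightarrow> act P f (monomial D \<one> 0) = f"
  by (rule ext) (simp add: act_monomial_right right_module.smult_one vanishes_below_closed)

section \<open>The ring \<open>R\<close> and the modules \<open>P((x))\<close>\<close>

lemma laurent_abelian_group:
  assumes "right_module D P" shows "abelian_group (LM P)"
proof -
  interpret P: right_module D P by fact
  show ?thesis
  proof (rule abelian_groupI, goal_cases)
    case (1 f g) then show ?case using vanishes_below_add[OF P.M.abelian_monoid_axioms] by (simp, blast)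
  next
    case 2 then show ?case by (auto simp: vanishes_below_def)
  next
    case (6 f)
    then obtain k where "vanishes_below P k f" by auto
    then have "vanishes_below P k (\<lambda>i. \<ominus>\<^bsub>P\<^esub> f i)" "(\<lambda>i. \<ominus>\<^bsub>P\<^esub> f i \<oplus>\<^bsub>P\<^esub> f i) = (\<lambda>_. \<zero>\<^bsub>P\<^esub>)"
      by (auto simp: vanishes_below_def P.M.l_neg)
    then show ?case by (intro bexI[of _ "\<lambda>i. \<ominus>\<^bsub>P\<^esub> f i"]) auto
  qed (auto simp: vanishes_below_def P.M.a_ac)
qed

lemma ring_R: "ring R"
proof -
  note reg = right_module_regular[OF ring_axioms]
  have ab: "abelian_group R"
  proof -
    note L = abelian_groupE[OF laurent_abelian_group[OF reg]]
    show ?thesis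
    proof (rule abelian_groupI, goal_cases)
      case (1 f g) then show ?case using L(1)[of f g] by simp
    next
      case 2 show ?case using L(2) by simp
    next
      case (3 f g h) then show ?case using L(3)[of f g h] by simp
    next
      case (4 f g) then show ?case using L(4)[of f g] by simp
    next
      case (5 f) then show ?case using L(5)[of f] by simp
    next
      case (6 f) then show ?case using L(6)[of f] by (simp add: Bex_def)
    qed
  qed
  have one: "vanishes_below D 0 (monomial D \<one> 0)" by (rule vanishes_below_monomial) (auto simp: abelian_monoid_axioms)
  show ?thesis
  proof (rule ringI[OF ab])
    show "monoid R"
    proof (rule monoidI, goal_cases)
      case (1 f g)
      then show ?case using act_closed[OF reg] by fastforce
    next
      case 2 then show ?case using one by auto
    next
      case (3 f g h)
      then show ?case using act_assoc[OF reg] by auto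
    next
      case (4 f)
      then obtain k where k: "vanishes_below D k f" by auto
      then show ?case
        using act_monomial_left[OF reg _ k, of \<one> 0] vanishes_below_closed[OF k]
        by (auto simp: monomial_regular)
    next
      case (5 f) then show ?case using act_one[OF reg] by auto
    qed
  next
    fix f g h assume "f \<in> carrier R" "g \<in> carrier R" "h \<in> carrier R"
    then show "(f \<oplus>\<^bsub>R\<^esub> g) \<otimes>\<^bsub>R\<^esub> h = f \<otimes>\<^bsub>R\<^esub> h \<oplus>\<^bsub>R\<^esub> g \<otimes>\<^bsub>R\<^esub> h"
      "h \<otimes>\<^bsub>R\<^esub> (f \<oplus>\<^bsub>R\<^esub> g) = h \<otimes>\<^bsub>R\<^esub> f \<oplus>\<^bsub>R\<^esub> h \<otimes>\<^bsub>R\<^esub> g"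
      using act_add_left[OF reg] act_add_right[OF reg] by auto
  qed
qed

lemma right_module_laurent:
  assumes "right_module D P" shows "right_module R (LM P)"
proof -
  interpret P: right_module D P by fact
  show ?thesis
  proof (rule right_moduleI[OF ring_R laurent_abelian_group[OF assms]], goal_cases)
    case (1 g f) then show ?case using act_closed[OF assms] by fastforce
  next
    case (2 g h f) then show ?case using act_add_right[OF assms] by auto
  next
    case (3 g f h) then show ?case using act_add_left[OF assms] by auto
  next
    case (4 g h f) then show ?case using act_assoc[OF assms] by auto
  next
    case (5 f) then show ?case using act_one[OF assms] by auto
  qed
qed

section \<open>Functoriality of \<open>P((x))\<close>\<close>

lemma vanishes_below_map:
  assumes "right_module D P" "right_module D P'" "right_linear D P P' h" "vanishes_below P k f"
  shows "vanishes_below P' k (\<lambda>i. h (f i))"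
  using assms(4) right_linearD(1)[OF assms(3)] right_linear_zero[OF assms(1-3)]
  by (simp add: vanishes_below_def)

lemma laurent_map_linear:
  assumes "right_module D P" "right_module D P'" "right_linear D P P' h"
  shows "right_linear R (LM P) (LM P') (\<lambda>f i. h (f i))"
proof (rule right_linearI)
  interpret P: right_module D P by fact
  note l = right_linearD[OF assms(3)]
  fix g f assume "g \<in> carrier R" "f \<in> carrier (LM P)"
  then obtain k l where k: "vanishes_below P k f" and l': "vanishes_below D l g" by auto
  note c = vanishes_below_closed[OF k] vanishes_below_closed[OF l']
  have "h (act P f g n) = act P' (\<lambda>i. h (f i)) g n" for n
  proof -
    have "h (act P f g n) = (\<Oplus>\<^bsub>P'\<^esub>i\<in>{k..n - l}. h (s i (g (n - i)) \<odot>\<^bsub>P\<^esub> f i))"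
      unfolding act_window[OF assms(1) k l' order_refl order_refl]
      by (rule right_linear_finsum[OF assms]) (use c in \<open>auto simp: P.smult_closed\<close>)
    also have "\<dots> = act P' (\<lambda>i. h (f i)) g n"
      unfolding act_window[OF assms(2) vanishes_below_map[OF assms k] l' order_refl order_refl]
      using c l by (simp)
    finally show ?thesis .
  qed
  then show "(\<lambda>i. h ((g \<odot>\<^bsub>LM P\<^esub> f) i)) = g \<odot>\<^bsub>LM P'\<^esub> (\<lambda>i. h (f i))" by auto
next
  fix f f' assume "f \<in> carrier (LM P)" "f' \<in> carrier (LM P)"
  then have "f i \<in> carrier P" "f' i \<in> carrier P" for i by (auto intro: vanishes_below_closed)
  then show "(\<lambda>i. h ((f \<oplus>\<^bsub>LM P\<^esub> f') i)) = (\<lambda>i. h (f i)) \<oplus>\<^bsub>LM P'\<^esub> (\<lambda>i. h (f' i))"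
    by (simp add: right_linearD(2)[OF assms(3)])
qed (use vanishes_below_map[OF assms] in auto)

lemma laurent_finsum_apply:
  assumes "right_module D P" "F \<in> A \<rightarrow> carrier (LM P)"
  shows "finsum (LM P) F A n = (\<Oplus>\<^bsub>P\<^esub>i\<in>A. F i n)"
proof -
  have "(\<lambda>f. f n) \<in> carrier (LM P) \<rightarrow> carrier P" by (auto intro: vanishes_below_closed)
  from additive_finsum[OF laurent_abelian_group[OF assms(1)] right_moduleD(2)[OF assms(1)] this _ assms(2)]
  show ?thesis by simp
qed

lemma laurent_isomorphic:
  assumes "right_module D P" "right_module D P'" "module_isomorphic D P P'"
  shows "module_isomorphic R (LM P) (LM P')"
proof -
  obtain h where h: "bij_betw h (carrier P) (carrier P')" "right_linear D P P' h"
    using assms(3) by (auto simp: module_isomorphic_iff)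
  let ?g = "inv_into (carrier P) h"
  note g = right_linear_inv[OF assms(1) h]
  have "bij_betw (\<lambda>f i. h (f i)) (carrier (LM P)) (carrier (LM P'))"
  proof (rule bij_betw_byWitness[where f' = "\<lambda>f i. ?g (f i)"])
    show "\<forall>f\<in>carrier (LM P). (\<lambda>i. ?g (h (f i))) = f"
      using h(1) vanishes_below_closed by (fastforce simp: bij_betw_def inv_into_f_f)
    show "\<forall>f\<in>carrier (LM P'). (\<lambda>i. h (?g (f i))) = f"
      using h(1) vanishes_below_closed by (fastforce simp: bij_betw_def f_inv_into_f)
    show "(\<lambda>f i. h (f i)) ` carrier (LM P) \<subseteq> carrier (LM P')"
      using vanishes_below_map[OF assms(1,2) h(2)] by fastforce
    show "(\<lambda>f i. ?g (f i)) ` carrier (LM P') \<subseteq> carrier (LM P)"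
      using vanishes_below_map[OF assms(2,1) g] by fastforce
  qed
  then show ?thesis using laurent_map_linear[OF assms(1,2) h(2)] by (auto simp: module_isomorphic_iff)
qed

lemma laurent_direct_sum:
  assumes "right_module D P" "right_module D Q"
  shows "module_isomorphic R (LM (direct_sum_module P Q)) (direct_sum_module (LM P) (LM Q))"
proof -
  let ?PQ = "direct_sum_module P Q"
  note PQ = right_module_direct_sum[OF assms]
  have f: "right_linear D ?PQ P fst" "right_linear D ?PQ Q snd" by (auto simp: right_linear_def)
  note f1 = laurent_map_linear[OF PQ assms(1) f(1)] and f2 = laurent_map_linear[OF PQ assms(2) f(2)]
  have "right_linear R (LM ?PQ) (direct_sum_module (LM P) (LM Q)) (\<lambda>f. (\<lambda>i. fst (f i), \<lambda>i. snd (f i)))"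
    using right_linearD[OF f1] right_linearD[OF f2] by (intro right_linearI) (auto simp del: laurent_module_simps)
  moreover have "bij_betw (\<lambda>f. (\<lambda>i. fst (f i), \<lambda>i. snd (f i))) (carrier (LM ?PQ))
      (carrier (direct_sum_module (LM P) (LM Q)))"
  proof (rule bij_betw_byWitness[where f' = "\<lambda>(p, q) i. (p i, q i)"])
    show "(\<lambda>f. (\<lambda>i. fst (f i), \<lambda>i. snd (f i))) ` carrier (LM ?PQ) \<subseteq> carrier (direct_sum_module (LM P) (LM Q))"
      using right_linearD(1)[OF f1] right_linearD(1)[OF f2] by (auto simp del: laurent_module_simps)
    show "(\<lambda>(p, q) i. (p i, q i)) ` carrier (direct_sum_module (LM P) (LM Q)) \<subseteq> carrier (LM ?PQ)"
    proof clarsimp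
      fix p q k l assume "vanishes_below P k p" "vanishes_below Q l q"
      then have "vanishes_below ?PQ (min k l) (\<lambda>i. (p i, q i))" by (auto simp: vanishes_below_def)
      then show "\<exists>m. vanishes_below ?PQ m (\<lambda>i. (p i, q i))" by blast
    qed
  qed auto
  ultimately show ?thesis unfolding module_isomorphic_iff by blast
qed

text \<open>The constant series on the \<open>p i\<close>, with the functionals applied
  coefficientwise, form a dual basis. A constant stands at exponent 0, so acting on it involves no
  power of \<open>\<sigma>\<close> and the expansion can be checked in each coefficient
  separately.\<close>

lemma fin_proj_laurent:
  assumes "fin_proj D P" shows "fin_proj R (LM P)"
proof -
  obtain N p \<phi> where b: "dual_basis D P {..<N::nat} p \<phi>" and P: "right_module D P"
    using assms by (auto simp: fin_proj_def)
  interpret P: right_module D P by fact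
  note reg = right_module_regular[OF ring_axioms]
  have p: "p i \<in> carrier P" if "i < N" for i using b that by (auto simp: dual_basis_def)
  have regLM: "right_linear R (LM P) (regular_module R) f"
    if "right_linear R (LM P) (LM (regular_module D)) f" for f
    using that by (simp add: right_linear_def Pi_iff)
  interpret L: right_module R "LM P" by (rule right_module_laurent[OF P])
  have pL: "monomial P (p i) 0 \<in> carrier (LM P)" if "i < N" for i
    using vanishes_below_monomial[OF P.M.abelian_monoid_axioms p[OF that] order_refl] by auto
  have lin: "right_linear R (LM P) (regular_module R) (\<lambda>f n. \<phi> i (f n))" if "i < N" for i
    by (rule regLM[OF laurent_map_linear[OF P reg]]) (use b that in \<open>auto simp: dual_basis_def\<close>)
  have "dual_basis R (LM P) {..<N} (\<lambda>i. monomial P (p i) 0) (\<lambda>i f n. \<phi> i (f n))"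
    unfolding dual_basis_def
  proof (intro conjI ballI)
    fix f assume f: "f \<in> carrier (LM P)"
    then obtain k where k: "vanishes_below P k f" by auto
    have cl: "(\<lambda>i. (\<lambda>n. \<phi> i (f n)) \<odot>\<^bsub>LM P\<^esub> monomial P (p i) 0) \<in> {..<N} \<rightarrow> carrier (LM P)"
      using right_linearD(1)[OF lin f] pL
      by (intro Pi_I L.smult_closed) (simp_all del: laurent_module_simps skew_laurent_ring_simps)
    show "f = (\<Oplus>\<^bsub>LM P\<^esub>i\<in>{..<N}. (\<lambda>n. \<phi> i (f n)) \<odot>\<^bsub>LM P\<^esub> monomial P (p i) 0)"
    proof
      fix n
      have "(\<Oplus>\<^bsub>LM P\<^esub>i\<in>{..<N}. (\<lambda>n. \<phi> i (f n)) \<odot>\<^bsub>LM P\<^esub> monomial P (p i) 0) n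
          = (\<Oplus>\<^bsub>P\<^esub>i\<in>{..<N}. \<phi> i (f n) \<odot>\<^bsub>P\<^esub> p i)"
        unfolding laurent_finsum_apply[OF P cl]
      proof (rule P.M.finsum_cong')
        show "(\<lambda>i. \<phi> i (f n) \<odot>\<^bsub>P\<^esub> p i) \<in> {..<N} \<rightarrow> carrier P"
          using dual_basis_scalar_closed[OF b] vanishes_below_closed[OF k] p by (auto simp: P.smult_closed)
        fix i assume i: "i \<in> {..<N}"
        obtain l where l: "vanishes_below D l (\<lambda>n. \<phi> i (f n))"
          using right_linearD(1)[OF lin f] i by auto
        show "((\<lambda>n. \<phi> i (f n)) \<odot>\<^bsub>LM P\<^esub> monomial P (p i) 0) n = \<phi> i (f n) \<odot>\<^bsub>P\<^esub> p i"
          using act_monomial_left[OF P p[of i] l, of 0 n] i by simp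
      qed simp
      also have "\<dots> = f n" by (rule dual_basis_expand[OF b vanishes_below_closed[OF k]])
      finally show "f n = (\<Oplus>\<^bsub>LM P\<^esub>i\<in>{..<N}. (\<lambda>n. \<phi> i (f n)) \<odot>\<^bsub>LM P\<^esub> monomial P (p i) 0) n" by simp
    qed
  qed (use pL lin in auto)
  then show ?thesis by (rule fin_projI[OF L.right_module_axioms])
qed

lemma noncommutative_domain_R: "noncommutative_domain R"
  unfolding noncommutative_domain_def
proof (intro conjI ballI impI)
  show "ring R" by (rule ring_R)
  have "monomial D \<one> 0 (0::int) \<noteq> \<zero>" by (simp add: monomial_def)
  then show "\<one>\<^bsub>R\<^esub> \<noteq> \<zero>\<^bsub>R\<^esub>" by (auto simp: fun_eq_iff)
next
  fix f g assume fg: "f \<in> carrier R" "g \<in> carrier R" "f \<otimes>\<^bsub>R\<^esub> g = \<zero>\<^bsub>R\<^esub>"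
  note reg = right_module_regular[OF ring_axioms]
  show "f = \<zero>\<^bsub>R\<^esub> \<or> g = \<zero>\<^bsub>R\<^esub>"
  proof (rule ccontr)
    assume "\<not> ?thesis"
    then have "f \<noteq> (\<lambda>_. \<zero>)" "g \<noteq> (\<lambda>_. \<zero>)" by auto
    then obtain k l where k: "vanishes_below D k f" "f k \<noteq> \<zero>" and l: "vanishes_below D l g" "g l \<noteq> \<zero>"
      using fg(1,2) leading_index[of D _ f] leading_index[of D _ g] unfolding skew_laurent_ring_simps by metis
    have "f k \<otimes> s k (g l) = \<zero>"
      using act_leading[OF reg _ l(1), of k f] k(1) fg(3) by (simp add: fun_eq_iff)
    then show False using k l integral[of "f k" "s k (g l)"] vanishes_below_closed[OF k(1), of k]
      vanishes_below_closed[OF l(1), of l] by auto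
  qed
qed

end

section \<open>Extension to the field of fractions\<close>

declare skew_laurent_ring_simps [simp del]

text \<open>\<open>ideal_prod\<close> is generated inductively by products and sums of two elements.
  Concatenating families turns membership into a single indexed sum; for the unit element this
  yields the relation \<open>\<Sum> a i b i = 1\<close>.\<close>

lemma ideal_prod_finsum:
  assumes "ring Q" "A \<subseteq> carrier Q" "B \<subseteq> carrier Q" "z \<in> ideal_prod Q A B"
  shows "\<exists>(n::nat) a b. (\<forall>i<n. a i \<in> A \<and> b i \<in> B) \<and> z = (\<Oplus>\<^bsub>Q\<^esub>i\<in>{..<n}. a i \<otimes>\<^bsub>Q\<^esub> b i)"
  using assms(4)
proof induction
  case (prod i j)
  interpret ring Q by fact
  have "i \<otimes>\<^bsub>Q\<^esub> j \<in> carrier Q" using prod assms by auto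
  then have "i \<otimes>\<^bsub>Q\<^esub> j = (\<Oplus>\<^bsub>Q\<^esub>k\<in>{..<1::nat}. i \<otimes>\<^bsub>Q\<^esub> j)" by (simp add: lessThan_Suc)
  then show ?case using prod by (intro exI[of _ 1] exI[of _ "\<lambda>_. i"] exI[of _ "\<lambda>_. j"]) auto
next
  case (sum s1 s2)
  interpret ring Q by fact
  obtain n a b where 1: "\<forall>i<n::nat. a i \<in> A \<and> b i \<in> B" "s1 = (\<Oplus>\<^bsub>Q\<^esub>i\<in>{..<n}. a i \<otimes>\<^bsub>Q\<^esub> b i)"
    using sum.IH(1) by blast
  obtain m a' b' where 2: "\<forall>i<m::nat. a' i \<in> A \<and> b' i \<in> B" "s2 = (\<Oplus>\<^bsub>Q\<^esub>i\<in>{..<m}. a' i \<otimes>\<^bsub>Q\<^esub> b' i)"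
    using sum.IH(2) by blast
  define c where "c i = (if i < n then a i else a' (i - n))" for i
  define d where "d i = (if i < n then b i else b' (i - n))" for i
  have cl: "a i \<otimes>\<^bsub>Q\<^esub> b i \<in> carrier Q" if "i < n" for i
    using 1(1) that assms(2,3) by (meson m_closed subsetD)
  have cl': "a' i \<otimes>\<^bsub>Q\<^esub> b' i \<in> carrier Q" if "i < m" for i
    using 2(1) that assms(2,3) by (meson m_closed subsetD)
  have cd: "c i \<in> A \<and> d i \<in> B" if "i < n + m" for i
    using 1(1) 2(1) that by (auto simp: c_def d_def)
  have clc: "c i \<otimes>\<^bsub>Q\<^esub> d i \<in> carrier Q" if "i < n + m" for i
    using cd[OF that] assms(2,3) by (meson m_closed subsetD)
  have "{..<n + m} = {..<n} \<union> (\<lambda>i. i + n) ` {..<m}"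
  proof (intro equalityI subsetI)
    fix x assume "x \<in> {..<n + m}"
    then show "x \<in> {..<n} \<union> (\<lambda>i. i + n) ` {..<m}"
      by (cases "x < n") (auto intro!: image_eqI[of _ _ "x - n"])
  qed auto
  then have "(\<Oplus>\<^bsub>Q\<^esub>i\<in>{..<n + m}. c i \<otimes>\<^bsub>Q\<^esub> d i) =
      (\<Oplus>\<^bsub>Q\<^esub>i\<in>{..<n}. c i \<otimes>\<^bsub>Q\<^esub> d i) \<oplus>\<^bsub>Q\<^esub> (\<Oplus>\<^bsub>Q\<^esub>i\<in>(\<lambda>i. i + n) ` {..<m}. c i \<otimes>\<^bsub>Q\<^esub> d i)"
    using clc by (simp, intro finsum_Un_disjoint) auto
  also have "(\<Oplus>\<^bsub>Q\<^esub>i\<in>{..<n}. c i \<otimes>\<^bsub>Q\<^esub> d i) = s1"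
    unfolding 1(2) using cl by (intro finsum_cong') (auto simp: c_def d_def)
  also have "(\<Oplus>\<^bsub>Q\<^esub>i\<in>(\<lambda>i. i + n) ` {..<m}. c i \<otimes>\<^bsub>Q\<^esub> d i) = (\<Oplus>\<^bsub>Q\<^esub>i\<in>{..<m}. c (i + n) \<otimes>\<^bsub>Q\<^esub> d (i + n))"
    using clc by (intro finsum_reindex) auto
  also have "\<dots> = s2"
    unfolding 2(2) using cl' by (intro finsum_cong') (auto simp: c_def d_def)
  finally show ?case using cd by (intro exI[of _ "n + m"] exI[of _ c] exI[of _ d]) auto
qed

context skew_laurent
begin

section \<open>Coefficients of elements of \<open>R\<close>\<close>

lemma R_memI: "vanishes_below D k f \<Longrightarrow> f \<in> carrier R"
  by (auto simp: skew_laurent_ring_simps)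

lemma R_memE: "f \<in> carrier R \<Longrightarrow> \<exists>k. vanishes_below D k f"
  by (auto simp: skew_laurent_ring_simps)

lemma R_coeff_closed: "f \<in> carrier R \<Longrightarrow> f i \<in> carrier D"
  using R_memE vanishes_below_closed by blast

lemma R_mult_vanishes:
  "vanishes_below D k f \<Longrightarrow> vanishes_below D l g \<Longrightarrow> vanishes_below D (k + l) (f \<otimes>\<^bsub>R\<^esub> g)"
  using act_closed[OF right_module_regular[OF ring_axioms]] by (simp add: skew_laurent_ring_simps)

lemma R_mult_leading:
  "vanishes_below D k f \<Longrightarrow> vanishes_below D l g \<Longrightarrow> (f \<otimes>\<^bsub>R\<^esub> g) (k + l) = f k \<otimes> s k (g l)"
  using act_leading[OF right_module_regular[OF ring_axioms]] by (simp add: skew_laurent_ring_simps)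

lemma R_mult_window:
  assumes "vanishes_below D k f" "vanishes_below D l g" "a \<le> k" "n - l \<le> b"
  shows "(f \<otimes>\<^bsub>R\<^esub> g) n = (\<Oplus>i\<in>{a..b}. f i \<otimes> s i (g (n - i)))"
  using act_window[OF right_module_regular[OF ring_axioms], of k f l g] assms
  by (simp add: skew_laurent_ring_simps finsum_regular)

lemma monomial_closed [simp]: "a \<in> carrier D \<Longrightarrow> monomial D a m \<in> carrier R"
  using R_memI vanishes_below_monomial[OF abelian_monoid_axioms] by blast

lemma R_mult_monomial_right:
  "f \<in> carrier R \<Longrightarrow> a \<in> carrier D \<Longrightarrow> (f \<otimes>\<^bsub>R\<^esub> monomial D a m) n = f (n - m) \<otimes> s (n - m) a"
  using act_monomial_right[OF right_module_regular[OF ring_axioms]] R_memE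
  by (fastforce simp: skew_laurent_ring_simps)

lemma R_mult_monomial_left:
  "f \<in> carrier R \<Longrightarrow> a \<in> carrier D \<Longrightarrow> (monomial D a m \<otimes>\<^bsub>R\<^esub> f) n = a \<otimes> s m (f (n - m))"
  using act_monomial_left[OF right_module_regular[OF ring_axioms]] R_memE
  by (fastforce simp: skew_laurent_ring_simps)

lemma R_add_apply: "(f \<oplus>\<^bsub>R\<^esub> g) i = f i \<oplus> g i"
  by (simp add: skew_laurent_ring_simps)

lemma R_zero_apply: "\<zero>\<^bsub>R\<^esub> i = \<zero>"
  by (simp add: skew_laurent_ring_simps)

lemma R_one: "\<one>\<^bsub>R\<^esub> = monomial D \<one> 0"
  by (simp add: skew_laurent_ring_simps)

lemma R_uminus_apply:
  assumes "f \<in> carrier R" shows "(\<ominus>\<^bsub>R\<^esub> f) i = \<ominus> f i"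
proof -
  interpret R: ring R by (rule ring_R)
  have "(\<ominus>\<^bsub>R\<^esub> f) i \<oplus> f i = \<zero>"
    using R.l_neg[OF assms] R_add_apply[of "\<ominus>\<^bsub>R\<^esub> f" f i] by (simp add: R_zero_apply)
  then show ?thesis
    using assms R_coeff_closed R.add.inv_closed minus_equality by (metis minus_minus)
qed

lemma R_minus_apply: "f \<in> carrier R \<Longrightarrow> g \<in> carrier R \<Longrightarrow> (f \<ominus>\<^bsub>R\<^esub> g) i = f i \<ominus> g i"
  by (simp add: a_minus_def R_add_apply R_uminus_apply)

lemma R_finsum_apply:
  assumes "F \<in> A \<rightarrow> carrier R" shows "finsum R F A n = (\<Oplus>i\<in>A. F i n)"
proof -
  interpret R: ring R by (rule ring_R)
  show ?thesis
    by (rule additive_finsum[OF R.abelian_group_axioms abelian_group_axioms _ _ assms])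
       (auto simp: R_add_apply R_coeff_closed)
qed

end

text \<open>If \<open>x y = 1\<close> and \<open>y z = 1\<close>, then associativity gives
  \<open>z = x\<close>, so the right inverse \<open>y\<close> is two-sided.\<close>

lemma (in ring) unitsI_right_inverses:
  assumes "\<And>x. x \<in> carrier R - {\<zero>} \<Longrightarrow> \<exists>y\<in>carrier R. x \<otimes> y = \<one>" "\<one> \<noteq> \<zero>"
  shows "Units R = carrier R - {\<zero>}"
proof
  show "Units R \<subseteq> carrier R - {\<zero>}" using assms(2) by (auto simp: Units_def)
  show "carrier R - {\<zero>} \<subseteq> Units R"
  proof
    fix x assume x: "x \<in> carrier R - {\<zero>}"
    then obtain y where y: "y \<in> carrier R" "x \<otimes> y = \<one>" using assms(1) by blast
    then have "y \<noteq> \<zero>" using x assms(2) by auto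
    then obtain z where z: "z \<in> carrier R" "y \<otimes> z = \<one>" using assms(1) y by blast
    have "z = x \<otimes> (y \<otimes> z)" using x y z m_assoc[of x y z] by simp
    then have "z = x" using x z by simp
    then show "x \<in> Units R" using x y z by (auto simp: Units_def)
  qed
qed

text \<open>Coefficients of the inverse of a series with lowest term \<open>c x\<^sup>k\<close>; stage \<open>n\<close> fixes the
  \<open>n\<close>-th of them.\<close>

primrec (in skew_laurent) inverse_coeffs :: "(int \<Rightarrow> 'a) \<Rightarrow> int \<Rightarrow> nat \<Rightarrow> nat \<Rightarrow> 'a" where
  "inverse_coeffs f k 0 = (\<lambda>_. \<zero>)"
| "inverse_coeffs f k (Suc n) = (inverse_coeffs f k n)
     (n := s (- k) (inv (f k) \<otimes> ((if n = 0 then \<one> else \<zero>) \<ominus>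
        (\<Oplus>i\<in>{1..n}. f (k + int i) \<otimes> s (k + int i) (inverse_coeffs f k n (n - i))))))"

text \<open>In \<open>f g = 1\<close> the equation for the coefficient of \<open>x\<^sup>n\<close>
  consists of \<open>f k \<sigma>\<^sup>k(h n)\<close> and terms in \<open>h 0\<close>, ...,
  \<open>h (n - 1)\<close>. As \<open>f k\<close> is invertible, it determines \<open>h n\<close>
  after untwisting by \<open>s (- k)\<close>.\<close>

lemma (in skew_laurent) division_ring_R:
  assumes "Units D = carrier D - {\<zero>}"
  shows "division_ring R"
proof -
  interpret R: ring R by (rule ring_R)
  have one: "\<one>\<^bsub>R\<^esub> \<noteq> \<zero>\<^bsub>R\<^esub>" using noncommutative_domain_R by (simp add: noncommutative_domain_def)
  have "\<exists>g\<in>carrier R. f \<otimes>\<^bsub>R\<^esub> g = \<one>\<^bsub>R\<^esub>" if f: "f \<in> carrier R - {\<zero>\<^bsub>R\<^esub>}" for f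
  proof -
    have "f \<noteq> (\<lambda>_. \<zero>)" using f by (auto simp: skew_laurent_ring_simps)
    then obtain k where k: "vanishes_below D k f" "f k \<noteq> \<zero>"
      using f R_memE leading_index by blast
    note c = vanishes_below_closed[OF k(1)]
    have u: "f k \<in> Units D" using k c assms by auto
    let ?H = "inverse_coeffs f k"
    define h where "h n = ?H (Suc n) n" for n
    have Hcl: "?H n i \<in> carrier D" for n i
    proof (induction n arbitrary: i)
      case (Suc n)
      then show ?case using u c by (auto intro!: s_closed m_closed minus_closed finsum_closed)
    qed simp
    \<comment> \<open>Stage \<open>Suc n\<close> changes only entry \<open>n\<close>, so every later
      stage agrees there with the diagonal sequence \<open>h\<close>.\<close>
    have Hh: "?H n i = h i" if "i < n" for n i
      using that
    proof (induction n)
      case (Suc n)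
      show ?case
      proof (cases "i = n")
        case False then show ?thesis using Suc by (simp add: h_def)
      qed (simp add: h_def)
    qed simp
    have hcl: "h i \<in> carrier D" for i using Hcl unfolding h_def by blast
    let ?d = "\<lambda>n::nat. if n = 0 then \<one> else \<zero>"
    let ?S = "\<lambda>n. \<Oplus>i\<in>{1..n}. f (k + int i) \<otimes> s (k + int i) (h (n - i))"
    have Scl: "?S n \<in> carrier D" for n using c hcl by (intro finsum_closed) auto
    have hn: "s k (h n) = inv (f k) \<otimes> (?d n \<ominus> ?S n)" for n
    proof -
      have "(\<Oplus>i\<in>{1..n}. f (k + int i) \<otimes> s (k + int i) (?H n (n - i))) = ?S n"
        using c hcl by (intro finsum_cong') (auto simp: Hh)
      then have "h n = s (- k) (inv (f k) \<otimes> (?d n \<ominus> ?S n))" by (simp add: h_def)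
      then show ?thesis using u Scl[of n] by (simp add: s_s)
    qed
    \<comment> \<open>The inverse starts at exponent \<open>- k\<close>, and \<open>h\<close> counts
      from there.\<close>
    define g where "g i = (if - k \<le> i then h (nat (i + k)) else \<zero>)" for i
    have g: "vanishes_below D (- k) g" using hcl by (auto simp: vanishes_below_def g_def)
    have fg: "vanishes_below D 0 (f \<otimes>\<^bsub>R\<^esub> g)" using R_mult_vanishes[OF k(1) g] by simp
    have eq: "(f \<otimes>\<^bsub>R\<^esub> g) (int n) = ?d n" for n
    proof -
      have "(f \<otimes>\<^bsub>R\<^esub> g) (int n) = (\<Oplus>i\<in>{k..int n + k}. f i \<otimes> s i (g (int n - i)))"
        by (rule R_mult_window[OF k(1) g]) auto
      also have "{k..int n + k} = (\<lambda>i. k + int i) ` {0..n}"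
      proof (intro equalityI subsetI)
        fix x assume "x \<in> {k..int n + k}"
        then show "x \<in> (\<lambda>i. k + int i) ` {0..n}" by (intro image_eqI[of _ _ "nat (x - k)"]) auto
      qed auto
      also have "(\<Oplus>i\<in>(\<lambda>i. k + int i) ` {0..n}. f i \<otimes> s i (g (int n - i)))
         = (\<Oplus>i\<in>{0..n}. f (k + int i) \<otimes> s (k + int i) (g (int n - (k + int i))))"
        using c vanishes_below_closed[OF g] by (intro finsum_reindex) (auto simp: inj_on_def)
      also have "\<dots> = (\<Oplus>i\<in>{0..n}. f (k + int i) \<otimes> s (k + int i) (h (n - i)))"
      proof (rule finsum_cong')
        fix i assume "i \<in> {0..n}"
        then have "g (int n - (k + int i)) = h (n - i)" by (auto simp: g_def nat_diff_distrib)
        then show "f (k + int i) \<otimes> s (k + int i) (g (int n - (k + int i)))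
          = f (k + int i) \<otimes> s (k + int i) (h (n - i))" by simp
      qed (use c hcl in auto)
      also have "{0..n} = insert 0 {1..n}" by auto
      also have "(\<Oplus>i\<in>insert 0 {1..n}. f (k + int i) \<otimes> s (k + int i) (h (n - i))) = f k \<otimes> s k (h n) \<oplus> ?S n"
        using c hcl by (subst finsum_insert) auto
      also have "f k \<otimes> s k (h n) = ?d n \<ominus> ?S n"
        unfolding hn using u c Scl[of n] by (simp add: m_assoc[symmetric])
      also have "(?d n \<ominus> ?S n) \<oplus> ?S n = ?d n"
        using Scl[of n] by (simp add: a_minus_def a_assoc l_neg)
      finally show ?thesis .
    qed
    have "f \<otimes>\<^bsub>R\<^esub> g = \<one>\<^bsub>R\<^esub>"
    proof
      fix m show "(f \<otimes>\<^bsub>R\<^esub> g) m = \<one>\<^bsub>R\<^esub> m"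
      proof (cases "m < 0")
        case True then show ?thesis using vanishes_below_zero[OF fg] by (simp add: R_one monomial_def)
      next
        case False
        then show ?thesis using eq[of "nat m"] by (simp add: R_one monomial_def)
      qed
    qed
    then show ?thesis using R_memI[OF g] by blast
  qed
  then have "Units R = carrier R - {\<zero>\<^bsub>R\<^esub>}" using R.unitsI_right_inverses one by blast
  then show ?thesis using one ring_R by (simp add: division_ring_def)
qed

text \<open>Both \<open>\<sigma>\<close> and the field of fractions are parameters, so the locale
  can be interpreted a second time, with the inverse automorphism over the same \<open>D\<close> and
  \<open>K\<close>, when left ideals are treated.\<close>

locale dedekind_laurent = skew_laurent D \<sigma> for D :: "('a, 'm) ring_scheme" (structure) and \<sigma> +
  fixes K :: "('q, 'n) ring_scheme" and \<iota> :: "'a \<Rightarrow> 'q"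
  assumes fractions: "division_ring_of_fractions D K \<iota>"
    and ideals_invertible: "\<And>I. ideal I D \<Longrightarrow> I \<noteq> {\<zero>} \<Longrightarrow> invertible_ideal D K \<iota> I"
begin

section \<open>The field of fractions of \<open>D\<close>\<close>

lemma K_ring: "ring K" and K_Units: "Units K = carrier K - {\<zero>\<^bsub>K\<^esub>}" and K_one_not_zero: "\<one>\<^bsub>K\<^esub> \<noteq> \<zero>\<^bsub>K\<^esub>"
  and iota_hom: "\<iota> \<in> ring_hom D K" and iota_inj: "inj_on \<iota> (carrier D)"
  using fractions by (auto simp: division_ring_of_fractions_def division_ring_def)

lemma iota_closed [simp]: "a \<in> carrier D \<Longrightarrow> \<iota> a \<in> carrier K"
  and iota_mult [simp]: "a \<in> carrier D \<Longrightarrow> b \<in> carrier D \<Longrightarrow> \<iota> (a \<otimes> b) = \<iota> a \<otimes>\<^bsub>K\<^esub> \<iota> b"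
  and iota_add [simp]: "a \<in> carrier D \<Longrightarrow> b \<in> carrier D \<Longrightarrow> \<iota> (a \<oplus> b) = \<iota> a \<oplus>\<^bsub>K\<^esub> \<iota> b"
  and iota_one [simp]: "\<iota> \<one> = \<one>\<^bsub>K\<^esub>"
  using iota_hom by (auto simp: ring_hom_def)

lemma iota_zero [simp]: "\<iota> \<zero> = \<zero>\<^bsub>K\<^esub>"
  using additive_zero[of D K \<iota>] K_ring by (simp add: is_abelian_group ring.is_abelian_group)

lemma iota_eq_iff [simp]: "a \<in> carrier D \<Longrightarrow> b \<in> carrier D \<Longrightarrow> \<iota> a = \<iota> b \<longleftrightarrow> a = b"
  using iota_inj by (auto simp: inj_on_def)

lemma iota_eq_zero [simp]: "a \<in> carrier D \<Longrightarrow> \<iota> a = \<zero>\<^bsub>K\<^esub> \<longleftrightarrow> a = \<zero>"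
  using iota_eq_iff[of a \<zero>] by simp

lemma K_fraction:
  assumes "q \<in> carrier K"
  shows "\<exists>a\<in>carrier D. \<exists>t\<in>carrier D. t \<noteq> \<zero> \<and> q \<otimes>\<^bsub>K\<^esub> \<iota> t = \<iota> a"
proof -
  interpret K: ring K by (rule K_ring)
  obtain a t where at: "a \<in> carrier D" "t \<in> carrier D" "t \<noteq> \<zero>" "q = \<iota> a \<otimes>\<^bsub>K\<^esub> inv\<^bsub>K\<^esub> \<iota> t"
    using fractions assms unfolding division_ring_of_fractions_def by blast
  then have "\<iota> t \<in> Units K" by (simp add: K_Units)
  then have "q \<otimes>\<^bsub>K\<^esub> \<iota> t = \<iota> a" using at by (simp add: K.m_assoc)
  then show ?thesis using at by blast
qed

lemma K_cancel:
  assumes "p \<in> carrier K" "q \<in> carrier K" "t \<in> carrier D" "t \<noteq> \<zero>" "p \<otimes>\<^bsub>K\<^esub> \<iota> t = q \<otimes>\<^bsub>K\<^esub> \<iota> t"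
  shows "p = q"
proof -
  interpret K: ring K by (rule K_ring)
  have t: "\<iota> t \<in> Units K" using assms by (simp add: K_Units)
  have "(p \<otimes>\<^bsub>K\<^esub> \<iota> t) \<otimes>\<^bsub>K\<^esub> inv\<^bsub>K\<^esub> \<iota> t = p" "(q \<otimes>\<^bsub>K\<^esub> \<iota> t) \<otimes>\<^bsub>K\<^esub> inv\<^bsub>K\<^esub> \<iota> t = q"
    using assms(1,2) t K.Units_closed[OF t] by (simp_all add: K.m_assoc)
  then show ?thesis by (metis assms(5))
qed

text \<open>Commutativity of \<open>K\<close> is not part of
  \<open>division_ring_of_fractions\<close>. It is obtained by clearing denominators, here against
  elements of \<open>D\<close> and then, in \<open>K_domain\<close>, against all of
  \<open>K\<close>.\<close>

lemma K_commute_iota: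
  assumes q: "q \<in> carrier K" and b: "b \<in> carrier D"
  shows "q \<otimes>\<^bsub>K\<^esub> \<iota> b = \<iota> b \<otimes>\<^bsub>K\<^esub> q"
proof -
  interpret K: ring K by (rule K_ring)
  obtain a t where at: "a \<in> carrier D" "t \<in> carrier D" "t \<noteq> \<zero>" "q \<otimes>\<^bsub>K\<^esub> \<iota> t = \<iota> a"
    using K_fraction[OF q] by blast
  have "(q \<otimes>\<^bsub>K\<^esub> \<iota> b) \<otimes>\<^bsub>K\<^esub> \<iota> t = q \<otimes>\<^bsub>K\<^esub> \<iota> (b \<otimes> t)" using q b at by (simp add: K.m_assoc)
  also have "\<dots> = q \<otimes>\<^bsub>K\<^esub> \<iota> (t \<otimes> b)" using b at by (simp only: m_comm)
  also have "\<dots> = \<iota> (a \<otimes> b)" using q b at by (simp add: K.m_assoc[symmetric])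
  also have "\<dots> = \<iota> (b \<otimes> a)" using b at by (simp only: m_comm)
  also have "\<dots> = (\<iota> b \<otimes>\<^bsub>K\<^esub> q) \<otimes>\<^bsub>K\<^esub> \<iota> t" using q b at by (simp add: K.m_assoc)
  finally show ?thesis using K_cancel[of "q \<otimes>\<^bsub>K\<^esub> \<iota> b" "\<iota> b \<otimes>\<^bsub>K\<^esub> q" t] q b at by simp
qed

lemma K_domain: "domain K"
proof -
  interpret K: ring K by (rule K_ring)
  have comm: "p \<otimes>\<^bsub>K\<^esub> q = q \<otimes>\<^bsub>K\<^esub> p" if p: "p \<in> carrier K" and q: "q \<in> carrier K" for p q
  proof -
    obtain a t where at: "a \<in> carrier D" "t \<in> carrier D" "t \<noteq> \<zero>" "q \<otimes>\<^bsub>K\<^esub> \<iota> t = \<iota> a"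
      using K_fraction[OF q] by blast
    have "(p \<otimes>\<^bsub>K\<^esub> q) \<otimes>\<^bsub>K\<^esub> \<iota> t = p \<otimes>\<^bsub>K\<^esub> \<iota> a" using p q at by (simp add: K.m_assoc)
    also have "\<dots> = \<iota> a \<otimes>\<^bsub>K\<^esub> p" using p at by (simp add: K_commute_iota)
    also have "\<dots> = q \<otimes>\<^bsub>K\<^esub> (\<iota> t \<otimes>\<^bsub>K\<^esub> p)" using p q at by (simp add: K.m_assoc[symmetric])
    also have "\<dots> = (q \<otimes>\<^bsub>K\<^esub> p) \<otimes>\<^bsub>K\<^esub> \<iota> t" using p q at K_commute_iota[of p t] by (simp add: K.m_assoc)
    finally show ?thesis using K_cancel[of "p \<otimes>\<^bsub>K\<^esub> q" "q \<otimes>\<^bsub>K\<^esub> p" t] p q at by simp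
  qed
  have "a = \<zero>\<^bsub>K\<^esub> \<or> b = \<zero>\<^bsub>K\<^esub>" if "a \<otimes>\<^bsub>K\<^esub> b = \<zero>\<^bsub>K\<^esub>" "a \<in> carrier K" "b \<in> carrier K" for a b
  proof (rule ccontr)
    assume "\<not> ?thesis"
    then have a: "a \<in> Units K" "b \<noteq> \<zero>\<^bsub>K\<^esub>" using that by (auto simp: K_Units)
    have "b = inv\<^bsub>K\<^esub> a \<otimes>\<^bsub>K\<^esub> (a \<otimes>\<^bsub>K\<^esub> b)" using a(1) that(2,3) by (simp add: K.m_assoc[symmetric])
    also have "\<dots> = \<zero>\<^bsub>K\<^esub>" unfolding that(1) using a(1) by simp
    finally show False using a(2) by simp
  qed
  then show ?thesis
    using comm K_one_not_zero
    by (intro domain.intro domain_axioms.intro cring.intro K_ring comm_monoid.intro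
        comm_monoid_axioms.intro K.is_monoid) auto
qed

section \<open>Extension of the automorphism to \<open>K\<close>\<close>

definition sK :: "'q \<Rightarrow> 'q" where
  "sK q = (THE r. r \<in> carrier K \<and> (\<exists>a\<in>carrier D. \<exists>t\<in>carrier D. t \<noteq> \<zero> \<and>
      q \<otimes>\<^bsub>K\<^esub> \<iota> t = \<iota> a \<and> r \<otimes>\<^bsub>K\<^esub> \<iota> (\<sigma> t) = \<iota> (\<sigma> a)))"

lemma sigma_closed [simp]: "a \<in> carrier D \<Longrightarrow> \<sigma> a \<in> carrier D"
  and sigma_mult: "a \<in> carrier D \<Longrightarrow> b \<in> carrier D \<Longrightarrow> \<sigma> (a \<otimes> b) = \<sigma> a \<otimes> \<sigma> b"
  and sigma_add: "a \<in> carrier D \<Longrightarrow> b \<in> carrier D \<Longrightarrow> \<sigma> (a \<oplus> b) = \<sigma> a \<oplus> \<sigma> b"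
  and sigma_one [simp]: "\<sigma> \<one> = \<one>"
  and sigma_eq_zero [simp]: "a \<in> carrier D \<Longrightarrow> \<sigma> a = \<zero> \<longleftrightarrow> a = \<zero>"
  using s_closed[of a 1] s_mult[of a b 1] s_add[of a b 1] s_one[of 1] s_eq_zero[of a 1] by (auto simp: s_1 simp del: s_one)

text \<open>\<open>sK\<close> sends \<open>a / t\<close> to \<open>\<sigma> a / \<sigma> t\<close>.
  Two presentations \<open>a / t\<close> and \<open>b / u\<close> of \<open>q\<close> satisfy
  \<open>b t = a u\<close> in \<open>D\<close>; applying \<open>\<sigma>\<close> to this equation
  makes the two candidate values agree.\<close>

lemma sK_eqI:
  assumes q: "q \<in> carrier K" and r: "r \<in> carrier K"
    and at: "a \<in> carrier D" "t \<in> carrier D" "t \<noteq> \<zero>"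
    and "q \<otimes>\<^bsub>K\<^esub> \<iota> t = \<iota> a" "r \<otimes>\<^bsub>K\<^esub> \<iota> (\<sigma> t) = \<iota> (\<sigma> a)"
  shows "sK q = r"
  unfolding sK_def
proof (rule the_equality)
  interpret K: "domain" K by (rule K_domain)
  show "r \<in> carrier K \<and> (\<exists>a\<in>carrier D. \<exists>t\<in>carrier D. t \<noteq> \<zero> \<and>
      q \<otimes>\<^bsub>K\<^esub> \<iota> t = \<iota> a \<and> r \<otimes>\<^bsub>K\<^esub> \<iota> (\<sigma> t) = \<iota> (\<sigma> a))" using assms by blast
  fix r' assume "r' \<in> carrier K \<and> (\<exists>a\<in>carrier D. \<exists>t\<in>carrier D. t \<noteq> \<zero> \<and>
      q \<otimes>\<^bsub>K\<^esub> \<iota> t = \<iota> a \<and> r' \<otimes>\<^bsub>K\<^esub> \<iota> (\<sigma> t) = \<iota> (\<sigma> a))"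
  then obtain b u where r': "r' \<in> carrier K" and bu: "b \<in> carrier D" "u \<in> carrier D" "u \<noteq> \<zero>"
    "q \<otimes>\<^bsub>K\<^esub> \<iota> u = \<iota> b" "r' \<otimes>\<^bsub>K\<^esub> \<iota> (\<sigma> u) = \<iota> (\<sigma> b)" by blast
  have "\<iota> (b \<otimes> t) = q \<otimes>\<^bsub>K\<^esub> \<iota> u \<otimes>\<^bsub>K\<^esub> \<iota> t" using bu at by simp
  also have "\<dots> = q \<otimes>\<^bsub>K\<^esub> \<iota> t \<otimes>\<^bsub>K\<^esub> \<iota> u" using q bu(1-3) at(1-3) by (simp add: K.m_ac)
  also have "\<dots> = \<iota> (a \<otimes> u)" using bu at assms by simp
  finally have "b \<otimes> t = a \<otimes> u" using bu(1,2) at(1,2) by (subst (asm) iota_eq_iff) auto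
  then have e: "\<sigma> b \<otimes> \<sigma> t = \<sigma> a \<otimes> \<sigma> u" using bu at by (simp add: sigma_mult[symmetric])
  have "r' \<otimes>\<^bsub>K\<^esub> \<iota> (\<sigma> u \<otimes> \<sigma> t) = (r' \<otimes>\<^bsub>K\<^esub> \<iota> (\<sigma> u)) \<otimes>\<^bsub>K\<^esub> \<iota> (\<sigma> t)"
    using r' bu(1-3) at by (simp add: K.m_assoc)
  also have "\<dots> = \<iota> (\<sigma> b \<otimes> \<sigma> t)" using bu at by simp
  also have "\<dots> = \<iota> (\<sigma> a) \<otimes>\<^bsub>K\<^esub> \<iota> (\<sigma> u)" unfolding e using bu at by simp
  also have "\<dots> = (r \<otimes>\<^bsub>K\<^esub> \<iota> (\<sigma> t)) \<otimes>\<^bsub>K\<^esub> \<iota> (\<sigma> u)" using assms(7) by simp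
  also have "\<dots> = r \<otimes>\<^bsub>K\<^esub> \<iota> (\<sigma> u \<otimes> \<sigma> t)" using r bu at by (simp add: K.m_ac)
  finally show "r' = r" using K_cancel[of r' r "\<sigma> u \<otimes> \<sigma> t"] r r' bu at integral[of "\<sigma> u" "\<sigma> t"] by auto
qed

lemma sK_fraction:
  assumes q: "q \<in> carrier K" and at: "a \<in> carrier D" "t \<in> carrier D" "t \<noteq> \<zero>" "q \<otimes>\<^bsub>K\<^esub> \<iota> t = \<iota> a"
  shows "sK q \<in> carrier K" "sK q \<otimes>\<^bsub>K\<^esub> \<iota> (\<sigma> t) = \<iota> (\<sigma> a)"
proof -
  interpret K: "domain" K by (rule K_domain)
  have u: "\<iota> (\<sigma> t) \<in> Units K" using at by (simp add: K_Units)
  define r where "r = \<iota> (\<sigma> a) \<otimes>\<^bsub>K\<^esub> inv\<^bsub>K\<^esub> \<iota> (\<sigma> t)"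
  have r: "r \<in> carrier K" "r \<otimes>\<^bsub>K\<^esub> \<iota> (\<sigma> t) = \<iota> (\<sigma> a)" using u at by (auto simp: r_def K.m_assoc)
  have "sK q = r" by (rule sK_eqI[OF q r(1) at r(2)])
  then show "sK q \<in> carrier K" "sK q \<otimes>\<^bsub>K\<^esub> \<iota> (\<sigma> t) = \<iota> (\<sigma> a)" using r by auto
qed

lemma sK_iota: "a \<in> carrier D \<Longrightarrow> sK (\<iota> a) = \<iota> (\<sigma> a)"
  by (rule sK_eqI[of _ _ a \<one>]) (use K_ring in \<open>auto simp: ring.ring_simprules monoid.r_one ring.is_monoid\<close>)

lemma sK_iso: "sK \<in> ring_iso K K"
proof -
  interpret K: "domain" K by (rule K_domain)
  have cl: "sK q \<in> carrier K" if "q \<in> carrier K" for q using K_fraction[OF that] sK_fraction that by blast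
  have hom: "sK \<in> ring_hom K K"
  proof (rule ring_hom_memI)
    fix p q assume pq: "p \<in> carrier K" "q \<in> carrier K"
    obtain a t where at: "a \<in> carrier D" "t \<in> carrier D" "t \<noteq> \<zero>" "p \<otimes>\<^bsub>K\<^esub> \<iota> t = \<iota> a"
      using K_fraction[OF pq(1)] by blast
    obtain b u where bu: "b \<in> carrier D" "u \<in> carrier D" "u \<noteq> \<zero>" "q \<otimes>\<^bsub>K\<^esub> \<iota> u = \<iota> b"
      using K_fraction[OF pq(2)] by blast
    note P = sK_fraction[OF pq(1) at] and Q = sK_fraction[OF pq(2) bu]
    have tu: "t \<otimes> u \<in> carrier D" "t \<otimes> u \<noteq> \<zero>" using at bu integral by auto
    have mul: "x \<otimes>\<^bsub>K\<^esub> y \<otimes>\<^bsub>K\<^esub> (v \<otimes>\<^bsub>K\<^esub> w) = (x \<otimes>\<^bsub>K\<^esub> v) \<otimes>\<^bsub>K\<^esub> (y \<otimes>\<^bsub>K\<^esub> w)"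
      if "x \<in> carrier K" "y \<in> carrier K" "v \<in> carrier K" "w \<in> carrier K" for x y v w
      using that by (simp add: K.m_ac)
    have add: "(x \<oplus>\<^bsub>K\<^esub> y) \<otimes>\<^bsub>K\<^esub> (v \<otimes>\<^bsub>K\<^esub> w) = (x \<otimes>\<^bsub>K\<^esub> v) \<otimes>\<^bsub>K\<^esub> w \<oplus>\<^bsub>K\<^esub> (y \<otimes>\<^bsub>K\<^esub> w) \<otimes>\<^bsub>K\<^esub> v"
      if "x \<in> carrier K" "y \<in> carrier K" "v \<in> carrier K" "w \<in> carrier K" for x y v w
    proof -
      have "y \<otimes>\<^bsub>K\<^esub> (v \<otimes>\<^bsub>K\<^esub> w) = (y \<otimes>\<^bsub>K\<^esub> w) \<otimes>\<^bsub>K\<^esub> v" using that by (simp add: K.m_ac)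
      then show ?thesis using that by (simp add: K.l_distr K.m_assoc)
    qed
    show "sK (p \<otimes>\<^bsub>K\<^esub> q) = sK p \<otimes>\<^bsub>K\<^esub> sK q"
      by (rule sK_eqI[of _ _ "a \<otimes> b" "t \<otimes> u"])
         (use pq at bu P Q tu mul[OF pq, of "\<iota> t" "\<iota> u"] in \<open>simp_all add: mul sigma_mult del: K.m_assoc\<close>)
    show "sK (p \<oplus>\<^bsub>K\<^esub> q) = sK p \<oplus>\<^bsub>K\<^esub> sK q"
      by (rule sK_eqI[of _ _ "a \<otimes> u \<oplus> b \<otimes> t" "t \<otimes> u"])
         (use pq at bu P Q tu in \<open>simp_all add: add sigma_mult sigma_add\<close>)
  next
    show "sK \<one>\<^bsub>K\<^esub> = \<one>\<^bsub>K\<^esub>" using sK_iota[of \<one>] by simp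
  qed (rule cl)
  have "inj_on sK (carrier K)"
  proof (rule inj_onI)
    fix p q assume pq: "p \<in> carrier K" "q \<in> carrier K" "sK p = sK q"
    obtain a t where at: "a \<in> carrier D" "t \<in> carrier D" "t \<noteq> \<zero>" "p \<otimes>\<^bsub>K\<^esub> \<iota> t = \<iota> a"
      using K_fraction[OF pq(1)] by blast
    obtain b u where bu: "b \<in> carrier D" "u \<in> carrier D" "u \<noteq> \<zero>" "q \<otimes>\<^bsub>K\<^esub> \<iota> u = \<iota> b"
      using K_fraction[OF pq(2)] by blast
    note P = sK_fraction[OF pq(1) at] and Q = sK_fraction[OF pq(2) bu]
    have swap: "x \<otimes>\<^bsub>K\<^esub> v \<otimes>\<^bsub>K\<^esub> w = x \<otimes>\<^bsub>K\<^esub> w \<otimes>\<^bsub>K\<^esub> v"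
      if "x \<in> carrier K" "v \<in> carrier K" "w \<in> carrier K" for x v w using that by (simp add: K.m_ac)
    have "\<iota> (\<sigma> (a \<otimes> u)) = \<iota> (\<sigma> (b \<otimes> t))"
      using P Q at bu swap[OF P(1), of "\<iota> (\<sigma> t)" "\<iota> (\<sigma> u)"] pq(3) by (simp add: sigma_mult)
    then have "\<sigma> (a \<otimes> u) = \<sigma> (b \<otimes> t)" using at bu by simp
    then have e: "a \<otimes> u = b \<otimes> t" using at bu sigma_bij by (auto simp: bij_betw_def dest: inj_onD)
    have "p \<otimes>\<^bsub>K\<^esub> \<iota> (t \<otimes> u) = \<iota> (a \<otimes> u)" using pq at bu by (simp add: K.m_assoc[symmetric])
    also have "\<dots> = q \<otimes>\<^bsub>K\<^esub> \<iota> u \<otimes>\<^bsub>K\<^esub> \<iota> t" unfolding e using at bu by simp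
    also have "\<dots> = q \<otimes>\<^bsub>K\<^esub> \<iota> (t \<otimes> u)" using pq(1,2) at(1-3) bu(1-3) by (simp add: K.m_ac)
    finally show "p = q" using K_cancel[of p q "t \<otimes> u"] pq at bu integral[of t u] by auto
  qed
  moreover have "sK ` carrier K = carrier K"
  proof
    show "carrier K \<subseteq> sK ` carrier K"
    proof
      fix r assume r: "r \<in> carrier K"
      obtain a t where at: "a \<in> carrier D" "t \<in> carrier D" "t \<noteq> \<zero>" "r \<otimes>\<^bsub>K\<^esub> \<iota> t = \<iota> a"
        using K_fraction[OF r] by blast
      define b where "b = s (- 1) a" define u where "u = s (- 1) t"
      have bu: "b \<in> carrier D" "u \<in> carrier D" "u \<noteq> \<zero>" "\<sigma> b = a" "\<sigma> u = t"
        using at s_s[of a 1 "- 1"] s_s[of t 1 "- 1"] by (auto simp: b_def u_def s_1)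
      then have uU: "\<iota> u \<in> Units K" by (simp add: K_Units)
      define q where "q = \<iota> b \<otimes>\<^bsub>K\<^esub> inv\<^bsub>K\<^esub> \<iota> u"
      have q: "q \<in> carrier K" "q \<otimes>\<^bsub>K\<^esub> \<iota> u = \<iota> b" using uU bu by (auto simp: q_def K.m_assoc)
      have "sK q = r" by (rule sK_eqI[OF q(1) r bu(1-3) q(2)]) (use bu at in simp)
      then show "r \<in> sK ` carrier K" using q by blast
    qed
  qed (use cl in auto)
  ultimately show ?thesis using hom by (simp add: ring_iso_def bij_betw_def)
qed

section \<open>The division ring \<open>E\<close> and the embedding \<open>j\<close> of
  \<open>R\<close>\<close>

sublocale EK: skew_laurent K sK
  by (intro skew_laurent.intro skew_laurent_axioms.intro K_domain sK_iso)

abbreviation "E \<equiv> skew_laurent_ring K sK"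

definition j :: "(int \<Rightarrow> 'a) \<Rightarrow> int \<Rightarrow> 'q" where "j f = (\<lambda>i. \<iota> (f i))"

lemma sK_power_iota: "a \<in> carrier D \<Longrightarrow> EK.s i (\<iota> a) = \<iota> (s i a)"
proof (induction i rule: int_induct[where k = 0])
  case (step1 i)
  then show ?case using EK.s_succ[of "\<iota> a" i] s_succ[of a i] by (simp add: sK_iota)
next
  case (step2 i)
  have "sK (EK.s (i - 1) (\<iota> a)) = EK.s i (\<iota> a)" using EK.s_succ[of "\<iota> a" "i - 1"] step2 by simp
  also have "\<dots> = sK (\<iota> (s (i - 1) a))" using step2 s_succ[of a "i - 1"] by (simp add: sK_iota)
  finally show ?case using EK.sigma_bij step2 by (auto simp: bij_betw_def inj_on_def)
qed simp

lemma j_vanishes: "vanishes_below D k f \<Longrightarrow> vanishes_below K k (j f)"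
  by (simp add: vanishes_below_def j_def)

lemma j_closed [simp]: "f \<in> carrier R \<Longrightarrow> j f \<in> carrier E"
  using R_memE j_vanishes EK.R_memI by blast

lemma j_mult:
  assumes "f \<in> carrier R" "g \<in> carrier R"
  shows "j (f \<otimes>\<^bsub>R\<^esub> g) = j f \<otimes>\<^bsub>E\<^esub> j g"
proof
  fix n
  obtain k l where k: "vanishes_below D k f" and l: "vanishes_below D l g" using assms R_memE by blast
  note c = vanishes_below_closed[OF k] vanishes_below_closed[OF l]
  have "j (f \<otimes>\<^bsub>R\<^esub> g) n = \<iota> (\<Oplus>i\<in>{k..n - l}. f i \<otimes> s i (g (n - i)))"
    unfolding j_def R_mult_window[OF k l order_refl order_refl] ..
  also have "\<dots> = (\<Oplus>\<^bsub>K\<^esub>i\<in>{k..n - l}. \<iota> (f i \<otimes> s i (g (n - i))))"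
    by (rule additive_finsum[OF is_abelian_group EK.is_abelian_group]) (use c in auto)
  also have "\<dots> = (\<Oplus>\<^bsub>K\<^esub>i\<in>{k..n - l}. j f i \<otimes>\<^bsub>K\<^esub> EK.s i (j g (n - i)))"
    using c by (simp add: j_def sK_power_iota)
  also have "\<dots> = (j f \<otimes>\<^bsub>E\<^esub> j g) n"
    by (rule EK.R_mult_window[OF j_vanishes[OF k] j_vanishes[OF l] order_refl order_refl, symmetric])
  finally show "j (f \<otimes>\<^bsub>R\<^esub> g) n = (j f \<otimes>\<^bsub>E\<^esub> j g) n" .
qed

lemma j_hom: "j \<in> ring_hom R E"
proof (rule ring_hom_memI)
  show "j \<one>\<^bsub>R\<^esub> = \<one>\<^bsub>E\<^esub>" by (simp add: R_one EK.R_one j_def monomial_def fun_eq_iff)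
  show "j (f \<oplus>\<^bsub>R\<^esub> g) = j f \<oplus>\<^bsub>E\<^esub> j g" if "f \<in> carrier R" "g \<in> carrier R" for f g
    using that R_coeff_closed by (simp add: j_def skew_laurent_ring_simps fun_eq_iff)
qed (auto simp: j_mult)

lemma j_inj: "inj_on j (carrier R)"
proof (rule inj_onI)
  fix f g assume "f \<in> carrier R" "g \<in> carrier R" "j f = j g"
  then show "f = g" using R_coeff_closed by (auto simp: j_def fun_eq_iff)
qed

lemma E_division_ring: "division_ring E"
  by (rule EK.division_ring_R[OF K_Units])

end

section \<open>Right ideals\<close>

context skew_laurent
begin

text \<open>Exponent 0 suffices because right multiplication by a power of \<open>x\<close> moves
  any lowest term there without changing its coefficient (\<open>leading_idealI\<close>). The
  coefficient \<open>f 0\<close> may vanish, so that zero belongs to the ideal.\<close>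

definition leading_ideal :: "(int \<Rightarrow> 'a) set \<Rightarrow> 'a set" where
  "leading_ideal I = {f 0 | f. f \<in> I \<and> vanishes_below D 0 f}"

lemma leading_ideal_memI: "f \<in> I \<Longrightarrow> vanishes_below D 0 f \<Longrightarrow> f 0 \<in> leading_ideal I"
  by (auto simp: leading_ideal_def)

lemma leading_idealI:
  assumes "right_ideal I R" "g \<in> I" "vanishes_below D m g"
  shows "g m \<in> leading_ideal I"
proof -
  interpret R: ring R by (rule ring_R)
  have g: "g \<in> carrier R" using assms(3) by (rule R_memI)
  let ?h = "g \<otimes>\<^bsub>R\<^esub> monomial D \<one> (- m)"
  have "?h \<in> I" using assms(1,2) monomial_closed[of \<one> "- m"] by (auto simp: right_ideal_def)
  moreover have "?h n = g (n + m)" for n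
    using R_mult_monomial_right[OF g, of \<one> "- m" n] R_coeff_closed[OF g] by simp
  moreover from this have "vanishes_below D 0 ?h" using assms(3) by (simp add: vanishes_below_def)
  ultimately show ?thesis using leading_ideal_memI by (metis add_0)
qed

lemma leading_ideal_ideal:
  assumes "right_ideal I R"
  shows "ideal (leading_ideal I) D"
proof -
  interpret R: ring R by (rule ring_R)
  interpret I: additive_subgroup I R using assms by (simp add: right_ideal_def)
  let ?J = "leading_ideal I"
  have sub: "?J \<subseteq> carrier D" by (auto simp: leading_ideal_def vanishes_below_def)
  have mult: "a \<otimes> d \<in> ?J" if a: "a \<in> ?J" and d: "d \<in> carrier D" for a d
  proof -
    obtain f where f: "f \<in> I" "vanishes_below D 0 f" "a = f 0" using a by (auto simp: leading_ideal_def)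
    have fR: "f \<in> carrier R" using f(2) by (rule R_memI)
    let ?h = "f \<otimes>\<^bsub>R\<^esub> monomial D d 0"
    have "?h \<in> I" using assms f(1) monomial_closed[OF d] by (auto simp: right_ideal_def)
    moreover have "vanishes_below D 0 ?h"
      using R_mult_vanishes[OF f(2) vanishes_below_monomial[OF abelian_monoid_axioms d order_refl]] by simp
    moreover have "?h 0 = a \<otimes> d" using R_mult_monomial_right[OF fR d, of 0 0] f(3) by simp
    ultimately show ?thesis using leading_ideal_memI by metis
  qed
  have add: "a \<oplus> b \<in> ?J" if ab: "a \<in> ?J" "b \<in> ?J" for a b
  proof -
    obtain f g where fg: "f \<in> I" "vanishes_below D 0 f" "a = f 0" "g \<in> I" "vanishes_below D 0 g" "b = g 0"
      using ab by (auto simp: leading_ideal_def)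
    have "f \<oplus>\<^bsub>R\<^esub> g \<in> I" using fg by simp
    moreover have "vanishes_below D 0 (f \<oplus>\<^bsub>R\<^esub> g)"
      using vanishes_below_add[OF abelian_monoid_axioms fg(2,5)] by (simp add: skew_laurent_ring_simps)
    moreover have "(f \<oplus>\<^bsub>R\<^esub> g) 0 = a \<oplus> b" using fg by (simp add: R_add_apply)
    ultimately show ?thesis using leading_ideal_memI by metis
  qed
  have zero: "\<zero> \<in> ?J"
    unfolding leading_ideal_def using I.zero_closed
    by (auto intro!: exI[of _ "\<zero>\<^bsub>R\<^esub>"] simp: R_zero_apply vanishes_below_def)
  have neg: "\<ominus> a \<in> ?J" if a: "a \<in> ?J" for a
  proof -
    have "a \<otimes> (\<ominus> \<one>) \<in> ?J" by (rule mult[OF a]) simp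
    then show ?thesis using a sub by (auto simp: r_minus)
  qed
  show ?thesis
  proof (rule idealI[OF ring_axioms])
    show "subgroup ?J (add_monoid D)"
      by (rule add.subgroupI) (use sub zero neg add in \<open>auto simp: a_inv_def\<close>)
  next
    fix a x assume ax: "a \<in> ?J" "x \<in> carrier D"
    then show "a \<otimes> x \<in> ?J" by (rule mult)
    then show "x \<otimes> a \<in> ?J" using ax sub m_comm[of x a] by auto
  qed
qed

lemma leading_ideal_nonzero:
  assumes "right_ideal I R" "I \<noteq> {\<zero>\<^bsub>R\<^esub>}"
  shows "leading_ideal I \<noteq> {\<zero>}"
proof -
  interpret I: additive_subgroup I R using assms(1) by (simp add: right_ideal_def)
  obtain g where g: "g \<in> I" "g \<noteq> \<zero>\<^bsub>R\<^esub>" using assms(2) I.zero_closed by blast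
  have "g \<noteq> (\<lambda>_. \<zero>)" using g(2) by (simp add: skew_laurent_ring_simps)
  moreover have "g \<in> carrier R" using g(1) I.a_subset by blast
  ultimately obtain m where "vanishes_below D m g" "g m \<noteq> \<zero>" using R_memE leading_index by blast
  then show ?thesis using leading_idealI[OF assms(1) g(1)] by auto
qed

lemma ideal_imp_right_ideal: "ideal J D \<Longrightarrow> right_ideal J D"
  by (auto simp: right_ideal_def ideal_def ideal_axioms_def)

lemma right_ideal_imp_ideal:
  assumes "right_ideal J D" shows "ideal J D"
proof -
  interpret J: additive_subgroup J D using assms by (simp add: right_ideal_def)
  show ?thesis
  proof (rule idealI[OF ring_axioms])
    fix a x assume ax: "a \<in> J" "x \<in> carrier D"
    then show "a \<otimes> x \<in> J" using assms by (auto simp: right_ideal_def)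
    then show "x \<otimes> a \<in> J" using ax J.a_subset m_comm[of x a] by auto
  qed (rule J.a_subgroup)
qed

end

context dedekind_laurent
begin

text \<open>Invertibility of \<open>J\<close> in the form in which it is used: elements with
  \<open>\<Sum> a i b i = 1\<close> and \<open>b i J \<subseteq> D\<close>. The same elements give
  the dual basis of \<open>J\<close>, the unit attached to a right ideal, and the inverse of a
  two-sided ideal.\<close>

lemma invertible_data:
  assumes "ideal J D" "J \<noteq> {\<zero>}"
  shows "\<exists>(n::nat) a b. (\<forall>i<n. a i \<in> J \<and> b i \<in> carrier K \<and> (\<forall>x\<in>J. b i \<otimes>\<^bsub>K\<^esub> \<iota> x \<in> \<iota> ` carrier D)) \<and>
    (\<Oplus>\<^bsub>K\<^esub>i\<in>{..<n}. \<iota> (a i) \<otimes>\<^bsub>K\<^esub> b i) = \<one>\<^bsub>K\<^esub>"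
proof -
  obtain B where B: "sub_bimodule D K \<iota> B" "ideal_prod K (\<iota> ` J) B = \<iota> ` carrier D"
     "ideal_prod K B (\<iota> ` J) = \<iota> ` carrier D"
    using ideals_invertible[OF assms] by (auto simp: invertible_ideal_def)
  have Bc: "B \<subseteq> carrier K" using B(1) by (simp add: sub_bimodule_def additive_subgroup.a_subset)
  have Jc: "J \<subseteq> carrier D" using assms(1) by (simp add: additive_subgroup.a_subset ideal.axioms(1))
  then have iJ: "\<iota> ` J \<subseteq> carrier K" by auto
  have "\<one>\<^bsub>K\<^esub> \<in> ideal_prod K (\<iota> ` J) B" unfolding B(2) by (rule image_eqI[of _ _ \<one>]) auto
  then obtain n c b where cb: "\<forall>i<n::nat. c i \<in> \<iota> ` J \<and> b i \<in> B"
    and sum: "\<one>\<^bsub>K\<^esub> = (\<Oplus>\<^bsub>K\<^esub>i\<in>{..<n}. c i \<otimes>\<^bsub>K\<^esub> b i)"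
    using ideal_prod_finsum[OF K_ring iJ Bc] by blast
  have "\<forall>i. \<exists>a. i < n \<longrightarrow> a \<in> J \<and> c i = \<iota> a" using cb by blast
  then obtain a where a: "\<And>i. i < n \<Longrightarrow> a i \<in> J \<and> c i = \<iota> (a i)" by metis
  have "b i \<otimes>\<^bsub>K\<^esub> \<iota> x \<in> \<iota> ` carrier D" if "i < n" "x \<in> J" for i x
    unfolding B(3)[symmetric] using cb that by (intro ideal_prod.prod) auto
  moreover have "(\<Oplus>\<^bsub>K\<^esub>i\<in>{..<n}. \<iota> (a i) \<otimes>\<^bsub>K\<^esub> b i) = \<one>\<^bsub>K\<^esub>"
    unfolding sum using a cb Bc Jc by (intro EK.finsum_cong') (auto simp: subset_iff)
  ultimately show ?thesis using a cb Bc by (intro exI[of _ n] exI[of _ a] exI[of _ b]) auto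
qed

text \<open>Multiplying \<open>\<Sum> a i b i = 1\<close> by an element \<open>x\<close> of
  \<open>J\<close> shows that the \<open>a i\<close> together with the functionals
  \<open>x \<mapsto> b i x\<close> form a dual basis of \<open>J\<close>.\<close>

lemma ideals_fin_proj_D: "ideals_fin_proj D"
  unfolding ideals_fin_proj_def
proof (intro conjI allI impI)
  show "ring D" by (rule ring_axioms)
  fix J assume "right_ideal J D"
  then have J: "ideal J D" and M: "right_module D (ideal_as_module D J)"
    using right_ideal_imp_ideal right_module_ideal ring_axioms by auto
  interpret M: right_module D "ideal_as_module D J" by (rule M)
  have Jc: "J \<subseteq> carrier D" using J by (simp add: additive_subgroup.a_subset ideal.axioms(1))
  show "fin_proj D (ideal_as_module D J)"
  proof (cases "J = {\<zero>}")
    case True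
    have "dual_basis D (ideal_as_module D J) {} p \<phi>" for p :: "nat \<Rightarrow> 'a" and \<phi>
      using True by (simp add: dual_basis_def) (metis M.M.finsum_empty ideal_as_module_simps(2))
    then show ?thesis by (rule fin_projI[OF M])
  next
    case False
    obtain n a b where ab: "\<And>i. i < n \<Longrightarrow> a i \<in> J" "\<And>i. i < n \<Longrightarrow> b i \<in> carrier K"
      "\<And>i x. i < n \<Longrightarrow> x \<in> J \<Longrightarrow> b i \<otimes>\<^bsub>K\<^esub> \<iota> x \<in> \<iota> ` carrier D"
      and sum: "(\<Oplus>\<^bsub>K\<^esub>i\<in>{..<n::nat}. \<iota> (a i) \<otimes>\<^bsub>K\<^esub> b i) = \<one>\<^bsub>K\<^esub>"
      using invertible_data[OF J False] by blast
    define \<phi> where "\<phi> i x = inv_into (carrier D) \<iota> (b i \<otimes>\<^bsub>K\<^esub> \<iota> x)" for i x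
    have \<phi>: "\<phi> i x \<in> carrier D" "\<iota> (\<phi> i x) = b i \<otimes>\<^bsub>K\<^esub> \<iota> x" if "i < n" "x \<in> J" for i x
      using ab(3)[OF that] by (auto simp: \<phi>_def inv_into_into f_inv_into_f)
    have eq: "x = y" if "x \<in> carrier D" "y \<in> carrier D" "\<iota> x = \<iota> y" for x y using that by simp
    have Jadd: "x \<oplus> y \<in> J" if "x \<in> J" "y \<in> J" for x y using M.M.a_closed[of x y] that by simp
    have Jm: "x \<otimes> y \<in> J" if "x \<in> J" "y \<in> carrier D" for x y using M.smult_closed[of y x] that by simp
    have "dual_basis D (ideal_as_module D J) {..<n} a \<phi>"
      unfolding dual_basis_def
    proof (intro conjI ballI)
      show "a \<in> {..<n} \<rightarrow> carrier (ideal_as_module D J)" using ab by auto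
    next
      fix i assume i: "i \<in> {..<n}"
      show "right_linear D (ideal_as_module D J) (regular_module D) (\<phi> i)"
      proof (rule right_linearI)
        fix x y assume "x \<in> carrier (ideal_as_module D J)" "y \<in> carrier (ideal_as_module D J)"
        then have xy: "x \<in> J" "y \<in> J" "x \<in> carrier D" "y \<in> carrier D" using Jc by auto
        have "\<phi> i (x \<oplus> y) = \<phi> i x \<oplus> \<phi> i y"
        proof (rule eq)
          show "\<phi> i (x \<oplus> y) \<in> carrier D" "\<phi> i x \<oplus> \<phi> i y \<in> carrier D"
            using i xy \<phi>(1) Jadd by auto
          show "\<iota> (\<phi> i (x \<oplus> y)) = \<iota> (\<phi> i x \<oplus> \<phi> i y)"
            using i xy \<phi>[of i] Jadd[OF xy(1,2)] ab(2)[of i] by (simp add: EK.r_distr)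
        qed
        then show "\<phi> i (x \<oplus>\<^bsub>ideal_as_module D J\<^esub> y) = \<phi> i x \<oplus>\<^bsub>regular_module D\<^esub> \<phi> i y" by simp
      next
        fix d x assume "d \<in> carrier D" "x \<in> carrier (ideal_as_module D J)"
        then have dx: "d \<in> carrier D" "x \<in> J" "x \<in> carrier D" using Jc by auto
        have "\<phi> i (x \<otimes> d) = \<phi> i x \<otimes> d"
        proof (rule eq)
          show "\<phi> i (x \<otimes> d) \<in> carrier D" "\<phi> i x \<otimes> d \<in> carrier D"
            using i dx \<phi>(1) Jm by auto
          show "\<iota> (\<phi> i (x \<otimes> d)) = \<iota> (\<phi> i x \<otimes> d)"
            using i dx \<phi>[of i] Jm[OF dx(2,1)] ab(2)[of i] by (simp add: EK.m_assoc)
        qed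
        then show "\<phi> i (d \<odot>\<^bsub>ideal_as_module D J\<^esub> x) = d \<odot>\<^bsub>regular_module D\<^esub> \<phi> i x" by simp
      qed (use i \<phi>(1) in auto)
    next
      fix x assume "x \<in> carrier (ideal_as_module D J)"
      then have x: "x \<in> J" "x \<in> carrier D" using Jc by auto
      have cl: "(\<lambda>i. a i \<otimes> \<phi> i x) \<in> {..<n} \<rightarrow> J" using ab(1) \<phi>(1)[OF _ x(1)] Jm by auto
      then have cl': "(\<lambda>i. a i \<otimes> \<phi> i x) \<in> {..<n} \<rightarrow> carrier D" using Jc by blast
      have "(\<Oplus>\<^bsub>ideal_as_module D J\<^esub>i\<in>{..<n}. a i \<otimes> \<phi> i x) = (\<Oplus>i\<in>{..<n}. a i \<otimes> \<phi> i x)"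
        by (rule finsum_right_ideal[OF ring_axioms \<open>right_ideal J D\<close> cl])
      moreover have "(\<Oplus>i\<in>{..<n}. a i \<otimes> \<phi> i x) = x"
      proof (rule eq)
        have "\<iota> (\<Oplus>i\<in>{..<n}. a i \<otimes> \<phi> i x) = (\<Oplus>\<^bsub>K\<^esub>i\<in>{..<n}. \<iota> (a i \<otimes> \<phi> i x))"
          by (rule additive_finsum[OF is_abelian_group EK.is_abelian_group]) (use cl' in auto)
        also have "\<dots> = (\<Oplus>\<^bsub>K\<^esub>i\<in>{..<n}. (\<iota> (a i) \<otimes>\<^bsub>K\<^esub> b i) \<otimes>\<^bsub>K\<^esub> \<iota> x)"
        proof (rule EK.finsum_cong')
          fix i assume i: "i \<in> {..<n}"
          then have "a i \<in> carrier D" "\<phi> i x \<in> carrier D" "b i \<in> carrier K"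
            using ab(1,2) Jc \<phi>(1)[OF _ x(1)] by auto
          then show "\<iota> (a i \<otimes> \<phi> i x) = (\<iota> (a i) \<otimes>\<^bsub>K\<^esub> b i) \<otimes>\<^bsub>K\<^esub> \<iota> x"
            using i x \<phi>(2)[OF _ x(1), of i] by (simp add: EK.m_assoc)
        qed (use ab Jc x in \<open>auto simp: subset_iff\<close>)
        also have "\<dots> = \<one>\<^bsub>K\<^esub> \<otimes>\<^bsub>K\<^esub> \<iota> x" unfolding sum[symmetric]
          by (rule EK.finsum_ldistr[symmetric]) (use ab Jc x in \<open>auto simp: subset_iff\<close>)
        finally show "\<iota> (\<Oplus>i\<in>{..<n}. a i \<otimes> \<phi> i x) = \<iota> x" using x by simp
      qed (use cl' x in auto)
      ultimately show "x = (\<Oplus>\<^bsub>ideal_as_module D J\<^esub>i\<in>{..<n}. \<phi> i x \<odot>\<^bsub>ideal_as_module D J\<^esub> a i)" by simp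
    qed simp
    then show ?thesis by (rule fin_projI[OF M])
  qed
qed

text \<open>\<open>J((x))\<close> as a subset of \<open>R\<close>. For an ideal \<open>J\<close> it
  has the same elements as the Laurent module over \<open>J\<close>; this is checked in
  \<open>right_ideal_isomorphic\<close>.\<close>

definition ideal_series :: "'a set \<Rightarrow> (int \<Rightarrow> 'a) set" where
  "ideal_series J = {h \<in> carrier R. range h \<subseteq> J}"

lemma E_ring: "ring E" by (rule EK.ring_R)

lemma j_diff: "f \<in> carrier R \<Longrightarrow> g \<in> carrier R \<Longrightarrow> j (f \<ominus>\<^bsub>R\<^esub> g) = j f \<ominus>\<^bsub>E\<^esub> j g"
proof -
  assume fg: "f \<in> carrier R" "g \<in> carrier R"
  interpret R: ring R by (rule ring_R)
  have "\<iota> (\<ominus> x) = \<ominus>\<^bsub>K\<^esub> \<iota> x" if "x \<in> carrier D" for x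
  proof (rule EK.minus_equality[symmetric])
    show "\<iota> (\<ominus> x) \<oplus>\<^bsub>K\<^esub> \<iota> x = \<zero>\<^bsub>K\<^esub>"
      using iota_add[of "\<ominus> x" x] that by (simp add: l_neg del: iota_add)
  qed (use that in auto)
  then have "\<iota> (x \<ominus> y) = \<iota> x \<ominus>\<^bsub>K\<^esub> \<iota> y" if "x \<in> carrier D" "y \<in> carrier D" for x y
    using that by (simp add: a_minus_def)
  then have "j (f \<ominus>\<^bsub>R\<^esub> g) i = j f i \<ominus>\<^bsub>K\<^esub> j g i" for i
    using fg R_coeff_closed by (simp add: j_def R_minus_apply)
  then show ?thesis using fg by (auto simp: EK.R_minus_apply)
qed

lemma j_in_image:
  assumes "w \<in> carrier E" "\<And>i. w i \<in> \<iota> ` J" "J \<subseteq> carrier D"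
  shows "\<exists>h\<in>carrier R. j h = w \<and> range h \<subseteq> J"
proof -
  define h where "h i = inv_into (carrier D) \<iota> (w i)" for i
  have h: "h i \<in> J" "\<iota> (h i) = w i" for i
  proof -
    obtain a where "a \<in> J" "w i = \<iota> a" using assms(2) by blast
    then show "h i \<in> J" "\<iota> (h i) = w i" using assms(3) iota_inj by (auto simp: h_def inv_into_f_f subset_iff)
  qed
  obtain k where k: "vanishes_below K k w" using assms(1) EK.R_memE by blast
  have "h i = \<zero>" if "i < k" for i using vanishes_below_zero[OF k that] h[of i] assms(3) by auto
  then have "vanishes_below D k h" using h assms(3) by (auto simp: vanishes_below_def)
  then have "h \<in> carrier R" by (rule R_memI)
  then show ?thesis using h by (intro bexI[of _ h]) (auto simp: j_def)
qed

text \<open>Lowest terms multiply. If the inverse of \<open>u\<close> starts at exponent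
  \<open>k\<close>, then the product with \<open>u\<close> has a nonzero coefficient there, which
  forces \<open>k = 0\<close>.\<close>

lemma E_unit_inverse:
  assumes u: "u \<in> carrier E" "vanishes_below K 0 u" "u 0 = \<one>\<^bsub>K\<^esub>"
  shows "u \<in> Units E" "vanishes_below K 0 (inv\<^bsub>E\<^esub> u)" "(inv\<^bsub>E\<^esub> u) 0 = \<one>\<^bsub>K\<^esub>"
proof -
  interpret E: ring E by (rule E_ring)
  have "u \<noteq> \<zero>\<^bsub>E\<^esub>" using u K_one_not_zero EK.R_zero_apply[of 0] by auto
  then show U: "u \<in> Units E" using E_division_ring u by (simp add: division_ring_def)
  let ?v = "inv\<^bsub>E\<^esub> u"
  have v: "?v \<in> carrier E" using U by simp
  have uv: "u \<otimes>\<^bsub>E\<^esub> ?v = monomial K \<one>\<^bsub>K\<^esub> 0" using U EK.R_one by simp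
  have "?v \<noteq> (\<lambda>_. \<zero>\<^bsub>K\<^esub>)"
  proof
    assume "?v = (\<lambda>_. \<zero>\<^bsub>K\<^esub>)"
    then have "?v = \<zero>\<^bsub>E\<^esub>" by (simp add: skew_laurent_ring_simps)
    then have "\<one>\<^bsub>E\<^esub> = \<zero>\<^bsub>E\<^esub>" using U u(1) E.Units_r_inv[OF U] by simp
    then show False using E_division_ring by (simp add: division_ring_def)
  qed
  then obtain k where k: "vanishes_below K k ?v" "?v k \<noteq> \<zero>\<^bsub>K\<^esub>"
    using EK.R_memE[OF v] leading_index by blast
  have l: "monomial K \<one>\<^bsub>K\<^esub> 0 k = ?v k"
    using EK.R_mult_leading[OF u(2) k(1)] vanishes_below_closed[OF k(1)] uv u(3) by simp
  then have "k = 0" using k(2) by (auto simp: monomial_def split: if_splits)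
  then show "vanishes_below K 0 ?v" "?v 0 = \<one>\<^bsub>K\<^esub>" using k(1) l by (auto simp: monomial_def)
qed

text \<open>Induction over the exponents, which can start because \<open>w\<close> vanishes below
  some \<open>N\<close>. It takes the place of successive approximation: \<open>w\<close> exists
  beforehand, and only the position of its coefficients is in question.\<close>

lemma coefficients_induct:
  assumes "w \<in> carrier E" "\<zero> \<in> J" "\<And>m. (\<And>i. i < m \<Longrightarrow> w i \<in> \<iota> ` J) \<Longrightarrow> w m \<in> \<iota> ` J"
  shows "w m \<in> \<iota> ` J"
proof -
  obtain N where N: "vanishes_below K N w" using EK.R_memE[OF assms(1)] by blast
  show ?thesis
  proof (induction "nat (m - N)" arbitrary: m rule: less_induct)
    case less
    show ?case
    proof (rule assms(3))
      fix i assume i: "i < m"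
      show "w i \<in> \<iota> ` J"
      proof (cases "i < N")
        case True
        then have "w i = \<iota> \<zero>" using vanishes_below_zero[OF N] by simp
        then show ?thesis using assms(2) by blast
      qed (use less i in simp)
    qed
  qed
qed

text \<open>If \<open>J\<close> is the leading ideal of \<open>I\<close> and \<open>\<Sum> a\<^sub>i b\<^sub>i = 1\<close> with \<open>a\<^sub>i \<in> J\<close> and
  \<open>b\<^sub>i \<in> J\<^sup>-\<^sup>1\<close>, then the unit is \<open>u = \<Sum> f\<^sub>i b\<^sub>i\<close> for lifts \<open>f\<^sub>i \<in> I\<close> of the \<open>a\<^sub>i\<close>.\<close>

lemma right_ideal_structure:
  assumes I: "right_ideal I R" "I \<noteq> {\<zero>\<^bsub>R\<^esub>}"
  shows "\<exists>u. u \<in> carrier E \<and> vanishes_below K 0 u \<and> u 0 = \<one>\<^bsub>K\<^esub> \<and>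
    j ` I = (\<lambda>h. u \<otimes>\<^bsub>E\<^esub> j h) ` ideal_series (leading_ideal I)"
proof -
  interpret R: ring R by (rule ring_R)
  interpret E: ring E by (rule E_ring)
  interpret I: additive_subgroup I R using I(1) by (simp add: right_ideal_def)
  let ?J = "leading_ideal I"
  have J: "ideal ?J D" "?J \<noteq> {\<zero>}" using leading_ideal_ideal leading_ideal_nonzero I by auto
  have Jc: "?J \<subseteq> carrier D" using J by (simp add: additive_subgroup.a_subset ideal.axioms(1))
  have IR: "I \<subseteq> carrier R" by (rule I.a_subset)
  obtain n a b where ab: "\<And>i. i < n \<Longrightarrow> a i \<in> ?J" "\<And>i. i < n \<Longrightarrow> b i \<in> carrier K"
      "\<And>i x. i < n \<Longrightarrow> x \<in> ?J \<Longrightarrow> b i \<otimes>\<^bsub>K\<^esub> \<iota> x \<in> \<iota> ` carrier D"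
      and sum: "(\<Oplus>\<^bsub>K\<^esub>i\<in>{..<n::nat}. \<iota> (a i) \<otimes>\<^bsub>K\<^esub> b i) = \<one>\<^bsub>K\<^esub>"
    using invertible_data[OF J] by blast
  have "\<forall>i. \<exists>f. i < n \<longrightarrow> f \<in> I \<and> vanishes_below D 0 f \<and> a i = f 0"
    using ab(1) unfolding leading_ideal_def by blast
  then obtain f where f: "\<And>i. i < n \<Longrightarrow> f i \<in> I" "\<And>i. i < n \<Longrightarrow> vanishes_below D 0 (f i)"
     "\<And>i. i < n \<Longrightarrow> a i = f i 0" by metis
  have fR: "f i \<in> carrier R" if "i < n" for i using f(1) IR that by blast
  let ?b = "\<lambda>i. monomial K (b i) 0"
  have bE: "?b i \<in> carrier E" if "i < n" for i using ab(2) that by simp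
  define u where "u = (\<Oplus>\<^bsub>E\<^esub>i\<in>{..<n}. j (f i) \<otimes>\<^bsub>E\<^esub> ?b i)"
  have cl: "(\<lambda>i. j (f i) \<otimes>\<^bsub>E\<^esub> ?b i) \<in> {..<n} \<rightarrow> carrier E" using fR bE by auto
  have uE: "u \<in> carrier E" unfolding u_def using cl by (rule E.finsum_closed)
  have fb: "(j (f i) \<otimes>\<^bsub>E\<^esub> ?b i) m = \<iota> (f i m) \<otimes>\<^bsub>K\<^esub> EK.s m (b i)" if "i < n" for i m
    using EK.R_mult_monomial_right[OF j_closed[OF fR[OF that]] ab(2)[OF that], of 0 m] by (simp add: j_def)
  have um: "u m = (\<Oplus>\<^bsub>K\<^esub>i\<in>{..<n}. \<iota> (f i m) \<otimes>\<^bsub>K\<^esub> EK.s m (b i))" for m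
    unfolding u_def EK.R_finsum_apply[OF cl]
    using fb R_coeff_closed[OF fR] ab(2) by (intro EK.finsum_cong') auto
  have u0: "u 0 = \<one>\<^bsub>K\<^esub>"
    unfolding um sum[symmetric] using f(3) ab(1,2) Jc
    by (intro EK.finsum_cong') (auto simp: subset_iff)
  have uv: "vanishes_below K 0 u"
    unfolding vanishes_below_def
  proof (intro conjI allI impI)
    show "u i \<in> carrier K" for i by (rule EK.R_coeff_closed[OF uE])
    fix m :: int assume "m < 0"
    then have "u m = (\<Oplus>\<^bsub>K\<^esub>i\<in>{..<n}. \<zero>\<^bsub>K\<^esub>)"
      unfolding um using ab(2) vanishes_below_zero[OF f(2)] by (intro EK.finsum_cong') auto
    then show "u m = \<zero>\<^bsub>K\<^esub>" by simp
  qed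
  \<comment> \<open>Write \<open>u h = \<Sum> f i (b i h)\<close>. The constant \<open>b i\<close>
    multiplies coefficients from the left without a twist, and \<open>b i J \<subseteq> D\<close>,
    so each \<open>b i h\<close> lies in \<open>R\<close> and the sum lies in the right ideal
    \<open>I\<close>.\<close>
  have down: "\<exists>g\<in>I. u \<otimes>\<^bsub>E\<^esub> j h = j g" if h: "h \<in> ideal_series ?J" for h
  proof -
    have hR: "h \<in> carrier R" and hJ: "h i \<in> ?J" for i using h by (auto simp: ideal_series_def)
    have "\<exists>h'\<in>carrier R. j h' = ?b i \<otimes>\<^bsub>E\<^esub> j h" if i: "i < n" for i
    proof -
      have "(?b i \<otimes>\<^bsub>E\<^esub> j h) m \<in> \<iota> ` carrier D" for m
        using EK.R_mult_monomial_left[OF j_closed[OF hR] ab(2)[OF i], of 0 m] ab(3)[OF i hJ[of m]]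
        by (simp add: j_def)
      then show ?thesis using j_in_image[of "?b i \<otimes>\<^bsub>E\<^esub> j h" "carrier D"] bE[OF i] hR by auto
    qed
    then have "\<forall>i. \<exists>h'. i < n \<longrightarrow> h' \<in> carrier R \<and> j h' = ?b i \<otimes>\<^bsub>E\<^esub> j h" by blast
    then obtain h' where h': "\<And>i. i < n \<Longrightarrow> h' i \<in> carrier R" "\<And>i. i < n \<Longrightarrow> j (h' i) = ?b i \<otimes>\<^bsub>E\<^esub> j h"
      by metis
    have fh: "f i \<otimes>\<^bsub>R\<^esub> h' i \<in> I" if "i < n" for i using I(1) f(1) h'(1) that by (auto simp: right_ideal_def)
    have fh': "f i \<otimes>\<^bsub>R\<^esub> h' i \<in> carrier R" if "i < n" for i using fh[OF that] IR by blast
    have "u \<otimes>\<^bsub>E\<^esub> j h = (\<Oplus>\<^bsub>E\<^esub>i\<in>{..<n}. (j (f i) \<otimes>\<^bsub>E\<^esub> ?b i) \<otimes>\<^bsub>E\<^esub> j h)"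
      unfolding u_def by (rule E.finsum_ldistr) (use cl hR in auto)
    also have "\<dots> = (\<Oplus>\<^bsub>E\<^esub>i\<in>{..<n}. j (f i \<otimes>\<^bsub>R\<^esub> h' i))"
      using fR bE hR h' by (intro E.finsum_cong') (auto simp: j_mult E.m_assoc)
    also have "\<dots> = j (\<Oplus>\<^bsub>R\<^esub>i\<in>{..<n}. f i \<otimes>\<^bsub>R\<^esub> h' i)"
      by (rule additive_finsum[OF R.is_abelian_group E.is_abelian_group, symmetric])
        (use fh' j_hom in \<open>auto simp: ring_hom_def\<close>)
    finally have "u \<otimes>\<^bsub>E\<^esub> j h = j (\<Oplus>\<^bsub>R\<^esub>i\<in>{..<n}. f i \<otimes>\<^bsub>R\<^esub> h' i)" .
    moreover have "finsum (regular_module R) (\<lambda>i. f i \<otimes>\<^bsub>R\<^esub> h' i) {..<n} \<in> I"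
      by (rule right_submodule_finsum[OF right_module_regular[OF ring_R]])
        (use I(1) fh right_submodule_regular_iff[OF ring_R] in auto)
    ultimately show ?thesis unfolding finsum_regular by blast
  qed
  have uU: "u \<in> Units E" by (rule E_unit_inverse(1)[OF uE uv u0])
  have up: "\<exists>h\<in>ideal_series ?J. j g = u \<otimes>\<^bsub>E\<^esub> j h" if g: "g \<in> I" for g
  proof -
    have gR: "g \<in> carrier R" using g IR by blast
    define w where "w = inv\<^bsub>E\<^esub> u \<otimes>\<^bsub>E\<^esub> j g"
    have wE: "w \<in> carrier E" using uU gR by (simp add: w_def)
    have uw: "u \<otimes>\<^bsub>E\<^esub> w = j g" using uU uE gR by (simp add: w_def E.m_assoc[symmetric])
    obtain N where N: "vanishes_below K N w" using EK.R_memE[OF wE] by blast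
    have zJ: "\<zero> \<in> ?J" using J(1) by (simp add: additive_subgroup.zero_closed ideal.axioms(1))
    \<comment> \<open>Let \<open>t\<close> be the part of \<open>w\<close> below exponent
      \<open>M\<close>. By \<open>down\<close>, \<open>u t\<close> lies in \<open>I\<close>, hence
      so does \<open>g - u t = u (w - t)\<close>. Since \<open>u\<close> starts with 1, the
      coefficient of this element at \<open>M\<close> is \<open>w M\<close>, and all lower ones
      vanish; so \<open>w M\<close> is a lowest coefficient of an element of
      \<open>I\<close>.\<close>
    have step: "w M \<in> \<iota> ` ?J" if M: "\<And>m. m < M \<Longrightarrow> w m \<in> \<iota> ` ?J" for M
    proof -
      define t where "t m = (if m < M then w m else \<zero>\<^bsub>K\<^esub>)" for m
      have tE: "t \<in> carrier E"
        using N by (intro EK.R_memI[of N]) (auto simp: vanishes_below_def t_def)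
      have "t m \<in> \<iota> ` ?J" for m using M zJ by (auto simp: t_def intro!: image_eqI[of _ \<iota> \<zero>])
      then obtain h where h: "h \<in> carrier R" "j h = t" "range h \<subseteq> ?J" using j_in_image[OF tE _ Jc] by blast
      then obtain g' where g': "g' \<in> I" "u \<otimes>\<^bsub>E\<^esub> j h = j g'"
        using down[of h] by (auto simp: ideal_series_def)
      have g'R: "g' \<in> carrier R" using g' IR by blast
      have gg: "g \<ominus>\<^bsub>R\<^esub> g' \<in> I" using g g' by (simp add: a_minus_def I.a_inv_closed)
      have "j (g \<ominus>\<^bsub>R\<^esub> g') = u \<otimes>\<^bsub>E\<^esub> (w \<ominus>\<^bsub>E\<^esub> t)"
        unfolding j_diff[OF gR g'R] uw[symmetric] g'(2)[symmetric] h(2)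
        using uE wE tE by (simp add: a_minus_def E.r_distr E.r_minus)
      moreover have wt: "vanishes_below K M (w \<ominus>\<^bsub>E\<^esub> t)"
        unfolding vanishes_below_def EK.R_minus_apply[OF wE tE]
        using EK.R_coeff_closed[OF wE] EK.R_coeff_closed[OF tE]
        by (auto simp: t_def a_minus_def EK.r_neg)
      ultimately have v: "vanishes_below K M (j (g \<ominus>\<^bsub>R\<^esub> g'))" and
        l: "j (g \<ominus>\<^bsub>R\<^esub> g') M = u 0 \<otimes>\<^bsub>K\<^esub> EK.s 0 ((w \<ominus>\<^bsub>E\<^esub> t) M)"
        using EK.R_mult_vanishes[OF uv wt] EK.R_mult_leading[OF uv wt] by auto
      have l': "\<iota> ((g \<ominus>\<^bsub>R\<^esub> g') M) = w M"
        using l EK.R_coeff_closed[OF wE] unfolding u0 EK.R_minus_apply[OF wE tE]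
        by (simp add: j_def t_def a_minus_def)
      have ggR: "g \<ominus>\<^bsub>R\<^esub> g' \<in> carrier R" using gg IR by blast
      have "(g \<ominus>\<^bsub>R\<^esub> g') i = \<zero>" if "i < M" for i
        using vanishes_below_zero[OF v that] R_coeff_closed[OF ggR] by (simp add: j_def)
      then have "vanishes_below D M (g \<ominus>\<^bsub>R\<^esub> g')" using R_coeff_closed[OF ggR] by (simp add: vanishes_below_def)
      then have "(g \<ominus>\<^bsub>R\<^esub> g') M \<in> ?J" by (rule leading_idealI[OF I(1) gg])
      then show ?thesis using l' by force
    qed
    have "w m \<in> \<iota> ` ?J" for m by (rule coefficients_induct[OF wE zJ step])
    then obtain h where "h \<in> carrier R" "j h = w" "range h \<subseteq> ?J" using j_in_image[OF wE _ Jc] by blast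
    then show ?thesis using uw by (intro bexI[of _ h]) (auto simp: ideal_series_def)
  qed
  have "j ` I = (\<lambda>h. u \<otimes>\<^bsub>E\<^esub> j h) ` ideal_series ?J"
  proof (intro equalityI subsetI)
    fix y assume "y \<in> j ` I"
    then show "y \<in> (\<lambda>h. u \<otimes>\<^bsub>E\<^esub> j h) ` ideal_series ?J" using up by blast
  next
    fix y assume "y \<in> (\<lambda>h. u \<otimes>\<^bsub>E\<^esub> j h) ` ideal_series ?J"
    then show "y \<in> j ` I" using down by blast
  qed
  then show ?thesis using uE uv u0 by blast
qed

text \<open>The isomorphism is left multiplication by \<open>u\<close>, which commutes with the
  right action. It has to be carried out in \<open>E\<close>, since \<open>u\<close> has
  coefficients in \<open>K\<close>, and is read back in \<open>I\<close> through the injectivity of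
  \<open>j\<close>.\<close>

lemma right_ideal_isomorphic:
  assumes I: "right_ideal I R" "I \<noteq> {\<zero>\<^bsub>R\<^esub>}"
  shows "module_isomorphic R (LM (ideal_as_module D (leading_ideal I))) (ideal_as_module R I)"
proof -
  interpret R: ring R by (rule ring_R)
  interpret E: ring E by (rule E_ring)
  let ?J = "leading_ideal I" let ?M = "ideal_as_module D ?J"
  have J: "ideal ?J D" using leading_ideal_ideal I by auto
  have Jc: "?J \<subseteq> carrier D" using J by (simp add: additive_subgroup.a_subset ideal.axioms(1))
  have M: "right_module D ?M" by (rule right_module_ideal[OF ring_axioms ideal_imp_right_ideal[OF J]])
  obtain u where u: "u \<in> carrier E" "vanishes_below K 0 u" "u 0 = \<one>\<^bsub>K\<^esub>"
    and im: "j ` I = (\<lambda>h. u \<otimes>\<^bsub>E\<^esub> j h) ` ideal_series ?J" using right_ideal_structure[OF I] by blast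
  have uU: "u \<in> Units E" by (rule E_unit_inverse(1)[OF u])
  have IR: "I \<subseteq> carrier R" using I(1) by (auto simp: right_ideal_def dest: additive_subgroup.a_subset)
  have LMJ: "carrier (LM ?M) = ideal_series ?J"
  proof (intro equalityI subsetI)
    fix h assume "h \<in> carrier (LM ?M)"
    then obtain k where k: "vanishes_below ?M k h" by auto
    then have "vanishes_below D k h" using Jc by (auto simp: vanishes_below_def)
    then show "h \<in> ideal_series ?J"
      using k R_memI by (auto simp: ideal_series_def vanishes_below_def)
  next
    fix h assume h: "h \<in> ideal_series ?J"
    then have "h \<in> carrier R" by (simp add: ideal_series_def)
    then obtain k where "vanishes_below D k h" using R_memE by blast
    then have "vanishes_below ?M k h" using h by (auto simp: ideal_series_def vanishes_below_def)
    then show "h \<in> carrier (LM ?M)" by auto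
  qed
  have LMc: "h \<in> carrier R" if "h \<in> ideal_series ?J" for h using that by (simp add: ideal_series_def)
  define \<theta> where "\<theta> h = inv_into I j (u \<otimes>\<^bsub>E\<^esub> j h)" for h
  have \<theta>: "\<theta> h \<in> I" "j (\<theta> h) = u \<otimes>\<^bsub>E\<^esub> j h" if "h \<in> ideal_series ?J" for h
  proof -
    have "u \<otimes>\<^bsub>E\<^esub> j h \<in> j ` I" using im that by blast
    then show "\<theta> h \<in> I" "j (\<theta> h) = u \<otimes>\<^bsub>E\<^esub> j h" by (auto simp: \<theta>_def inv_into_into f_inv_into_f)
  qed
  have jI: "x = y" if "x \<in> carrier R" "y \<in> carrier R" "j x = j y" for x y
    using that j_inj by (auto dest: inj_onD)
  have smul: "g \<odot>\<^bsub>LM ?M\<^esub> h = h \<otimes>\<^bsub>R\<^esub> g" if h: "h \<in> ideal_series ?J" and g: "g \<in> carrier R" for g h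
  proof
    fix n
    obtain k l where k: "vanishes_below D k h" and l: "vanishes_below D l g"
      using g LMc[OF h] R_memE by blast
    have hJ: "h i \<in> ?J" for i using h by (auto simp: ideal_series_def)
    have k': "vanishes_below ?M k h" using k hJ by (simp add: vanishes_below_def)
    have cl: "(\<lambda>i. h i \<otimes> s i (g (n - i))) \<in> {k..n - l} \<rightarrow> ?J"
      using hJ vanishes_below_closed[OF l] J by (auto simp: ideal.I_r_closed)
    show "(g \<odot>\<^bsub>LM ?M\<^esub> h) n = (h \<otimes>\<^bsub>R\<^esub> g) n"
      using act_window[OF M k' l order_refl order_refl, of n] R_mult_window[OF k l order_refl order_refl, of n]
        finsum_right_ideal[OF ring_axioms ideal_imp_right_ideal[OF J] cl] by simp
  qed
  interpret L: right_module R "LM ?M" by (rule right_module_laurent[OF M])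
  have "right_linear R (LM ?M) (ideal_as_module R I) \<theta>"
  proof (rule right_linearI)
    fix h assume "h \<in> carrier (LM ?M)"
    then show "\<theta> h \<in> carrier (ideal_as_module R I)" using \<theta>(1) by (simp add: LMJ del: laurent_module_simps)
  next
    fix h h' assume hh: "h \<in> carrier (LM ?M)" "h' \<in> carrier (LM ?M)"
    have c: "h \<oplus>\<^bsub>LM ?M\<^esub> h' \<in> ideal_series ?J" using L.M.a_closed[OF hh] unfolding LMJ .
    have hh': "h \<in> ideal_series ?J" "h' \<in> ideal_series ?J" using hh unfolding LMJ by auto
    have e: "h \<oplus>\<^bsub>LM ?M\<^esub> h' = h \<oplus>\<^bsub>R\<^esub> h'" by (simp add: skew_laurent_ring_simps)
    have "\<theta> (h \<oplus>\<^bsub>R\<^esub> h') = \<theta> h \<oplus>\<^bsub>R\<^esub> \<theta> h'"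
    proof (rule jI)
      show "\<theta> (h \<oplus>\<^bsub>R\<^esub> h') \<in> carrier R" "\<theta> h \<oplus>\<^bsub>R\<^esub> \<theta> h' \<in> carrier R"
        using \<theta>(1)[OF c] \<theta>(1)[OF hh'(1)] \<theta>(1)[OF hh'(2)] IR unfolding e by auto
      show "j (\<theta> (h \<oplus>\<^bsub>R\<^esub> h')) = j (\<theta> h \<oplus>\<^bsub>R\<^esub> \<theta> h')"
        using \<theta>[OF c[unfolded e]] \<theta>[OF hh'(1)] \<theta>[OF hh'(2)] IR LMc[OF hh'(1)] LMc[OF hh'(2)] j_hom u(1)
        by (simp add: ring_hom_def E.r_distr subset_iff)
    qed
    then show "\<theta> (h \<oplus>\<^bsub>LM ?M\<^esub> h') = \<theta> h \<oplus>\<^bsub>ideal_as_module R I\<^esub> \<theta> h'" unfolding e by simp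
  next
    fix g h assume gh: "g \<in> carrier R" "h \<in> carrier (LM ?M)"
    have c: "g \<odot>\<^bsub>LM ?M\<^esub> h \<in> ideal_series ?J" using L.smult_closed[OF gh] unfolding LMJ .
    have h': "h \<in> ideal_series ?J" using gh unfolding LMJ by auto
    note e = smul[OF h' gh(1)]
    have "\<theta> (h \<otimes>\<^bsub>R\<^esub> g) = \<theta> h \<otimes>\<^bsub>R\<^esub> g"
    proof (rule jI)
      show "\<theta> (h \<otimes>\<^bsub>R\<^esub> g) \<in> carrier R" "\<theta> h \<otimes>\<^bsub>R\<^esub> g \<in> carrier R"
        using \<theta>(1)[OF c] \<theta>(1)[OF h'] IR gh(1) unfolding e by auto
      show "j (\<theta> (h \<otimes>\<^bsub>R\<^esub> g)) = j (\<theta> h \<otimes>\<^bsub>R\<^esub> g)"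
        using \<theta>[OF c[unfolded e]] \<theta>[OF h'] IR LMc[OF h'] gh(1) u(1)
        by (simp add: j_mult E.m_assoc subset_iff)
    qed
    then show "\<theta> (g \<odot>\<^bsub>LM ?M\<^esub> h) = g \<odot>\<^bsub>ideal_as_module R I\<^esub> \<theta> h" unfolding e by simp
  qed
  moreover have "bij_betw \<theta> (carrier (LM ?M)) (carrier (ideal_as_module R I))"
    unfolding LMJ bij_betw_def
  proof
    show "inj_on \<theta> (ideal_series ?J)"
    proof (rule inj_onI)
      fix x y assume xy: "x \<in> ideal_series ?J" "y \<in> ideal_series ?J" "\<theta> x = \<theta> y"
      then have "u \<otimes>\<^bsub>E\<^esub> j x = u \<otimes>\<^bsub>E\<^esub> j y" using \<theta>(2) by metis
      then have "j x = j y" using uU xy LMc by simp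
      then show "x = y" using jI LMc xy by blast
    qed
    show "\<theta> ` ideal_series ?J = carrier (ideal_as_module R I)"
    proof (intro equalityI subsetI)
      fix g assume "g \<in> carrier (ideal_as_module R I)"
      then have g: "g \<in> I" by simp
      then have "j g \<in> (\<lambda>h. u \<otimes>\<^bsub>E\<^esub> j h) ` ideal_series ?J" using im by blast
      then obtain h where h: "h \<in> ideal_series ?J" "j g = u \<otimes>\<^bsub>E\<^esub> j h" by blast
      have "\<theta> h = g" using \<theta>[OF h(1)] h(2) g IR by (intro jI) auto
      then show "g \<in> \<theta> ` ideal_series ?J" using h(1) by blast
    qed (use \<theta>(1) in auto)
  qed
  ultimately show ?thesis unfolding module_isomorphic_iff by blast
qed

text \<open>A separate case, because the zero ideal of \<open>D\<close> has no inverse from which a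
  unit could be built.\<close>

lemma zero_ideal_isomorphic:
  "module_isomorphic R (LM (ideal_as_module D {\<zero>})) (ideal_as_module R {\<zero>\<^bsub>R\<^esub>})"
proof -
  have "carrier (LM (ideal_as_module D {\<zero>})) = {\<lambda>_. \<zero>}"
    by (auto simp: vanishes_below_def)
  moreover have "act (ideal_as_module D {\<zero>}) (\<lambda>_. \<zero>) g = (\<lambda>_. \<zero>)" for g
  proof -
    have "abelian_monoid (ideal_as_module D {\<zero>})"
      using right_moduleD(2)[OF right_module_ideal[OF ring_axioms ideal_imp_right_ideal[OF zeroideal]]]
      by (rule abelian_group.axioms)
    then show ?thesis
      by (simp add: laurent_action_def fun_eq_iff abelian_monoid.finsum_empty)
  qed
  moreover have "\<zero>\<^bsub>R\<^esub> \<otimes>\<^bsub>R\<^esub> g = \<zero>\<^bsub>R\<^esub>" "\<zero>\<^bsub>R\<^esub> \<oplus>\<^bsub>R\<^esub> \<zero>\<^bsub>R\<^esub> = \<zero>\<^bsub>R\<^esub>" if "g \<in> carrier R" for g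
  proof -
    interpret R: ring R by (rule ring_R)
    show "\<zero>\<^bsub>R\<^esub> \<otimes>\<^bsub>R\<^esub> g = \<zero>\<^bsub>R\<^esub>" "\<zero>\<^bsub>R\<^esub> \<oplus>\<^bsub>R\<^esub> \<zero>\<^bsub>R\<^esub> = \<zero>\<^bsub>R\<^esub>" using that by simp_all
  qed
  ultimately show ?thesis unfolding module_isomorphic_def
    by (intro exI[of _ "\<lambda>f. f"])
       (auto simp: bij_betw_def skew_laurent_ring_simps simp del: laurent_module_simps(1))
qed

lemma right_ideal_laurent:
  assumes "right_ideal I R"
  shows "\<exists>J. ideal J D \<and> module_isomorphic R (LM (ideal_as_module D J)) (ideal_as_module R I)"
  using right_ideal_isomorphic[OF assms] leading_ideal_ideal[OF assms] zero_ideal_isomorphic zeroideal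
  by (cases "I = {\<zero>\<^bsub>R\<^esub>}") auto

lemma ideals_fin_proj_R: "ideals_fin_proj R"
  unfolding ideals_fin_proj_def
proof (intro conjI allI impI)
  show "ring R" by (rule ring_R)
  fix I assume I: "right_ideal I R"
  obtain J where J: "ideal J D" "module_isomorphic R (LM (ideal_as_module D J)) (ideal_as_module R I)"
    using right_ideal_laurent[OF I] by blast
  have "fin_proj D (ideal_as_module D J)"
    using ideals_fin_proj_D ideal_imp_right_ideal[OF J(1)] by (simp add: ideals_fin_proj_def)
  then show "fin_proj R (ideal_as_module R I)"
    using fin_proj_isomorphic[OF fin_proj_laurent right_module_ideal[OF ring_R I] J(2)] by blast
qed

end

section \<open>Ore conditions and rings of fractions\<close>

text \<open>If \<open>aS \<inter> tS = 0\<close>, then the right ideals \<open>I\<^sub>0 = 0\<close>, \<open>I\<^sub>n\<^sub>+\<^sub>1 = tS + a I\<^sub>n\<close> form a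
  strictly increasing chain: \<open>a\<^sup>n t \<in> I\<^sub>n\<^sub>+\<^sub>1 - I\<^sub>n\<close>.\<close>

lemma right_ore:
  assumes dom: "noncommutative_domain S" and noeth: "right_noetherian S"
    and a: "a \<in> carrier S" and t: "t \<in> carrier S" "t \<noteq> \<zero>\<^bsub>S\<^esub>"
  shows "\<exists>a'\<in>carrier S. \<exists>t'\<in>carrier S. t' \<noteq> \<zero>\<^bsub>S\<^esub> \<and> a \<otimes>\<^bsub>S\<^esub> t' = t \<otimes>\<^bsub>S\<^esub> a'"
proof (rule ccontr)
  assume no: "\<not> ?thesis"
  interpret ring S using dom by (simp add: noncommutative_domain_def)
  define I where "I = rec_nat {\<zero>\<^bsub>S\<^esub>} (\<lambda>_ Y. {t \<otimes>\<^bsub>S\<^esub> r \<oplus>\<^bsub>S\<^esub> a \<otimes>\<^bsub>S\<^esub> y | r y. r \<in> carrier S \<and> y \<in> Y})"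
  have I0: "I 0 = {\<zero>\<^bsub>S\<^esub>}" by (simp add: I_def)
  have IS: "I (Suc n) = {t \<otimes>\<^bsub>S\<^esub> r \<oplus>\<^bsub>S\<^esub> a \<otimes>\<^bsub>S\<^esub> y | r y. r \<in> carrier S \<and> y \<in> I n}" for n
    by (simp add: I_def)
  have ISI: "t \<otimes>\<^bsub>S\<^esub> r \<oplus>\<^bsub>S\<^esub> a \<otimes>\<^bsub>S\<^esub> y \<in> I (Suc n)" if "r \<in> carrier S" "y \<in> I n" for r y n
    unfolding IS using that by blast
  have sub: "right_submodule S (regular_module S) (I n)" for n
  proof (induction n)
    case 0 show ?case by (auto simp: I0 right_submodule_def)
  next
    case (Suc n)
    have c: "I n \<subseteq> carrier S" using Suc by (simp add: right_submodule_def)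
    show ?case unfolding right_submodule_def
    proof (intro conjI ballI)
      show "I (Suc n) \<subseteq> carrier (regular_module S)" unfolding IS using c a t by auto
      have "t \<otimes>\<^bsub>S\<^esub> \<zero>\<^bsub>S\<^esub> \<oplus>\<^bsub>S\<^esub> a \<otimes>\<^bsub>S\<^esub> \<zero>\<^bsub>S\<^esub> \<in> I (Suc n)"
        by (rule ISI) (use Suc in \<open>auto simp: right_submodule_def\<close>)
      then show "\<zero>\<^bsub>regular_module S\<^esub> \<in> I (Suc n)" using a t by simp
    next
      fix x y assume "x \<in> I (Suc n)" "y \<in> I (Suc n)"
      then obtain r p r' p' where rp: "x = t \<otimes>\<^bsub>S\<^esub> r \<oplus>\<^bsub>S\<^esub> a \<otimes>\<^bsub>S\<^esub> p" "r \<in> carrier S" "p \<in> I n"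
        "y = t \<otimes>\<^bsub>S\<^esub> r' \<oplus>\<^bsub>S\<^esub> a \<otimes>\<^bsub>S\<^esub> p'" "r' \<in> carrier S" "p' \<in> I n" unfolding IS by blast
      then have pc: "p \<in> carrier S" "p' \<in> carrier S" using c by auto
      have "t \<otimes>\<^bsub>S\<^esub> (r \<oplus>\<^bsub>S\<^esub> r') \<oplus>\<^bsub>S\<^esub> a \<otimes>\<^bsub>S\<^esub> (p \<oplus>\<^bsub>S\<^esub> p') \<in> I (Suc n)"
        by (rule ISI) (use rp right_submodule_add[OF Suc, of p p'] in auto)
      then show "x \<oplus>\<^bsub>regular_module S\<^esub> y \<in> I (Suc n)"
        using rp pc a t by (simp add: r_distr a_ac)
    next
      fix d x assume d: "d \<in> carrier S" and "x \<in> I (Suc n)"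
      then obtain r p where rp: "x = t \<otimes>\<^bsub>S\<^esub> r \<oplus>\<^bsub>S\<^esub> a \<otimes>\<^bsub>S\<^esub> p" "r \<in> carrier S" "p \<in> I n"
        unfolding IS by blast
      then have pc: "p \<in> carrier S" using c by auto
      have "t \<otimes>\<^bsub>S\<^esub> (r \<otimes>\<^bsub>S\<^esub> d) \<oplus>\<^bsub>S\<^esub> a \<otimes>\<^bsub>S\<^esub> (p \<otimes>\<^bsub>S\<^esub> d) \<in> I (Suc n)"
        by (rule ISI) (use rp d right_submodule_smult[OF Suc d, of p] in auto)
      then show "d \<odot>\<^bsub>regular_module S\<^esub> x \<in> I (Suc n)"
        using rp pc a t d by (simp add: l_distr m_assoc)
    qed
  qed
  have Ic: "I n \<subseteq> carrier S" for n using sub by (simp add: right_submodule_def)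
  have inc: "I n \<subseteq> I (Suc n)" for n
  proof (induction n)
    case 0
    have "t \<otimes>\<^bsub>S\<^esub> \<zero>\<^bsub>S\<^esub> \<oplus>\<^bsub>S\<^esub> a \<otimes>\<^bsub>S\<^esub> \<zero>\<^bsub>S\<^esub> \<in> I (Suc 0)" by (rule ISI) (auto simp: I0)
    then show ?case using a t by (simp add: I0)
  next
    case (Suc n)
    show ?case
    proof
      fix x assume "x \<in> I (Suc n)"
      then obtain r p where "x = t \<otimes>\<^bsub>S\<^esub> r \<oplus>\<^bsub>S\<^esub> a \<otimes>\<^bsub>S\<^esub> p" "r \<in> carrier S" "p \<in> I n"
        unfolding IS by blast
      then show "x \<in> I (Suc (Suc n))" using ISI[of r p "Suc n"] Suc by auto
    qed
  qed
  define w where "w = rec_nat t (\<lambda>_ x. a \<otimes>\<^bsub>S\<^esub> x)"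
  have w0: "w 0 = t" and wS: "w (Suc n) = a \<otimes>\<^bsub>S\<^esub> w n" for n by (simp_all add: w_def)
  have wc: "w n \<in> carrier S" for n by (induction n) (use a t in \<open>auto simp: w0 wS\<close>)
  have win: "w n \<in> I (Suc n)" for n
  proof (induction n)
    case 0
    have "t \<otimes>\<^bsub>S\<^esub> \<one>\<^bsub>S\<^esub> \<oplus>\<^bsub>S\<^esub> a \<otimes>\<^bsub>S\<^esub> \<zero>\<^bsub>S\<^esub> \<in> I (Suc 0)" by (rule ISI) (auto simp: I0)
    then show ?case using a t by (simp add: w0)
  next
    case (Suc n)
    have "t \<otimes>\<^bsub>S\<^esub> \<zero>\<^bsub>S\<^esub> \<oplus>\<^bsub>S\<^esub> a \<otimes>\<^bsub>S\<^esub> w n \<in> I (Suc (Suc n))" by (rule ISI) (use Suc in auto)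
    then show ?case using a t wc by (simp add: wS)
  qed
  have wout: "w n \<notin> I n" for n
  proof (induction n)
    case 0 show ?case using t by (simp add: w0 I0)
  next
    case (Suc n)
    show ?case
    proof
      assume "w (Suc n) \<in> I (Suc n)"
      then obtain r y where ry: "a \<otimes>\<^bsub>S\<^esub> w n = t \<otimes>\<^bsub>S\<^esub> r \<oplus>\<^bsub>S\<^esub> a \<otimes>\<^bsub>S\<^esub> y" "r \<in> carrier S" "y \<in> I n"
        unfolding IS wS by blast
      then have y: "y \<in> carrier S" using Ic by blast
      \<comment> \<open>Unless \<open>w n = y\<close>, the pair \<open>r\<close>,
        \<open>w n - y\<close> would be the one whose existence was denied.\<close>
      have "a \<otimes>\<^bsub>S\<^esub> (w n \<ominus>\<^bsub>S\<^esub> y) = t \<otimes>\<^bsub>S\<^esub> r"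
        using ry(1,2) y wc[of n] a t by (simp add: a_minus_def r_distr r_minus a_assoc r_neg)
      then have "w n \<ominus>\<^bsub>S\<^esub> y = \<zero>\<^bsub>S\<^esub>" using no ry(2) y wc[of n] by blast
      then have "w n = y" using wc[of n] y by simp
      then show False using Suc ry(3) by simp
    qed
  qed
  have "\<forall>n. right_ideal (I n) S"
    unfolding right_submodule_regular_iff[OF ring_axioms, symmetric] using sub by blast
  then have "\<exists>N. \<forall>n\<ge>N. I n = I N" using noeth inc unfolding right_noetherian_def by blast
  then obtain N where N: "\<forall>n\<ge>N. I n = I N" ..
  have "I (Suc N) = I N" by (rule N[rule_format]) simp
  then show False using win[of N] wout[of N] by simp
qed

section \<open>Opposite rings and the left Ore condition\<close>

lemma opposite_ring_simps [simp]:
  "carrier (opposite_ring S) = carrier S" "\<zero>\<^bsub>opposite_ring S\<^esub> = \<zero>\<^bsub>S\<^esub>" "\<one>\<^bsub>opposite_ring S\<^esub> = \<one>\<^bsub>S\<^esub>"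
  "x \<oplus>\<^bsub>opposite_ring S\<^esub> y = x \<oplus>\<^bsub>S\<^esub> y" "x \<otimes>\<^bsub>opposite_ring S\<^esub> y = y \<otimes>\<^bsub>S\<^esub> x"
  by (simp_all add: opposite_ring_def)

lemma ring_opposite:
  assumes "ring S" shows "ring (opposite_ring S)"
proof -
  interpret ring S by fact
  show ?thesis
  proof (rule ringI)
    show "abelian_group (opposite_ring S)"
    proof (rule abelian_groupI, goal_cases)
      case (6 x) then show ?case by (auto intro!: bexI[of _ "\<ominus>\<^bsub>S\<^esub> x"] simp: l_neg)
    qed (auto simp: a_ac)
    show "monoid (opposite_ring S)" by (rule monoidI) (auto simp: m_assoc)
  qed (auto simp: l_distr r_distr)
qed

lemma noncommutative_domain_opposite:
  "noncommutative_domain S \<Longrightarrow> noncommutative_domain (opposite_ring S)"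
  by (auto simp: noncommutative_domain_def ring_opposite)

lemma left_ore:
  assumes "noncommutative_domain S" "left_noetherian S" "a \<in> carrier S" "t \<in> carrier S" "t \<noteq> \<zero>\<^bsub>S\<^esub>"
  shows "\<exists>a'\<in>carrier S. \<exists>t'\<in>carrier S. t' \<noteq> \<zero>\<^bsub>S\<^esub> \<and> t' \<otimes>\<^bsub>S\<^esub> a = a' \<otimes>\<^bsub>S\<^esub> t"
  using right_ore[OF noncommutative_domain_opposite[OF assms(1)], of a t] assms
  by (simp add: left_noetherian_def)

section \<open>Rings of fractions inside a division ring\<close>

lemma division_ring_of_fractionsI:
  assumes S: "ring S" and Q: "ring Q" "\<one>\<^bsub>Q\<^esub> \<noteq> \<zero>\<^bsub>Q\<^esub>"
    and inv: "\<And>x. x \<in> carrier Q \<Longrightarrow> x \<noteq> \<zero>\<^bsub>Q\<^esub> \<Longrightarrow> \<exists>y\<in>carrier Q. x \<otimes>\<^bsub>Q\<^esub> y = \<one>\<^bsub>Q\<^esub>"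
    and \<iota>: "\<iota> \<in> ring_hom S Q" "inj_on \<iota> (carrier S)"
    and r: "\<And>q. q \<in> carrier Q \<Longrightarrow> \<exists>a\<in>carrier S. \<exists>t\<in>carrier S. t \<noteq> \<zero>\<^bsub>S\<^esub> \<and> q \<otimes>\<^bsub>Q\<^esub> \<iota> t = \<iota> a"
    and l: "\<And>q. q \<in> carrier Q \<Longrightarrow> \<exists>a\<in>carrier S. \<exists>t\<in>carrier S. t \<noteq> \<zero>\<^bsub>S\<^esub> \<and> \<iota> t \<otimes>\<^bsub>Q\<^esub> q = \<iota> a"
  shows "division_ring_of_fractions S Q \<iota>"
proof -
  interpret S: ring S by fact
  interpret Q: ring Q by fact
  have U: "Units Q = carrier Q - {\<zero>\<^bsub>Q\<^esub>}" using Q.unitsI_right_inverses inv Q(2) by blast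
  have c: "\<iota> a \<in> carrier Q" if "a \<in> carrier S" for a using \<iota>(1) that by (auto simp: ring_hom_def)
  have z: "\<iota> \<zero>\<^bsub>S\<^esub> = \<zero>\<^bsub>Q\<^esub>"
    using \<iota>(1) by (intro additive_zero[OF S.is_abelian_group Q.is_abelian_group]) (auto simp: ring_hom_def)
  have u: "\<iota> t \<in> Units Q" if "t \<in> carrier S" "t \<noteq> \<zero>\<^bsub>S\<^esub>" for t
    using that c[of t] z \<iota>(2) S.zero_closed unfolding U inj_on_def by (metis DiffI singletonD)
  show ?thesis unfolding division_ring_of_fractions_def
  proof (intro conjI ballI)
    fix q assume q: "q \<in> carrier Q"
    obtain a t where at: "a \<in> carrier S" "t \<in> carrier S" "t \<noteq> \<zero>\<^bsub>S\<^esub>" "q \<otimes>\<^bsub>Q\<^esub> \<iota> t = \<iota> a" using r[OF q] by blast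
    have "q = \<iota> a \<otimes>\<^bsub>Q\<^esub> inv\<^bsub>Q\<^esub> \<iota> t"
      unfolding at(4)[symmetric] using q u[OF at(2,3)] c[OF at(2)] by (simp add: Q.m_assoc)
    then show "\<exists>a\<in>carrier S. \<exists>s\<in>carrier S - {\<zero>\<^bsub>S\<^esub>}. q = \<iota> a \<otimes>\<^bsub>Q\<^esub> inv\<^bsub>Q\<^esub> \<iota> s" using at by blast
    obtain b s where bs: "b \<in> carrier S" "s \<in> carrier S" "s \<noteq> \<zero>\<^bsub>S\<^esub>" "\<iota> s \<otimes>\<^bsub>Q\<^esub> q = \<iota> b" using l[OF q] by blast
    have "q = inv\<^bsub>Q\<^esub> \<iota> s \<otimes>\<^bsub>Q\<^esub> \<iota> b"
      unfolding bs(4)[symmetric] using q u[OF bs(2,3)] c[OF bs(2)] by (simp add: Q.m_assoc[symmetric])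
    then show "\<exists>a\<in>carrier S. \<exists>s\<in>carrier S - {\<zero>\<^bsub>S\<^esub>}. q = inv\<^bsub>Q\<^esub> \<iota> s \<otimes>\<^bsub>Q\<^esub> \<iota> a" using bs by blast
  qed (use Q U \<iota> in \<open>auto simp: division_ring_def\<close>)
qed

lemma ideal_prod_iso:
  assumes e: "\<And>x y. x \<in> C \<Longrightarrow> y \<in> C \<Longrightarrow> e (x \<otimes>\<^bsub>E\<^esub> y) = e x \<otimes>\<^bsub>Q\<^esub> e y \<and> e (x \<oplus>\<^bsub>E\<^esub> y) = e x \<oplus>\<^bsub>Q\<^esub> e y"
    and C: "\<And>x y. x \<in> C \<Longrightarrow> y \<in> C \<Longrightarrow> x \<otimes>\<^bsub>E\<^esub> y \<in> C \<and> x \<oplus>\<^bsub>E\<^esub> y \<in> C" and AB: "A \<subseteq> C" "B \<subseteq> C"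
  shows "ideal_prod Q (e ` A) (e ` B) = e ` ideal_prod E A B"
proof -
  have c: "x \<in> C" if "x \<in> ideal_prod E A B" for x
    using that by induction (use C AB in auto)
  show ?thesis
  proof (intro equalityI subsetI)
    fix x assume "x \<in> ideal_prod Q (e ` A) (e ` B)"
    then show "x \<in> e ` ideal_prod E A B"
    proof induction
      case (prod i j)
      then obtain a b where ab: "a \<in> A" "b \<in> B" "i = e a" "j = e b" by blast
      then have "i \<otimes>\<^bsub>Q\<^esub> j = e (a \<otimes>\<^bsub>E\<^esub> b)" using e AB by (metis subsetD)
      then show ?case using ideal_prod.prod[of a A b B E] ab by blast
    next
      case (sum s1 s2)
      then obtain a b where ab: "a \<in> ideal_prod E A B" "b \<in> ideal_prod E A B" "s1 = e a" "s2 = e b" by blast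
      then have "s1 \<oplus>\<^bsub>Q\<^esub> s2 = e (a \<oplus>\<^bsub>E\<^esub> b)" using e c by metis
      then show ?case using ideal_prod.sum[OF ab(1,2)] by blast
    qed
  next
    fix y assume "y \<in> e ` ideal_prod E A B"
    then obtain x where x: "x \<in> ideal_prod E A B" "y = e x" by blast
    from x(1) have "e x \<in> ideal_prod Q (e ` A) (e ` B)"
    proof induction
      case (prod i j)
      then have "i \<in> C" "j \<in> C" using AB by auto
      then show ?case using e[of i j] ideal_prod.prod[of "e i" "e ` A" "e j" "e ` B" Q] prod by auto
    next
      case (sum s1 s2)
      then show ?case using e[of s1 s2] c[of s1] c[of s2] ideal_prod.sum by metis
    qed
    then show "y \<in> ideal_prod Q (e ` A) (e ` B)" using x by simp
  qed
qed

text \<open>\<open>E\<close> may contain more than the fractions of \<open>S\<close>, and the ring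
  of fractions is required on a fixed type. So the subring \<open>Q0\<close> of right fractions is
  cut out of \<open>E\<close> and copied to that type. The hypothesis \<open>dual\<close> can still
  be checked in \<open>E\<close>: if \<open>e I \<subseteq> S\<close> for a nonzero ideal
  \<open>I\<close>, then \<open>e\<close> is already a fraction.\<close>

lemma asano_criterion:
  fixes S :: "('a, 'm) ring_scheme" and E :: "('e, 'n) ring_scheme"
  assumes dom: "noncommutative_domain S" and noeth: "left_noetherian S" "right_noetherian S"
    and E: "division_ring E" and j: "j \<in> ring_hom S E" "inj_on j (carrier S)"
    and dual: "\<And>I J. \<lbrakk>ideal I S; I \<noteq> {\<zero>\<^bsub>S\<^esub>};
        J = {e \<in> carrier E. \<forall>i\<in>I. e \<otimes>\<^bsub>E\<^esub> j i \<in> j ` carrier S}\<rbrakk> \<Longrightarrow>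
        (\<forall>e\<in>J. \<forall>i\<in>I. j i \<otimes>\<^bsub>E\<^esub> e \<in> j ` carrier S) \<and>
        \<one>\<^bsub>E\<^esub> \<in> ideal_prod E (j ` I) J \<and> \<one>\<^bsub>E\<^esub> \<in> ideal_prod E J (j ` I)"
  shows "all_nonzero_ideals_invertible S"
proof -
  interpret S: ring S using dom by (simp add: noncommutative_domain_def)
  interpret E: ring E using E by (simp add: division_ring_def)
  have integral: "a = \<zero>\<^bsub>S\<^esub> \<or> b = \<zero>\<^bsub>S\<^esub>" if "a \<in> carrier S" "b \<in> carrier S" "a \<otimes>\<^bsub>S\<^esub> b = \<zero>\<^bsub>S\<^esub>" for a b
    using dom that by (simp add: noncommutative_domain_def)
  have one: "\<one>\<^bsub>E\<^esub> \<noteq> \<zero>\<^bsub>E\<^esub>" and U: "Units E = carrier E - {\<zero>\<^bsub>E\<^esub>}" using E by (auto simp: division_ring_def)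
  have jc [simp]: "j a \<in> carrier E" if "a \<in> carrier S" for a using j(1) that by (auto simp: ring_hom_def)
  have jm: "j (a \<otimes>\<^bsub>S\<^esub> b) = j a \<otimes>\<^bsub>E\<^esub> j b" and ja: "j (a \<oplus>\<^bsub>S\<^esub> b) = j a \<oplus>\<^bsub>E\<^esub> j b"
    if "a \<in> carrier S" "b \<in> carrier S" for a b using j(1) that by (auto simp: ring_hom_def)
  have j1: "j \<one>\<^bsub>S\<^esub> = \<one>\<^bsub>E\<^esub>" using j(1) by (auto simp: ring_hom_def)
  have j0: "j \<zero>\<^bsub>S\<^esub> = \<zero>\<^bsub>E\<^esub>"
    by (rule additive_zero[OF S.is_abelian_group E.is_abelian_group]) (auto simp: ja)
  have jz: "j a \<noteq> \<zero>\<^bsub>E\<^esub>" if "a \<in> carrier S" "a \<noteq> \<zero>\<^bsub>S\<^esub>" for a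
    using that j(2) j0 S.zero_closed by (metis inj_onD)
  have jn: "j (\<ominus>\<^bsub>S\<^esub> a) = \<ominus>\<^bsub>E\<^esub> j a" if "a \<in> carrier S" for a
  proof (rule E.minus_equality[symmetric])
    show "j (\<ominus>\<^bsub>S\<^esub> a) \<oplus>\<^bsub>E\<^esub> j a = \<zero>\<^bsub>E\<^esub>" using ja[of "\<ominus>\<^bsub>S\<^esub> a" a] that by (simp add: S.l_neg j0)
  qed (use that in auto)
  define Q0 where "Q0 = {q \<in> carrier E. \<exists>a\<in>carrier S. \<exists>t\<in>carrier S. t \<noteq> \<zero>\<^bsub>S\<^esub> \<and> q \<otimes>\<^bsub>E\<^esub> j t = j a}"
  have Q0E: "Q0 \<subseteq> carrier E" by (auto simp: Q0_def)
  have Q0I: "q \<in> Q0" if "q \<in> carrier E" "a \<in> carrier S" "t \<in> carrier S" "t \<noteq> \<zero>\<^bsub>S\<^esub>" "q \<otimes>\<^bsub>E\<^esub> j t = j a"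
    for q a t using that by (auto simp: Q0_def)
  have sub: "subring Q0 E"
  proof (rule E.subringI[OF Q0E])
    have "\<one>\<^bsub>S\<^esub> \<noteq> \<zero>\<^bsub>S\<^esub>" using dom by (simp add: noncommutative_domain_def)
    then show "\<one>\<^bsub>E\<^esub> \<in> Q0" by (intro Q0I[of _ "\<one>\<^bsub>S\<^esub>" "\<one>\<^bsub>S\<^esub>"]) (auto simp: j1)
  next
    fix q assume "q \<in> Q0"
    then obtain a t where "q \<in> carrier E" "a \<in> carrier S" "t \<in> carrier S" "t \<noteq> \<zero>\<^bsub>S\<^esub>" "q \<otimes>\<^bsub>E\<^esub> j t = j a"
      by (auto simp: Q0_def)
    then show "\<ominus>\<^bsub>E\<^esub> q \<in> Q0" by (intro Q0I[of _ "\<ominus>\<^bsub>S\<^esub> a" t]) (auto simp: E.l_minus jn)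
  next
    fix q p assume "q \<in> Q0" "p \<in> Q0"
    then obtain a t b u where q: "q \<in> carrier E" "a \<in> carrier S" "t \<in> carrier S" "t \<noteq> \<zero>\<^bsub>S\<^esub>" "q \<otimes>\<^bsub>E\<^esub> j t = j a"
      and p: "p \<in> carrier E" "b \<in> carrier S" "u \<in> carrier S" "u \<noteq> \<zero>\<^bsub>S\<^esub>" "p \<otimes>\<^bsub>E\<^esub> j u = j b"
      unfolding Q0_def by blast
    \<comment> \<open>For \<open>q = a / t\<close> and \<open>p = b / u\<close>, the Ore condition
      moves \<open>t\<close> past \<open>b\<close>: from \<open>b t' = t b'\<close> follows
      \<open>q p (u t') = a b'\<close>.\<close>
    obtain b' t' where o: "b' \<in> carrier S" "t' \<in> carrier S" "t' \<noteq> \<zero>\<^bsub>S\<^esub>" "b \<otimes>\<^bsub>S\<^esub> t' = t \<otimes>\<^bsub>S\<^esub> b'"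
      using right_ore[OF dom noeth(2) p(2) q(3,4)] by blast
    have "q \<otimes>\<^bsub>E\<^esub> p \<otimes>\<^bsub>E\<^esub> j (u \<otimes>\<^bsub>S\<^esub> t') = q \<otimes>\<^bsub>E\<^esub> (p \<otimes>\<^bsub>E\<^esub> j u) \<otimes>\<^bsub>E\<^esub> j t'"
      using q(1) p(1,3) o by (simp add: jm E.m_assoc)
    also have "\<dots> = q \<otimes>\<^bsub>E\<^esub> j (b \<otimes>\<^bsub>S\<^esub> t')" unfolding p(5) using q(1) p(2) o(2) by (simp add: jm E.m_assoc)
    also have "\<dots> = (q \<otimes>\<^bsub>E\<^esub> j t) \<otimes>\<^bsub>E\<^esub> j b'" unfolding o(4) using q(1,3) o(1) by (simp add: jm E.m_assoc)
    also have "\<dots> = j (a \<otimes>\<^bsub>S\<^esub> b')" unfolding q(5) using q o by (simp add: jm)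
    finally show "q \<otimes>\<^bsub>E\<^esub> p \<in> Q0"
      using q p o integral[of u t'] by (intro Q0I[of _ "a \<otimes>\<^bsub>S\<^esub> b'" "u \<otimes>\<^bsub>S\<^esub> t'"]) auto
    \<comment> \<open>The common multiple \<open>t t'' = u u'\<close> serves as a common denominator
      for the sum of \<open>q\<close> and \<open>p\<close>.\<close>
    obtain u' t'' where v: "u' \<in> carrier S" "t'' \<in> carrier S" "t'' \<noteq> \<zero>\<^bsub>S\<^esub>" "t \<otimes>\<^bsub>S\<^esub> t'' = u \<otimes>\<^bsub>S\<^esub> u'"
      using right_ore[OF dom noeth(2) q(3) p(3,4)] by blast
    have 1: "q \<otimes>\<^bsub>E\<^esub> j (t \<otimes>\<^bsub>S\<^esub> t'') = j (a \<otimes>\<^bsub>S\<^esub> t'')"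
    proof -
      have "q \<otimes>\<^bsub>E\<^esub> j (t \<otimes>\<^bsub>S\<^esub> t'') = (q \<otimes>\<^bsub>E\<^esub> j t) \<otimes>\<^bsub>E\<^esub> j t''" using q(1,3) v(2) by (simp add: jm E.m_assoc)
      then show ?thesis unfolding q(5) using q v by (simp add: jm)
    qed
    have 2: "p \<otimes>\<^bsub>E\<^esub> j (t \<otimes>\<^bsub>S\<^esub> t'') = j (b \<otimes>\<^bsub>S\<^esub> u')"
    proof -
      have "p \<otimes>\<^bsub>E\<^esub> j (t \<otimes>\<^bsub>S\<^esub> t'') = (p \<otimes>\<^bsub>E\<^esub> j u) \<otimes>\<^bsub>E\<^esub> j u'"
        unfolding v(4) using p(1,3) v(1) by (simp add: jm E.m_assoc)
      then show ?thesis unfolding p(5) using p v by (simp add: jm)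
    qed
    have "(q \<oplus>\<^bsub>E\<^esub> p) \<otimes>\<^bsub>E\<^esub> j (t \<otimes>\<^bsub>S\<^esub> t'') = j (a \<otimes>\<^bsub>S\<^esub> t'' \<oplus>\<^bsub>S\<^esub> b \<otimes>\<^bsub>S\<^esub> u')"
      using q(1-3) p(1-3) v(1,2) by (simp add: E.l_distr 1 2 ja)
    then show "q \<oplus>\<^bsub>E\<^esub> p \<in> Q0"
      using q p v integral[of t t''] by (intro Q0I[of _ "a \<otimes>\<^bsub>S\<^esub> t'' \<oplus>\<^bsub>S\<^esub> b \<otimes>\<^bsub>S\<^esub> u'" "t \<otimes>\<^bsub>S\<^esub> t''"]) auto
  qed
  let ?F = "E\<lparr>carrier := Q0\<rparr>"
  interpret F: ring ?F by (rule E.subring_is_ring[OF sub])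
  have Finv: "\<exists>y\<in>Q0. x \<otimes>\<^bsub>E\<^esub> y = \<one>\<^bsub>E\<^esub>" if x: "x \<in> Q0" "x \<noteq> \<zero>\<^bsub>E\<^esub>" for x
  proof -
    obtain a t where q: "x \<in> carrier E" "a \<in> carrier S" "t \<in> carrier S" "t \<noteq> \<zero>\<^bsub>S\<^esub>" "x \<otimes>\<^bsub>E\<^esub> j t = j a"
      using x by (auto simp: Q0_def)
    have xU: "x \<in> Units E" "j t \<in> Units E" using x q jz by (auto simp: U)
    have e: "inv\<^bsub>E\<^esub> x \<otimes>\<^bsub>E\<^esub> j a = j t"
      unfolding q(5)[symmetric] using xU(1) q(1,3) by (simp add: E.m_assoc[symmetric])
    have "a \<noteq> \<zero>\<^bsub>S\<^esub>"
    proof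
      assume "a = \<zero>\<^bsub>S\<^esub>"
      then have "j t = \<zero>\<^bsub>E\<^esub>" using e xU(1) by (simp add: j0)
      then show False using jz q by blast
    qed
    then have "inv\<^bsub>E\<^esub> x \<in> Q0" using Q0I[OF _ q(3,2) _ e] xU by simp
    then show ?thesis using xU by (intro bexI[of _ "inv\<^bsub>E\<^esub> x"]) auto
  qed
  \<comment> \<open>A fraction is encoded as the set of all its presentations as a right fraction;
    by cancellation a single presentation already determines it.\<close>
  define enc where "enc q = {(a, t). a \<in> carrier S \<and> t \<in> carrier S \<and> t \<noteq> \<zero>\<^bsub>S\<^esub> \<and> q \<otimes>\<^bsub>E\<^esub> j t = j a}" for q
  have enc_inj: "inj_on enc Q0"
  proof (rule inj_onI)
    fix x y assume xy: "x \<in> Q0" "y \<in> Q0" "enc x = enc y"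
    then obtain a t where q: "x \<in> carrier E" "a \<in> carrier S" "t \<in> carrier S" "t \<noteq> \<zero>\<^bsub>S\<^esub>" "x \<otimes>\<^bsub>E\<^esub> j t = j a"
      by (auto simp: Q0_def)
    then have "(a, t) \<in> enc y" unfolding xy(3)[symmetric] by (simp add: enc_def)
    then have e: "y \<otimes>\<^bsub>E\<^esub> j t = x \<otimes>\<^bsub>E\<^esub> j t" by (simp add: enc_def q(5))
    have tU: "j t \<in> Units E" using q jz by (simp add: U)
    have "y \<otimes>\<^bsub>E\<^esub> j t \<otimes>\<^bsub>E\<^esub> inv\<^bsub>E\<^esub> j t = y" "x \<otimes>\<^bsub>E\<^esub> j t \<otimes>\<^bsub>E\<^esub> inv\<^bsub>E\<^esub> j t = x"
      using tU q(1,3) xy(2) Q0E by (auto simp: E.m_assoc)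
    then show "x = y" unfolding e by simp
  qed
  define Q where "Q = image_ring enc ?F"
  have iso: "enc \<in> ring_iso ?F Q" unfolding Q_def by (rule inj_imp_image_ring_iso) (use enc_inj in simp)
  have Qring: "ring Q" unfolding Q_def by (rule F.inj_imp_image_ring_is_ring) (use enc_inj in simp)
  interpret Q: ring Q by (rule Qring)
  have Qc: "carrier Q = enc ` Q0" using iso by (auto simp: ring_iso_def bij_betw_def)
  have em: "enc (x \<otimes>\<^bsub>E\<^esub> y) = enc x \<otimes>\<^bsub>Q\<^esub> enc y" and ea: "enc (x \<oplus>\<^bsub>E\<^esub> y) = enc x \<oplus>\<^bsub>Q\<^esub> enc y"
    if "x \<in> Q0" "y \<in> Q0" for x y using iso that by (auto simp: ring_iso_def ring_hom_def)
  have e1: "enc \<one>\<^bsub>E\<^esub> = \<one>\<^bsub>Q\<^esub>" using iso by (auto simp: ring_iso_def ring_hom_def)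
  have e0: "enc \<zero>\<^bsub>E\<^esub> = \<zero>\<^bsub>Q\<^esub>"
    using additive_zero[OF F.is_abelian_group Q.is_abelian_group, of enc] by (auto simp: Qc ea)
  have Q0c: "x \<otimes>\<^bsub>E\<^esub> y \<in> Q0" "x \<oplus>\<^bsub>E\<^esub> y \<in> Q0" if "x \<in> Q0" "y \<in> Q0" for x y
    using F.m_closed[of x y] F.a_closed[of x y] that by auto
  have Q01: "\<one>\<^bsub>E\<^esub> \<in> Q0" "\<zero>\<^bsub>E\<^esub> \<in> Q0" using F.one_closed F.zero_closed by auto
  have jQ0: "j a \<in> Q0" if "a \<in> carrier S" for a
    using that dom by (intro Q0I[of _ a "\<one>\<^bsub>S\<^esub>"]) (auto simp: j1 noncommutative_domain_def)
  define \<iota> where "\<iota> a = enc (j a)" for a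
  have frac: "division_ring_of_fractions S Q \<iota>"
  proof (rule division_ring_of_fractionsI[OF S.ring_axioms Qring])
    show "\<one>\<^bsub>Q\<^esub> \<noteq> \<zero>\<^bsub>Q\<^esub>" unfolding e1[symmetric] e0[symmetric] using one enc_inj Q01 by (metis inj_onD)
    show "\<iota> \<in> ring_hom S Q"
      by (rule ring_hom_memI) (auto simp: \<iota>_def Qc jQ0 jm ja em ea j1 e1)
    show "inj_on \<iota> (carrier S)"
    proof -
      have "j ` carrier S \<subseteq> Q0" using jQ0 by auto
      then show ?thesis
        unfolding \<iota>_def using comp_inj_on[OF j(2) inj_on_subset[OF enc_inj]] by (simp add: comp_def)
    qed
    fix q assume "q \<in> carrier Q"
    then obtain x where x: "x \<in> Q0" "q = enc x" by (auto simp: Qc)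
    {
      assume "q \<noteq> \<zero>\<^bsub>Q\<^esub>"
      then have "x \<noteq> \<zero>\<^bsub>E\<^esub>" using x e0 by auto
      then obtain y where "y \<in> Q0" "x \<otimes>\<^bsub>E\<^esub> y = \<one>\<^bsub>E\<^esub>" using Finv x by blast
      then show "\<exists>y\<in>carrier Q. q \<otimes>\<^bsub>Q\<^esub> y = \<one>\<^bsub>Q\<^esub>"
        using x em[of x y] by (intro bexI[of _ "enc y"]) (auto simp: e1 Qc)
    }
    obtain a t where q: "x \<in> carrier E" "a \<in> carrier S" "t \<in> carrier S" "t \<noteq> \<zero>\<^bsub>S\<^esub>" "x \<otimes>\<^bsub>E\<^esub> j t = j a"
      using x by (auto simp: Q0_def)
    then show "\<exists>a\<in>carrier S. \<exists>t\<in>carrier S. t \<noteq> \<zero>\<^bsub>S\<^esub> \<and> q \<otimes>\<^bsub>Q\<^esub> \<iota> t = \<iota> a"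
      using x em[of x "j t"] jQ0[of t] by (auto simp: \<iota>_def)
    \<comment> \<open>From \<open>s a = b t\<close> and \<open>x t = a\<close> one gets
      \<open>s x t = b t\<close>. Cancelling \<open>t\<close> leaves \<open>s x = b\<close>, which
      presents \<open>x\<close> as a left fraction.\<close>
    obtain b s where o: "b \<in> carrier S" "s \<in> carrier S" "s \<noteq> \<zero>\<^bsub>S\<^esub>" "s \<otimes>\<^bsub>S\<^esub> a = b \<otimes>\<^bsub>S\<^esub> t"
      using left_ore[OF dom noeth(1) q(2-4)] by blast
    have tU: "j t \<in> Units E" using q jz by (simp add: U)
    have "(j s \<otimes>\<^bsub>E\<^esub> x) \<otimes>\<^bsub>E\<^esub> j t = j (s \<otimes>\<^bsub>S\<^esub> a)"
      using q(1-3) o(2) by (simp add: E.m_assoc jm q(5))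
    then have e: "(j s \<otimes>\<^bsub>E\<^esub> x) \<otimes>\<^bsub>E\<^esub> j t = j b \<otimes>\<^bsub>E\<^esub> j t" unfolding o(4) using o(1) q(3) by (simp add: jm)
    have "(j s \<otimes>\<^bsub>E\<^esub> x) \<otimes>\<^bsub>E\<^esub> j t \<otimes>\<^bsub>E\<^esub> inv\<^bsub>E\<^esub> j t = j s \<otimes>\<^bsub>E\<^esub> x" "j b \<otimes>\<^bsub>E\<^esub> j t \<otimes>\<^bsub>E\<^esub> inv\<^bsub>E\<^esub> j t = j b"
      using tU q(1,3) o(1,2) E.Units_closed[OF tU] E.Units_inv_closed[OF tU] E.Units_r_inv[OF tU]
      by (simp_all only: E.m_assoc E.m_closed jc E.r_one)
    then have "j s \<otimes>\<^bsub>E\<^esub> x = j b" unfolding e by simp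
    then show "\<exists>a\<in>carrier S. \<exists>t\<in>carrier S. t \<noteq> \<zero>\<^bsub>S\<^esub> \<and> \<iota> t \<otimes>\<^bsub>Q\<^esub> q = \<iota> a"
      using x o em[of "j s" x] jQ0[of s] by (auto simp: \<iota>_def)
  qed
  have "invertible_ideal S Q \<iota> I" if I: "ideal I S" "I \<noteq> {\<zero>\<^bsub>S\<^esub>}" for I
  proof -
    interpret I: ideal I S by (rule I(1))
    have IS: "I \<subseteq> carrier S" by (rule I.a_subset)
    define J where "J = {e \<in> carrier E. \<forall>i\<in>I. e \<otimes>\<^bsub>E\<^esub> j i \<in> j ` carrier S}"
    note d = dual[OF I J_def]
    obtain i0 where i0: "i0 \<in> I" "i0 \<noteq> \<zero>\<^bsub>S\<^esub>" using I(2) I.zero_closed by blast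
    have JE: "J \<subseteq> carrier E" by (auto simp: J_def)
    \<comment> \<open>Any nonzero element \<open>i0\<close> of \<open>I\<close> is a denominator for
      every \<open>e\<close> in \<open>J\<close>, as \<open>e i0\<close> lies in
      \<open>S\<close>.\<close>
    have JQ0: "J \<subseteq> Q0"
    proof
      fix e assume e: "e \<in> J"
      then obtain a where "a \<in> carrier S" "e \<otimes>\<^bsub>E\<^esub> j i0 = j a" using i0(1) by (auto simp: J_def)
      then show "e \<in> Q0" using Q0I[of e a i0] e i0 IS by (auto simp: J_def)
    qed
    have jI: "j ` I \<subseteq> Q0" using jQ0 IS by auto
    have jS: "x \<oplus>\<^bsub>E\<^esub> y \<in> j ` carrier S" if xy: "x \<in> j ` carrier S" "y \<in> j ` carrier S" for x y
    proof -
      obtain a b where "a \<in> carrier S" "b \<in> carrier S" "x = j a" "y = j b" using xy by blast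
      then show ?thesis using ja[of a b] by (metis S.a_closed imageI)
    qed
    have jS': "x \<otimes>\<^bsub>E\<^esub> y \<in> j ` carrier S" if xy: "x \<in> j ` carrier S" "y \<in> j ` carrier S" for x y
    proof -
      obtain a b where "a \<in> carrier S" "b \<in> carrier S" "x = j a" "y = j b" using xy by blast
      then show ?thesis using jm[of a b] by (metis S.m_closed imageI)
    qed
    have sub1: "x \<in> j ` carrier S" if "x \<in> ideal_prod E (j ` I) J" for x
      using that by induction (use d jS in auto)
    have sub2: "x \<in> j ` carrier S" if "x \<in> ideal_prod E J (j ` I)" for x
      using that by induction (use jS in \<open>auto simp: J_def\<close>)
    have pE: "x \<in> carrier E" if "x \<in> ideal_prod E J (j ` I)" for x using sub2[OF that] by auto
    have pE1: "x \<in> carrier E" if "x \<in> ideal_prod E (j ` I) J" for x using sub1[OF that] by auto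
    \<comment> \<open>\<open>J I\<close> is stable under right multiplication by \<open>S\<close>
      because \<open>I\<close> is a right ideal, and dually \<open>I J\<close> under left
      multiplication. Hence each product is all of \<open>S\<close> once it contains 1.\<close>
    have r2: "x \<otimes>\<^bsub>E\<^esub> j r \<in> ideal_prod E J (j ` I)" if r: "r \<in> carrier S" and "x \<in> ideal_prod E J (j ` I)" for x r
      using that(2)
    proof induction
      case (prod e y)
      then obtain i where i: "i \<in> I" "y = j i" by blast
      have "e \<otimes>\<^bsub>E\<^esub> j (i \<otimes>\<^bsub>S\<^esub> r) \<in> ideal_prod E J (j ` I)"
        using prod i r I.I_r_closed by (intro ideal_prod.prod) auto
      then show ?case using i IS r prod(1) JE by (simp add: jm E.m_assoc subset_iff)
    next
      case (sum x y)
      then show ?case using ideal_prod.sum[OF sum(3,4)] pE[OF sum(1)] pE[OF sum(2)] r by (simp add: E.l_distr)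
    qed
    have r1: "j r \<otimes>\<^bsub>E\<^esub> x \<in> ideal_prod E (j ` I) J" if r: "r \<in> carrier S" and "x \<in> ideal_prod E (j ` I) J" for x r
      using that(2)
    proof induction
      case (prod y e)
      then obtain i where i: "i \<in> I" "y = j i" by blast
      have "j (r \<otimes>\<^bsub>S\<^esub> i) \<otimes>\<^bsub>E\<^esub> e \<in> ideal_prod E (j ` I) J"
        using prod i r I.I_l_closed by (intro ideal_prod.prod) auto
      then show ?case using i IS r prod(2) JE by (simp add: jm E.m_assoc subset_iff)
    next
      case (sum x y)
      then show ?case using ideal_prod.sum[OF sum(3,4)] pE1[OF sum(1)] pE1[OF sum(2)] r by (simp add: E.r_distr)
    qed
    have P1: "ideal_prod E (j ` I) J = j ` carrier S"
    proof (intro equalityI subsetI sub1)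
      fix y assume "y \<in> j ` carrier S"
      then obtain r where r: "r \<in> carrier S" "y = j r" by blast
      then show "y \<in> ideal_prod E (j ` I) J" using r1[OF r(1), of "\<one>\<^bsub>E\<^esub>"] d by simp
    qed
    have P2: "ideal_prod E J (j ` I) = j ` carrier S"
    proof (intro equalityI subsetI sub2)
      fix y assume "y \<in> j ` carrier S"
      then obtain r where r: "r \<in> carrier S" "y = j r" by blast
      then show "y \<in> ideal_prod E J (j ` I)" using r2[OF r(1), of "\<one>\<^bsub>E\<^esub>"] d by simp
    qed
    have \<iota>I: "\<iota> ` I = enc ` (j ` I)" "\<iota> ` carrier S = enc ` (j ` carrier S)" by (auto simp: \<iota>_def)
    have "ideal_prod Q (\<iota> ` I) (enc ` J) = \<iota> ` carrier S"
      unfolding \<iota>I P1[symmetric] by (rule ideal_prod_iso[where C = Q0]) (use em ea Q0c jI JQ0 in auto)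
    moreover have "ideal_prod Q (enc ` J) (\<iota> ` I) = \<iota> ` carrier S"
      unfolding \<iota>I P2[symmetric] by (rule ideal_prod_iso[where C = Q0]) (use em ea Q0c jI JQ0 in auto)
    moreover have "sub_bimodule S Q \<iota> (enc ` J)"
    proof -
      have Jadd: "x \<oplus>\<^bsub>E\<^esub> y \<in> J" if xy: "x \<in> J" "y \<in> J" for x y
        using xy jS IS unfolding J_def by (auto simp: E.l_distr subset_iff)
      have Jl: "j a \<otimes>\<^bsub>E\<^esub> x \<in> J" if a: "a \<in> carrier S" and x: "x \<in> J" for a x
        using a x jS' IS unfolding J_def by (auto simp: E.m_assoc subset_iff)
      have Jr: "x \<otimes>\<^bsub>E\<^esub> j a \<in> J" if a: "a \<in> carrier S" and x: "x \<in> J" for a x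
      proof -
        have "x \<otimes>\<^bsub>E\<^esub> j (a \<otimes>\<^bsub>S\<^esub> i) \<in> j ` carrier S" if "i \<in> I" for i
          using x I.I_l_closed[OF that a] by (auto simp: J_def)
        then show ?thesis using a x IS unfolding J_def by (auto simp: E.m_assoc jm subset_iff)
      qed
      have J0: "\<zero>\<^bsub>E\<^esub> \<in> J" using IS j0 by (auto simp: J_def subset_iff intro!: image_eqI[of _ j "\<zero>\<^bsub>S\<^esub>"])
      have Jn: "\<ominus>\<^bsub>E\<^esub> x \<in> J" if x: "x \<in> J" for x
      proof -
        have "j (\<ominus>\<^bsub>S\<^esub> \<one>\<^bsub>S\<^esub>) \<otimes>\<^bsub>E\<^esub> x \<in> J" by (rule Jl[OF _ x]) simp
        then show ?thesis using x JE by (simp add: jn j1 E.l_minus subset_iff)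
      qed
      have "additive_subgroup (enc ` J) Q"
      proof (intro additive_subgroupI Q.add.subgroupI)
        show "enc ` J \<subseteq> carrier Q" using JQ0 by (auto simp: Qc)
        show "enc ` J \<noteq> {}" using J0 by blast
      next
        fix x assume "x \<in> enc ` J"
        then obtain e where e: "e \<in> J" "x = enc e" by blast
        have "enc (\<ominus>\<^bsub>E\<^esub> e) = \<ominus>\<^bsub>Q\<^esub> enc e"
        proof (rule Q.minus_equality[symmetric])
          have m: "\<ominus>\<^bsub>E\<^esub> e \<in> Q0" "e \<in> Q0" "e \<in> carrier E" using Jn[OF e(1)] JQ0 e JE by auto
          show "enc (\<ominus>\<^bsub>E\<^esub> e) \<oplus>\<^bsub>Q\<^esub> enc e = \<zero>\<^bsub>Q\<^esub>" using ea[OF m(1,2)] m(3) by (simp add: E.l_neg e0)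
          show "enc e \<in> carrier Q" "enc (\<ominus>\<^bsub>E\<^esub> e) \<in> carrier Q" using m by (auto simp: Qc)
        qed
        then show "\<ominus>\<^bsub>Q\<^esub> x \<in> enc ` J" using e Jn by (metis imageI)
      next
        fix x y assume "x \<in> enc ` J" "y \<in> enc ` J"
        then obtain e f where ef: "e \<in> J" "x = enc e" "f \<in> J" "y = enc f" by blast
        then have "x \<oplus>\<^bsub>Q\<^esub> y = enc (e \<oplus>\<^bsub>E\<^esub> f)" using ea[of e f] JQ0 by auto
        then show "x \<oplus>\<^bsub>Q\<^esub> y \<in> enc ` J" using Jadd ef by blast
      qed
      moreover have "\<iota> a \<otimes>\<^bsub>Q\<^esub> x \<in> enc ` J \<and> x \<otimes>\<^bsub>Q\<^esub> \<iota> a \<in> enc ` J"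
        if a: "a \<in> carrier S" and x: "x \<in> enc ` J" for a x
      proof -
        obtain e where e: "e \<in> J" "x = enc e" using x by blast
        then have "\<iota> a \<otimes>\<^bsub>Q\<^esub> x = enc (j a \<otimes>\<^bsub>E\<^esub> e)" "x \<otimes>\<^bsub>Q\<^esub> \<iota> a = enc (e \<otimes>\<^bsub>E\<^esub> j a)"
          using em[of "j a" e] em[of e "j a"] jQ0[OF a] JQ0 by (auto simp: \<iota>_def)
        then show ?thesis using Jl[OF a e(1)] Jr[OF a e(1)] by simp
      qed
      ultimately show ?thesis by (auto simp: sub_bimodule_def)
    qed
    ultimately show ?thesis unfolding invertible_ideal_def by blast
  qed
  then show ?thesis unfolding all_nonzero_ideals_invertible_def using frac by blast
qed

section \<open>Left ideals\<close>

text \<open>The opposite of a skew Laurent series ring is isomorphic to such a ring but not equal to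
  it. Dual bases of right ideals are therefore carried through the isomorphism, scalars
  included.\<close>

lemma ideals_fin_proj_transport:
  assumes S: "ring S" and h: "h \<in> ring_iso S S'" and S': "ideals_fin_proj S'"
  shows "ideals_fin_proj S"
  unfolding ideals_fin_proj_def
proof (intro conjI allI impI S)
  fix I assume I: "right_ideal I S"
  interpret S: ring S by fact
  interpret S': ring S' using S' by (simp add: ideals_fin_proj_def)
  have hc: "h a \<in> carrier S'" if "a \<in> carrier S" for a using h that by (auto simp: ring_iso_def ring_hom_def)
  have hm: "h (a \<otimes>\<^bsub>S\<^esub> b) = h a \<otimes>\<^bsub>S'\<^esub> h b" and ha: "h (a \<oplus>\<^bsub>S\<^esub> b) = h a \<oplus>\<^bsub>S'\<^esub> h b"
    if "a \<in> carrier S" "b \<in> carrier S" for a b using h that by (auto simp: ring_iso_def ring_hom_def)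
  have bij: "bij_betw h (carrier S) (carrier S')" using h by (simp add: ring_iso_def)
  have hinj: "a = b" if "a \<in> carrier S" "b \<in> carrier S" "h a = h b" for a b
    using bij that by (auto simp: bij_betw_def dest: inj_onD)
  let ?g = "inv_into (carrier S) h"
  have g: "?g y \<in> carrier S" "h (?g y) = y" if "y \<in> carrier S'" for y
  proof -
    have "y \<in> h ` carrier S" using bij that by (simp add: bij_betw_def)
    then show "?g y \<in> carrier S" "h (?g y) = y" by (auto intro: inv_into_into f_inv_into_f)
  qed
  have gh: "?g (h a) = a" if "a \<in> carrier S" for a using hinj[OF g(1)[OF hc[OF that]] that g(2)[OF hc[OF that]]] .
  have Is: "right_submodule S (regular_module S) I" using I right_submodule_regular_iff[OF S] by blast
  have IS: "I \<subseteq> carrier S" using Is by (simp add: right_submodule_def)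
  have M: "right_module S (ideal_as_module S I)" by (rule right_module_ideal[OF S I])
  interpret M: right_module S "ideal_as_module S I" by (rule M)
  have I': "right_ideal (h ` I) S'"
    unfolding right_submodule_regular_iff[OF S'.ring_axioms, symmetric] right_submodule_def
  proof (intro conjI ballI)
    show "h ` I \<subseteq> carrier (regular_module S')" using IS hc by auto
    have "h \<zero>\<^bsub>S\<^esub> = \<zero>\<^bsub>S'\<^esub>"
      by (rule additive_zero[OF S.is_abelian_group S'.is_abelian_group]) (auto simp: hc ha)
    then show "\<zero>\<^bsub>regular_module S'\<^esub> \<in> h ` I" using Is by (metis ideal_as_module_simps(2) imageI right_submodule_def)
  next
    fix x y assume "x \<in> h ` I" "y \<in> h ` I"
    then obtain a b where ab: "a \<in> I" "b \<in> I" "x = h a" "y = h b" by blast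
    then have "a \<in> carrier S" "b \<in> carrier S" using IS by auto
    then have "x \<oplus>\<^bsub>S'\<^esub> y = h (a \<oplus>\<^bsub>S\<^esub> b)" using ha[of a b] ab by simp
    then show "x \<oplus>\<^bsub>regular_module S'\<^esub> y \<in> h ` I" using M.M.a_closed[of a b] ab by auto
  next
    fix d x assume d: "d \<in> carrier S'" and "x \<in> h ` I"
    then obtain a where a: "a \<in> I" "x = h a" by blast
    then have "x \<otimes>\<^bsub>S'\<^esub> d = h (a \<otimes>\<^bsub>S\<^esub> ?g d)" using hm[of a "?g d"] IS g[OF d] by auto
    then show "d \<odot>\<^bsub>regular_module S'\<^esub> x \<in> h ` I" using M.smult_closed[of "?g d" a] a g[OF d] by auto
  qed
  then have "fin_proj S' (ideal_as_module S' (h ` I))" using S' by (simp add: ideals_fin_proj_def)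
  then obtain n p \<phi> where b: "dual_basis S' (ideal_as_module S' (h ` I)) {..<n::nat} p \<phi>"
    by (auto simp: fin_proj_def)
  have p: "p i \<in> h ` I" if "i < n" for i using b that by (auto simp: dual_basis_def)
  have pc: "p i \<in> carrier S'" if "i < n" for i using p[OF that] IS hc by auto
  have gp: "?g (p i) \<in> I" if "i < n" for i using p[OF that] gh IS by auto
  have \<phi>c: "\<phi> i (h x) \<in> carrier S'" if "i < n" "x \<in> I" for i x
    using dual_basis_scalar_closed[OF b, of i "h x"] that by auto
  define \<psi> where "\<psi> i x = ?g (\<phi> i (h x))" for i x
  have \<psi>: "\<psi> i x \<in> carrier S" "h (\<psi> i x) = \<phi> i (h x)" if "i < n" "x \<in> I" for i x
    unfolding \<psi>_def using g[OF \<phi>c[OF that]] by auto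
  have "dual_basis S (ideal_as_module S I) {..<n} (\<lambda>i. ?g (p i)) \<psi>"
    unfolding dual_basis_def
  proof (intro conjI ballI)
    show "(\<lambda>i. ?g (p i)) \<in> {..<n} \<rightarrow> carrier (ideal_as_module S I)" using gp by auto
  next
    fix i assume i: "i \<in> {..<n}"
    show "right_linear S (ideal_as_module S I) (regular_module S) (\<psi> i)"
    proof (rule right_linearI)
      fix x y assume "x \<in> carrier (ideal_as_module S I)" "y \<in> carrier (ideal_as_module S I)"
      then have xy: "x \<in> I" "y \<in> I" "x \<oplus>\<^bsub>S\<^esub> y \<in> I" using M.M.a_closed[of x y] by auto
      then have xyc: "x \<in> carrier S" "y \<in> carrier S" using IS by auto
      have "\<psi> i (x \<oplus>\<^bsub>S\<^esub> y) = \<psi> i x \<oplus>\<^bsub>S\<^esub> \<psi> i y"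
      proof (rule hinj)
        show "h (\<psi> i (x \<oplus>\<^bsub>S\<^esub> y)) = h (\<psi> i x \<oplus>\<^bsub>S\<^esub> \<psi> i y)"
          using dual_basis_scalar_add[OF b i, of "h x" "h y"] \<psi>[of i] i xy xyc by (simp add: ha)
      qed (use \<psi>[of i] i xy in auto)
      then show "\<psi> i (x \<oplus>\<^bsub>ideal_as_module S I\<^esub> y) = \<psi> i x \<oplus>\<^bsub>regular_module S\<^esub> \<psi> i y" by simp
    next
      fix d x assume d: "d \<in> carrier S" and "x \<in> carrier (ideal_as_module S I)"
      then have x: "x \<in> I" "x \<otimes>\<^bsub>S\<^esub> d \<in> I" using M.smult_closed[of d x] by auto
      then have xc: "x \<in> carrier S" using IS by auto
      have "\<psi> i (x \<otimes>\<^bsub>S\<^esub> d) = \<psi> i x \<otimes>\<^bsub>S\<^esub> d"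
      proof (rule hinj)
        show "h (\<psi> i (x \<otimes>\<^bsub>S\<^esub> d)) = h (\<psi> i x \<otimes>\<^bsub>S\<^esub> d)"
          using dual_basis_scalar_smult[OF b i, of "h x" "h d"] \<psi>[of i] i x xc d hc by (simp add: hm)
      qed (use \<psi>[of i] i x d in auto)
      then show "\<psi> i (d \<odot>\<^bsub>ideal_as_module S I\<^esub> x) = d \<odot>\<^bsub>regular_module S\<^esub> \<psi> i x" by simp
    qed (use \<psi>(1) i in auto)
  next
    fix x assume "x \<in> carrier (ideal_as_module S I)"
    then have x: "x \<in> I" "x \<in> carrier S" using IS by auto
    have cl: "(\<lambda>i. ?g (p i) \<otimes>\<^bsub>S\<^esub> \<psi> i x) \<in> {..<n} \<rightarrow> I"
      using M.smult_closed gp \<psi>(1)[OF _ x(1)] by auto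
    have cl': "(\<lambda>i. p i \<otimes>\<^bsub>S'\<^esub> \<phi> i (h x)) \<in> {..<n} \<rightarrow> h ` I"
    proof
      fix i assume "i \<in> {..<n}"
      then have "p i \<in> h ` I" "\<phi> i (h x) \<in> carrier S'" using p \<phi>c[OF _ x(1)] by auto
      then show "p i \<otimes>\<^bsub>S'\<^esub> \<phi> i (h x) \<in> h ` I" using I' unfolding right_ideal_def by blast
    qed
    have "(\<Oplus>\<^bsub>S\<^esub>i\<in>{..<n}. ?g (p i) \<otimes>\<^bsub>S\<^esub> \<psi> i x) = x"
    proof (rule hinj)
      have "h (\<Oplus>\<^bsub>S\<^esub>i\<in>{..<n}. ?g (p i) \<otimes>\<^bsub>S\<^esub> \<psi> i x) = (\<Oplus>\<^bsub>S'\<^esub>i\<in>{..<n}. h (?g (p i) \<otimes>\<^bsub>S\<^esub> \<psi> i x))"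
        by (rule additive_finsum[OF S.is_abelian_group S'.is_abelian_group]) (use hc ha cl IS in auto)
      also have "\<dots> = (\<Oplus>\<^bsub>S'\<^esub>i\<in>{..<n}. p i \<otimes>\<^bsub>S'\<^esub> \<phi> i (h x))"
        by (rule S'.finsum_cong') (use g[OF pc] \<psi>[OF _ x(1)] \<phi>c[OF _ x(1)] pc in \<open>auto simp: hm\<close>)
      also have "\<dots> = h x"
        using dual_basis_expand[OF b, of "h x"] x finsum_right_ideal[OF S'.ring_axioms I' cl'] by simp
      finally show "h (\<Oplus>\<^bsub>S\<^esub>i\<in>{..<n}. ?g (p i) \<otimes>\<^bsub>S\<^esub> \<psi> i x) = h x" .
    next
      show "(\<Oplus>\<^bsub>S\<^esub>i\<in>{..<n}. ?g (p i) \<otimes>\<^bsub>S\<^esub> \<psi> i x) \<in> carrier S"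
        using cl IS by (intro S.finsum_closed) blast
    qed (use x in auto)
    then show "x = (\<Oplus>\<^bsub>ideal_as_module S I\<^esub>i\<in>{..<n}. \<psi> i x \<odot>\<^bsub>ideal_as_module S I\<^esub> ?g (p i))"
      using finsum_right_ideal[OF S I cl] by simp
  qed simp
  then show "fin_proj S (ideal_as_module S I)" by (rule fin_projI[OF M])
qed

context skew_laurent
begin

section \<open>The opposite ring as a Laurent series ring\<close>

lemma inverse_automorphism: "skew_laurent D (s (- 1))"
proof -
  have "bij_betw (s (- 1)) (carrier D) (carrier D)"
    by (rule bij_betw_byWitness[where f' = "s 1"]) (auto simp: s_s)
  then have "s (- 1) \<in> ring_iso D D" using s_hom by (simp add: ring_iso_def)
  then show ?thesis by (intro skew_laurent.intro skew_laurent_axioms.intro domain_axioms)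
qed

lemma inverse_automorphism_power:
  assumes "a \<in> carrier D" shows "automorphism_power D (s (- 1)) i a = s (- i) a"
proof -
  interpret O: skew_laurent D "s (- 1)" by (rule inverse_automorphism)
  show ?thesis using assms
  proof (induction i rule: int_induct[where k = 0])
    case (step1 i)
    then show ?case using O.s_succ[of a i] by (simp add: s_s algebra_simps)
  next
    case (step2 i)
    have "s (- 1) (automorphism_power D (s (- 1)) (i - 1) a) = automorphism_power D (s (- 1)) i a"
      using O.s_succ[of a "i - 1"] step2 by simp
    also have "\<dots> = s (- i) a" using step2 by simp
    finally have "s 1 (s (- 1) (automorphism_power D (s (- 1)) (i - 1) a)) = s 1 (s (- i) a)" by simp
    then show ?case using step2 by (simp add: s_s O.s_closed)
  qed simp
qed

text \<open>Writing coefficients on the other side, \<open>a x\<^sup>i = x\<^sup>i \<sigma>\<^sup>-\<^sup>i(a)\<close>, identifies the opposite ring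
  with the Laurent series ring of \<open>\<sigma>\<^sup>-\<^sup>1\<close>.\<close>

lemma opposite_laurent_iso:
  "(\<lambda>f i. s (- i) (f i)) \<in> ring_iso (opposite_ring R) (skew_laurent_ring D (s (- 1)))"
proof -
  interpret O: skew_laurent D "s (- 1)" by (rule inverse_automorphism)
  have v: "vanishes_below D k (\<lambda>i. s (q i) (f i))" if "vanishes_below D k f" for k f q
    using that by (simp add: vanishes_below_def)
  have "(\<lambda>f i. s (- i) (f i)) \<in> ring_hom (opposite_ring R) (skew_laurent_ring D (s (- 1)))"
  proof (rule ring_hom_memI)
    fix f assume "f \<in> carrier (opposite_ring R)"
    then show "(\<lambda>i. s (- i) (f i)) \<in> carrier (skew_laurent_ring D (s (- 1)))"
      using v[of _ f uminus] by (auto simp: skew_laurent_ring_simps)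
  next
    fix f g assume fg: "f \<in> carrier (opposite_ring R)" "g \<in> carrier (opposite_ring R)"
    then show "(\<lambda>i. s (- i) ((f \<oplus>\<^bsub>opposite_ring R\<^esub> g) i)) =
        (\<lambda>i. s (- i) (f i)) \<oplus>\<^bsub>skew_laurent_ring D (s (- 1))\<^esub> (\<lambda>i. s (- i) (g i))"
      using R_coeff_closed by (auto simp: R_add_apply O.R_add_apply s_add fun_eq_iff)
    obtain k l where k: "vanishes_below D k f" and l: "vanishes_below D l g"
      using fg R_memE unfolding opposite_ring_simps by blast
    note c = vanishes_below_closed[OF k] vanishes_below_closed[OF l]
    show "(\<lambda>i. s (- i) ((f \<otimes>\<^bsub>opposite_ring R\<^esub> g) i)) =
        (\<lambda>i. s (- i) (f i)) \<otimes>\<^bsub>skew_laurent_ring D (s (- 1))\<^esub> (\<lambda>i. s (- i) (g i))"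
    proof
      fix n
      \<comment> \<open>The general term, indexed by the exponent of \<open>f\<close>. The product
        in the opposite ring is indexed by the exponent of \<open>g\<close>, whence the reflection
        \<open>n - i\<close>; commutativity of \<open>D\<close> brings the two factors into the
        right order.\<close>
      let ?t = "\<lambda>i. s (- i) (f i) \<otimes> s (- n) (g (n - i))"
      have t: "?t i \<in> carrier D" for i using c by simp
      have "s (- n) ((f \<otimes>\<^bsub>opposite_ring R\<^esub> g) n) = s (- n) (\<Oplus>i\<in>{l..n - k}. g i \<otimes> s i (f (n - i)))"
        using R_mult_window[OF l k order_refl order_refl, of n] by simp
      also have "\<dots> = (\<Oplus>i\<in>{l..n - k}. s (- n) (g i \<otimes> s i (f (n - i))))"
        using c by (intro s_finsum) auto
      also have "\<dots> = (\<Oplus>i\<in>{l..n - k}. ?t (n - i))"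
        using c by (intro finsum_cong') (auto simp: s_mult s_s m_comm algebra_simps)
      also have "\<dots> = (\<Oplus>i\<in>(\<lambda>i. n - i) ` {l..n - k}. ?t i)"
        by (rule finsum_reindex[symmetric]) (use t in \<open>auto simp: inj_on_def\<close>)
      also have "(\<lambda>i. n - i) ` {l..n - k} = {k..n - l}"
        by (auto intro!: image_eqI[of _ _ "n - _"])
      also have "(\<Oplus>i\<in>{k..n - l}. ?t i) = (\<Oplus>i\<in>{k..n - l}. s (- i) (f i) \<otimes>
          automorphism_power D (s (- 1)) i (s (- (n - i)) (g (n - i))))"
        using c by (intro finsum_cong') (auto simp: inverse_automorphism_power s_s)
      also have "\<dots> = ((\<lambda>i. s (- i) (f i)) \<otimes>\<^bsub>skew_laurent_ring D (s (- 1))\<^esub> (\<lambda>i. s (- i) (g i))) n"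
        by (rule O.R_mult_window[OF v[OF k] v[OF l] order_refl order_refl, symmetric])
      finally show "s (- n) ((f \<otimes>\<^bsub>opposite_ring R\<^esub> g) n) =
        ((\<lambda>i. s (- i) (f i)) \<otimes>\<^bsub>skew_laurent_ring D (s (- 1))\<^esub> (\<lambda>i. s (- i) (g i))) n" .
    qed
  next
    show "(\<lambda>i. s (- i) (\<one>\<^bsub>opposite_ring R\<^esub> i)) = \<one>\<^bsub>skew_laurent_ring D (s (- 1))\<^esub>"
      by (auto simp: R_one O.R_one monomial_def)
  qed
  moreover have "bij_betw (\<lambda>f i. s (- i) (f i)) (carrier (opposite_ring R)) (carrier (skew_laurent_ring D (s (- 1))))"
  proof (rule bij_betw_byWitness[where f' = "\<lambda>f i. s i (f i)"])
    show "\<forall>f\<in>carrier (opposite_ring R). (\<lambda>i. s i (s (- i) (f i))) = f"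
      using R_coeff_closed by (auto simp: s_s)
    show "\<forall>f\<in>carrier (skew_laurent_ring D (s (- 1))). (\<lambda>i. s (- i) (s i (f i))) = f"
      using O.R_coeff_closed by (auto simp: s_s)
    show "(\<lambda>f i. s (- i) (f i)) ` carrier (opposite_ring R) \<subseteq> carrier (skew_laurent_ring D (s (- 1)))"
      using v[of _ _ uminus] by (auto simp: skew_laurent_ring_simps) blast
    show "(\<lambda>f i. s i (f i)) ` carrier (skew_laurent_ring D (s (- 1))) \<subseteq> carrier (opposite_ring R)"
      using v[of _ _ "\<lambda>i. i"] by (auto simp: skew_laurent_ring_simps) blast
  qed
  ultimately show ?thesis by (simp add: ring_iso_def)
qed

end

text \<open>Zero is mentioned because of the empty sum: the inductive \<open>ideal_prod\<close> has
  no clause for it. In the applications it is a product of zeros.\<close>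

lemma ideal_prod_finsum_closed:
  assumes "ring Q" "A \<subseteq> carrier Q" "B \<subseteq> carrier Q" "\<zero>\<^bsub>Q\<^esub> \<in> ideal_prod Q A B"
    and "\<And>i. i < (n::nat) \<Longrightarrow> a i \<in> A \<and> b i \<in> B"
  shows "(\<Oplus>\<^bsub>Q\<^esub>i\<in>{..<n}. a i \<otimes>\<^bsub>Q\<^esub> b i) \<in> ideal_prod Q A B"
proof -
  interpret ring Q by fact
  show ?thesis using assms(5)
  proof (induction n)
    case (Suc n)
    have c: "a i \<otimes>\<^bsub>Q\<^esub> b i \<in> carrier Q" if "i < Suc n" for i
      using Suc.prems[OF that] assms(2,3) by (meson m_closed subsetD)
    have "(\<Oplus>\<^bsub>Q\<^esub>i\<in>{..<Suc n}. a i \<otimes>\<^bsub>Q\<^esub> b i) = a n \<otimes>\<^bsub>Q\<^esub> b n \<oplus>\<^bsub>Q\<^esub> (\<Oplus>\<^bsub>Q\<^esub>i\<in>{..<n}. a i \<otimes>\<^bsub>Q\<^esub> b i)"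
      using c by (simp add: lessThan_Suc Pi_def)
    moreover have "a n \<otimes>\<^bsub>Q\<^esub> b n \<in> ideal_prod Q A B" using Suc.prems by (intro ideal_prod.prod) auto
    moreover have "(\<Oplus>\<^bsub>Q\<^esub>i\<in>{..<n}. a i \<otimes>\<^bsub>Q\<^esub> b i) \<in> ideal_prod Q A B" using Suc by simp
    ultimately show ?case using ideal_prod.sum by metis
  qed (use assms(4) in simp)
qed

context dedekind_laurent
begin

lemma ideals_fin_proj_opposite: "ideals_fin_proj (opposite_ring R)"
proof -
  interpret O: skew_laurent D "s (- 1)" by (rule inverse_automorphism)
  interpret O: dedekind_laurent D "s (- 1)" K \<iota>
    by (intro dedekind_laurent.intro dedekind_laurent_axioms.intro O.skew_laurent_axioms fractions ideals_invertible)
  show ?thesis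
    by (rule ideals_fin_proj_transport[OF ring_opposite[OF ring_R] opposite_laurent_iso O.ideals_fin_proj_R])
qed

section \<open>Two-sided ideals\<close>

text \<open>With \<open>I = u J((x))\<close> and \<open>v\<close> inverse to \<open>u\<close>, the
  elements \<open>u a i\<close> of \<open>I\<close> and \<open>b i v\<close> of the dual have
  products summing to 1 in both orders. The harder part is that \<open>e I \<subseteq> R\<close>
  implies \<open>I e \<subseteq> R\<close>; this is where conjugation by \<open>u\<close> has to
  preserve \<open>R\<close>.\<close>

lemma two_sided_ideal_dual:
  assumes I: "ideal I R" "I \<noteq> {\<zero>\<^bsub>R\<^esub>}" and J': "J' = {e \<in> carrier E. \<forall>i\<in>I. e \<otimes>\<^bsub>E\<^esub> j i \<in> j ` carrier R}"
  shows "(\<forall>e\<in>J'. \<forall>i\<in>I. j i \<otimes>\<^bsub>E\<^esub> e \<in> j ` carrier R) \<and>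
        \<one>\<^bsub>E\<^esub> \<in> ideal_prod E (j ` I) J' \<and> \<one>\<^bsub>E\<^esub> \<in> ideal_prod E J' (j ` I)"
proof -
  interpret R: ring R by (rule ring_R)
  interpret E: ring E by (rule E_ring)
  interpret I: ideal I R by (rule I(1))
  have Ir: "right_ideal I R" using I.I_r_closed by (simp add: right_ideal_def I.additive_subgroup_axioms)
  have IR: "I \<subseteq> carrier R" by (rule I.a_subset)
  let ?J = "leading_ideal I" let ?JR = "ideal_series ?J"
  have J: "ideal ?J D" "?J \<noteq> {\<zero>}" using leading_ideal_ideal leading_ideal_nonzero Ir I(2) by auto
  interpret J: ideal ?J D by (rule J(1))
  have Jc: "?J \<subseteq> carrier D" by (rule J.a_subset)
  obtain u where u: "u \<in> carrier E" "vanishes_below K 0 u" "u 0 = \<one>\<^bsub>K\<^esub>"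
    and im: "j ` I = (\<lambda>h. u \<otimes>\<^bsub>E\<^esub> j h) ` ?JR" using right_ideal_structure[OF Ir I(2)] by blast
  define v where "v = inv\<^bsub>E\<^esub> u"
  note uU = E_unit_inverse(1)[OF u] and v0 = E_unit_inverse(2,3)[OF u, folded v_def]
  have v: "v \<in> carrier E" "u \<otimes>\<^bsub>E\<^esub> v = \<one>\<^bsub>E\<^esub>" "v \<otimes>\<^bsub>E\<^esub> u = \<one>\<^bsub>E\<^esub>" using uU by (auto simp: v_def)
  have uv: "u \<otimes>\<^bsub>E\<^esub> (v \<otimes>\<^bsub>E\<^esub> x) = x" "v \<otimes>\<^bsub>E\<^esub> (u \<otimes>\<^bsub>E\<^esub> x) = x" if "x \<in> carrier E" for x
    using that u v by (simp_all add: E.m_assoc[symmetric])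
  have im1: "\<exists>h\<in>?JR. j i = u \<otimes>\<^bsub>E\<^esub> j h" if "i \<in> I" for i
  proof -
    have "j i \<in> (\<lambda>h. u \<otimes>\<^bsub>E\<^esub> j h) ` ?JR" using im that by blast
    then show ?thesis by blast
  qed
  have im2: "\<exists>i\<in>I. j i = u \<otimes>\<^bsub>E\<^esub> j h" if "h \<in> ?JR" for h
  proof -
    have "u \<otimes>\<^bsub>E\<^esub> j h \<in> j ` I" using im that by blast
    then show ?thesis by (metis imageE)
  qed
  have JRc: "h \<in> carrier R" if "h \<in> ?JR" for h using that by (simp add: ideal_series_def)
  have JRJ: "h i \<in> ?J" if "h \<in> ?JR" for h i using that by (auto simp: ideal_series_def)
  have const: "monomial D a 0 \<in> ?JR" if "a \<in> ?J" for a
    using that Jc J.zero_closed monomial_closed[of a 0]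
    by (auto simp: ideal_series_def image_subset_iff) (simp add: monomial_def)
  have jconst: "j (monomial D a m) = monomial K (\<iota> a) m" for a m
    by (simp add: j_def monomial_def fun_eq_iff)
  obtain n a b where ab: "\<And>i. i < n \<Longrightarrow> a i \<in> ?J" "\<And>i. i < n \<Longrightarrow> b i \<in> carrier K"
      "\<And>i x. i < n \<Longrightarrow> x \<in> ?J \<Longrightarrow> b i \<otimes>\<^bsub>K\<^esub> \<iota> x \<in> \<iota> ` carrier D"
      and sum: "(\<Oplus>\<^bsub>K\<^esub>i\<in>{..<n::nat}. \<iota> (a i) \<otimes>\<^bsub>K\<^esub> b i) = \<one>\<^bsub>K\<^esub>"
    using invertible_data[OF J] by blast
  have aD: "a i \<in> carrier D" if "i < n" for i using ab(1)[OF that] Jc by blast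
  \<comment> \<open>Here \<open>I\<close> is used as a left ideal: multiplying by
    \<open>x\<^sup>i\<close> from the left applies \<open>\<sigma>\<^sup>i\<close> to the lowest
    coefficient. So \<open>J\<close> is stable under all powers of \<open>\<sigma>\<close>, negative
    ones included.\<close>
  have sJ: "s i c \<in> ?J" if c: "c \<in> ?J" for i c
  proof -
    obtain f where f: "f \<in> I" "vanishes_below D 0 f" "c = f 0" using c by (auto simp: leading_ideal_def)
    have fR: "f \<in> carrier R" using f IR by blast
    have m: "monomial D \<one> i \<otimes>\<^bsub>R\<^esub> f \<in> I" by (rule I.I_l_closed[OF f(1)]) simp
    have "vanishes_below D (i + 0) (monomial D \<one> i \<otimes>\<^bsub>R\<^esub> f)"
      by (rule R_mult_vanishes[OF vanishes_below_monomial[OF abelian_monoid_axioms one_closed order_refl] f(2)])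
    then have "(monomial D \<one> i \<otimes>\<^bsub>R\<^esub> f) i \<in> ?J" by (intro leading_idealI[OF Ir m]) simp
    then show ?thesis using R_mult_monomial_left[OF fR one_closed, of i i] R_coeff_closed[OF fR] f(3) by simp
  qed
  have iD: "x \<oplus>\<^bsub>K\<^esub> y \<in> \<iota> ` carrier D" "x \<otimes>\<^bsub>K\<^esub> y \<in> \<iota> ` carrier D"
    if "x \<in> \<iota> ` carrier D" "y \<in> \<iota> ` carrier D" for x y
  proof -
    from that(1) obtain c where c: "x = \<iota> c" "c \<in> carrier D" by (rule imageE)
    from that(2) obtain d where d: "y = \<iota> d" "d \<in> carrier D" by (rule imageE)
    note cd = c d
    then have "x \<oplus>\<^bsub>K\<^esub> y = \<iota> (c \<oplus> d)" "x \<otimes>\<^bsub>K\<^esub> y = \<iota> (c \<otimes> d)" by simp_all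
    moreover have "c \<oplus> d \<in> carrier D" "c \<otimes> d \<in> carrier D" using cd by simp_all
    ultimately show "x \<oplus>\<^bsub>K\<^esub> y \<in> \<iota> ` carrier D" "x \<otimes>\<^bsub>K\<^esub> y \<in> \<iota> ` carrier D" by simp_all
  qed
  have iDsum: "(\<Oplus>\<^bsub>K\<^esub>i\<in>A. F i) \<in> \<iota> ` carrier D" if F: "\<And>i. i \<in> A \<Longrightarrow> F i \<in> \<iota> ` carrier D" for F and A :: "'z set"
    using F
  proof (induction A rule: infinite_finite_induct)
    case (insert x A)
    have ic: "\<iota> ` carrier D \<subseteq> carrier K" by auto
    have "F \<in> A \<rightarrow> carrier K" "F x \<in> carrier K"
      using insert.prems[THEN subsetD[OF ic]] by simp_all
    then show ?case using insert iD by simp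
  qed (auto intro!: image_eqI[of _ \<iota> \<zero>])
  \<comment> \<open>\<open>J\<^sup>-\<^sup>1 J = D\<close>\<close>
  have quot: "q \<in> \<iota> ` carrier D" if q: "q \<in> carrier K" and qJ: "\<And>c. c \<in> ?J \<Longrightarrow> q \<otimes>\<^bsub>K\<^esub> \<iota> c \<in> \<iota> ` ?J" for q
  proof -
    have "q = q \<otimes>\<^bsub>K\<^esub> (\<Oplus>\<^bsub>K\<^esub>i\<in>{..<n}. \<iota> (a i) \<otimes>\<^bsub>K\<^esub> b i)" using q by (simp add: sum)
    also have "\<dots> = (\<Oplus>\<^bsub>K\<^esub>i\<in>{..<n}. q \<otimes>\<^bsub>K\<^esub> (\<iota> (a i) \<otimes>\<^bsub>K\<^esub> b i))"
      by (rule EK.finsum_rdistr) (use q aD ab(2) in auto)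
    also have "\<dots> \<in> \<iota> ` carrier D"
    proof (rule iDsum)
      fix i assume i: "i \<in> {..<n}"
      obtain c where c: "c \<in> ?J" "q \<otimes>\<^bsub>K\<^esub> \<iota> (a i) = \<iota> c" using qJ[OF ab(1)] i by blast
      have "q \<otimes>\<^bsub>K\<^esub> (\<iota> (a i) \<otimes>\<^bsub>K\<^esub> b i) = \<iota> c \<otimes>\<^bsub>K\<^esub> b i"
        unfolding c(2)[symmetric] using i q aD ab(2) by (simp add: EK.m_assoc)
      also have "\<dots> = b i \<otimes>\<^bsub>K\<^esub> \<iota> c" using i c(1) Jc ab(2) by (intro EK.m_comm) auto
      finally show "q \<otimes>\<^bsub>K\<^esub> (\<iota> (a i) \<otimes>\<^bsub>K\<^esub> b i) \<in> \<iota> ` carrier D" using ab(3)[OF _ c(1)] i by simp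
    qed
    finally show ?thesis .
  qed
  have jR: "x \<in> j ` carrier R" if "x \<in> carrier E" "\<And>i. x i \<in> \<iota> ` carrier D" for x
    using j_in_image[OF that] by blast
  \<comment> \<open>conjugation by \<open>u\<close> preserves \<open>R\<close>, in both directions\<close>
  have conj1: "v \<otimes>\<^bsub>E\<^esub> (j r \<otimes>\<^bsub>E\<^esub> u) \<in> j ` carrier R" if r: "r \<in> carrier R" for r
  proof (rule jR)
    let ?z = "v \<otimes>\<^bsub>E\<^esub> (j r \<otimes>\<^bsub>E\<^esub> u)"
    show zE: "?z \<in> carrier E" using v u r by simp
    fix m
    show "?z m \<in> \<iota> ` carrier D"
    proof (rule quot[OF EK.R_coeff_closed[OF zE]])
      fix c assume c: "c \<in> ?J"
      \<comment> \<open>The constant is twisted by \<open>\<sigma>\<^sup>-\<^sup>m\<close> in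
        advance. Moving it past \<open>x\<^sup>m\<close> undoes the twist, so the coefficient at
        \<open>m\<close> is multiplied by \<open>c\<close> itself.\<close>
      let ?c = "monomial D (s (- m) c) 0"
      have c': "s (- m) c \<in> ?J" by (rule sJ[OF c])
      obtain i where i: "i \<in> I" "j i = u \<otimes>\<^bsub>E\<^esub> j ?c" using im2[OF const[OF c']] by blast
      have "r \<otimes>\<^bsub>R\<^esub> i \<in> I" by (rule I.I_l_closed[OF i(1) r])
      then obtain h where h: "h \<in> ?JR" "j (r \<otimes>\<^bsub>R\<^esub> i) = u \<otimes>\<^bsub>E\<^esub> j h" using im1 by blast
      have cR: "?c \<in> carrier R" using c' Jc by auto
      have "?z \<otimes>\<^bsub>E\<^esub> j ?c = v \<otimes>\<^bsub>E\<^esub> (j r \<otimes>\<^bsub>E\<^esub> (u \<otimes>\<^bsub>E\<^esub> j ?c))" using v(1) u(1) r cR by (simp add: E.m_assoc)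
      also have "\<dots> = v \<otimes>\<^bsub>E\<^esub> j (r \<otimes>\<^bsub>R\<^esub> i)" unfolding i(2)[symmetric] using r i(1) IR by (simp add: j_mult subset_iff)
      also have "\<dots> = j h" unfolding h(2) using uv JRc[OF h(1)] by simp
      finally have e: "?z \<otimes>\<^bsub>E\<^esub> j ?c = j h" .
      have "(?z \<otimes>\<^bsub>E\<^esub> j ?c) m = ?z m \<otimes>\<^bsub>K\<^esub> EK.s m (\<iota> (s (- m) c))"
        unfolding jconst using EK.R_mult_monomial_right[OF zE, of "\<iota> (s (- m) c)" 0 m] c' Jc by auto
      also have "EK.s m (\<iota> (s (- m) c)) = \<iota> c" using c Jc sK_power_iota[of "s (- m) c" m] by (auto simp: s_s)
      finally have "?z m \<otimes>\<^bsub>K\<^esub> \<iota> c = \<iota> (h m)" unfolding e by (simp add: j_def)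
      then show "?z m \<otimes>\<^bsub>K\<^esub> \<iota> c \<in> \<iota> ` ?J" using JRJ[OF h(1), of m] by simp
    qed
  qed
  have conj2: "u \<otimes>\<^bsub>E\<^esub> (j r \<otimes>\<^bsub>E\<^esub> v) \<in> j ` carrier R" if r: "r \<in> carrier R" for r
  proof (rule jR)
    let ?w = "u \<otimes>\<^bsub>E\<^esub> (j r \<otimes>\<^bsub>E\<^esub> v)"
    show wE: "?w \<in> carrier E" using v u r by simp
    fix m
    show "?w m \<in> \<iota> ` carrier D"
    proof (rule coefficients_induct[OF wE zero_closed])
      fix M assume M: "\<And>i. i < M \<Longrightarrow> ?w i \<in> \<iota> ` carrier D"
      define t where "t i = (if i < M then ?w i else \<zero>\<^bsub>K\<^esub>)" for i
      obtain N where N: "vanishes_below K N ?w" using EK.R_memE[OF wE] by blast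
      have tE: "t \<in> carrier E"
        using vanishes_below_closed[OF N] vanishes_below_zero[OF N]
        by (intro EK.R_memI[of N]) (auto simp: vanishes_below_def t_def)
      have "t i \<in> \<iota> ` carrier D" for i using M by (auto simp: t_def intro!: image_eqI[of _ \<iota> \<zero>])
      then obtain h where h: "h \<in> carrier R" "j h = t" using jR[OF tE] by blast
      \<comment> \<open>The part \<open>t\<close> of \<open>?w\<close> below \<open>M\<close> comes
        from \<open>R\<close>, so the other conjugation gives \<open>v t u\<close> in
        \<open>R\<close>. Then \<open>v (?w - t) u\<close> comes from \<open>R\<close> as well, and
        its coefficient at \<open>M\<close> is that of \<open>?w\<close>, since \<open>u\<close> and
        \<open>v\<close> both start with 1.\<close>
      obtain r' where r': "r' \<in> carrier R" "v \<otimes>\<^bsub>E\<^esub> (j h \<otimes>\<^bsub>E\<^esub> u) = j r'" using conj1[OF h(1)] by force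
      have wt: "vanishes_below K M (?w \<ominus>\<^bsub>E\<^esub> t)"
        unfolding vanishes_below_def EK.R_minus_apply[OF wE tE]
        using EK.R_coeff_closed[OF wE] EK.R_coeff_closed[OF tE]
        by (auto simp: t_def a_minus_def EK.r_neg)
      have vw: "v \<otimes>\<^bsub>E\<^esub> (?w \<otimes>\<^bsub>E\<^esub> u) = j r" using u(1) v r uv by (simp add: E.m_assoc)
      have "v \<otimes>\<^bsub>E\<^esub> ((?w \<ominus>\<^bsub>E\<^esub> t) \<otimes>\<^bsub>E\<^esub> u) = v \<otimes>\<^bsub>E\<^esub> (?w \<otimes>\<^bsub>E\<^esub> u) \<ominus>\<^bsub>E\<^esub> v \<otimes>\<^bsub>E\<^esub> (t \<otimes>\<^bsub>E\<^esub> u)"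
        using u(1) v(1) wE tE by (simp add: a_minus_def E.l_distr E.r_distr E.l_minus E.r_minus)
      also have "\<dots> = j (r \<ominus>\<^bsub>R\<^esub> r')" unfolding vw using h(2) r'(2) r r'(1) by (simp add: j_diff)
      finally have e: "v \<otimes>\<^bsub>E\<^esub> ((?w \<ominus>\<^bsub>E\<^esub> t) \<otimes>\<^bsub>E\<^esub> u) = j (r \<ominus>\<^bsub>R\<^esub> r')" .
      have wtu: "vanishes_below K M ((?w \<ominus>\<^bsub>E\<^esub> t) \<otimes>\<^bsub>E\<^esub> u)" using EK.R_mult_vanishes[OF wt u(2)] by simp
      have wMc: "?w M \<in> carrier K" by (rule EK.R_coeff_closed[OF wE])
      have wtM: "(?w \<ominus>\<^bsub>E\<^esub> t) M = ?w M"
        unfolding EK.R_minus_apply[OF wE tE] using wMc by (simp add: t_def a_minus_def)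
      have "((?w \<ominus>\<^bsub>E\<^esub> t) \<otimes>\<^bsub>E\<^esub> u) M = ?w M"
        using EK.R_mult_leading[OF wt u(2)] wMc by (simp add: u(3) wtM)
      then have "(v \<otimes>\<^bsub>E\<^esub> ((?w \<ominus>\<^bsub>E\<^esub> t) \<otimes>\<^bsub>E\<^esub> u)) M = ?w M"
        using EK.R_mult_leading[OF v0(1) wtu] wMc by (simp add: v0(2))
      then have "?w M = \<iota> ((r \<ominus>\<^bsub>R\<^esub> r') M)" unfolding e by (simp add: j_def)
      then show "?w M \<in> \<iota> ` carrier D" using R_coeff_closed[OF R.minus_closed[OF r r'(1)]] by simp
    qed
  qed
  have J'E: "J' \<subseteq> carrier E" by (auto simp: J')
  have jIE: "j ` I \<subseteq> carrier E" using IR by auto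
  have j0: "j \<zero>\<^bsub>R\<^esub> = \<zero>\<^bsub>E\<^esub>" by (simp add: j_def skew_laurent_ring_simps)
  have zJ': "\<zero>\<^bsub>E\<^esub> \<in> J'"
    unfolding J'
  proof (intro CollectI conjI ballI E.zero_closed)
    fix i assume "i \<in> I"
    then have "\<zero>\<^bsub>E\<^esub> \<otimes>\<^bsub>E\<^esub> j i = j \<zero>\<^bsub>R\<^esub>" using jIE by (auto simp: j0)
    then show "\<zero>\<^bsub>E\<^esub> \<otimes>\<^bsub>E\<^esub> j i \<in> j ` carrier R" using R.zero_closed by blast
  qed
  \<comment> \<open>Put \<open>y = e u\<close>. From \<open>e I \<subseteq> R\<close> the
    coefficients of \<open>y\<close> multiply \<open>J\<close> into \<open>D\<close>, so
    \<open>h y\<close> lies in \<open>R\<close> for \<open>h\<close> in \<open>J((x))\<close>.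
    Finally \<open>i e = u (h y) v\<close> lies in \<open>R\<close> by \<open>conj2\<close>.\<close>
  have h1: "j i \<otimes>\<^bsub>E\<^esub> e \<in> j ` carrier R" if e: "e \<in> J'" and i: "i \<in> I" for e i
  proof -
    have eE: "e \<in> carrier E" using e J'E by blast
    obtain h where h: "h \<in> ?JR" "j i = u \<otimes>\<^bsub>E\<^esub> j h" using im1[OF i] by blast
    have hR: "h \<in> carrier R" using h JRc by blast
    define y where "y = e \<otimes>\<^bsub>E\<^esub> u"
    have yE: "y \<in> carrier E" using eE u by (simp add: y_def)
    have yJ: "y m \<otimes>\<^bsub>K\<^esub> \<iota> c \<in> \<iota> ` carrier D" if c: "c \<in> ?J" for m c
    proof -
      let ?c = "monomial D (s (- m) c) 0"
      have c': "s (- m) c \<in> ?J" by (rule sJ[OF c])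
      obtain i' where i': "i' \<in> I" "j i' = u \<otimes>\<^bsub>E\<^esub> j ?c" using im2[OF const[OF c']] by blast
      have "?c \<in> carrier R" using c' Jc by auto
      then have "y \<otimes>\<^bsub>E\<^esub> j ?c = e \<otimes>\<^bsub>E\<^esub> j i'" unfolding i'(2) y_def using eE u(1) by (simp add: E.m_assoc)
      then obtain r where r: "r \<in> carrier R" "y \<otimes>\<^bsub>E\<^esub> j ?c = j r" using e i'(1) by (auto simp: J')
      have "(y \<otimes>\<^bsub>E\<^esub> j ?c) m = y m \<otimes>\<^bsub>K\<^esub> EK.s m (\<iota> (s (- m) c))"
        unfolding jconst using EK.R_mult_monomial_right[OF yE, of "\<iota> (s (- m) c)" 0 m] c' Jc by auto
      also have "EK.s m (\<iota> (s (- m) c)) = \<iota> c" using c Jc sK_power_iota[of "s (- m) c" m] by (auto simp: s_s)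
      finally have "y m \<otimes>\<^bsub>K\<^esub> \<iota> c = \<iota> (r m)" unfolding r(2) by (simp add: j_def)
      then show ?thesis using R_coeff_closed[OF r(1), of m] by simp
    qed
    have "j h \<otimes>\<^bsub>E\<^esub> y \<in> j ` carrier R"
    proof (rule jR)
      show "j h \<otimes>\<^bsub>E\<^esub> y \<in> carrier E" using hR yE by simp
      fix m
      obtain k where k: "vanishes_below D k h" using hR R_memE by blast
      obtain l where l: "vanishes_below K l y" using yE EK.R_memE by blast
      show "(j h \<otimes>\<^bsub>E\<^esub> y) m \<in> \<iota> ` carrier D"
        unfolding EK.R_mult_window[OF j_vanishes[OF k] l order_refl order_refl]
      proof (rule iDsum)
        fix i
        \<comment> \<open>\<open>h i \<sigma>\<^sup>i(y (m - i))\<close> equals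
          \<open>\<sigma>\<^sup>i\<close> of \<open>\<sigma>\<^sup>-\<^sup>i(h i) y (m - i)\<close>,
          and \<open>\<sigma>\<^sup>-\<^sup>i(h i)\<close> still lies in \<open>J\<close> by
          \<open>sJ\<close>.\<close>
        let ?c = "s (- i) (h i)"
        have c: "?c \<in> ?J" by (rule sJ[OF JRJ[OF h(1)]])
        then have cD: "?c \<in> carrier D" using Jc by blast
        have yc: "y (m - i) \<in> carrier K" by (rule EK.R_coeff_closed[OF yE])
        obtain d where d: "d \<in> carrier D" "y (m - i) \<otimes>\<^bsub>K\<^esub> \<iota> ?c = \<iota> d" using yJ[OF c] by blast
        have "EK.s i (\<iota> ?c) = \<iota> (h i)" using sK_power_iota[OF cD, of i] R_coeff_closed[OF hR] by (simp add: s_s)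
        then have "j h i \<otimes>\<^bsub>K\<^esub> EK.s i (y (m - i)) = EK.s i (\<iota> ?c) \<otimes>\<^bsub>K\<^esub> EK.s i (y (m - i))" by (simp add: j_def)
        also have "\<dots> = EK.s i (\<iota> d)"
          unfolding d(2)[symmetric] using yc cD by (simp add: EK.s_mult EK.m_comm)
        also have "\<dots> = \<iota> (s i d)" by (rule sK_power_iota[OF d(1)])
        finally show "j h i \<otimes>\<^bsub>K\<^esub> EK.s i (y (m - i)) \<in> \<iota> ` carrier D" using d(1) by simp
      qed
    qed
    then obtain r where r: "r \<in> carrier R" "j h \<otimes>\<^bsub>E\<^esub> y = j r" by blast
    have "j i \<otimes>\<^bsub>E\<^esub> e = u \<otimes>\<^bsub>E\<^esub> ((j h \<otimes>\<^bsub>E\<^esub> y) \<otimes>\<^bsub>E\<^esub> v)"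
      unfolding h(2) y_def using u(1) v hR eE by (simp add: E.m_assoc)
    then show ?thesis using conj2[OF r(1)] unfolding r(2) by simp
  qed
  define e where "e i = monomial K (b i) 0 \<otimes>\<^bsub>E\<^esub> v" for i
  have bE: "monomial K (b i) 0 \<in> carrier E" if "i < n" for i using ab(2)[OF that] by simp
  have eE: "e i \<in> carrier E" if "i < n" for i using bE[OF that] v by (simp add: e_def)
  have eJ: "e i \<in> J'" if i: "i < n" for i
    unfolding J'
  proof (intro CollectI conjI ballI eE[OF i])
    fix g assume "g \<in> I"
    then obtain h where h: "h \<in> ?JR" "j g = u \<otimes>\<^bsub>E\<^esub> j h" using im1 by blast
    have hE: "j h \<in> carrier E" using JRc h by simp
    have "e i \<otimes>\<^bsub>E\<^esub> j g = monomial K (b i) 0 \<otimes>\<^bsub>E\<^esub> j h"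
      unfolding h(2) e_def using bE[OF i] v(1) u(1) hE by (simp add: E.m_assoc uv)
    also have "\<dots> \<in> j ` carrier R"
    proof (rule jR)
      show "monomial K (b i) 0 \<otimes>\<^bsub>E\<^esub> j h \<in> carrier E" using bE[OF i] hE by simp
      fix m
      have "(monomial K (b i) 0 \<otimes>\<^bsub>E\<^esub> j h) m = b i \<otimes>\<^bsub>K\<^esub> \<iota> (h m)"
        using EK.R_mult_monomial_left[OF hE ab(2)[OF i], of 0 m] by (simp add: j_def)
      then show "(monomial K (b i) 0 \<otimes>\<^bsub>E\<^esub> j h) m \<in> \<iota> ` carrier D" using ab(3)[OF i JRJ[OF h(1)]] by simp
    qed
    finally show "e i \<otimes>\<^bsub>E\<^esub> j g \<in> j ` carrier R" .
  qed
  define f where "f i = u \<otimes>\<^bsub>E\<^esub> monomial K (\<iota> (a i)) 0" for i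
  have aE: "monomial K (\<iota> (a i)) 0 \<in> carrier E" if "i < n" for i using aD[OF that] by simp
  have fI: "f i \<in> j ` I" if "i < n" for i
    using im2[OF const[OF ab(1)[OF that]]] unfolding f_def jconst by force
  have mono_mult: "monomial K x 0 \<otimes>\<^bsub>E\<^esub> monomial K y 0 = monomial K (x \<otimes>\<^bsub>K\<^esub> y) 0"
    if "x \<in> carrier K" "y \<in> carrier K" for x y
  proof
    fix m
    show "(monomial K x 0 \<otimes>\<^bsub>E\<^esub> monomial K y 0) m = monomial K (x \<otimes>\<^bsub>K\<^esub> y) 0 m"
      unfolding EK.R_mult_monomial_left[OF EK.monomial_closed[OF that(2)] that(1)]
      using that by (simp add: monomial_def)
  qed
  have mono_sum: "(\<Oplus>\<^bsub>E\<^esub>i\<in>{..<n}. monomial K (x i) 0) = monomial K (\<Oplus>\<^bsub>K\<^esub>i\<in>{..<n}. x i) 0"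
    if "\<And>i. i < n \<Longrightarrow> x i \<in> carrier K" for x
  proof
    fix m
    have "(\<Oplus>\<^bsub>E\<^esub>i\<in>{..<n}. monomial K (x i) 0) m = (\<Oplus>\<^bsub>K\<^esub>i\<in>{..<n}. monomial K (x i) 0 m)"
      by (rule EK.R_finsum_apply) (use that in auto)
    then show "(\<Oplus>\<^bsub>E\<^esub>i\<in>{..<n}. monomial K (x i) 0) m = monomial K (\<Oplus>\<^bsub>K\<^esub>i\<in>{..<n}. x i) 0 m"
      by (cases "m = 0") (simp_all add: monomial_def)
  qed
  have abc: "\<iota> (a i) \<otimes>\<^bsub>K\<^esub> b i \<in> carrier K" "b i \<otimes>\<^bsub>K\<^esub> \<iota> (a i) \<in> carrier K" if "i < n" for i
    using aD ab(2) that by auto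
  have h2: "\<one>\<^bsub>E\<^esub> \<in> ideal_prod E (j ` I) J'"
  proof -
    have "(\<Oplus>\<^bsub>E\<^esub>i\<in>{..<n}. f i \<otimes>\<^bsub>E\<^esub> e i) = (\<Oplus>\<^bsub>E\<^esub>i\<in>{..<n}. u \<otimes>\<^bsub>E\<^esub> (monomial K (\<iota> (a i) \<otimes>\<^bsub>K\<^esub> b i) 0 \<otimes>\<^bsub>E\<^esub> v))"
    proof (rule E.finsum_cong')
      fix i assume i: "i \<in> {..<n}"
      have "f i \<otimes>\<^bsub>E\<^esub> e i = u \<otimes>\<^bsub>E\<^esub> ((monomial K (\<iota> (a i)) 0 \<otimes>\<^bsub>E\<^esub> monomial K (b i) 0) \<otimes>\<^bsub>E\<^esub> v)"
        unfolding f_def e_def using i aE[of i] bE[of i] u(1) v(1) by (simp add: E.m_assoc)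
      then show "f i \<otimes>\<^bsub>E\<^esub> e i = u \<otimes>\<^bsub>E\<^esub> (monomial K (\<iota> (a i) \<otimes>\<^bsub>K\<^esub> b i) 0 \<otimes>\<^bsub>E\<^esub> v)"
        using i aD ab(2) by (simp add: mono_mult)
    qed (use abc u(1) v(1) in auto)
    also have "\<dots> = u \<otimes>\<^bsub>E\<^esub> (\<Oplus>\<^bsub>E\<^esub>i\<in>{..<n}. monomial K (\<iota> (a i) \<otimes>\<^bsub>K\<^esub> b i) 0 \<otimes>\<^bsub>E\<^esub> v)"
      by (rule E.finsum_rdistr[symmetric]) (use abc u(1) v(1) in auto)
    also have "(\<Oplus>\<^bsub>E\<^esub>i\<in>{..<n}. monomial K (\<iota> (a i) \<otimes>\<^bsub>K\<^esub> b i) 0 \<otimes>\<^bsub>E\<^esub> v)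
        = (\<Oplus>\<^bsub>E\<^esub>i\<in>{..<n}. monomial K (\<iota> (a i) \<otimes>\<^bsub>K\<^esub> b i) 0) \<otimes>\<^bsub>E\<^esub> v"
      by (rule E.finsum_ldistr[symmetric]) (use abc v(1) in auto)
    also have "(\<Oplus>\<^bsub>E\<^esub>i\<in>{..<n}. monomial K (\<iota> (a i) \<otimes>\<^bsub>K\<^esub> b i) 0) = \<one>\<^bsub>E\<^esub>"
      using abc by (simp add: mono_sum sum EK.R_one)
    also have "u \<otimes>\<^bsub>E\<^esub> (\<one>\<^bsub>E\<^esub> \<otimes>\<^bsub>E\<^esub> v) = \<one>\<^bsub>E\<^esub>" using v by simp
    finally have eq: "(\<Oplus>\<^bsub>E\<^esub>i\<in>{..<n}. f i \<otimes>\<^bsub>E\<^esub> e i) = \<one>\<^bsub>E\<^esub>" .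
    have "j \<zero>\<^bsub>R\<^esub> \<otimes>\<^bsub>E\<^esub> \<zero>\<^bsub>E\<^esub> \<in> ideal_prod E (j ` I) J'"
      using I.zero_closed zJ' by (intro ideal_prod.prod) auto
    then have "(\<Oplus>\<^bsub>E\<^esub>i\<in>{..<n}. f i \<otimes>\<^bsub>E\<^esub> e i) \<in> ideal_prod E (j ` I) J'"
      using fI eJ by (intro ideal_prod_finsum_closed[OF E_ring jIE J'E]) (auto simp: j0)
    then show ?thesis unfolding eq .
  qed
  have h3: "\<one>\<^bsub>E\<^esub> \<in> ideal_prod E J' (j ` I)"
  proof -
    have "(\<Oplus>\<^bsub>E\<^esub>i\<in>{..<n}. e i \<otimes>\<^bsub>E\<^esub> f i) = (\<Oplus>\<^bsub>E\<^esub>i\<in>{..<n}. monomial K (\<iota> (a i) \<otimes>\<^bsub>K\<^esub> b i) 0)"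
    proof (rule E.finsum_cong')
      fix i assume i: "i \<in> {..<n}"
      have "e i \<otimes>\<^bsub>E\<^esub> f i = monomial K (b i) 0 \<otimes>\<^bsub>E\<^esub> monomial K (\<iota> (a i)) 0"
        unfolding f_def e_def using i aE[of i] bE[of i] u(1) v(1) by (simp add: E.m_assoc uv)
      then show "e i \<otimes>\<^bsub>E\<^esub> f i = monomial K (\<iota> (a i) \<otimes>\<^bsub>K\<^esub> b i) 0"
        using i aD ab(2) EK.m_comm[of "b i" "\<iota> (a i)"] by (simp add: mono_mult)
    qed (use abc in auto)
    also have "\<dots> = \<one>\<^bsub>E\<^esub>" using abc by (simp add: mono_sum sum EK.R_one)
    finally have eq: "(\<Oplus>\<^bsub>E\<^esub>i\<in>{..<n}. e i \<otimes>\<^bsub>E\<^esub> f i) = \<one>\<^bsub>E\<^esub>" .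
    have "\<zero>\<^bsub>E\<^esub> \<otimes>\<^bsub>E\<^esub> j \<zero>\<^bsub>R\<^esub> \<in> ideal_prod E J' (j ` I)"
      using I.zero_closed zJ' by (intro ideal_prod.prod) auto
    then have "(\<Oplus>\<^bsub>E\<^esub>i\<in>{..<n}. e i \<otimes>\<^bsub>E\<^esub> f i) \<in> ideal_prod E J' (j ` I)"
      using fI eJ by (intro ideal_prod_finsum_closed[OF E_ring J'E jIE]) (auto simp: j0)
    then show ?thesis unfolding eq .
  qed
  show ?thesis using h1 h2 h3 by blast
qed

lemma noncommutative_dedekind_R: "noncommutative_dedekind_domain R"
proof -
  have l: "left_noetherian R" "left_hereditary R"
    using ideals_fin_proj_opposite ideals_fin_proj_imp_noetherian ideals_fin_proj_imp_hereditary
    by (auto simp: left_noetherian_def left_hereditary_def)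
  have r: "right_noetherian R" "right_hereditary R"
    using ideals_fin_proj_R ideals_fin_proj_imp_noetherian ideals_fin_proj_imp_hereditary by auto
  have "all_nonzero_ideals_invertible R"
    by (rule asano_criterion[OF noncommutative_domain_R l(1) r(1) E_division_ring j_hom j_inj two_sided_ideal_dual])
  then show ?thesis using l r noncommutative_domain_R by (simp add: noncommutative_dedekind_domain_def)
qed

end

section \<open>Twists by the automorphism\<close>

context skew_laurent
begin

text \<open>Restriction of scalars along \<open>\<sigma>\<^sup>i\<close>. It compensates for the
  semilinearity of multiplication by \<open>x\<^sup>i\<close>.\<close>

definition twist :: "int \<Rightarrow> ('a, 'u) module \<Rightarrow> ('a, 'u) module" where
  "twist i T = T\<lparr>smult := \<lambda>d t. s i d \<odot>\<^bsub>T\<^esub> t\<rparr>"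

lemma twist_simps [simp]:
  "carrier (twist i T) = carrier T" "\<zero>\<^bsub>twist i T\<^esub> = \<zero>\<^bsub>T\<^esub>" "x \<oplus>\<^bsub>twist i T\<^esub> y = x \<oplus>\<^bsub>T\<^esub> y"
  "d \<odot>\<^bsub>twist i T\<^esub> x = s i d \<odot>\<^bsub>T\<^esub> x"
  by (simp_all add: twist_def)

lemma finsum_twist: "finsum (twist i T) f A = finsum T f A"
  by (rule finsum_record_cong) (simp_all add: twist_def)

lemma right_module_twist:
  assumes "right_module D T" shows "right_module D (twist i T)"
proof -
  interpret T: right_module D T by fact
  have "abelian_group (twist i T)"
  proof (rule abelian_groupI, goal_cases)
    case (6 x) then show ?case by (auto intro!: bexI[of _ "\<ominus>\<^bsub>T\<^esub> x"] simp: T.M.l_neg)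
  qed (auto simp: T.M.a_ac)
  then show ?thesis
    by (rule right_moduleI[OF ring_axioms])
       (auto simp: T.smult_closed s_add s_mult T.smult_distrib_scalar T.smult_distrib_vector T.smult_assoc T.smult_one)
qed

text \<open>The vectors stay. The functionals are composed with
  \<open>\<sigma>\<^sup>-\<^sup>i\<close>, which makes them linear for the twisted action and leaves
  each summand of the expansion unchanged.\<close>

lemma fin_proj_twist:
  assumes "fin_proj D T" shows "fin_proj D (twist i T)"
proof -
  obtain n p \<phi> where b: "dual_basis D T {..<n::nat} p \<phi>" and T: "right_module D T"
    using assms by (auto simp: fin_proj_def)
  interpret T: right_module D T by fact
  note c = dual_basis_scalar_closed[OF b]
  have p: "p k \<in> carrier T" if "k < n" for k using b that by (auto simp: dual_basis_def)
  have "dual_basis D (twist i T) {..<n} p (\<lambda>k x. s (- i) (\<phi> k x))"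
    unfolding dual_basis_def
  proof (intro conjI ballI)
    fix k assume k: "k \<in> {..<n}"
    show "right_linear D (twist i T) (regular_module D) (\<lambda>x. s (- i) (\<phi> k x))"
      by (rule right_linearI)
         (use k c in \<open>auto simp: dual_basis_scalar_add[OF b k] dual_basis_scalar_smult[OF b k] s_add s_mult s_s\<close>)
  next
    fix x assume "x \<in> carrier (twist i T)"
    then have x: "x \<in> carrier T" by simp
    have "x = (\<Oplus>\<^bsub>T\<^esub>k\<in>{..<n}. \<phi> k x \<odot>\<^bsub>T\<^esub> p k)" using dual_basis_expand[OF b x] by simp
    also have "\<dots> = (\<Oplus>\<^bsub>T\<^esub>k\<in>{..<n}. s (- i) (\<phi> k x) \<odot>\<^bsub>twist i T\<^esub> p k)"
      using c[OF _ x] p by (intro T.M.finsum_cong') (auto simp: s_s T.smult_closed)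
    finally show "x = (\<Oplus>\<^bsub>twist i T\<^esub>k\<in>{..<n}. s (- i) (\<phi> k x) \<odot>\<^bsub>twist i T\<^esub> p k)"
      by (simp only: finsum_twist)
  qed (use p in auto)
  then show ?thesis by (rule fin_projI[OF right_module_twist[OF T]])
qed

lemma twist_isomorphic:
  assumes "module_isomorphic D M N" shows "module_isomorphic D (twist i M) (twist i N)"
  using assms s_closed unfolding module_isomorphic_def by fastforce

lemma twist_direct_sum:
  "module_isomorphic D (twist i (direct_sum_module P Q)) (direct_sum_module (twist i P) (twist i Q))"
  unfolding module_isomorphic_def by (rule exI[of _ "\<lambda>x. x"]) (auto simp: bij_betw_def)

text \<open>The map \<open>\<sigma>\<^sup>-\<^sup>1\<close> identifies the twist of \<open>J\<close>
  with the ideal \<open>\<sigma>\<^sup>-\<^sup>1(J)\<close>. The hypothesis is applied to this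
  ideal, whose image under \<open>\<sigma>\<close> is \<open>J\<close>.\<close>

lemma twist_trivial_ideal:
  assumes triv: "acts_trivially_on_class_group D \<sigma>" and J: "right_ideal J D"
  shows "module_isomorphic D (twist 1 (ideal_as_module D J)) (ideal_as_module D J)"
proof -
  interpret J: ideal J D by (rule right_ideal_imp_ideal[OF J])
  let ?I = "s (- 1) ` J"
  have Jc: "J \<subseteq> carrier D" by (rule J.a_subset)
  have I: "right_submodule D (regular_module D) ?I"
    unfolding right_submodule_def
  proof (intro conjI ballI)
    show "?I \<subseteq> carrier (regular_module D)" using Jc by auto
    show "\<zero>\<^bsub>regular_module D\<^esub> \<in> ?I" using J.zero_closed by (auto intro!: image_eqI[of _ _ \<zero>])
  next
    fix x y assume "x \<in> ?I" "y \<in> ?I"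
    then obtain a b where ab: "a \<in> J" "b \<in> J" "x = s (- 1) a" "y = s (- 1) b" by blast
    then have "a \<in> carrier D" "b \<in> carrier D" using Jc by auto
    then have "x \<oplus> y = s (- 1) (a \<oplus> b)" using ab by (simp add: s_add)
    then show "x \<oplus>\<^bsub>regular_module D\<^esub> y \<in> ?I" using ab by simp
  next
    fix d x assume d: "d \<in> carrier D" and "x \<in> ?I"
    then obtain a where a: "a \<in> J" "x = s (- 1) a" by blast
    then have "a \<in> carrier D" using Jc by auto
    then have "x \<otimes> d = s (- 1) (a \<otimes> s 1 d)" using a d by (simp add: s_mult s_s)
    then show "d \<odot>\<^bsub>regular_module D\<^esub> x \<in> ?I" using a d J.I_r_closed by simp
  qed
  then have Ii: "ideal ?I D" using right_submodule_regular_iff[OF ring_axioms] right_ideal_imp_ideal by blast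
  have "\<sigma> ` ?I = J"
  proof -
    have "\<sigma> (s (- 1) a) = a" if "a \<in> J" for a
    proof -
      have "a \<in> carrier D" using that Jc by (rule subsetD[rotated])
      then show ?thesis using s_s[of a 1 "- 1"] by (simp add: s_1)
    qed
    then have "(\<lambda>a. \<sigma> (s (- 1) a)) ` J = (\<lambda>a. a) ` J" by (intro image_cong) auto
    then show ?thesis by (simp add: image_image)
  qed
  then have JI: "module_isomorphic D (ideal_as_module D J) (ideal_as_module D ?I)"
    using triv Ii unfolding acts_trivially_on_class_group_def by metis
  have TI: "module_isomorphic D (twist 1 (ideal_as_module D J)) (ideal_as_module D ?I)"
    unfolding module_isomorphic_def
  proof (intro exI[of _ "s (- 1)"] conjI ballI)
    have "inj_on (s (- 1)) J"
    proof (rule inj_onI)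
      fix x y assume xy: "x \<in> J" "y \<in> J" "s (- 1) x = s (- 1) y"
      then have xyD: "x \<in> carrier D" "y \<in> carrier D" using Jc by auto
      have "x = s 1 (s (- 1) x)" using xyD by (simp add: s_s)
      also have "\<dots> = y" unfolding xy(3) using xyD by (simp add: s_s)
      finally show "x = y" .
    qed
    then show "bij_betw (s (- 1)) (carrier (twist 1 (ideal_as_module D J))) (carrier (ideal_as_module D ?I))"
      by (simp add: bij_betw_def)
  qed (use Jc in \<open>auto simp: s_add s_mult s_s subset_iff\<close>)
  show ?thesis
    by (rule module_isomorphic_trans[OF TI module_isomorphic_sym[OF right_module_ideal[OF ring_axioms J] JI]])
qed

text \<open>The hypothesis concerns ideals only. Twisting respects isomorphisms and direct sums, so
  the decomposition of projective modules into ideals extends it to all of them.\<close>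

lemma twist_trivial:
  assumes fp: "ideals_fin_proj D" and triv: "acts_trivially_on_class_group D \<sigma>"
    and M: "fin_proj D M"
  shows "module_isomorphic D (twist 1 M) M"
proof -
  have mod: "right_module D N" if "N \<in> fg_projective_modules D" for N
    using that by (simp add: fg_projective_modules_iff fin_proj_def)
  have *: "module_isomorphic D (twist 1 N) N" if "N \<in> fg_projective_modules D" for N
    using fp that
  proof (induction rule: fg_projective_induct)
    case (ideal N I)
    have "module_isomorphic D (twist 1 N) (ideal_as_module D I)"
      by (rule module_isomorphic_trans[OF twist_isomorphic[OF ideal(3)] twist_trivial_ideal[OF triv ideal(1)]])
    then show ?case using module_isomorphic_trans module_isomorphic_sym[OF mod[OF ideal(2)] ideal(3)] by blast
  next
    case (sum N P Q)
    have "module_isomorphic D (twist 1 N) (direct_sum_module P Q)"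
      by (rule module_isomorphic_trans[OF module_isomorphic_trans[OF twist_isomorphic[OF sum(4)] twist_direct_sum]
          module_isomorphic_direct_sum[OF sum(5,6)]])
    then show ?case using module_isomorphic_trans module_isomorphic_sym[OF mod[OF sum(1)] sum(4)] by blast
  qed
  obtain N :: "('a, nat \<Rightarrow> 'a) module" where N: "N \<in> fg_projective_modules D" "module_isomorphic D N M"
    using fin_proj_copy[OF M] by blast
  have "module_isomorphic D M N" by (rule module_isomorphic_sym[OF mod[OF N(1)] N(2)])
  then have MN: "module_isomorphic D (twist 1 M) (twist 1 N)" by (rule twist_isomorphic)
  show ?thesis by (rule module_isomorphic_trans[OF module_isomorphic_trans[OF MN *[OF N(1)]] N(2)])
qed

section \<open>Lattices in a Laurent series module\<close>

text \<open>This is right multiplication by \<open>x\<^sup>m\<close>; the coefficient 1 of the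
  monomial is fixed by \<open>\<sigma>\<close>, so no twist appears in the formula.\<close>

definition shift :: "int \<Rightarrow> (int \<Rightarrow> 'u) \<Rightarrow> int \<Rightarrow> 'u" where
  "shift m f = (\<lambda>n. f (n - m))"

text \<open>\<open>P((x))\<close> as a right \<open>D\<close>-module; \<open>(p x\<^sup>n) d = p \<sigma>\<^sup>n(d) x\<^sup>n\<close>.\<close>

definition restricted :: "('a, 'u) module \<Rightarrow> ('a, int \<Rightarrow> 'u) module" where
  "restricted P =
     \<lparr>carrier = carrier (LM P), monoid.mult = (\<lambda>_ _. undefined), one = undefined,
      ring.zero = (\<lambda>_. \<zero>\<^bsub>P\<^esub>), ring.add = (\<lambda>f g i. f i \<oplus>\<^bsub>P\<^esub> g i), smult = (\<lambda>d f n. s n d \<odot>\<^bsub>P\<^esub> f n)\<rparr>"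

lemma restricted_simps [simp]:
  "carrier (restricted P) = carrier (LM P)" "\<zero>\<^bsub>restricted P\<^esub> = (\<lambda>_. \<zero>\<^bsub>P\<^esub>)"
  "f \<oplus>\<^bsub>restricted P\<^esub> g = (\<lambda>i. f i \<oplus>\<^bsub>P\<^esub> g i)" "d \<odot>\<^bsub>restricted P\<^esub> f = (\<lambda>n. s n d \<odot>\<^bsub>P\<^esub> f n)"
  by (simp_all add: restricted_def)

lemma shift_shift [simp]: "shift a (shift b f) = shift (a + b) f"
  by (simp add: shift_def algebra_simps)

lemma shift_0 [simp]: "shift 0 f = f"
  by (simp add: shift_def)

lemma shift_eq_iff [simp]: "shift m f = shift m g \<longleftrightarrow> f = g"
  by (metis add.left_inverse shift_0 shift_shift)

lemma shift_mem_image_iff [simp]: "shift m f \<in> shift m ` N \<longleftrightarrow> f \<in> N"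
  by auto

lemma vanishes_below_shift [simp]: "vanishes_below P k (shift m f) \<longleftrightarrow> vanishes_below P (k - m) f"
proof
  assume "vanishes_below P k (shift m f)"
  then have "f (i + m - m) \<in> carrier P" "i + m < k \<Longrightarrow> f (i + m - m) = \<zero>\<^bsub>P\<^esub>" for i
    unfolding vanishes_below_def shift_def by blast+
  then show "vanishes_below P (k - m) f" by (simp add: vanishes_below_def)
qed (simp add: vanishes_below_def shift_def)

lemma shift_closed: "f \<in> carrier (LM P) \<Longrightarrow> shift m f \<in> carrier (LM P)"
  by (auto intro: exI[of _ "_ + m"])

lemma shift_add: "shift m (f \<oplus>\<^bsub>restricted P\<^esub> g) = shift m f \<oplus>\<^bsub>restricted P\<^esub> shift m g"
  by (simp add: shift_def)

text \<open>This is \<open>d x\<^sup>m = x\<^sup>m \<sigma>\<^sup>-\<^sup>m(d)\<close>. It is the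
  source of all twists below.\<close>

lemma shift_smult:
  "d \<in> carrier D \<Longrightarrow> shift m (d \<odot>\<^bsub>restricted P\<^esub> f) = s (- m) d \<odot>\<^bsub>restricted P\<^esub> shift m f"
  by (simp add: shift_def s_s)

lemma right_module_restricted:
  assumes "right_module D P" shows "right_module D (restricted P)"
proof -
  interpret P: right_module D P by fact
  note E = abelian_groupE[OF laurent_abelian_group[OF assms]]
  have "abelian_group (restricted P)"
  proof (rule abelian_groupI, goal_cases)
    case (1 f g) then show ?case using E(1)[of f g] by simp
  next
    case 2 show ?case using E(2) by simp
  next
    case (3 f g h) then show ?case using E(3)[of f g h] by simp
  next
    case (4 f g) then show ?case using E(4)[of f g] by simp
  next
    case (5 f) then show ?case using E(5)[of f] by simp
  next
    case (6 f) then show ?case using E(6)[of f] by simp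
  qed
  then show ?thesis
  proof (rule right_moduleI[OF ring_axioms], goal_cases)
    case (1 d f)
    then obtain k where k: "vanishes_below P k f" by auto
    then have "vanishes_below P k (\<lambda>n. s n d \<odot>\<^bsub>P\<^esub> f n)" using 1(1) by (simp add: vanishes_below_def P.smult_closed)
    then show ?case by auto
  next
    case (2 a b x)
    then have "x n \<in> carrier P" for n by (auto intro: vanishes_below_closed)
    then show ?case using 2 by (simp add: s_add P.smult_distrib_scalar)
  next
    case (3 a x y)
    then have "x n \<in> carrier P" "y n \<in> carrier P" for n by (auto intro: vanishes_below_closed)
    then show ?case using 3 by (simp add: P.smult_distrib_vector)
  next
    case (4 a b x)
    then have "x n \<in> carrier P" for n by (auto intro: vanishes_below_closed)
    then show ?case using 4 by (simp add: s_mult P.smult_assoc)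
  next
    case (5 x)
    then have "x n \<in> carrier P" for n by (auto intro: vanishes_below_closed)
    then show ?case by (simp add: P.smult_one)
  qed
qed

text \<open>A lattice with residue module \<open>P\<close>, that is, \<open>N / N x \<cong> P\<close>.\<close>

definition lattice_with_residue :: "('a, int \<Rightarrow> 'u) module \<Rightarrow> (int \<Rightarrow> 'u) set \<Rightarrow> ('a, 'v) module \<Rightarrow> bool" where
  "lattice_with_residue V N P \<longleftrightarrow> right_submodule D V N \<and> shift 1 ` N \<subseteq> N \<and>
     (\<exists>\<pi>. right_linear D (V\<lparr>carrier := N\<rparr>) P \<pi> \<and> \<pi> ` N = carrier P \<and> {f \<in> N. \<pi> f = \<zero>\<^bsub>P\<^esub>} = shift 1 ` N)"

lemma right_submodule_shift:
  assumes "right_submodule D (restricted P) N" shows "right_submodule D (restricted P) (shift m ` N)"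
  unfolding right_submodule_def
proof (intro conjI ballI)
  have N: "N \<subseteq> carrier (LM P)" using assms by (simp add: right_submodule_def del: laurent_module_simps)
  show "shift m ` N \<subseteq> carrier (restricted P)"
  proof
    fix y assume "y \<in> shift m ` N"
    then obtain f where "f \<in> N" "y = shift m f" by (rule imageE)
    then show "y \<in> carrier (restricted P)" using shift_closed[of f P m] N by (simp only: restricted_simps subsetD)
  qed
  have "(\<lambda>_. \<zero>\<^bsub>P\<^esub>) \<in> N" using assms by (simp add: right_submodule_def)
  moreover have "shift m (\<lambda>_. \<zero>\<^bsub>P\<^esub>) = (\<lambda>_. \<zero>\<^bsub>P\<^esub>)" by (simp add: shift_def)
  ultimately show "\<zero>\<^bsub>restricted P\<^esub> \<in> shift m ` N"
    by (intro image_eqI[of _ _ "\<lambda>_. \<zero>\<^bsub>P\<^esub>"]) simp_all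
next
  fix x y assume "x \<in> shift m ` N" "y \<in> shift m ` N"
  then obtain f g where fg: "f \<in> N" "g \<in> N" "x = shift m f" "y = shift m g" by blast
  then have "x \<oplus>\<^bsub>restricted P\<^esub> y = shift m (f \<oplus>\<^bsub>restricted P\<^esub> g)" by (simp only: shift_add)
  then show "x \<oplus>\<^bsub>restricted P\<^esub> y \<in> shift m ` N"
    using right_submodule_add[OF assms fg(1,2)] by (simp only: shift_mem_image_iff)
next
  fix d x assume d: "d \<in> carrier D" and "x \<in> shift m ` N"
  then obtain f where f: "f \<in> N" "x = shift m f" by blast
  have eq: "d \<odot>\<^bsub>restricted P\<^esub> x = shift m (s m d \<odot>\<^bsub>restricted P\<^esub> f)"
    unfolding shift_smult[OF s_closed[OF d]] using d f by (simp add: s_s)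
  have "s m d \<odot>\<^bsub>restricted P\<^esub> f \<in> N" by (rule right_submodule_smult[OF assms s_closed[OF d] f(1)])
  then show "d \<odot>\<^bsub>restricted P\<^esub> x \<in> shift m ` N" unfolding eq by (rule imageI)
qed

text \<open>Shifting back is semilinear, and the twist of the target absorbs this. In terms of
  quotients, \<open>N x\<^sup>m / L x\<^sup>m\<close> is the twist of \<open>N / L\<close> by
  \<open>\<sigma>\<^sup>m\<close>.\<close>

lemma right_linear_shifted:
  assumes N: "right_submodule D (restricted P) N" and f: "right_linear D ((restricted P)\<lparr>carrier := N\<rparr>) T f"
  shows "right_linear D ((restricted P)\<lparr>carrier := shift m ` N\<rparr>) (twist m T) (\<lambda>y. f (shift (- m) y))"
proof (rule right_linearI)
  fix y assume "y \<in> carrier ((restricted P)\<lparr>carrier := shift m ` N\<rparr>)"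
  then show "f (shift (- m) y) \<in> carrier (twist m T)" using right_linearD(1)[OF f] by auto
next
  fix x y assume "x \<in> carrier ((restricted P)\<lparr>carrier := shift m ` N\<rparr>)"
    "y \<in> carrier ((restricted P)\<lparr>carrier := shift m ` N\<rparr>)"
  then obtain u v where uv: "u \<in> N" "v \<in> N" "x = shift m u" "y = shift m v" by auto
  have "shift (- m) (x \<oplus>\<^bsub>restricted P\<^esub> y) = u \<oplus>\<^bsub>restricted P\<^esub> v"
    unfolding shift_add uv by simp
  then show "f (shift (- m) (x \<oplus>\<^bsub>(restricted P)\<lparr>carrier := shift m ` N\<rparr>\<^esub> y)) =
      f (shift (- m) x) \<oplus>\<^bsub>twist m T\<^esub> f (shift (- m) y)"
    using right_linearD(2)[OF f, of u v] uv by simp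
next
  fix d y assume d: "d \<in> carrier D" and "y \<in> carrier ((restricted P)\<lparr>carrier := shift m ` N\<rparr>)"
  then obtain u where u: "u \<in> N" "y = shift m u" by auto
  have "shift (- m) (d \<odot>\<^bsub>restricted P\<^esub> y) = s m d \<odot>\<^bsub>restricted P\<^esub> u"
    unfolding shift_smult[OF d] u(2) by simp
  then show "f (shift (- m) (d \<odot>\<^bsub>(restricted P)\<lparr>carrier := shift m ` N\<rparr>\<^esub> y)) = d \<odot>\<^bsub>twist m T\<^esub> f (shift (- m) y)"
    using right_linearD(3)[OF f, of "s m d" u] d u by simp
qed

text \<open>The residue module of \<open>N x\<close> is the twist of that of \<open>N\<close>, and
  \<open>triv\<close> identifies it with \<open>P\<close> again.\<close>

lemma lattice_shift:
  assumes N: "lattice_with_residue (restricted P') N P" and P: "right_module D P"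
    and triv: "module_isomorphic D (twist 1 P) P"
  shows "lattice_with_residue (restricted P') (shift (int m) ` N) P"
proof (induction m)
  case 0 then show ?case using N by (simp add: image_def)
next
  case (Suc m)
  let ?N = "shift (int m) ` N"
  have NS: "shift (int (Suc m)) ` N = shift 1 ` ?N" by (simp add: image_image)
  obtain \<pi> where sub: "right_submodule D (restricted P') ?N" "shift 1 ` ?N \<subseteq> ?N"
    and \<pi>: "right_linear D ((restricted P')\<lparr>carrier := ?N\<rparr>) P \<pi>" "\<pi> ` ?N = carrier P"
      "{f \<in> ?N. \<pi> f = \<zero>\<^bsub>P\<^esub>} = shift 1 ` ?N"
    using Suc by (auto simp: lattice_with_residue_def)
  obtain \<theta> where \<theta>: "bij_betw \<theta> (carrier P) (carrier P)" "right_linear D (twist 1 P) P \<theta>"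
    using triv by (auto simp: module_isomorphic_iff)
  have P1: "right_module D (twist 1 P)" by (rule right_module_twist[OF P])
  have \<theta>0: "\<theta> p = \<zero>\<^bsub>P\<^esub> \<longleftrightarrow> p = \<zero>\<^bsub>P\<^esub>" if "p \<in> carrier P" for p
    using right_linear_inj_iff[OF P1 P \<theta>(2)] right_linear_zero[OF P1 P \<theta>(2)] \<theta>(1) that by (auto simp: bij_betw_def)
  let ?q = "\<lambda>y. \<theta> (\<pi> (shift (- 1) y))"
  have lin: "right_linear D ((restricted P')\<lparr>carrier := shift 1 ` ?N\<rparr>) P ?q"
    by (rule right_linear_compose[OF right_linear_shifted[OF sub(1) \<pi>(1)] \<theta>(2)])
  have im: "?q ` shift 1 ` ?N = carrier P"
  proof -
    have "?q ` shift 1 ` ?N = \<theta> ` \<pi> ` ?N" by (simp add: image_image)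
    then show ?thesis using \<pi>(2) \<theta>(1) by (simp add: bij_betw_def)
  qed
  have ker: "{f \<in> shift 1 ` ?N. ?q f = \<zero>\<^bsub>P\<^esub>} = shift 1 ` shift 1 ` ?N"
  proof -
    have "{f \<in> shift 1 ` ?N. ?q f = \<zero>\<^bsub>P\<^esub>} = shift 1 ` {f \<in> ?N. \<theta> (\<pi> f) = \<zero>\<^bsub>P\<^esub>}" by auto
    also have "{f \<in> ?N. \<theta> (\<pi> f) = \<zero>\<^bsub>P\<^esub>} = {f \<in> ?N. \<pi> f = \<zero>\<^bsub>P\<^esub>}"
    proof (rule Collect_cong, rule conj_cong[OF refl])
      fix f assume "f \<in> ?N"
      then have "\<pi> f \<in> carrier P" using right_linearD(1)[OF \<pi>(1)] by auto
      then show "\<theta> (\<pi> f) = \<zero>\<^bsub>P\<^esub> \<longleftrightarrow> \<pi> f = \<zero>\<^bsub>P\<^esub>" by (rule \<theta>0)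
    qed
    finally show ?thesis unfolding \<pi>(3) .
  qed
  have "shift 1 ` shift 1 ` ?N \<subseteq> shift 1 ` ?N" by (rule image_mono[OF sub(2)])
  then show ?case unfolding NS lattice_with_residue_def
    using right_submodule_shift[OF sub(1)] lin im ker by blast
qed

text \<open>All factors of the filtration \<open>N\<close>, \<open>N x\<close>, ...,
  \<open>N x\<^sup>k\<close> are isomorphic to the projective module \<open>B\<close>, so the
  successive extensions split and a model \<open>Q\<close> of \<open>N / N x\<^sup>k\<close> is
  projective.\<close>

lemma lattice_quotient_power:
  assumes B: "fin_proj D (B :: ('a, nat \<Rightarrow> 'a) module)"
    and V: "right_module D P'" and N: "lattice_with_residue (restricted P') N B"
    and triv: "module_isomorphic D (twist 1 B) B"
  shows "\<exists>(Q :: ('a, nat \<Rightarrow> 'a) module) g. fin_proj D Q \<and>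
    right_linear D ((restricted P')\<lparr>carrier := N\<rparr>) Q g \<and> g ` N = carrier Q \<and>
    {f \<in> N. g f = \<zero>\<^bsub>Q\<^esub>} = shift (int k) ` N"
proof -
  have Bm: "right_module D B" using B by (simp add: fin_proj_def)
  have Nsub: "right_submodule D (restricted P') N" using N by (simp add: lattice_with_residue_def)
  have NM: "right_module D ((restricted P')\<lparr>carrier := N\<rparr>)"
    by (rule right_module_submodule[OF right_module_restricted[OF V] Nsub])
  show ?thesis
  proof (induction k)
    case 0
    obtain Z :: "('a, nat \<Rightarrow> 'a) module" where Z: "Z \<in> fg_projective_modules D" "carrier Z = {\<zero>\<^bsub>Z\<^esub>}"
      using zero_module_exists[OF ring_axioms] by blast
    have Z': "fin_proj D Z" using Z(1) by (simp add: fg_projective_modules_iff)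
    then interpret Z: right_module D Z by (simp add: fin_proj_def)
    have "right_linear D ((restricted P')\<lparr>carrier := N\<rparr>) Z (\<lambda>_. \<zero>\<^bsub>Z\<^esub>)" by (rule right_linearI) auto
    moreover have "N \<noteq> {}" using Nsub by (auto simp: right_submodule_def)
    then have "(\<lambda>_. \<zero>\<^bsub>Z\<^esub>) ` N = carrier Z" using Z(2) by auto
    moreover have "{f \<in> N. \<zero>\<^bsub>Z\<^esub> = \<zero>\<^bsub>Z\<^esub>} = shift (int 0) ` N" by (simp add: image_def)
    ultimately show ?case using Z' by (intro exI[of _ Z] exI[of _ "\<lambda>_. \<zero>\<^bsub>Z\<^esub>"]) blast
  next
    case (Suc k)
    then obtain Q :: "('a, nat \<Rightarrow> 'a) module" and g where Q: "fin_proj D Q"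
      and g: "right_linear D ((restricted P')\<lparr>carrier := N\<rparr>) Q g" "g ` N = carrier Q"
        "{f \<in> N. g f = \<zero>\<^bsub>Q\<^esub>} = shift (int k) ` N" by blast
    obtain \<pi> where \<pi>: "right_linear D ((restricted P')\<lparr>carrier := shift (int k) ` N\<rparr>) B \<pi>"
      "\<pi> ` shift (int k) ` N = carrier B"
      "{f \<in> shift (int k) ` N. \<pi> f = \<zero>\<^bsub>B\<^esub>} = shift 1 ` shift (int k) ` N"
      using lattice_shift[OF N Bm triv, of k] by (auto simp: lattice_with_residue_def)
    have "\<exists>h. right_linear D ((restricted P')\<lparr>carrier := N\<rparr>) (direct_sum_module Q B) h \<and>
       h ` carrier ((restricted P')\<lparr>carrier := N\<rparr>) = carrier (direct_sum_module Q B) \<and>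
       {x \<in> carrier ((restricted P')\<lparr>carrier := N\<rparr>). h x = \<zero>\<^bsub>direct_sum_module Q B\<^esub>}
         = {x \<in> shift (int k) ` N. \<pi> x = \<zero>\<^bsub>B\<^esub>}"
      by (rule extension_split[OF NM Q Bm g(1)]) (use g \<pi> in simp_all)
    then obtain h where h: "right_linear D ((restricted P')\<lparr>carrier := N\<rparr>) (direct_sum_module Q B) h"
       "h ` N = carrier (direct_sum_module Q B)"
       "{x \<in> N. h x = \<zero>\<^bsub>direct_sum_module Q B\<^esub>} = {x \<in> shift (int k) ` N. \<pi> x = \<zero>\<^bsub>B\<^esub>}" by auto
    have QB: "fin_proj D (direct_sum_module Q B)" by (rule fin_proj_direct_sum[OF Q B])
    then have QBm: "right_module D (direct_sum_module Q B)" by (simp add: fin_proj_def)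
    \<comment> \<open>A direct sum has a larger type than its summands; the copy returns to the type
      demanded by the induction.\<close>
    obtain C :: "('a, nat \<Rightarrow> 'a) module" where C: "C \<in> fg_projective_modules D"
      "module_isomorphic D C (direct_sum_module Q B)" using fin_proj_copy[OF QB] by blast
    have C': "fin_proj D C" using C(1) by (simp add: fg_projective_modules_iff)
    then have Cm: "right_module D C" by (simp add: fin_proj_def)
    obtain \<theta> where \<theta>: "bij_betw \<theta> (carrier (direct_sum_module Q B)) (carrier C)"
      "right_linear D (direct_sum_module Q B) C \<theta>"
      using module_isomorphic_sym[OF Cm C(2)] unfolding module_isomorphic_iff by blast
    have \<theta>0: "\<theta> p = \<zero>\<^bsub>C\<^esub> \<longleftrightarrow> p = \<zero>\<^bsub>direct_sum_module Q B\<^esub>" if "p \<in> carrier (direct_sum_module Q B)" for p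
      using right_linear_inj_iff[OF QBm Cm \<theta>(2)] right_linear_zero[OF QBm Cm \<theta>(2)] \<theta>(1) that
      unfolding bij_betw_def by blast
    have hc: "h f \<in> carrier (direct_sum_module Q B)" if "f \<in> N" for f
      using right_linearD(1)[OF h(1), of f] that by simp
    have "(\<lambda>f. \<theta> (h f)) ` N = \<theta> ` h ` N" by (simp add: image_image)
    then have im: "(\<lambda>f. \<theta> (h f)) ` N = carrier C" unfolding h(2) using \<theta>(1) by (simp add: bij_betw_def)
    have "{f \<in> N. \<theta> (h f) = \<zero>\<^bsub>C\<^esub>} = {x \<in> N. h x = \<zero>\<^bsub>direct_sum_module Q B\<^esub>}"
      using \<theta>0[OF hc] by blast
    also have "\<dots> = shift (int (Suc k)) ` N" unfolding h(3) \<pi>(3) by (simp add: image_image)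
    finally have ker: "{f \<in> N. \<theta> (h f) = \<zero>\<^bsub>C\<^esub>} = shift (int (Suc k)) ` N" .
    show ?case using C' right_linear_compose[OF h(1) \<theta>(2)] im ker
      by (intro exI[of _ C] exI[of _ "\<lambda>f. \<theta> (h f)"]) blast
  qed
qed

text \<open>With \<open>T = W / N\<close>, computing \<open>W / N x\<close> along \<open>N\<close> and along \<open>W x\<close> gives
  \<open>[T] + [B] = [A] + [T\<^sup>\<sigma>]\<close>.  Here \<open>T\<close> is projective because it is isomorphic, up to a twist, to
  \<open>W x\<^sup>k / N x\<^sup>k\<close>, which lies in the projective module \<open>N / N x\<^sup>k\<close>.\<close>

lemma lattice_comparison:
  assumes fp: "ideals_fin_proj D" and triv: "acts_trivially_on_class_group D \<sigma>"
    and A: "fin_proj D (A :: ('a, nat \<Rightarrow> 'a) module)" and B: "fin_proj D (B :: ('a, nat \<Rightarrow> 'a) module)"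
    and V: "right_module D P'"
    and W: "lattice_with_residue (restricted P') W A" and N: "lattice_with_residue (restricted P') N B"
    and NW: "N \<subseteq> W" and WN: "shift (int k) ` W \<subseteq> N"
  shows "k0_class D A = k0_class D B"
proof -
  let ?V = "restricted P'"
  have Am: "right_module D A" and Bm: "right_module D B" using A B by (auto simp: fin_proj_def)
  have VM: "right_module D ?V" by (rule right_module_restricted[OF V])
  have Wsub: "right_submodule D ?V W" and Nsub: "right_submodule D ?V N" using W N by (auto simp: lattice_with_residue_def)
  let ?W = "?V\<lparr>carrier := W\<rparr>" let ?N = "?V\<lparr>carrier := N\<rparr>"
  have WM: "right_module D ?W" by (rule right_module_submodule[OF VM Wsub])
  obtain Q :: "('a, nat \<Rightarrow> 'a) module" and g where Q: "fin_proj D Q"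
    and g: "right_linear D ?N Q g" "g ` N = carrier Q" "{f \<in> N. g f = \<zero>\<^bsub>Q\<^esub>} = shift (int k) ` N"
    using lattice_quotient_power[OF B V N twist_trivial[OF fp triv B]] by blast
  have Qm: "right_module D Q" using Q by (simp add: fin_proj_def)
  let ?Wk = "?V\<lparr>carrier := shift (int k) ` W\<rparr>"
  have Wk: "right_submodule D ?V (shift (int k) ` W)" by (rule right_submodule_shift[OF Wsub])
  have WkM: "right_module D ?Wk" by (rule right_module_submodule[OF VM Wk])
  have gk: "right_linear D ?Wk Q g"
    using right_linear_subset[OF g(1), of "shift (int k) ` W"] WN by simp
  define U where "U = g ` shift (int k) ` W"
  have Usub: "right_submodule D Q U" unfolding U_def using right_submodule_image[OF WkM Qm gk] by simp
  have QU: "fin_proj D (Q\<lparr>carrier := U\<rparr>)" by (rule fin_proj_submodule[OF fp Q Usub])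
  define T where "T = twist (- int k) (Q\<lparr>carrier := U\<rparr>)"
  have T: "fin_proj D T" unfolding T_def by (rule fin_proj_twist[OF QU])
  have Tm: "right_module D T" using T by (simp add: fin_proj_def)
  have Tc: "carrier T = U" "\<zero>\<^bsub>T\<^esub> = \<zero>\<^bsub>Q\<^esub>" by (simp_all add: T_def)
  \<comment> \<open>\<open>f w\<close> is \<open>g (w x\<^sup>k)\<close>. As \<open>g\<close> has
    kernel \<open>N x\<^sup>k\<close>, the kernel of \<open>f\<close> is \<open>N\<close>; the twist
    by \<open>- k\<close> in \<open>T\<close> makes it linear. So \<open>T\<close> is a model of
    \<open>W / N\<close>.\<close>
  define f where "f w = g (shift (int k) w)" for w
  have f: "right_linear D ?W T f"
  proof -
    have "right_linear D ?Wk (Q\<lparr>carrier := U\<rparr>) g" by (rule right_linear_into[OF gk]) (simp add: U_def)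
    from right_linear_shifted[OF Wk this, of "- int k"] show ?thesis
      by (simp add: T_def f_def[abs_def] image_image)
  qed
  have fW: "f ` W = carrier T" by (simp add: Tc U_def f_def[abs_def] image_image)
  have fk: "{w \<in> W. f w = \<zero>\<^bsub>T\<^esub>} = N"
  proof (intro equalityI subsetI)
    fix w assume "w \<in> {w \<in> W. f w = \<zero>\<^bsub>T\<^esub>}"
    then have "shift (int k) w \<in> {f \<in> N. g f = \<zero>\<^bsub>Q\<^esub>}" using WN by (auto simp: f_def Tc)
    then show "w \<in> N" unfolding g(3) by simp
  next
    fix w assume w: "w \<in> N"
    then have "shift (int k) w \<in> {f \<in> N. g f = \<zero>\<^bsub>Q\<^esub>}" unfolding g(3) by simp
    then show "w \<in> {w \<in> W. f w = \<zero>\<^bsub>T\<^esub>}" using w NW by (auto simp: f_def Tc)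
  qed
  obtain \<pi> where \<pi>: "right_linear D ?N B \<pi>" "\<pi> ` N = carrier B" "{f \<in> N. \<pi> f = \<zero>\<^bsub>B\<^esub>} = shift 1 ` N"
    using N by (auto simp: lattice_with_residue_def)
  obtain \<rho> where \<rho>: "right_linear D ?W A \<rho>" "\<rho> ` W = carrier A" "{f \<in> W. \<rho> f = \<zero>\<^bsub>A\<^esub>} = shift 1 ` W"
    using W by (auto simp: lattice_with_residue_def)
  \<comment> \<open>\<open>W / N x\<close> along \<open>N\<close>: the factors are
    \<open>W / N\<close>, modelled by \<open>T\<close>, and \<open>N / N x\<close>, modelled by
    \<open>B\<close>.\<close>
  have "\<exists>h. right_linear D ?W (direct_sum_module T B) h \<and>
      h ` carrier ?W = carrier (direct_sum_module T B) \<and>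
      {x \<in> carrier ?W. h x = \<zero>\<^bsub>direct_sum_module T B\<^esub>} = {x \<in> N. \<pi> x = \<zero>\<^bsub>B\<^esub>}"
    by (rule extension_split[OF WM T Bm f]) (use fW fk \<pi> in simp_all)
  then obtain h1 where h1: "right_linear D ?W (direct_sum_module T B) h1"
      "h1 ` carrier ?W = carrier (direct_sum_module T B)"
      "{x \<in> carrier ?W. h1 x = \<zero>\<^bsub>direct_sum_module T B\<^esub>} = shift 1 ` N" unfolding \<pi>(3) by blast
  let ?T1 = "twist 1 T"
  have T1: "fin_proj D ?T1" by (rule fin_proj_twist[OF T])
  have T1m: "right_module D ?T1" using T1 by (simp add: fin_proj_def)
  let ?fx = "\<lambda>y. f (shift (- 1) y)"
  have fx: "right_linear D (?V\<lparr>carrier := shift 1 ` W\<rparr>) ?T1 ?fx"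
    by (rule right_linear_shifted[OF Wsub f])
  have fxW: "?fx ` shift 1 ` W = carrier ?T1" using fW by (simp add: image_image)
  have fxk: "{y \<in> shift 1 ` W. ?fx y = \<zero>\<^bsub>?T1\<^esub>} = shift 1 ` N"
  proof -
    have "{y \<in> shift 1 ` W. ?fx y = \<zero>\<^bsub>?T1\<^esub>} = shift 1 ` {w \<in> W. f w = \<zero>\<^bsub>T\<^esub>}" by auto
    then show ?thesis unfolding fk .
  qed
  \<comment> \<open>\<open>W / N x\<close> along \<open>W x\<close>: the factors are
    \<open>W / W x\<close>, modelled by \<open>A\<close>, and \<open>W x / N x\<close>, which is the
    twist of \<open>T\<close>.\<close>
  have "\<exists>h. right_linear D ?W (direct_sum_module A ?T1) h \<and>
      h ` carrier ?W = carrier (direct_sum_module A ?T1) \<and>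
      {x \<in> carrier ?W. h x = \<zero>\<^bsub>direct_sum_module A ?T1\<^esub>} = {x \<in> shift 1 ` W. ?fx x = \<zero>\<^bsub>?T1\<^esub>}"
    by (rule extension_split[OF WM A T1m \<rho>(1)]) (use \<rho> fx fxW in simp_all)
  then obtain h2 where h2: "right_linear D ?W (direct_sum_module A ?T1) h2"
      "h2 ` carrier ?W = carrier (direct_sum_module A ?T1)"
      "{x \<in> carrier ?W. h2 x = \<zero>\<^bsub>direct_sum_module A ?T1\<^esub>} = shift 1 ` N" unfolding fxk by blast
  have "module_isomorphic D (direct_sum_module T B) (direct_sum_module A ?T1)"
    by (rule isomorphic_of_same_kernel[OF WM right_module_direct_sum[OF Tm Bm] right_module_direct_sum[OF Am T1m]
        h1(1,2) h2(1,2)]) (use h1(3) h2(3) in simp)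
  then have "k0_class D T \<otimes>\<^bsub>K0 D\<^esub> k0_class D B = k0_class D A \<otimes>\<^bsub>K0 D\<^esub> k0_class D ?T1"
    using k0_class_cong[OF fin_proj_direct_sum[OF T B]] k0_class_sum[OF T B] k0_class_sum[OF A T1] by metis
  also have "k0_class D ?T1 = k0_class D T" by (rule k0_class_cong[OF T1 twist_trivial[OF fp triv T]])
  finally have e: "k0_class D T \<otimes>\<^bsub>K0 D\<^esub> k0_class D B = k0_class D A \<otimes>\<^bsub>K0 D\<^esub> k0_class D T" .
  interpret K: comm_group "K0 D" by (rule comm_group_K0)
  show ?thesis
    using e k0_class_closed[OF T] k0_class_closed[OF A] k0_class_closed[OF B]
    by (metis K.m_comm K.l_cancel)
qed

text \<open>A series without negative exponents is a combination of the constants \<open>p i\<close>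
  with scalars \<open>\<phi> i (f)\<close> that again have no negative exponents. By linearity a
  common lower bound for the finitely many images of the constants serves for all such series. This
  makes lattices on both sides of an isomorphism comparable.\<close>

lemma laurent_linear_bounded:
  assumes P: "fin_proj D P" and P': "right_module D P'" and \<psi>: "right_linear R (LM P) (LM P') \<psi>"
  shows "\<exists>m::nat. \<forall>f. vanishes_below P 0 f \<longrightarrow> vanishes_below P' (- int m) (\<psi> f)"
proof -
  obtain N p \<phi> where b: "dual_basis D P {..<N::nat} p \<phi>" and Pm: "right_module D P"
    using P by (auto simp: fin_proj_def)
  interpret P: right_module D P by fact
  interpret P': right_module D P' by fact
  note L = right_module_laurent[OF Pm] and L' = right_module_laurent[OF P']
  have p: "p i \<in> carrier P" if "i < N" for i using b that by (auto simp: dual_basis_def)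
  let ?m = "\<lambda>i. monomial P (p i) 0"
  have mL: "?m i \<in> carrier (LM P)" if "i < N" for i
    using vanishes_below_monomial[OF P.M.abelian_monoid_axioms p[OF that] order_refl] by auto
  have "\<forall>i. \<exists>k. i < N \<longrightarrow> vanishes_below P' k (\<psi> (?m i))"
    using right_linearD(1)[OF \<psi> mL] by auto
  then obtain k where k: "\<And>i. i < N \<Longrightarrow> vanishes_below P' (k i) (\<psi> (?m i))" by metis
  \<comment> \<open>The inserted 0 keeps the maximum defined when the dual basis is empty.\<close>
  define m where "m = Max (insert 0 ((\<lambda>i. nat (- k i)) ` {..<N}))"
  have mk: "- int m \<le> k i" if "i < N" for i
  proof -
    have "nat (- k i) \<le> m" unfolding m_def using that by (intro Max_ge) auto
    then show ?thesis by linarith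
  qed
  have "vanishes_below P' (- int m) (\<psi> f)" if f: "vanishes_below P 0 f" for f
  proof -
    let ?g = "\<lambda>i n. \<phi> i (f n)"
    have g: "vanishes_below D 0 (?g i)" if i: "i < N" for i
      by (rule vanishes_below_map[OF Pm right_module_regular[OF ring_axioms] _ f, simplified vanishes_below_regular])
        (use b i in \<open>auto simp: dual_basis_def\<close>)
    have gR: "?g i \<in> carrier R" if "i < N" for i by (rule R_memI[OF g[OF that]])
    have cl: "(\<lambda>i. ?g i \<odot>\<^bsub>LM P\<^esub> ?m i) \<in> {..<N} \<rightarrow> carrier (LM P)"
      using gR mL right_module.smult_closed[OF L] by (simp del: laurent_module_simps)
    have fe: "f = (\<Oplus>\<^bsub>LM P\<^esub>i\<in>{..<N}. ?g i \<odot>\<^bsub>LM P\<^esub> ?m i)"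
    proof
      fix n
      have "(\<Oplus>\<^bsub>LM P\<^esub>i\<in>{..<N}. ?g i \<odot>\<^bsub>LM P\<^esub> ?m i) n = (\<Oplus>\<^bsub>P\<^esub>i\<in>{..<N}. \<phi> i (f n) \<odot>\<^bsub>P\<^esub> p i)"
        unfolding laurent_finsum_apply[OF Pm cl]
      proof (rule P.M.finsum_cong')
        fix i assume "i \<in> {..<N}"
        then show "(?g i \<odot>\<^bsub>LM P\<^esub> ?m i) n = \<phi> i (f n) \<odot>\<^bsub>P\<^esub> p i"
          using act_monomial_left[OF Pm p[of i] g, of i 0 n] by simp
      qed (use dual_basis_scalar_closed[OF b _ vanishes_below_closed[OF f]] p in \<open>auto simp: P.smult_closed\<close>)
      then show "f n = (\<Oplus>\<^bsub>LM P\<^esub>i\<in>{..<N}. ?g i \<odot>\<^bsub>LM P\<^esub> ?m i) n"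
        using dual_basis_expand[OF b vanishes_below_closed[OF f]] by simp
    qed
    have "\<psi> f = (\<Oplus>\<^bsub>LM P'\<^esub>i\<in>{..<N}. \<psi> (?g i \<odot>\<^bsub>LM P\<^esub> ?m i))"
      by (subst fe) (rule right_linear_finsum[OF L L' \<psi> cl])
    also have "\<dots> = (\<Oplus>\<^bsub>LM P'\<^esub>i\<in>{..<N}. ?g i \<odot>\<^bsub>LM P'\<^esub> \<psi> (?m i))"
    proof (rule abelian_monoid.finsum_cong')
      show "abelian_monoid (LM P')" using laurent_abelian_group[OF P'] by (rule abelian_group.axioms)
      show "(\<lambda>i. ?g i \<odot>\<^bsub>LM P'\<^esub> \<psi> (?m i)) \<in> {..<N} \<rightarrow> carrier (LM P')"
        using gR right_linearD(1)[OF \<psi> mL] right_module.smult_closed[OF L'] by (simp del: laurent_module_simps)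
    qed (use right_linearD(3)[OF \<psi> gR mL] in auto)
    finally have e: "\<psi> f = (\<Oplus>\<^bsub>LM P'\<^esub>i\<in>{..<N}. ?g i \<odot>\<^bsub>LM P'\<^esub> \<psi> (?m i))" .
    have v: "vanishes_below P' (- int m) (?g i \<odot>\<^bsub>LM P'\<^esub> \<psi> (?m i))" if i: "i < N" for i
      using act_closed[OF P' k[OF i] g[OF i]] mk[OF i] vanishes_below_mono by fastforce
    have cl': "(\<lambda>i. ?g i \<odot>\<^bsub>LM P'\<^esub> \<psi> (?m i)) \<in> {..<N} \<rightarrow> carrier (LM P')"
    proof
      fix i assume "i \<in> {..<N}"
      then have "vanishes_below P' (- int m) (?g i \<odot>\<^bsub>LM P'\<^esub> \<psi> (?m i))" using v by simp
      then show "?g i \<odot>\<^bsub>LM P'\<^esub> \<psi> (?m i) \<in> carrier (LM P')" by (simp, blast)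
    qed
    have en: "\<psi> f n = (\<Oplus>\<^bsub>P'\<^esub>i\<in>{..<N}. (?g i \<odot>\<^bsub>LM P'\<^esub> \<psi> (?m i)) n)" for n
      unfolding e by (rule laurent_finsum_apply[OF P' cl'])
    show ?thesis unfolding vanishes_below_def
    proof (intro conjI allI impI)
      fix n
      show "\<psi> f n \<in> carrier P'"
        unfolding en using vanishes_below_closed[OF v] by (intro P'.M.finsum_closed) auto
      assume "n < - int m"
      then have "(\<Oplus>\<^bsub>P'\<^esub>i\<in>{..<N}. (?g i \<odot>\<^bsub>LM P'\<^esub> \<psi> (?m i)) n) = (\<Oplus>\<^bsub>P'\<^esub>i\<in>{..<N}. \<zero>\<^bsub>P'\<^esub>)"
        using vanishes_below_zero[OF v] by (intro P'.M.finsum_cong') auto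
      then show "\<psi> f n = \<zero>\<^bsub>P'\<^esub>" unfolding en by simp
    qed
  qed
  then show ?thesis by blast
qed

text \<open>The lattice \<open>P[[x]]\<close>, with the constant coefficient as its residue
  map.\<close>

lemma standard_lattice:
  assumes "right_module D P"
  shows "lattice_with_residue (restricted P) {f. vanishes_below P 0 f} P"
proof -
  interpret P: right_module D P by fact
  let ?N = "{f. vanishes_below P 0 f}"
  have sub: "right_submodule D (restricted P) ?N"
    unfolding right_submodule_def
  proof (intro conjI)
    show "?N \<subseteq> carrier (restricted P)" by auto
  qed (auto simp: vanishes_below_def P.smult_closed)
  have lin: "right_linear D ((restricted P)\<lparr>carrier := ?N\<rparr>) P (\<lambda>f. f 0)"
    by (rule right_linearI) (auto simp: vanishes_below_def)
  have im: "(\<lambda>f. f 0) ` ?N = carrier P"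
  proof (intro equalityI subsetI)
    fix p assume p: "p \<in> carrier P"
    have "vanishes_below P 0 (monomial P p 0)"
      by (rule vanishes_below_monomial[OF P.M.abelian_monoid_axioms p order_refl])
    then show "p \<in> (\<lambda>f. f 0) ` ?N" by (intro image_eqI[of _ _ "monomial P p 0"]) (auto simp: monomial_def)
  qed (auto simp: vanishes_below_def)
  have sh: "shift 1 ` ?N = {f. vanishes_below P 1 f}"
  proof (intro equalityI subsetI)
    fix f assume "f \<in> {f. vanishes_below P 1 f}"
    then show "f \<in> shift 1 ` ?N" by (intro image_eqI[of _ _ "shift (- 1) f"]) auto
  qed auto
  have ker: "{f \<in> ?N. f 0 = \<zero>\<^bsub>P\<^esub>} = shift 1 ` ?N"
    unfolding sh
  proof (intro equalityI subsetI)
    fix f assume f: "f \<in> {f \<in> ?N. f 0 = \<zero>\<^bsub>P\<^esub>}"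
    have "f i = \<zero>\<^bsub>P\<^esub>" if "i < 1" for i using that f by (cases "i = 0") (auto simp: vanishes_below_def)
    then show "f \<in> {f. vanishes_below P 1 f}" using f by (simp add: vanishes_below_def)
  qed (auto simp: vanishes_below_def)
  have "shift 1 ` ?N \<subseteq> ?N" unfolding sh by (auto intro: vanishes_below_mono)
  then show ?thesis unfolding lattice_with_residue_def using sub lin im ker by blast
qed

text \<open>Inside \<open>P'((x))\<close> the lattice \<open>P'[[x]]\<close> is compared with the
  image of \<open>P[[x]]\<close> under the isomorphism; their residue modules are \<open>P'\<close>
  and \<open>P\<close>. A shift by \<open>m\<close> places the image inside \<open>P'[[x]]\<close>,
  and the bound \<open>l\<close> for the inverse gives the containment needed in the other
  direction.\<close>

lemma laurent_injective:
  assumes fp: "ideals_fin_proj D" and triv: "acts_trivially_on_class_group D \<sigma>"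
    and P: "fin_proj D (P :: ('a, nat \<Rightarrow> 'a) module)" and P': "fin_proj D (P' :: ('a, nat \<Rightarrow> 'a) module)"
    and iso: "module_isomorphic R (LM P) (LM P')"
  shows "k0_class D P = k0_class D P'"
proof -
  have Pm: "right_module D P" and P'm: "right_module D P'" using P P' by (auto simp: fin_proj_def)
  note L = right_module_laurent[OF Pm]
  obtain \<psi> where bij: "bij_betw \<psi> (carrier (LM P)) (carrier (LM P'))" and \<psi>: "right_linear R (LM P) (LM P') \<psi>"
    using iso by (auto simp: module_isomorphic_iff)
  let ?\<chi> = "inv_into (carrier (LM P)) \<psi>"
  note \<chi> = right_linear_inv[OF L bij \<psi>]
  have \<chi>\<psi>: "?\<chi> (\<psi> f) = f" if "f \<in> carrier (LM P)" for f using bij that by (simp add: bij_betw_def inv_into_f_f)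
  have \<psi>\<chi>: "\<psi> (?\<chi> g) = g" if "g \<in> carrier (LM P')" for g
    using bij that by (metis bij_betw_def f_inv_into_f)
  have xR: "monomial D d m \<in> carrier R" if "d \<in> carrier D" for d m using that by simp
  \<comment> \<open>Linearity over \<open>R\<close> is used for two kinds of monomials: powers of
    \<open>x\<close>, which act as shifts, and constants, which give the action of \<open>D\<close>
    on the restricted module.\<close>
  have sh_act: "monomial D \<one> m \<odot>\<^bsub>LM Z\<^esub> f = shift m f" if Z: "right_module D Z" and "f \<in> carrier (LM Z)" for Z :: "('a, nat \<Rightarrow> 'a) module" and m f
  proof -
    obtain k where k: "vanishes_below Z k f" using \<open>f \<in> carrier (LM Z)\<close> by auto
    show ?thesis using act_monomial_right[OF Z k one_closed, of m] vanishes_below_closed[OF k] right_module.smult_one[OF Z]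
      by (auto simp: shift_def)
  qed
  have sc_act: "monomial D d 0 \<odot>\<^bsub>LM Z\<^esub> f = d \<odot>\<^bsub>restricted Z\<^esub> f" if Z: "right_module D Z" and "f \<in> carrier (LM Z)"
    and d: "d \<in> carrier D" for Z :: "('a, nat \<Rightarrow> 'a) module" and d f
  proof -
    obtain k where k: "vanishes_below Z k f" using \<open>f \<in> carrier (LM Z)\<close> by auto
    show ?thesis using act_monomial_right[OF Z k d, of 0] by auto
  qed
  have \<psi>sh: "\<psi> (shift m f) = shift m (\<psi> f)" if f: "f \<in> carrier (LM P)" for m f
    using right_linearD(3)[OF \<psi> xR[OF one_closed] f, of m] sh_act[OF Pm f, of m]
      sh_act[OF P'm right_linearD(1)[OF \<psi> f], of m] by simp
  let ?U = "{f. vanishes_below P 0 f}" let ?W = "{f. vanishes_below P' 0 f}"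
  have N0: "f \<in> carrier (LM P)" if "f \<in> ?U" for f using that by auto
  obtain m :: nat where m: "\<And>f. vanishes_below P 0 f \<Longrightarrow> vanishes_below P' (- int m) (\<psi> f)"
    using laurent_linear_bounded[OF P P'm \<psi>] by blast
  obtain l :: nat where l: "\<And>f. vanishes_below P' 0 f \<Longrightarrow> vanishes_below P (- int l) (?\<chi> f)"
    using laurent_linear_bounded[OF P' Pm \<chi>] by blast
  let ?N = "\<psi> ` ?U"
  have latW: "lattice_with_residue (restricted P') ?W P'" by (rule standard_lattice[OF P'm])
  have \<psi>r: "right_linear D ((restricted P)\<lparr>carrier := ?U\<rparr>) (restricted P') \<psi>"
  proof (rule right_linearI)
    fix f assume "f \<in> carrier ((restricted P)\<lparr>carrier := ?U\<rparr>)"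
    then show "\<psi> f \<in> carrier (restricted P')" using right_linearD(1)[OF \<psi>, of f] by auto
  next
    fix f g assume "f \<in> carrier ((restricted P)\<lparr>carrier := ?U\<rparr>)" "g \<in> carrier ((restricted P)\<lparr>carrier := ?U\<rparr>)"
    then show "\<psi> (f \<oplus>\<^bsub>(restricted P)\<lparr>carrier := ?U\<rparr>\<^esub> g) = \<psi> f \<oplus>\<^bsub>restricted P'\<^esub> \<psi> g"
      using right_linearD(2)[OF \<psi>, of f g] by auto
  next
    fix d f assume d: "d \<in> carrier D" and "f \<in> carrier ((restricted P)\<lparr>carrier := ?U\<rparr>)"
    then have f: "f \<in> carrier (LM P)" by auto
    show "\<psi> (d \<odot>\<^bsub>(restricted P)\<lparr>carrier := ?U\<rparr>\<^esub> f) = d \<odot>\<^bsub>restricted P'\<^esub> \<psi> f"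
      using right_linearD(3)[OF \<psi> xR[OF d] f, of 0] sc_act[OF Pm f d] sc_act[OF P'm right_linearD(1)[OF \<psi> f] d] by simp
  qed
  have latN: "lattice_with_residue (restricted P') ?N P"
  proof -
    obtain \<pi> where sub: "right_submodule D (restricted P) ?U" "shift 1 ` ?U \<subseteq> ?U"
      and \<pi>: "right_linear D ((restricted P)\<lparr>carrier := ?U\<rparr>) P \<pi>" "\<pi> ` ?U = carrier P"
        "{f \<in> ?U. \<pi> f = \<zero>\<^bsub>P\<^esub>} = shift 1 ` ?U"
      using standard_lattice[OF Pm] by (auto simp: lattice_with_residue_def)
    have N0M: "right_module D ((restricted P)\<lparr>carrier := ?U\<rparr>)"
      by (rule right_module_submodule[OF right_module_restricted[OF Pm] sub(1)])
    have subN: "right_submodule D (restricted P') ?N"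
      using right_submodule_image[OF N0M right_module_restricted[OF P'm] \<psi>r] by simp
    have sN: "shift 1 ` ?N = \<psi> ` shift 1 ` ?U"
      unfolding image_image using \<psi>sh[OF N0] by (intro image_cong) auto
    have bijN: "bij_betw \<psi> (carrier ((restricted P)\<lparr>carrier := ?U\<rparr>)) (carrier ((restricted P')\<lparr>carrier := ?N\<rparr>))"
      using bij N0 by (auto simp: bij_betw_def intro: inj_on_subset)
    have linN: "right_linear D ((restricted P)\<lparr>carrier := ?U\<rparr>) ((restricted P')\<lparr>carrier := ?N\<rparr>) \<psi>"
      by (rule right_linear_into[OF \<psi>r]) simp
    let ?i = "inv_into ?U \<psi>"
    have i: "?i (\<psi> f) = f" if "f \<in> ?U" for f using bijN that by (simp add: bij_betw_def inv_into_f_f)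
    have lin: "right_linear D ((restricted P')\<lparr>carrier := ?N\<rparr>) P (\<lambda>y. \<pi> (?i y))"
      by (rule right_linear_compose[OF _ \<pi>(1)]) (use right_linear_inv[OF N0M bijN linN] in simp)
    have im: "(\<lambda>y. \<pi> (?i y)) ` ?N = carrier P"
    proof -
      have "(\<lambda>y. \<pi> (?i y)) ` ?N = \<pi> ` ?U" unfolding image_image using i by (intro image_cong) auto
      then show ?thesis using \<pi>(2) by simp
    qed
    have ker: "{y \<in> ?N. \<pi> (?i y) = \<zero>\<^bsub>P\<^esub>} = shift 1 ` ?N"
    proof -
      have "{y \<in> ?N. \<pi> (?i y) = \<zero>\<^bsub>P\<^esub>} = \<psi> ` {f \<in> ?U. \<pi> f = \<zero>\<^bsub>P\<^esub>}" using i by auto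
      then show ?thesis unfolding \<pi>(3) sN .
    qed
    have "shift 1 ` ?N \<subseteq> ?N" unfolding sN by (rule image_mono[OF sub(2)])
    then show ?thesis unfolding lattice_with_residue_def using subN lin im ker by blast
  qed
  let ?M = "shift (int m) ` ?N"
  have latM: "lattice_with_residue (restricted P') ?M P"
    by (rule lattice_shift[OF latN Pm twist_trivial[OF fp triv P]])
  have MW: "?M \<subseteq> ?W" using m by auto
  \<comment> \<open>For \<open>w\<close> in \<open>P'[[x]]\<close>, the series
    \<open>?\<chi> w x\<^sup>l\<close> lies in \<open>P[[x]]\<close>, so \<open>w x\<^sup>l\<close>
    lies in the image of \<open>P[[x]]\<close>. A further shift by \<open>m\<close> accounts for the
    exponent \<open>m + l\<close>.\<close>
  have WM: "shift (int (m + l)) ` ?W \<subseteq> ?M"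
  proof
    fix y assume "y \<in> shift (int (m + l)) ` ?W"
    then obtain w where w: "vanishes_below P' 0 w" "y = shift (int (m + l)) w" by blast
    have wL: "w \<in> carrier (LM P')" using w by auto
    have \<chi>w: "?\<chi> w \<in> carrier (LM P)" by (rule right_linearD(1)[OF \<chi> wL])
    have "shift (int l) (?\<chi> w) \<in> ?U" using l[OF w(1)] by simp
    moreover have "\<psi> (shift (int l) (?\<chi> w)) = shift (int l) w" using \<psi>sh[OF \<chi>w] \<psi>\<chi>[OF wL] by simp
    ultimately have "shift (int l) w \<in> ?N" by (metis imageI)
    then have "shift (int m) (shift (int l) w) \<in> ?M" by blast
    then show "y \<in> ?M" using w(2) by simp
  qed
  show ?thesis by (rule lattice_comparison[OF fp triv P' P P'm latW latM MW WM, symmetric])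
qed

end

section \<open>Comparison of the Grothendieck groups\<close>

context dedekind_laurent
begin

text \<open>Every right ideal of \<open>R\<close> is isomorphic to \<open>J((x))\<close> for an
  ideal \<open>J\<close> of \<open>D\<close>, and \<open>P \<mapsto> P((x))\<close> respects direct
  sums; so the induction over finitely generated projective modules applies.\<close>

lemma laurent_essentially_surjective:
  assumes "fin_proj R (M :: (int \<Rightarrow> 'a, nat \<Rightarrow> int \<Rightarrow> 'a) module)"
  shows "\<exists>P :: ('a, nat \<Rightarrow> 'a) module. fin_proj D P \<and> module_isomorphic R (LM P) M"
proof -
  have M: "M \<in> fg_projective_modules R" using assms by (simp add: fg_projective_modules_iff)
  \<comment> \<open>Ideals and direct sums provide the required \<open>D\<close>-module on the wrong
    type. This step replaces it by a copy on \<open>nat \<Rightarrow> 'a\<close>.\<close>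
  have copy: "\<exists>P :: ('a, nat \<Rightarrow> 'a) module. fin_proj D P \<and> module_isomorphic R (LM P) N"
    if Z: "fin_proj D Z" and iso: "module_isomorphic R (LM Z) N" for Z :: "('a, 'z) module" and N :: "(int \<Rightarrow> 'a, 'y) module"
  proof -
    obtain P :: "('a, nat \<Rightarrow> 'a) module" where P: "P \<in> fg_projective_modules D" "module_isomorphic D P Z"
      using fin_proj_copy[OF Z] by blast
    have P': "fin_proj D P" using P(1) by (simp add: fg_projective_modules_iff)
    have "module_isomorphic R (LM P) (LM Z)"
      using P' Z P(2) by (intro laurent_isomorphic) (auto simp: fin_proj_def)
    then show ?thesis using P' iso module_isomorphic_trans by blast
  qed
  have mod: "right_module R N" if "N \<in> fg_projective_modules R" for N
    using that by (simp add: fg_projective_modules_iff fin_proj_def)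
  show ?thesis using ideals_fin_proj_R M
  proof (induction rule: fg_projective_induct)
    case (ideal N I)
    obtain J where J: "ideal J D" "module_isomorphic R (LM (ideal_as_module D J)) (ideal_as_module R I)"
      using right_ideal_laurent[OF ideal(1)] by blast
    have "fin_proj D (ideal_as_module D J)"
      using ideals_fin_proj_D ideal_imp_right_ideal[OF J(1)] by (simp add: ideals_fin_proj_def)
    then show ?case
      using copy module_isomorphic_trans[OF J(2) module_isomorphic_sym[OF mod[OF ideal(2)] ideal(3)]] by blast
  next
    case (sum N P Q)
    obtain A :: "('a, nat \<Rightarrow> 'a) module" where A: "fin_proj D A" "module_isomorphic R (LM A) P" using sum(5) by blast
    obtain B :: "('a, nat \<Rightarrow> 'a) module" where B: "fin_proj D B" "module_isomorphic R (LM B) Q" using sum(6) by blast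
    have "module_isomorphic R (LM (direct_sum_module A B)) (direct_sum_module (LM A) (LM B))"
      using A B by (intro laurent_direct_sum) (auto simp: fin_proj_def)
    then have "module_isomorphic R (LM (direct_sum_module A B)) (direct_sum_module P Q)"
      using module_isomorphic_direct_sum[OF A(2) B(2)] by (rule module_isomorphic_trans)
    then have "module_isomorphic R (LM (direct_sum_module A B)) N"
      using module_isomorphic_sym[OF mod[OF sum(1)] sum(4)] by (rule module_isomorphic_trans)
    then show ?case by (rule copy[OF fin_proj_direct_sum[OF A(1) B(1)]])
  qed
qed

lemma K0_laurent:
  assumes triv: "acts_trivially_on_class_group D \<sigma>"
  shows "K0 R \<cong> K0 D"
proof (rule K0_isomorphic[where F = LM])
  fix N P Q :: "('a, nat \<Rightarrow> 'a) module"
  assume a: "fin_proj D N" "fin_proj D P" "fin_proj D Q" "module_isomorphic D N (direct_sum_module P Q)"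
  then have m: "right_module D N" "right_module D P" "right_module D Q" by (auto simp: fin_proj_def)
  show "module_isomorphic R (LM N) (direct_sum_module (LM P) (LM Q))"
    by (rule module_isomorphic_trans[OF laurent_isomorphic[OF m(1) right_module_direct_sum[OF m(2,3)] a(4)]
        laurent_direct_sum[OF m(2,3)]])
next
  fix P Q :: "('a, nat \<Rightarrow> 'a) module"
  assume "fin_proj D P" "fin_proj D Q" "module_isomorphic R (LM P) (LM Q)"
  then show "k0_class D P = k0_class D Q" by (rule laurent_injective[OF ideals_fin_proj_D triv])
qed (use fin_proj_laurent laurent_essentially_surjective in auto)

end

theorem theorem1:
  fixes D :: "('a, 'm) ring_scheme" and \<sigma> :: "'a \<Rightarrow> 'a"
  assumes "commutative_dedekind_domain D" and "\<sigma> \<in> ring_iso D D"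
  shows "noncommutative_dedekind_domain (skew_laurent_ring D \<sigma>) \<and>
    (acts_trivially_on_class_group D \<sigma> \<longrightarrow> K0 (skew_laurent_ring D \<sigma>) \<cong> K0 D)"
proof -
  have "domain D" using assms(1) by (simp add: commutative_dedekind_domain_def)
  obtain K :: "('a \<times> 'a) set ring" and \<iota> where K: "division_ring_of_fractions D K \<iota>"
    "\<And>I. ideal I D \<Longrightarrow> I \<noteq> {\<zero>\<^bsub>D\<^esub>} \<Longrightarrow> invertible_ideal D K \<iota> I"
    using assms(1) unfolding commutative_dedekind_domain_def all_nonzero_ideals_invertible_def by blast
  interpret dedekind_laurent D \<sigma> K \<iota>
    by (intro dedekind_laurent.intro dedekind_laurent_axioms.intro skew_laurent.intro skew_laurent_axioms.intro
        \<open>domain D\<close> assms(2) K)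
  show ?thesis using noncommutative_dedekind_R K0_laurent by blast
qed

end
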